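(* Let $k$ be an algebraically closed field of characteristic zero, $G$ a finite group and $(P,Q)$ a section of $G$ ($Q\trianglelefteq P\le G$); write $H=P/Q$. Let $K_{(P,Q)}=\{\alpha\cdot\mathrm{Defres}^G_{P/Q}:\alpha\in kB(G,H)\}$ and $K_{<(P,Q)}=\{\alpha\cdot\mathrm{Defres}^G_{P/Q}:\alpha\in kI(G,H)\}$ (left ideals of $kB(G,G)$), and $\bar K_{(P,Q)}=K_{(P,Q)}/K_{<(P,Q)}$. Let $\Gamma=\Gamma_G(P,Q)$ be the image of $N_G(P,Q)$ in $\mathrm{Out}(H)$. Let $\langle\bar\phi,\bar\psi\rangle_G=\tau\pi(\phi^{op}\psi)$ be the bilinear form on $k\bar B(G,H)$, where $\pi:kB(H,H)\to k\mathrm{Out}(H)$ is the quotient map and $\tau$ the coefficient-of-$1$ form on $k\mathrm{Out}(H)$; transport its restriction to $k\bar B(G,H)^{\Gamma}$ to $\bar K_{(P,Q)}$ via the isomorphism $k\bar B(G,H)^\Gamma\to\bar K_{(P,Q)}$ induced by $\bar\alpha\mapsto\alpha\cdot\mathrm{Defres}^G_{P/Q}$, and let $R'$ be its kernel. Then $\bar K_{(P,Q)}/R'$ is a semi-simple $kB(G,G)$-module and $$\bar K_{(P,Q)}/R'\cong S_{H,W}(G)\cong\bigoplus_{j=1}^q m_j\cdot S_{H,W_j}(G),$$ where $W=k[\mathrm{Out}(H)/\Gamma]$ and $W=\bigoplus_{j=1}^q m_j\cdot W_j$ is its decomposition as a direct sum of simple $k\mathrm{Out}(H)$-modules.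
   Context: All groups finite. $(X,Y)$-bisets: finite sets with commuting left $X$- and right $Y$-actions; $kB(X,Y)=k\otimes B(X,Y)$ (Grothendieck group), composition $U\times_YV$, extended bilinearly; opposite $U^{op}$: same set with $y\cdot u\cdot x=x^{-1}uy^{-1}$. $\mathrm{Defres}^G_{P/Q}$ is the $(P/Q,G)$-biset $Q\backslash G$ with left $P/Q$-action and right $G$-action by multiplication. $N_G(P,Q)=\{g:gPg^{-1}=P,\ gQg^{-1}=Q\}$ acts on $P/Q$ by conjugation, giving $\Gamma_G(P,Q)\le\mathrm{Out}(P/Q)$. $K\sqsubset H$: $K$ isomorphic to a subquotient of $H$ with $|K|<|H|$; $kI(X,H)=\sum_{K\sqsubset H}kB(X,K)kB(K,H)$; $k\bar B(X,H)=kB(X,H)/kI(X,H)$, a right $k\mathrm{Out}(H)$-module via $k\bar B(H,H)\cong k\mathrm{Out}(H)$ ($\sigma\mapsto\mathrm{Iso}_\sigma$); $k\bar B(G,H)^\Gamma$ denotes $\Gamma$-fixed points. Biset functors: $k$-linear functors from the category of finite groups with $\mathrm{Hom}(H,G)=kB(G,H)$ to $k$-vector spaces. For a $k\mathrm{Out}(H)$-module $V$ (a $kB(H,H)$-module via the quotient): $L_{H,V}=kB(-,H)\otimes_{kB(H,H)}V$, $J_{H,V}(X)=\{\sum\phi_i\otimes v_i:\sum(\psi\phi_i)v_i=0\ \forall\psi\in kB(H,X)\}$, $S_{H,V}=L_{H,V}/J_{H,V}$. *)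

theory Defs
  imports "HOL-Algebra.Coset"
begin

definition alg_closed_field :: "'k::field itself \<Rightarrow> bool" where
  "alg_closed_field _ \<longleftrightarrow>
     (\<forall>n::nat. \<forall>a::nat \<Rightarrow> 'k. n \<ge> 1 \<longrightarrow> (\<exists>x. x ^ n + (\<Sum>i<n. a i * x ^ i) = 0))"

record ('a, 'k, 'm) kmod =
  mcar :: "'m set"
  mzero :: 'm
  madd :: "'m \<Rightarrow> 'm \<Rightarrow> 'm"
  msmul :: "'k \<Rightarrow> 'm \<Rightarrow> 'm"
  mact :: "'a \<Rightarrow> 'm \<Rightarrow> 'm"

definition submodule :: "'a set \<Rightarrow> ('a,'k,'m) kmod \<Rightarrow> 'm set \<Rightarrow> bool" where
  "submodule A M S \<longleftrightarrow> S \<subseteq> mcar M \<and> mzero M \<in> S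
     \<and> (\<forall>x\<in>S. \<forall>y\<in>S. madd M x y \<in> S) \<and> (\<forall>c. \<forall>x\<in>S. msmul M c x \<in> S)
     \<and> (\<forall>a\<in>A. \<forall>x\<in>S. mact M a x \<in> S)"

definition semisimple_mod :: "'a set \<Rightarrow> ('a,'k,'m) kmod \<Rightarrow> bool" where
  "semisimple_mod A M \<longleftrightarrow> (\<forall>S. submodule A M S \<longrightarrow>
     (\<exists>T. submodule A M T \<and> S \<inter> T = {mzero M} \<and> {madd M x y | x y. x \<in> S \<and> y \<in> T} = mcar M))"

definition simple_submodule :: "'a set \<Rightarrow> ('a,'k,'m) kmod \<Rightarrow> 'm set \<Rightarrow> bool" where
  "simple_submodule A M S \<longleftrightarrow> submodule A M S \<and> S \<noteq> {mzero M}
     \<and> (\<forall>T. submodule A M T \<longrightarrow> T \<subseteq> S \<longrightarrow> T = {mzero M} \<or> T = S)"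

definition mod_iso :: "'a set \<Rightarrow> ('a,'k,'m) kmod \<Rightarrow> ('a,'k,'n) kmod \<Rightarrow> bool" where
  "mod_iso A M N \<longleftrightarrow> (\<exists>f. bij_betw f (mcar M) (mcar N)
     \<and> (\<forall>x\<in>mcar M. \<forall>y\<in>mcar M. f (madd M x y) = madd N (f x) (f y))
     \<and> (\<forall>c. \<forall>x\<in>mcar M. f (msmul M c x) = msmul N c (f x))
     \<and> (\<forall>a\<in>A. \<forall>x\<in>mcar M. f (mact M a x) = mact N a (f x)))"

definition msum :: "('a,'k,'m) kmod \<Rightarrow> ('i \<Rightarrow> 'm) \<Rightarrow> 'i set \<Rightarrow> 'm" where
  "msum M g I = Finite_Set.fold (\<lambda>i acc. madd M (g i) acc) (mzero M) I"

definition qcos :: "('a,'k,'m) kmod \<Rightarrow> 'm set \<Rightarrow> 'm \<Rightarrow> 'm set" where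
  "qcos M N x = {madd M x n | n. n \<in> N}"

definition qrep :: "'m set \<Rightarrow> 'm" where "qrep X = (SOME x. x \<in> X)"

definition qmod :: "('a,'k,'m) kmod \<Rightarrow> 'm set \<Rightarrow> ('a,'k,'m set) kmod" where
  "qmod M N = \<lparr> mcar = qcos M N ` mcar M,
                mzero = qcos M N (mzero M),
                madd = (\<lambda>X Y. qcos M N (madd M (qrep X) (qrep Y))),
                msmul = (\<lambda>c X. qcos M N (msmul M c (qrep X))),
                mact = (\<lambda>a X. qcos M N (mact M a (qrep X))) \<rparr>"

definition submod :: "('a,'k,'m) kmod \<Rightarrow> 'm set \<Rightarrow> ('a,'k,'m) kmod" where
  "submod M S = M\<lparr>mcar := S\<rparr>"

definition dsum :: "nat \<Rightarrow> (nat \<Rightarrow> ('a,'k,'m) kmod) \<Rightarrow> ('a,'k,nat \<Rightarrow> 'm) kmod" where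
  "dsum n M = \<lparr> mcar = {f. (\<forall>i<n. f i \<in> mcar (M i)) \<and> (\<forall>i\<ge>n. f i = undefined)},
               mzero = (\<lambda>i. if i < n then mzero (M i) else undefined),
               madd = (\<lambda>f g i. if i < n then madd (M i) (f i) (g i) else undefined),
               msmul = (\<lambda>c f i. if i < n then msmul (M i) c (f i) else undefined),
               mact = (\<lambda>a f i. if i < n then mact (M i) a (f i) else undefined) \<rparr>"

definition internal_dsum :: "('a,'k,'m) kmod \<Rightarrow> nat \<Rightarrow> (nat \<Rightarrow> 'm set) \<Rightarrow> bool" where
  "internal_dsum M n U \<longleftrightarrow>
     (\<forall>w\<in>mcar M. \<exists>u. (\<forall>i<n. u i \<in> U i) \<and> w = msum M u {..<n})
   \<and> (\<forall>u. (\<forall>i<n. u i \<in> U i) \<longrightarrow> msum M u {..<n} = mzero M \<longrightarrow> (\<forall>i<n. u i = mzero M))"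

definition kspan :: "('c \<Rightarrow> 'k::field) set \<Rightarrow> ('c \<Rightarrow> 'k) set" where
  "kspan S = {x. \<exists>A c. finite A \<and> A \<subseteq> S \<and> x = (\<lambda>C. \<Sum>a\<in>A. c a * a C)}"

text \<open>A (X,Y)-biset is encoded as a left (X \<times> Y)-set via (x,y).u = x u y^{-1}.
  A finite D-set is sent to its class in kB, which is a k-valued function on
  the conjugacy classes of subgroups of D (= isomorphism classes of transitive D-sets,
  via stabilizers); the value at C is the number of orbits with stabilizer class C.\<close>

definition conjg :: "('d,'b) monoid_scheme \<Rightarrow> 'd \<Rightarrow> 'd set \<Rightarrow> 'd set" where
  "conjg D g L = (\<lambda>l. g \<otimes>\<^bsub>D\<^esub> l \<otimes>\<^bsub>D\<^esub> inv\<^bsub>D\<^esub> g) ` L"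

definition conj_classes :: "('d,'b) monoid_scheme \<Rightarrow> 'd set set set" where
  "conj_classes D = {(\<lambda>g. conjg D g L) ` carrier D | L. subgroup L D}"

definition orb :: "('d,'b) monoid_scheme \<Rightarrow> ('d \<Rightarrow> 'u \<Rightarrow> 'u) \<Rightarrow> 'u \<Rightarrow> 'u set" where
  "orb D act u = (\<lambda>g. act g u) ` carrier D"

definition stab :: "('d,'b) monoid_scheme \<Rightarrow> ('d \<Rightarrow> 'u \<Rightarrow> 'u) \<Rightarrow> 'u \<Rightarrow> 'd set" where
  "stab D act u = {g \<in> carrier D. act g u = u}"

definition biset_class :: "('d,'b) monoid_scheme \<Rightarrow> 'u set \<Rightarrow> ('d \<Rightarrow> 'u \<Rightarrow> 'u) \<Rightarrow> 'd set set \<Rightarrow> 'k::field" where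
  "biset_class D U act = (\<lambda>C. of_nat (card {Ob \<in> orb D act ` U. stab D act ` Ob = C}))"

definition kB :: "'x monoid \<Rightarrow> 'y monoid \<Rightarrow> (('x \<times> 'y) set set \<Rightarrow> 'k::field) set" where
  "kB X Y = {a. \<forall>C. C \<notin> conj_classes (X \<times>\<times> Y) \<longrightarrow> a C = 0}"

text \<open>Composition U \<times>_Y V of the transitive bisets (X\<times>Y)/L and (Y\<times>Z)/M.\<close>
definition tcomp_set :: "'x monoid \<Rightarrow> 'y monoid \<Rightarrow> 'z monoid \<Rightarrow> ('x \<times> 'y) set \<Rightarrow> ('y \<times> 'z) set
     \<Rightarrow> (('x \<times> 'y) set \<times> ('y \<times> 'z) set) set set" where
  "tcomp_set X Y Z L M =
     {(\<lambda>y. ((\<one>\<^bsub>X\<^esub>, y) <#\<^bsub>X \<times>\<times> Y\<^esub> u, (y, \<one>\<^bsub>Z\<^esub>) <#\<^bsub>Y \<times>\<times> Z\<^esub> v)) ` carrier Y | u v.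
        u \<in> {a <#\<^bsub>X \<times>\<times> Y\<^esub> L | a. a \<in> carrier (X \<times>\<times> Y)} \<and>
        v \<in> {b <#\<^bsub>Y \<times>\<times> Z\<^esub> M | b. b \<in> carrier (Y \<times>\<times> Z)}}"

definition tcomp_act :: "'x monoid \<Rightarrow> 'y monoid \<Rightarrow> 'z monoid \<Rightarrow> ('x \<times> 'z)
     \<Rightarrow> (('x \<times> 'y) set \<times> ('y \<times> 'z) set) set \<Rightarrow> (('x \<times> 'y) set \<times> ('y \<times> 'z) set) set" where
  "tcomp_act X Y Z g w =
     (\<lambda>(u, v). ((fst g, \<one>\<^bsub>Y\<^esub>) <#\<^bsub>X \<times>\<times> Y\<^esub> u, (\<one>\<^bsub>Y\<^esub>, snd g) <#\<^bsub>Y \<times>\<times> Z\<^esub> v)) ` w"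

definition bcomp :: "'x monoid \<Rightarrow> 'y monoid \<Rightarrow> 'z monoid \<Rightarrow> (('x \<times> 'y) set set \<Rightarrow> 'k::field)
     \<Rightarrow> (('y \<times> 'z) set set \<Rightarrow> 'k) \<Rightarrow> (('x \<times> 'z) set set \<Rightarrow> 'k)" where
  "bcomp X Y Z a b = (\<lambda>C. \<Sum>C1\<in>conj_classes (X \<times>\<times> Y). \<Sum>C2\<in>conj_classes (Y \<times>\<times> Z).
      a C1 * b C2 * biset_class (X \<times>\<times> Z)
        (tcomp_set X Y Z (SOME L. L \<in> C1) (SOME M. M \<in> C2)) (tcomp_act X Y Z) C)"

definition bop :: "(('x \<times> 'y) set set \<Rightarrow> 'k) \<Rightarrow> (('y \<times> 'x) set set \<Rightarrow> 'k)" where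
  "bop a = (\<lambda>C. a ((\<lambda>L. (\<lambda>(y, x). (x, y)) ` L) ` C))"

definition subquots :: "'h monoid \<Rightarrow> 'h set monoid set" where
  "subquots H = {(H\<lparr>carrier := S\<rparr>) Mod T | S T. subgroup S H \<and> T \<lhd> (H\<lparr>carrier := S\<rparr>)}"

definition kI :: "'x monoid \<Rightarrow> 'h monoid \<Rightarrow> (('x \<times> 'h) set set \<Rightarrow> 'k::field) set" where
  "kI X H = kspan {bcomp X K H a b | K a b. K \<in> subquots H \<and> card (carrier K) < card (carrier H)
                     \<and> a \<in> kB X K \<and> b \<in> kB K H}"

definition Autx :: "'h monoid \<Rightarrow> ('h \<Rightarrow> 'h) set" where
  "Autx H = {\<sigma>. \<sigma> \<in> iso H H \<and> \<sigma> \<in> extensional (carrier H)}"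

definition outcls :: "'h monoid \<Rightarrow> ('h \<Rightarrow> 'h) \<Rightarrow> ('h \<Rightarrow> 'h) set" where
  "outcls H \<sigma> = {\<tau> \<in> Autx H. \<exists>h\<in>carrier H. \<forall>x\<in>carrier H. \<tau> x = \<sigma> (h \<otimes>\<^bsub>H\<^esub> x \<otimes>\<^bsub>H\<^esub> inv\<^bsub>H\<^esub> h)}"

definition Out :: "'h monoid \<Rightarrow> ('h \<Rightarrow> 'h) set set" where
  "Out H = outcls H ` Autx H"

definition outid :: "'h monoid \<Rightarrow> ('h \<Rightarrow> 'h) set" where
  "outid H = outcls H (restrict (\<lambda>x. x) (carrier H))"

definition outmul :: "'h monoid \<Rightarrow> ('h \<Rightarrow> 'h) set \<Rightarrow> ('h \<Rightarrow> 'h) set \<Rightarrow> ('h \<Rightarrow> 'h) set" where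
  "outmul H oa ob2 = outcls H (compose (carrier H) (SOME \<sigma>. \<sigma> \<in> oa) (SOME \<sigma>. \<sigma> \<in> ob2))"

definition isoB :: "'h monoid \<Rightarrow> ('h \<Rightarrow> 'h) \<Rightarrow> (('h \<times> 'h) set set \<Rightarrow> 'k::field)" where
  "isoB H \<sigma> = biset_class (H \<times>\<times> H) (carrier H) (\<lambda>g u. fst g \<otimes>\<^bsub>H\<^esub> u \<otimes>\<^bsub>H\<^esub> inv\<^bsub>H\<^esub> (\<sigma> (snd g)))"

definition isoEl :: "'h monoid \<Rightarrow> ('h \<Rightarrow> 'h) set \<Rightarrow> (('h \<times> 'h) set set \<Rightarrow> 'k::field)" where
  "isoEl H ob = isoB H (SOME \<sigma>. \<sigma> \<in> ob)"

definition kOut :: "'h monoid \<Rightarrow> (('h \<Rightarrow> 'h) set \<Rightarrow> 'k::field) set" where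
  "kOut H = {f. \<forall>ob. ob \<notin> Out H \<longrightarrow> f ob = 0}"

text \<open>\<pi> : kB(H,H) \<rightarrow> k\<bar>B(H,H) \<cong> k Out(H), \<sigma> \<mapsto> Iso_\<sigma>.\<close>
definition piB :: "'h monoid \<Rightarrow> (('h \<times> 'h) set set \<Rightarrow> 'k::field) \<Rightarrow> (('h \<Rightarrow> 'h) set \<Rightarrow> 'k)" where
  "piB H x = (THE f. f \<in> kOut H \<and>
      (\<lambda>C. x C - (\<Sum>ob\<in>Out H. f ob * isoEl H ob C)) \<in> kI H H)"

definition tauO :: "'h monoid \<Rightarrow> (('h \<Rightarrow> 'h) set \<Rightarrow> 'k::field) \<Rightarrow> 'k" where
  "tauO H f = f (outid H)"

text \<open>A k Out(H)-module V (a kB(H,H)-module through \<pi>); the k-space of finitely supported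
  formal combinations of pairs (\<phi>,v), \<phi> \<in> kB(G,H), v \<in> V.\<close>

definition fdelta :: "'p \<Rightarrow> 'p \<Rightarrow> 'k::field" where
  "fdelta p = (\<lambda>q. if q = p then 1 else 0)"

definition Fsp :: "'g monoid \<Rightarrow> 'h monoid \<Rightarrow> ('f,'k,'v) kmod
     \<Rightarrow> (((('g \<times> 'h) set set \<Rightarrow> 'k::field) \<times> 'v) \<Rightarrow> 'k) set" where
  "Fsp G H V = {f. finite {q. f q \<noteq> 0} \<and> {q. f q \<noteq> 0} \<subseteq> kB G H \<times> mcar V}"

definition Fmod :: "'g monoid \<Rightarrow> 'h monoid \<Rightarrow> ('f,'k,'v) kmod
     \<Rightarrow> (('g \<times> 'g) set set \<Rightarrow> 'k::field, 'k, ((('g \<times> 'h) set set \<Rightarrow> 'k) \<times> 'v) \<Rightarrow> 'k) kmod" where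
  "Fmod G H V = \<lparr> mcar = Fsp G H V,
      mzero = (\<lambda>q. 0),
      madd = (\<lambda>f g q. f q + g q),
      msmul = (\<lambda>c f q. c * f q),
      mact = (\<lambda>\<psi> f p. \<Sum>q\<in>{q. f q \<noteq> 0 \<and> (bcomp G G H \<psi> (fst q), snd q) = p}. f q) \<rparr>"

definition tens_rel :: "'g monoid \<Rightarrow> 'h monoid \<Rightarrow> (('h \<Rightarrow> 'h) set \<Rightarrow> 'k, 'k, 'v) kmod
     \<Rightarrow> (((('g \<times> 'h) set set \<Rightarrow> 'k::field) \<times> 'v) \<Rightarrow> 'k) set" where
  "tens_rel G H V = kspan (
      {(\<lambda>q. fdelta (\<lambda>C. a C + a' C, v) q - fdelta (a, v) q - fdelta (a', v) q) | a a' v.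
          a \<in> kB G H \<and> a' \<in> kB G H \<and> v \<in> mcar V}
    \<union> {(\<lambda>q. fdelta (a, madd V v v') q - fdelta (a, v) q - fdelta (a, v') q) | a v v'.
          a \<in> kB G H \<and> v \<in> mcar V \<and> v' \<in> mcar V}
    \<union> {(\<lambda>q. fdelta (\<lambda>C. c * a C, v) q - c * fdelta (a, v) q) | c a v.
          a \<in> kB G H \<and> v \<in> mcar V}
    \<union> {(\<lambda>q. fdelta (a, msmul V c v) q - c * fdelta (a, v) q) | c a v.
          a \<in> kB G H \<and> v \<in> mcar V}
    \<union> {(\<lambda>q. fdelta (bcomp G H H a b, v) q - fdelta (a, mact V (piB H b) v) q) | a b v.
          a \<in> kB G H \<and> b \<in> kB H H \<and> v \<in> mcar V})"

text \<open>L_{H,V}(G) = kB(G,H) \<otimes>_{kB(H,H)} V, as a kB(G,G)-module.\<close>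
definition LHV :: "'g monoid \<Rightarrow> 'h monoid \<Rightarrow> (('h \<Rightarrow> 'h) set \<Rightarrow> 'k, 'k, 'v) kmod
     \<Rightarrow> (('g \<times> 'g) set set \<Rightarrow> 'k::field, 'k, (((('g \<times> 'h) set set \<Rightarrow> 'k) \<times> 'v) \<Rightarrow> 'k) set) kmod" where
  "LHV G H V = qmod (Fmod G H V) (tens_rel G H V)"

definition JHV :: "'g monoid \<Rightarrow> 'h monoid \<Rightarrow> (('h \<Rightarrow> 'h) set \<Rightarrow> 'k, 'k, 'v) kmod
     \<Rightarrow> (((('g \<times> 'h) set set \<Rightarrow> 'k::field) \<times> 'v) \<Rightarrow> 'k) set set" where
  "JHV G H V = {X \<in> mcar (LHV G H V). \<exists>f\<in>X. f \<in> Fsp G H V \<and>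
      (\<forall>\<psi>\<in>kB H G. msum V (\<lambda>q. msmul V (f q) (mact V (piB H (bcomp H G H \<psi> (fst q))) (snd q)))
                       {q. f q \<noteq> 0} = mzero V)}"

definition SHV :: "'g monoid \<Rightarrow> 'h monoid \<Rightarrow> (('h \<Rightarrow> 'h) set \<Rightarrow> 'k, 'k, 'v) kmod
     \<Rightarrow> (('g \<times> 'g) set set \<Rightarrow> 'k::field, 'k, (((('g \<times> 'h) set set \<Rightarrow> 'k) \<times> 'v) \<Rightarrow> 'k) set set) kmod" where
  "SHV G H V = qmod (LHV G H V) (JHV G H V)"

definition outcosets :: "'h monoid \<Rightarrow> ('h \<Rightarrow> 'h) set set \<Rightarrow> ('h \<Rightarrow> 'h) set set set" where
  "outcosets H \<Gamma> = {(\<lambda>\<gamma>. outmul H ob \<gamma>) ` \<Gamma> | ob. ob \<in> Out H}"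

definition permW :: "'h monoid \<Rightarrow> ('h \<Rightarrow> 'h) set set
     \<Rightarrow> (('h \<Rightarrow> 'h) set \<Rightarrow> 'k::field, 'k, ('h \<Rightarrow> 'h) set set \<Rightarrow> 'k) kmod" where
  "permW H \<Gamma> = \<lparr> mcar = {w. \<forall>D. D \<notin> outcosets H \<Gamma> \<longrightarrow> w D = 0},
      mzero = (\<lambda>D. 0),
      madd = (\<lambda>w w' D. w D + w' D),
      msmul = (\<lambda>c w D. c * w D),
      mact = (\<lambda>f w D. \<Sum>ob\<in>Out H. \<Sum>D'\<in>outcosets H \<Gamma>.
                  if (\<lambda>d. outmul H ob d) ` D' = D then f ob * w D' else 0) \<rparr>"

definition secq :: "'g monoid \<Rightarrow> 'g set \<Rightarrow> 'g set \<Rightarrow> 'g set monoid" where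
  "secq G P Q = (G\<lparr>carrier := P\<rparr>) Mod Q"

definition Defres :: "'g monoid \<Rightarrow> 'g set \<Rightarrow> 'g set \<Rightarrow> (('g set \<times> 'g) set set \<Rightarrow> 'k::field)" where
  "Defres G P Q = biset_class (secq G P Q \<times>\<times> G) (rcosets\<^bsub>G\<^esub> Q)
      (\<lambda>g S. (fst g <#>\<^bsub>G\<^esub> S) #>\<^bsub>G\<^esub> inv\<^bsub>G\<^esub> (snd g))"

definition NGPQ :: "'g monoid \<Rightarrow> 'g set \<Rightarrow> 'g set \<Rightarrow> 'g set" where
  "NGPQ G P Q = {g \<in> carrier G. conjg G g P = P \<and> conjg G g Q = Q}"

definition GammaGPQ :: "'g monoid \<Rightarrow> 'g set \<Rightarrow> 'g set \<Rightarrow> ('g set \<Rightarrow> 'g set) set set" where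
  "GammaGPQ G P Q = (\<lambda>g. outcls (secq G P Q)
       (restrict (\<lambda>S. (g <#\<^bsub>G\<^esub> S) #>\<^bsub>G\<^esub> inv\<^bsub>G\<^esub> g) (carrier (secq G P Q)))) ` NGPQ G P Q"

definition fixG :: "'g monoid \<Rightarrow> 'g set \<Rightarrow> 'g set \<Rightarrow> (('g \<times> 'g set) set set \<Rightarrow> 'k::field) \<Rightarrow> bool" where
  "fixG G P Q \<alpha> \<longleftrightarrow> (\<forall>ob\<in>GammaGPQ G P Q.
      (\<lambda>C. bcomp G (secq G P Q) (secq G P Q) \<alpha> (isoEl (secq G P Q) ob) C - \<alpha> C) \<in> kI G (secq G P Q))"

definition formG :: "'g monoid \<Rightarrow> 'g set \<Rightarrow> 'g set \<Rightarrow> (('g \<times> 'g set) set set \<Rightarrow> 'k::field)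
     \<Rightarrow> (('g \<times> 'g set) set set \<Rightarrow> 'k) \<Rightarrow> 'k" where
  "formG G P Q \<phi> \<psi> = tauO (secq G P Q) (piB (secq G P Q) (bcomp (secq G P Q) G (secq G P Q) (bop \<phi>) \<psi>))"

definition Kfull :: "'g monoid \<Rightarrow> 'g set \<Rightarrow> 'g set \<Rightarrow> (('g \<times> 'g) set set \<Rightarrow> 'k::field) set" where
  "Kfull G P Q = {bcomp G (secq G P Q) G \<alpha> (Defres G P Q) | \<alpha>. \<alpha> \<in> kB G (secq G P Q)}"

definition Kless :: "'g monoid \<Rightarrow> 'g set \<Rightarrow> 'g set \<Rightarrow> (('g \<times> 'g) set set \<Rightarrow> 'k::field) set" where
  "Kless G P Q = {bcomp G (secq G P Q) G \<alpha> (Defres G P Q) | \<alpha>. \<alpha> \<in> kI G (secq G P Q)}"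

text \<open>Preimage in K_(P,Q) of R' (the image of the radical of the form restricted to the \<Gamma>-fixed points).\<close>
definition Rpre :: "'g monoid \<Rightarrow> 'g set \<Rightarrow> 'g set \<Rightarrow> (('g \<times> 'g) set set \<Rightarrow> 'k::field) set" where
  "Rpre G P Q = {(\<lambda>C. x C + bcomp G (secq G P Q) G \<alpha> (Defres G P Q) C) | x \<alpha>.
      x \<in> Kless G P Q \<and> \<alpha> \<in> kB G (secq G P Q) \<and> fixG G P Q \<alpha> \<and>
      (\<forall>\<beta>\<in>kB G (secq G P Q). fixG G P Q \<beta> \<longrightarrow> formG G P Q \<alpha> \<beta> = 0)}"

definition regmod :: "'g monoid \<Rightarrow> (('g \<times> 'g) set set \<Rightarrow> 'k::field) set
     \<Rightarrow> (('g \<times> 'g) set set \<Rightarrow> 'k, 'k, ('g \<times> 'g) set set \<Rightarrow> 'k) kmod" where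
  "regmod G S = \<lparr> mcar = S, mzero = (\<lambda>C. 0), madd = (\<lambda>x y C. x C + y C),
      msmul = (\<lambda>c x C. c * x C), mact = (\<lambda>\<psi> x. bcomp G G G \<psi> x) \<rparr>"

text \<open>\<bar>K_(P,Q)/R' \<cong> K_(P,Q) / (K_<(P,Q) + preimage of R').\<close>
definition KbarR :: "'g monoid \<Rightarrow> 'g set \<Rightarrow> 'g set
     \<Rightarrow> (('g \<times> 'g) set set \<Rightarrow> 'k::field, 'k, (('g \<times> 'g) set set \<Rightarrow> 'k) set) kmod" where
  "KbarR G P Q = qmod (regmod G (Kfull G P Q)) (Rpre G P Q)"

end

(* In characteristic zero, composition of bisets is a convolution of functions on subgroups: if the class
   of (X x Y)/L is spread evenly over the conjugates of L, a pair (L, M) contributes, up to the factor |Y|,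
   kap(L,M) times the composite relation L O M, where kap(L,M) counts the y with (1,y) in L and (y,1) in M.
   Associativity becomes a cocycle identity for kap.  The ideal kI(X,H) consists of the elements vanishing on
   all L that project onto H and meet 1 x H trivially; for X = H these L are the graphs of automorphisms,
   whence kB(H,H)/kI(H,H) = k Out(H).

   Both sides of the isomorphism are realised by maps kB(H,G) -> W.  S_{H,W}(G) is the span of the maps
   psi |-> pi(psi phi) w, and alpha Defres |-> (psi |-> pi(psi alpha) Gamma) is well defined because an alpha
   with alpha Defres = 0 lies in kI(G,H) after averaging over Gamma; nondegeneracy of tau identifies the
   kernel with K_< + R'.  In this model a submodule S consists of all maps with values in the
   Out(H)-submodule of W spanned by the values of the members of S, so complements come from Maschke's
   theorem for Out(H), and a decomposition of W splits the maps. *)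

theory Submission
  imports Defs "HOL-Library.Function_Algebras" "HOL.Vector_Spaces"
begin

subsection \<open>Counting with finite group actions\<close>

text \<open>Two kinds of choice shape the development. \<open>bcomp\<close> picks representatives of
  conjugacy classes, and the Mackey formula written with double cosets would keep depending on them;
  once every class is spread over its members, all sums run over all subgroups and no double coset
  occurs. The price is division by group orders, the first use of characteristic zero; averaging
  over \<Gamma> and over \<open>Out H\<close> are the others. Quotient modules compute with chosen
  representatives of cosets, so each quotient is traded for the image of a homomorphism into a space
  of functions. The delicate point is that the form is tested only against \<Gamma>-fixed classes
  and only through \<tau>. Let s be the sum over \<Gamma>. It equals its own opposite and \<tau> is
  a trace, so testing a fixed class against fixed classes is as good as testing it against
  everything; composing with the Iso classes then recovers all coefficients of \<pi> from \<tau>.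
  Fixed means fixed modulo \<open>kI\<close>, whereas injectivity of composition with
  \<open>Defres\<close> needs exact invariance, and multiplication by s turns the one into the
  other. The permutation module appears because the left ideal k Out(H) s is isomorphic to
  k[Out(H)/\<Gamma>].\<close>

definition fin_group :: "('a,'b) monoid_scheme \<Rightarrow> bool" where
  "fin_group D \<longleftrightarrow> group D \<and> finite (carrier D)"

lemma fin_group_DirProd: "fin_group X \<Longrightarrow> fin_group Y \<Longrightarrow> fin_group (X \<times>\<times> Y)"
  by (auto simp: fin_group_def DirProd_group)

text \<open>The acting function is constrained only on \<open>S\<close>, because
  \<open>biset_class\<close> receives unrestricted functions such as multiplication of
  cosets.\<close>

definition acts_on :: "('d,'b) monoid_scheme \<Rightarrow> ('d \<Rightarrow> 'u \<Rightarrow> 'u) \<Rightarrow> 'u set \<Rightarrow> bool" where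
  "acts_on D act S \<longleftrightarrow> (\<forall>g\<in>carrier D. \<forall>s\<in>S. act g s \<in> S) \<and> (\<forall>s\<in>S. act \<one>\<^bsub>D\<^esub> s = s) \<and>
     (\<forall>g\<in>carrier D. \<forall>h\<in>carrier D. \<forall>s\<in>S. act (g \<otimes>\<^bsub>D\<^esub> h) s = act g (act h s))"

lemma acts_onD:
  assumes "acts_on D act S" "s \<in> S"
  shows "g \<in> carrier D \<Longrightarrow> act g s \<in> S" "act \<one>\<^bsub>D\<^esub> s = s"
    "g \<in> carrier D \<Longrightarrow> h \<in> carrier D \<Longrightarrow> act (g \<otimes>\<^bsub>D\<^esub> h) s = act g (act h s)"
  using assms by (auto simp: acts_on_def)

lemma acts_on_inv:
  assumes "group D" "acts_on D act S" "s \<in> S" "g \<in> carrier D"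
  shows "act (inv\<^bsub>D\<^esub> g) (act g s) = s" "act g (act (inv\<^bsub>D\<^esub> g) s) = s"
proof -
  interpret group D by fact
  show "act (inv\<^bsub>D\<^esub> g) (act g s) = s" "act g (act (inv\<^bsub>D\<^esub> g) s) = s"
    using acts_onD(2)[OF assms(2,3)] acts_onD(3)[OF assms(2,3) inv_closed[OF assms(4)] assms(4)]
      acts_onD(3)[OF assms(2,3) assms(4) inv_closed[OF assms(4)]] assms(4) by simp_all
qed

lemma acts_on_subset:
  "acts_on D act S \<Longrightarrow> T \<subseteq> S \<Longrightarrow> (\<And>g s. g \<in> carrier D \<Longrightarrow> s \<in> T \<Longrightarrow> act g s \<in> T) \<Longrightarrow> acts_on D act T"
  unfolding acts_on_def by blast

lemma stab_subgroup:
  assumes "group D" "acts_on D act S" "s \<in> S"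
  shows "subgroup (stab D act s) D"
proof -
  interpret group D by fact
  show ?thesis
  proof (rule subgroupI)
    show "stab D act s \<noteq> {}" using acts_onD(2)[OF assms(2,3)] by (auto simp: stab_def)
    show "inv\<^bsub>D\<^esub> a \<in> stab D act s" if "a \<in> stab D act s" for a
      using that acts_on_inv(1)[OF assms(1-3), of a] by (auto simp: stab_def)
    show "a \<otimes>\<^bsub>D\<^esub> b \<in> stab D act s" if "a \<in> stab D act s" "b \<in> stab D act s" for a b
      using that acts_onD(3)[OF assms(2,3)] by (auto simp: stab_def)
  qed (auto simp: stab_def)
qed

lemma orb_self: "group D \<Longrightarrow> acts_on D act S \<Longrightarrow> s \<in> S \<Longrightarrow> s \<in> orb D act s"
  using acts_onD(2)[of D act S s] by (auto simp: orb_def image_iff intro!: bexI[of _ "\<one>\<^bsub>D\<^esub>"] group.is_monoid monoid.one_closed)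

lemma orb_subset: "acts_on D act S \<Longrightarrow> s \<in> S \<Longrightarrow> orb D act s \<subseteq> S"
  by (auto simp: orb_def acts_on_def)

lemma orb_eq:
  assumes "group D" "acts_on D act S" "s \<in> S" "t \<in> orb D act s"
  shows "orb D act t = orb D act s"
proof -
  interpret group D by fact
  obtain g where g: "g \<in> carrier D" "t = act g s" using assms(4) by (auto simp: orb_def)
  have "act h t = act (h \<otimes>\<^bsub>D\<^esub> g) s" if "h \<in> carrier D" for h
    using acts_onD[OF assms(2,3)] g that by simp
  hence "orb D act t \<subseteq> orb D act s" using g(1) unfolding orb_def by (auto intro!: imageI)
  moreover have "act h s = act (h \<otimes>\<^bsub>D\<^esub> inv\<^bsub>D\<^esub> g) t" if "h \<in> carrier D" for h
  proof -
    have "act (h \<otimes>\<^bsub>D\<^esub> inv\<^bsub>D\<^esub> g) t = act h (act (inv\<^bsub>D\<^esub> g) t)"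
      using that g acts_onD[OF assms(2)] assms(3) by auto
    thus ?thesis using acts_on_inv[OF assms(1-3) g(1)] g by simp
  qed
  hence "orb D act s \<subseteq> orb D act t" using g(1) unfolding orb_def by (auto intro!: imageI)
  ultimately show ?thesis by blast
qed

text \<open>With \<open>t = g s\<close> the transporter is both the coset
  \<open>stab t \<cdot> g\<close> and the coset \<open>g \<cdot> stab s\<close>. The first
  description gives each point of the orbit its own weight, the second a weight that can leave the
  sum.\<close>

lemma card_transporter:
  assumes "group D" "acts_on D act S" "s \<in> S" "t \<in> orb D act s"
  shows "card {g \<in> carrier D. act g s = t} = card (stab D act t)"
    "card {g \<in> carrier D. act g s = t} = card (stab D act s)"
proof -
  interpret group D by fact
  obtain g where g: "g \<in> carrier D" "t = act g s" using assms(4) by (auto simp: orb_def)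
  note A = acts_onD[OF assms(2,3)] and I = acts_on_inv[OF assms(1-3)]
  have tS: "t \<in> S" using g A by auto
  note B = acts_onD[OF assms(2) tS] and J = acts_on_inv[OF assms(1,2) tS]
  have "bij_betw (\<lambda>h. h \<otimes>\<^bsub>D\<^esub> g) (stab D act t) {h \<in> carrier D. act h s = t}"
    by (rule bij_betwI[where g = "\<lambda>h. h \<otimes>\<^bsub>D\<^esub> inv\<^bsub>D\<^esub> g"])
      (use A B I J g in \<open>auto simp: stab_def m_assoc\<close>)
  thus "card {g \<in> carrier D. act g s = t} = card (stab D act t)"
    by (simp add: bij_betw_same_card)
  have K: "act (inv\<^bsub>D\<^esub> g) t = s" using I(1)[OF g(1)] g by simp
  have "bij_betw (\<lambda>h. g \<otimes>\<^bsub>D\<^esub> h) (stab D act s) {h \<in> carrier D. act h s = t}"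
    by (rule bij_betwI[where g = "\<lambda>h. inv\<^bsub>D\<^esub> g \<otimes>\<^bsub>D\<^esub> h"])
      (use A B I J K g in \<open>auto simp: stab_def m_assoc[symmetric]\<close>)
  thus "card {g \<in> carrier D. act g s = t} = card (stab D act s)"
    by (simp add: bij_betw_same_card)
qed

lemma sum_over_group:
  fixes h :: "'u \<Rightarrow> 'k::semiring_1"
  assumes "fin_group D" "acts_on D act S" "s \<in> S"
  shows "(\<Sum>g\<in>carrier D. h (act g s)) = (\<Sum>t\<in>orb D act s. of_nat (card (stab D act t)) * h t)"
    "(\<Sum>g\<in>carrier D. h (act g s)) = of_nat (card (stab D act s)) * (\<Sum>t\<in>orb D act s. h t)"
proof -
  have D: "group D" "finite (carrier D)" using assms by (auto simp: fin_group_def)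
  have "(\<Sum>g\<in>carrier D. h (act g s)) =
      (\<Sum>t\<in>orb D act s. \<Sum>g\<in>{g\<in>carrier D. act g s = t}. h (act g s))"
    unfolding orb_def by (rule sum.image_gen) fact
  also have "\<dots> = (\<Sum>t\<in>orb D act s. of_nat (card {g\<in>carrier D. act g s = t}) * h t)"
    by (intro sum.cong) auto
  finally have E: "(\<Sum>g\<in>carrier D. h (act g s)) =
     (\<Sum>t\<in>orb D act s. of_nat (card {g\<in>carrier D. act g s = t}) * h t)" .
  show "(\<Sum>g\<in>carrier D. h (act g s)) = (\<Sum>t\<in>orb D act s. of_nat (card (stab D act t)) * h t)"
    unfolding E by (intro sum.cong) (simp_all add: card_transporter(1)[OF D(1) assms(2,3)])
  show "(\<Sum>g\<in>carrier D. h (act g s)) = of_nat (card (stab D act s)) * (\<Sum>t\<in>orb D act s. h t)"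
    unfolding E sum_distrib_left
    by (intro sum.cong) (simp_all add: card_transporter(2)[OF D(1) assms(2,3)])
qed

lemma orbit_stabilizer:
  assumes "fin_group D" "acts_on D act S" "s \<in> S"
  shows "card (stab D act s) * card (orb D act s) = card (carrier D)"
    "(\<Sum>t\<in>orb D act s. card (stab D act t)) = card (carrier D)"
  using sum_over_group[OF assms, of "\<lambda>_. 1::nat"] by auto

lemma stab_act:
  assumes "group D" "acts_on D act S" "s \<in> S" "g \<in> carrier D"
  shows "stab D act (act g s) = conjg D g (stab D act s)"
proof -
  interpret group D by fact
  note A = acts_onD[OF assms(2,3)] and I = acts_on_inv[OF assms(1-4)]
  have 1: "h \<otimes>\<^bsub>D\<^esub> g = g \<otimes>\<^bsub>D\<^esub> (inv\<^bsub>D\<^esub> g \<otimes>\<^bsub>D\<^esub> h \<otimes>\<^bsub>D\<^esub> g)" if "h \<in> carrier D" for h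
    using that assms(4) by (simp add: m_assoc[symmetric])
  have 2: "h = g \<otimes>\<^bsub>D\<^esub> (inv\<^bsub>D\<^esub> g \<otimes>\<^bsub>D\<^esub> h \<otimes>\<^bsub>D\<^esub> g) \<otimes>\<^bsub>D\<^esub> inv\<^bsub>D\<^esub> g" if "h \<in> carrier D" for h
    using that assms(4) by (metis 1 inv_closed m_closed m_assoc r_inv r_one)
  have 3: "act (inv\<^bsub>D\<^esub> g \<otimes>\<^bsub>D\<^esub> h \<otimes>\<^bsub>D\<^esub> g) s = s" if "h \<in> carrier D" "act h (act g s) = act g s" for h
  proof -
    have "act (inv\<^bsub>D\<^esub> g \<otimes>\<^bsub>D\<^esub> h \<otimes>\<^bsub>D\<^esub> g) s = act (inv\<^bsub>D\<^esub> g) (act (h \<otimes>\<^bsub>D\<^esub> g) s)"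
      using that assms(4) A by (simp add: m_assoc)
    also have "\<dots> = s" using that A assms(4) I by simp
    finally show ?thesis .
  qed
  have 4: "act (g \<otimes>\<^bsub>D\<^esub> h \<otimes>\<^bsub>D\<^esub> inv\<^bsub>D\<^esub> g) (act g s) = act g s" if "h \<in> carrier D" "act h s = s" for h
  proof -
    have "act (g \<otimes>\<^bsub>D\<^esub> h \<otimes>\<^bsub>D\<^esub> inv\<^bsub>D\<^esub> g) (act g s) = act (g \<otimes>\<^bsub>D\<^esub> h \<otimes>\<^bsub>D\<^esub> inv\<^bsub>D\<^esub> g \<otimes>\<^bsub>D\<^esub> g) s"
      using that assms(4) A by simp
    also have "\<dots> = act (g \<otimes>\<^bsub>D\<^esub> h) s" using that assms(4) by (simp add: m_assoc)
    finally show ?thesis using that A assms(4) by simp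
  qed
  show ?thesis
  proof safe
    fix h assume "h \<in> stab D act (act g s)"
    hence h: "h \<in> carrier D" "act h (act g s) = act g s" by (auto simp: stab_def)
    have "inv\<^bsub>D\<^esub> g \<otimes>\<^bsub>D\<^esub> h \<otimes>\<^bsub>D\<^esub> g \<in> stab D act s" using 3 h assms(4) by (auto simp: stab_def)
    thus "h \<in> conjg D g (stab D act s)" unfolding conjg_def using 2[OF h(1)] by (rule rev_image_eqI)
  qed (use 4 assms(4) in \<open>auto simp: stab_def conjg_def\<close>)
qed

section \<open>Conjugacy classes of subgroups as orbits of the conjugation action\<close>

definition cls :: "('d,'b) monoid_scheme \<Rightarrow> 'd set \<Rightarrow> 'd set set" where
  "cls D L = (\<lambda>g. conjg D g L) ` carrier D"

lemma cls_orb: "cls D L = orb D (conjg D) L" by (simp add: cls_def orb_def)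

lemma conj_classes_cls: "conj_classes D = cls D ` {L. subgroup L D}"
  by (auto simp: conj_classes_def cls_def)

lemma stab_image_orb:
  assumes "group D" "acts_on D act S" "s \<in> S"
  shows "stab D act ` orb D act s = cls D (stab D act s)"
  using stab_act[OF assms] by (auto simp: cls_def orb_def image_iff)

definition Sub :: "('d,'b) monoid_scheme \<Rightarrow> 'd set set" where "Sub D = {L. subgroup L D}"

lemma conjg_Pow: "group D \<Longrightarrow> acts_on D (conjg D) (Pow (carrier D))"
proof -
  assume "group D"
  then interpret group D .
  show ?thesis unfolding acts_on_def
  proof (intro conjI ballI)
    fix g h s assume *: "g \<in> carrier D" "h \<in> carrier D" "s \<in> Pow (carrier D)"
    show "conjg D (g \<otimes>\<^bsub>D\<^esub> h) s = conjg D g (conjg D h s)"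
      unfolding conjg_def image_image using *
      by (intro image_cong refl) (auto simp: m_assoc inv_mult_group subset_iff)
  next
    fix s assume *: "s \<in> Pow (carrier D)"
    have "conjg D \<one>\<^bsub>D\<^esub> s = (\<lambda>x. x) ` s" unfolding conjg_def using *
      by (intro image_cong refl) auto
    thus "conjg D \<one>\<^bsub>D\<^esub> s = s" by simp
  qed (auto simp: conjg_def)
qed

lemma subgroup_conjg:
  assumes "group D" "subgroup L D" "g \<in> carrier D"
  shows "subgroup (conjg D g L) D"
proof -
  interpret group D by fact
  interpret L: subgroup L D by fact
  have [simp]: "x \<in> L \<Longrightarrow> x \<in> carrier D" for x by (rule L.mem_carrier)
  show ?thesis
  proof (rule subgroupI)
    show "conjg D g L \<noteq> {}" by (auto simp: conjg_def intro: L.one_closed)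
    show "inv\<^bsub>D\<^esub> a \<in> conjg D g L" if a: "a \<in> conjg D g L" for a
    proof -
      obtain l where l: "l \<in> L" "a = g \<otimes>\<^bsub>D\<^esub> l \<otimes>\<^bsub>D\<^esub> inv\<^bsub>D\<^esub> g" using a by (auto simp: conjg_def)
      have "inv\<^bsub>D\<^esub> a = g \<otimes>\<^bsub>D\<^esub> inv\<^bsub>D\<^esub> l \<otimes>\<^bsub>D\<^esub> inv\<^bsub>D\<^esub> g" using l assms(3) by (simp add: inv_mult_group m_assoc)
      thus ?thesis using l by (auto simp: conjg_def)
    qed
    show "a \<otimes>\<^bsub>D\<^esub> b \<in> conjg D g L" if a: "a \<in> conjg D g L" and b: "b \<in> conjg D g L" for a b
    proof -
      obtain l where l: "l \<in> L" "a = g \<otimes>\<^bsub>D\<^esub> l \<otimes>\<^bsub>D\<^esub> inv\<^bsub>D\<^esub> g" using a by (auto simp: conjg_def)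
      obtain m where m: "m \<in> L" "b = g \<otimes>\<^bsub>D\<^esub> m \<otimes>\<^bsub>D\<^esub> inv\<^bsub>D\<^esub> g" using b by (auto simp: conjg_def)
      have "a \<otimes>\<^bsub>D\<^esub> b = g \<otimes>\<^bsub>D\<^esub> (l \<otimes>\<^bsub>D\<^esub> (inv\<^bsub>D\<^esub> g \<otimes>\<^bsub>D\<^esub> g) \<otimes>\<^bsub>D\<^esub> m) \<otimes>\<^bsub>D\<^esub> inv\<^bsub>D\<^esub> g"
        using l m assms(3) by (simp only: m_assoc m_closed inv_closed L.mem_carrier)
      also have "\<dots> = g \<otimes>\<^bsub>D\<^esub> (l \<otimes>\<^bsub>D\<^esub> m) \<otimes>\<^bsub>D\<^esub> inv\<^bsub>D\<^esub> g" using assms(3) l m by simp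
      finally show ?thesis using l m by (auto simp: conjg_def)
    qed
  qed (use assms(3) in \<open>auto simp: conjg_def\<close>)
qed

lemma Sub_subset: "Sub D \<subseteq> Pow (carrier D)"
  by (auto simp: Sub_def dest: subgroup.subset)

lemma finite_Sub: "fin_group D \<Longrightarrow> finite (Sub D)"
  using finite_subset[OF Sub_subset] by (auto simp: fin_group_def)

lemma conjg_Sub: "group D \<Longrightarrow> acts_on D (conjg D) (Sub D)"
  by (rule acts_on_subset[OF conjg_Pow Sub_subset]) (auto simp: Sub_def subgroup_conjg)

lemma cls_subset_Sub: "group D \<Longrightarrow> L \<in> Sub D \<Longrightarrow> cls D L \<subseteq> Sub D"
  unfolding cls_orb by (rule orb_subset[OF conjg_Sub])

lemma cls_eq: "group D \<Longrightarrow> L \<in> Sub D \<Longrightarrow> M \<in> cls D L \<Longrightarrow> cls D M = cls D L"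
  unfolding cls_orb by (rule orb_eq[OF _ conjg_Sub])

lemma cls_self: "group D \<Longrightarrow> L \<in> Sub D \<Longrightarrow> L \<in> cls D L"
  unfolding cls_orb by (rule orb_self[OF _ conjg_Sub])

lemma cls_conjg: "group D \<Longrightarrow> L \<in> Sub D \<Longrightarrow> g \<in> carrier D \<Longrightarrow> cls D (conjg D g L) = cls D L"
  by (rule cls_eq) (auto simp: cls_def)

lemma finite_cls: "fin_group D \<Longrightarrow> finite (cls D L)"
  by (simp add: cls_def fin_group_def)

lemma card_conjg:
  assumes "group D" "L \<subseteq> carrier D" "g \<in> carrier D"
  shows "card (conjg D g L) = card L"
  unfolding conjg_def
proof (rule card_image, rule inj_onI)
  interpret group D by fact
  fix x y assume *: "x \<in> L" "y \<in> L" "g \<otimes>\<^bsub>D\<^esub> x \<otimes>\<^bsub>D\<^esub> inv\<^bsub>D\<^esub> g = g \<otimes>\<^bsub>D\<^esub> y \<otimes>\<^bsub>D\<^esub> inv\<^bsub>D\<^esub> g"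
  have "x \<in> carrier D" "y \<in> carrier D" using * assms by auto
  thus "x = y" using *(3) assms(3) by (simp add: m_assoc)
qed

lemma card_cls_mem: "group D \<Longrightarrow> L \<in> Sub D \<Longrightarrow> M \<in> cls D L \<Longrightarrow> card M = card L"
  using Sub_subset[of D] by (auto simp: cls_def card_conjg)

lemma sum_Sub:
  fixes F :: "'d set \<Rightarrow> 'k::comm_monoid_add"
  assumes "fin_group D"
  shows "(\<Sum>L\<in>Sub D. F L) = (\<Sum>C\<in>conj_classes D. \<Sum>L\<in>C. F L)"
proof -
  have D: "group D" using assms by (simp add: fin_group_def)
  have "(\<Sum>L\<in>Sub D. F L) = (\<Sum>C\<in>cls D ` Sub D. \<Sum>L\<in>{L\<in>Sub D. cls D L = C}. F L)"
    by (rule sum.image_gen) (rule finite_Sub[OF assms])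
  also have "\<dots> = (\<Sum>C\<in>conj_classes D. \<Sum>L\<in>C. F L)"
  proof (rule sum.cong)
    show "cls D ` Sub D = conj_classes D" by (simp add: conj_classes_cls Sub_def)
    fix C assume "C \<in> conj_classes D"
    then obtain L where L: "L \<in> Sub D" "C = cls D L" by (auto simp: conj_classes_cls Sub_def)
    have "{M\<in>Sub D. cls D M = C} = C"
      using L cls_subset_Sub[OF D L(1)] cls_eq[OF D L(1)] cls_self[OF D] by blast
    thus "(\<Sum>L\<in>{L\<in>Sub D. cls D L = C}. F L) = (\<Sum>L\<in>C. F L)" by simp
  qed
  finally show ?thesis .
qed

text \<open>The stabilizer orders along one orbit add up to \<open>|D|\<close>, so weighting points
  by them counts every orbit \<open>|D|\<close> times. Sums over orbits thus become sums over
  points; this serves both the orbits of the outer group on a composite and the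
  \<open>Y\<close>-orbits that make up the composite.\<close>

lemma sum_orbits:
  fixes h :: "'u set \<Rightarrow> 'k::comm_semiring_1"
  assumes "fin_group D" "acts_on D act S" "finite S"
  shows "of_nat (card (carrier D)) * (\<Sum>w\<in>orb D act ` S. h w)
    = (\<Sum>s\<in>S. of_nat (card (stab D act s)) * h (orb D act s))"
proof -
  have D: "group D" using assms by (simp add: fin_group_def)
  have "(\<Sum>s\<in>S. of_nat (card (stab D act s)) * h (orb D act s)) =
     (\<Sum>w\<in>orb D act ` S. \<Sum>s\<in>{s\<in>S. orb D act s = w}. of_nat (card (stab D act s)) * h (orb D act s))"
    by (rule sum.image_gen) fact
  also have "\<dots> = (\<Sum>w\<in>orb D act ` S. of_nat (card (carrier D)) * h w)"
  proof (rule sum.cong[OF refl])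
    fix w assume "w \<in> orb D act ` S"
    then obtain s where s: "s \<in> S" "w = orb D act s" by auto
    have "{t\<in>S. orb D act t = w} = orb D act s"
      using s orb_subset[OF assms(2) s(1)] orb_eq[OF D assms(2) s(1)] orb_self[OF D assms(2)] by blast
    hence "(\<Sum>s\<in>{s\<in>S. orb D act s = w}. of_nat (card (stab D act s)) * h (orb D act s))
       = (\<Sum>t\<in>orb D act s. of_nat (card (stab D act t)) * h w)"
      using s orb_eq[OF D assms(2) s(1)] by (intro sum.cong) auto
    also have "\<dots> = of_nat (\<Sum>t\<in>orb D act s. card (stab D act t)) * h w"
      by (simp add: sum_distrib_right)
    finally show "(\<Sum>s\<in>{s\<in>S. orb D act s = w}. of_nat (card (stab D act s)) * h (orb D act s))
        = of_nat (card (carrier D)) * h w"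
      using orbit_stabilizer(2)[OF assms(1,2) s(1)] by simp
  qed
  finally show ?thesis by (simp add: sum_distrib_left)
qed

lemma biset_class_sum:
  assumes "fin_group D" "acts_on D act S" "finite S"
  shows "of_nat (card (carrier D)) * biset_class D S act C
    = (\<Sum>s\<in>S. of_nat (card (stab D act s)) * (if cls D (stab D act s) = C then 1 else (0::'k::field)))"
proof -
  have D: "group D" using assms by (simp add: fin_group_def)
  have "biset_class D S act C = (\<Sum>w\<in>orb D act ` S. if stab D act ` w = C then 1 else (0::'k))"
    unfolding biset_class_def using assms(3) by (simp add: sum.If_cases Int_def)
  hence "of_nat (card (carrier D)) * biset_class D S act C = (\<Sum>s\<in>S. of_nat (card (stab D act s)) *
      (if stab D act ` orb D act s = C then 1 else (0::'k)))"
    using sum_orbits[OF assms, of "\<lambda>w. if stab D act ` w = C then 1 else (0::'k)"] by simp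
  also have "\<dots> = (\<Sum>s\<in>S. of_nat (card (stab D act s)) * (if cls D (stab D act s) = C then 1 else (0::'k)))"
    using stab_image_orb[OF D assms(2)] by (intro sum.cong) auto
  finally show ?thesis .
qed

text \<open>The class of the transitive set \<open>D/L\<close>; over representatives of the
  conjugacy classes these form a basis of \<open>kB\<close>.\<close>

definition bas :: "('d,'b) monoid_scheme \<Rightarrow> 'd set \<Rightarrow> 'd set set \<Rightarrow> 'k::field" where
  "bas D L = (\<lambda>C. if C = cls D L then 1 else 0)"

lemma biset_class_transitive:
  assumes "group D" "acts_on D act S" "s \<in> S" "S \<subseteq> orb D act s"
  shows "biset_class D S act = bas D (stab D act s)"
proof -
  have "orb D act ` S = {orb D act s}"
    using assms(3,4) orb_eq[OF assms(1,2,3)] by auto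
  hence "{Ob \<in> orb D act ` S. stab D act ` Ob = C} = (if C = cls D (stab D act s) then {orb D act s} else {})" for C
    using stab_image_orb[OF assms(1-3)] by auto
  thus ?thesis unfolding biset_class_def bas_def by auto
qed

subsection \<open>Sums over conjugates and cosets\<close>

text \<open>The fibres of \<open>g \<mapsto> conjg D g L\<close> are cosets of the normalizer of
  \<open>L\<close>, all of size \<open>|D| / |cls D L|\<close>. Denominators are cleared, so no
  division in the coefficients is required.\<close>

lemma sum_conjugates:
  fixes h :: "'d set \<Rightarrow> 'k::comm_semiring_1"
  assumes "fin_group D" "L \<in> Sub D"
  shows "of_nat (card (cls D L)) * (\<Sum>g\<in>carrier D. h (conjg D g L)) = of_nat (card (carrier D)) * (\<Sum>M\<in>cls D L. h M)"
proof -
  have D: "group D" using assms by (simp add: fin_group_def)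
  note A = conjg_Sub[OF D]
  have "of_nat (card (cls D L)) * (\<Sum>g\<in>carrier D. h (conjg D g L))
    = of_nat (card (stab D (conjg D) L) * card (orb D (conjg D) L)) * (\<Sum>M\<in>cls D L. h M)"
    unfolding sum_over_group(2)[OF assms(1) A assms(2), of h] cls_orb by (simp add: mult_ac)
  thus ?thesis using orbit_stabilizer(1)[OF assms(1) A assms(2)] by simp
qed

lemma lcos_acts: 
  assumes "group D" "L \<subseteq> carrier D"
  shows "acts_on D (\<lambda>g u. g <#\<^bsub>D\<^esub> u) {a <#\<^bsub>D\<^esub> L | a. a \<in> carrier D}"
proof -
  interpret group D by fact
  have 1: "g <#\<^bsub>D\<^esub> (a <#\<^bsub>D\<^esub> L) = (g \<otimes>\<^bsub>D\<^esub> a) <#\<^bsub>D\<^esub> L" if "g \<in> carrier D" "a \<in> carrier D" for g a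
    using that assms by (simp add: lcos_m_assoc)
  show ?thesis unfolding acts_on_def
    using assms by (auto simp: 1 m_assoc) 
qed

lemma stab_lcos:
  assumes "group D" "L \<in> Sub D"
  shows "L \<in> {a <#\<^bsub>D\<^esub> L | a. a \<in> carrier D}" 
    "orb D (\<lambda>g u. g <#\<^bsub>D\<^esub> u) L = {a <#\<^bsub>D\<^esub> L | a. a \<in> carrier D}"
    "stab D (\<lambda>g u. g <#\<^bsub>D\<^esub> u) L = L"
proof -
  interpret group D by fact
  have L: "subgroup L D" using assms by (simp add: Sub_def)
  have "\<one>\<^bsub>D\<^esub> <#\<^bsub>D\<^esub> L = L" using lcos_mult_one[of L] subgroup.subset[OF L] by blast
  thus "L \<in> {a <#\<^bsub>D\<^esub> L | a. a \<in> carrier D}" by force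
  show "orb D (\<lambda>g u. g <#\<^bsub>D\<^esub> u) L = {a <#\<^bsub>D\<^esub> L | a. a \<in> carrier D}" by (auto simp: orb_def)
  show "stab D (\<lambda>g u. g <#\<^bsub>D\<^esub> u) L = L"
  proof safe
    fix x assume x: "x \<in> stab D (\<lambda>g u. g <#\<^bsub>D\<^esub> u) L"
    have "x \<otimes>\<^bsub>D\<^esub> \<one>\<^bsub>D\<^esub> \<in> x <#\<^bsub>D\<^esub> L" using subgroup.one_closed[OF L] by (auto simp: l_coset_def)
    thus "x \<in> L" using x by (auto simp: stab_def)
  next
    fix x assume "x \<in> L"
    thus "x \<in> stab D (\<lambda>g u. g <#\<^bsub>D\<^esub> u) L"
      using subgroup.lcos_module_rev coset_join3[OF _ L, of x] subgroup.mem_carrier[OF L] by (auto simp: stab_def)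
  qed
qed

text \<open>Each coset \<open>g L\<close> arises from \<open>|L|\<close> elements \<open>g\<close>
  and has stabilizer \<open>g L g^-1\<close>; hence a sum over stabilizers of the points of
  \<open>D/L\<close> is a sum over conjugates of \<open>L\<close>.\<close>

lemma sum_lcos:
  fixes h :: "'d set \<Rightarrow> 'k::comm_semiring_1"
  assumes "fin_group D" "L \<in> Sub D"
  shows "of_nat (card (cls D L)) * of_nat (card L) * (\<Sum>u\<in>{a <#\<^bsub>D\<^esub> L | a. a \<in> carrier D}. h (stab D (\<lambda>g u. g <#\<^bsub>D\<^esub> u) u))
    = of_nat (card (carrier D)) * (\<Sum>M\<in>cls D L. h M)"
proof -
  have D: "group D" using assms by (simp add: fin_group_def)
  have L: "L \<subseteq> carrier D" using assms Sub_subset by auto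
  note A = lcos_acts[OF D L] and S = stab_lcos[OF D assms(2)]
  have "of_nat (card L) * (\<Sum>u\<in>{a <#\<^bsub>D\<^esub> L | a. a \<in> carrier D}. h (stab D (\<lambda>g u. g <#\<^bsub>D\<^esub> u) u))
     = (\<Sum>g\<in>carrier D. h (stab D (\<lambda>g u. g <#\<^bsub>D\<^esub> u) (g <#\<^bsub>D\<^esub> L)))"
    using sum_over_group(2)[OF assms(1) A S(1), of "\<lambda>u. h (stab D (\<lambda>g u. g <#\<^bsub>D\<^esub> u) u)"] unfolding S by simp
  also have "\<dots> = (\<Sum>g\<in>carrier D. h (conjg D g L))"
    using stab_act[OF D A S(1)] unfolding S by simp
  finally show ?thesis using sum_conjugates[OF assms, of h] by (simp add: mult.assoc)
qed

subsection \<open>Composition of bisets through subgroups\<close>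

lemma mem_Sub_DirProd:
  assumes "group X" "group Y" "L \<in> Sub (X \<times>\<times> Y)"
  shows "(x,y) \<in> L \<Longrightarrow> x \<in> carrier X" "(x,y) \<in> L \<Longrightarrow> y \<in> carrier Y" "(\<one>\<^bsub>X\<^esub>, \<one>\<^bsub>Y\<^esub>) \<in> L"
    "(x,y) \<in> L \<Longrightarrow> (x',y') \<in> L \<Longrightarrow> (x \<otimes>\<^bsub>X\<^esub> x', y \<otimes>\<^bsub>Y\<^esub> y') \<in> L"
    "(x,y) \<in> L \<Longrightarrow> (inv\<^bsub>X\<^esub> x, inv\<^bsub>Y\<^esub> y) \<in> L"
proof -
  have L: "subgroup L (X \<times>\<times> Y)" using assms by (simp add: Sub_def)
  show 1: "(x,y) \<in> L \<Longrightarrow> x \<in> carrier X" "(x,y) \<in> L \<Longrightarrow> y \<in> carrier Y"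
    using subgroup.mem_carrier[OF L] by auto
  show "(\<one>\<^bsub>X\<^esub>, \<one>\<^bsub>Y\<^esub>) \<in> L" using subgroup.one_closed[OF L] by simp
  show "(x,y) \<in> L \<Longrightarrow> (x',y') \<in> L \<Longrightarrow> (x \<otimes>\<^bsub>X\<^esub> x', y \<otimes>\<^bsub>Y\<^esub> y') \<in> L"
    using subgroup.m_closed[OF L, of "(x,y)" "(x',y')"] by simp
  show "(x,y) \<in> L \<Longrightarrow> (inv\<^bsub>X\<^esub> x, inv\<^bsub>Y\<^esub> y) \<in> L"
    using subgroup.m_inv_closed[OF L, of "(x,y)"] inv_DirProd[OF assms(1,2) 1] by simp
qed

lemma Sub_DirProdI:
  assumes "group X" "group Y" "L \<subseteq> carrier X \<times> carrier Y" "(\<one>\<^bsub>X\<^esub>, \<one>\<^bsub>Y\<^esub>) \<in> L"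
   "\<And>x y x' y'. (x,y) \<in> L \<Longrightarrow> (x',y') \<in> L \<Longrightarrow> (x \<otimes>\<^bsub>X\<^esub> x', y \<otimes>\<^bsub>Y\<^esub> y') \<in> L"
   "\<And>x y. (x,y) \<in> L \<Longrightarrow> (inv\<^bsub>X\<^esub> x, inv\<^bsub>Y\<^esub> y) \<in> L"
  shows "L \<in> Sub (X \<times>\<times> Y)"
  unfolding Sub_def mem_Collect_eq
proof (rule group.subgroupI[OF DirProd_group[OF assms(1,2)]])
  show "inv\<^bsub>X \<times>\<times> Y\<^esub> a \<in> L" if "a \<in> L" for a
    using that assms(3,6) inv_DirProd[OF assms(1,2), of "fst a" "snd a"] by (cases a) auto
qed (use assms in auto)

lemma relcomp_Sub:
  assumes X: "group X" and Y: "group Y" and Z: "group Z"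
    and L: "L \<in> Sub (X \<times>\<times> Y)" and M: "M \<in> Sub (Y \<times>\<times> Z)"
  shows "L O M \<in> Sub (X \<times>\<times> Z)"
proof -
  note l = mem_Sub_DirProd[OF X Y L] and m = mem_Sub_DirProd[OF Y Z M]
  show ?thesis
  proof (rule Sub_DirProdI[OF X Z])
    show "L O M \<subseteq> carrier X \<times> carrier Z" using l(1) m(2) by auto
    show "(\<one>\<^bsub>X\<^esub>, \<one>\<^bsub>Z\<^esub>) \<in> L O M" using l(3) m(3) by auto
    show "(x \<otimes>\<^bsub>X\<^esub> x', y \<otimes>\<^bsub>Z\<^esub> y') \<in> L O M" if xy: "(x, y) \<in> L O M" "(x', y') \<in> L O M" for x y x' y'
    proof -
      obtain v v' where "(x,v) \<in> L" "(v,y) \<in> M" "(x',v') \<in> L" "(v',y') \<in> M" using xy by auto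
      thus ?thesis using l(4)[of x v x' v'] m(4)[of v y v' y'] by auto
    qed
    show "(inv\<^bsub>X\<^esub> x, inv\<^bsub>Z\<^esub> y) \<in> L O M" if xy: "(x, y) \<in> L O M" for x y
    proof -
      obtain v where "(x,v) \<in> L" "(v,y) \<in> M" using xy by auto
      thus ?thesis using l(5)[of x v] m(5)[of v y] by auto
    qed
  qed
qed

lemma converse_Sub:
  assumes X: "group X" and Y: "group Y" and L: "L \<in> Sub (X \<times>\<times> Y)"
  shows "L\<inverse> \<in> Sub (Y \<times>\<times> X)"
  using mem_Sub_DirProd[OF X Y L] by (intro Sub_DirProdI X Y) auto

lemma mem_conjg_DirProd:
  assumes X: "group X" and Y: "group Y" and L: "L \<subseteq> carrier X \<times> carrier Y"
    and g: "x \<in> carrier X" "y \<in> carrier Y"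
  shows "conjg (X \<times>\<times> Y) (x,y) L
     = (\<lambda>(a,b). (x \<otimes>\<^bsub>X\<^esub> a \<otimes>\<^bsub>X\<^esub> inv\<^bsub>X\<^esub> x, y \<otimes>\<^bsub>Y\<^esub> b \<otimes>\<^bsub>Y\<^esub> inv\<^bsub>Y\<^esub> y)) ` L"
  unfolding conjg_def using g L X Y by (intro image_cong) auto

lemma conj_inj:
  assumes "group Y" "y \<in> carrier Y" "a \<in> carrier Y" "b \<in> carrier Y"
    "y \<otimes>\<^bsub>Y\<^esub> a \<otimes>\<^bsub>Y\<^esub> inv\<^bsub>Y\<^esub> y = y \<otimes>\<^bsub>Y\<^esub> b \<otimes>\<^bsub>Y\<^esub> inv\<^bsub>Y\<^esub> y"
  shows "a = b"
proof -
  interpret group Y by fact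
  show ?thesis using assms(2-5) by (simp add: m_assoc)
qed

text \<open>Conjugating both relations by the same \<open>y\<close> in the middle does not change
  which middle coordinates match. Unequal middle conjugations lead to the other terms of the Mackey
  formula.\<close>

lemma conjg_relcomp:
  assumes X: "group X" and Y: "group Y" and Z: "group Z"
    and L: "L \<in> Sub (X \<times>\<times> Y)" and M: "M \<in> Sub (Y \<times>\<times> Z)"
    and x: "x \<in> carrier X" "y \<in> carrier Y" "z \<in> carrier Z"
  shows "conjg (X \<times>\<times> Y) (x,y) L O conjg (Y \<times>\<times> Z) (y,z) M = conjg (X \<times>\<times> Z) (x,z) (L O M)"
proof -
  have s: "L \<subseteq> carrier X \<times> carrier Y" "M \<subseteq> carrier Y \<times> carrier Z" "L O M \<subseteq> carrier X \<times> carrier Z"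
    using Sub_subset L M relcomp_Sub[OF X Y Z L M] by fastforce+
  show ?thesis
    unfolding mem_conjg_DirProd[OF X Y s(1) x(1,2)] mem_conjg_DirProd[OF Y Z s(2) x(2,3)]
      mem_conjg_DirProd[OF X Z s(3) x(1,3)]
  proof safe
    fix a b c d e f assume *: "(a,b) \<in> L" "(d,e) \<in> M"
      "y \<otimes>\<^bsub>Y\<^esub> b \<otimes>\<^bsub>Y\<^esub> inv\<^bsub>Y\<^esub> y = y \<otimes>\<^bsub>Y\<^esub> d \<otimes>\<^bsub>Y\<^esub> inv\<^bsub>Y\<^esub> y"
    hence "b = d" using conj_inj[OF Y x(2)] s by blast
    thus "(x \<otimes>\<^bsub>X\<^esub> a \<otimes>\<^bsub>X\<^esub> inv\<^bsub>X\<^esub> x, z \<otimes>\<^bsub>Z\<^esub> e \<otimes>\<^bsub>Z\<^esub> inv\<^bsub>Z\<^esub> z)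
       \<in> (\<lambda>(a, b). (x \<otimes>\<^bsub>X\<^esub> a \<otimes>\<^bsub>X\<^esub> inv\<^bsub>X\<^esub> x, z \<otimes>\<^bsub>Z\<^esub> b \<otimes>\<^bsub>Z\<^esub> inv\<^bsub>Z\<^esub> z)) ` (L O M)"
      using *(1,2) by (intro rev_image_eqI[of "(a,e)"]) auto
  qed force
qed

text \<open>In the Mackey formula this is the order of \<open>k_2(L) \<inter> k_1(M)\<close>, the
  intersection of the two kernels inside the middle group. It is also the order of the stabilizer of
  a pair of cosets under the middle group, which is how it enters the composition.\<close>

definition kap :: "'x monoid \<Rightarrow> 'z monoid \<Rightarrow> ('x \<times> 'y) set \<Rightarrow> ('y \<times> 'z) set \<Rightarrow> nat" where
  "kap X Z L M = card {y. (\<one>\<^bsub>X\<^esub>, y) \<in> L \<and> (y, \<one>\<^bsub>Z\<^esub>) \<in> M}"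

text \<open>Two intermediate points \<open>y, y'\<close> over the same \<open>(x,z)\<close> differ
  by \<open>y' y^-1\<close>, which lies in both kernels; so every nonempty fibre is a coset of the
  group counted by \<open>kap\<close>.\<close>

lemma card_relcomp_fibre:
  assumes X: "group X" and Y: "group Y" and Z: "group Z"
    and L: "L \<in> Sub (X \<times>\<times> Y)" and M: "M \<in> Sub (Y \<times>\<times> Z)" and xz: "(x,z) \<in> L O M"
  shows "card {y. (x,y) \<in> L \<and> (y,z) \<in> M} = kap X Z L M"
proof -
  note l = mem_Sub_DirProd[OF X Y L] and m = mem_Sub_DirProd[OF Y Z M]
  interpret X: group X by fact
  interpret Y: group Y by fact
  interpret Z: group Z by fact
  obtain y where y: "(x,y) \<in> L" "(y,z) \<in> M" using xz by auto
  have c: "x \<in> carrier X" "y \<in> carrier Y" "z \<in> carrier Z" using l m y by auto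
  have "bij_betw (\<lambda>b. b \<otimes>\<^bsub>Y\<^esub> y) {y. (\<one>\<^bsub>X\<^esub>, y) \<in> L \<and> (y, \<one>\<^bsub>Z\<^esub>) \<in> M} {y. (x,y) \<in> L \<and> (y,z) \<in> M}"
  proof (rule bij_betwI[where g = "\<lambda>b. b \<otimes>\<^bsub>Y\<^esub> inv\<^bsub>Y\<^esub> y"], safe)
    fix b assume b: "(\<one>\<^bsub>X\<^esub>, b) \<in> L" "(b, \<one>\<^bsub>Z\<^esub>) \<in> M"
    have [simp]: "b \<in> carrier Y" using b l by auto
    show "(x, b \<otimes>\<^bsub>Y\<^esub> y) \<in> L" "(b \<otimes>\<^bsub>Y\<^esub> y, z) \<in> M"
      using l(4)[OF b(1) y(1)] m(4)[OF b(2) y(2)] c by auto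
    show "b \<otimes>\<^bsub>Y\<^esub> y \<otimes>\<^bsub>Y\<^esub> inv\<^bsub>Y\<^esub> y = b" using c by (simp add: Y.m_assoc)
  next
    fix b assume b: "(x, b) \<in> L" "(b, z) \<in> M"
    have [simp]: "b \<in> carrier Y" using b l by auto
    show "(\<one>\<^bsub>X\<^esub>, b \<otimes>\<^bsub>Y\<^esub> inv\<^bsub>Y\<^esub> y) \<in> L" "(b \<otimes>\<^bsub>Y\<^esub> inv\<^bsub>Y\<^esub> y, \<one>\<^bsub>Z\<^esub>) \<in> M"
      using l(4)[OF b(1) l(5)[OF y(1)]] m(4)[OF b(2) m(5)[OF y(2)]] c by auto
    show "b \<otimes>\<^bsub>Y\<^esub> inv\<^bsub>Y\<^esub> y \<otimes>\<^bsub>Y\<^esub> y = b" using c by (simp add: Y.m_assoc)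
  qed
  thus ?thesis unfolding kap_def by (simp add: bij_betw_same_card)
qed

text \<open>Both products count the pairs \<open>(y,z)\<close> with \<open>(1,y) \<in> L\<close>,
  \<open>(y,z) \<in> M\<close> and \<open>(z,1) \<in> N\<close>: projecting to \<open>z\<close>
  gives the left side, projecting to \<open>y\<close> the right one, and all fibres have equal size
  by \<open>card_relcomp_fibre\<close>.\<close>

lemma kap_cocycle:
  assumes X: "fin_group X" and Y: "fin_group Y" and Z: "fin_group Z" and T: "fin_group T"
    and L: "L \<in> Sub (X \<times>\<times> Y)" and M: "M \<in> Sub (Y \<times>\<times> Z)" and N: "N \<in> Sub (Z \<times>\<times> T)"
  shows "kap X Z L M * kap X T (L O M) N = kap X T L (M O N) * kap Y T M N"
proof -
  have g: "group X" "group Y" "group Z" "group T" and f: "finite (carrier Y)" "finite (carrier Z)" using assms by (auto simp: fin_group_def)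
  note l = mem_Sub_DirProd[OF g(1,2) L] and m = mem_Sub_DirProd[OF g(2,3) M] and n = mem_Sub_DirProd[OF g(3,4) N]
  let ?A = "{(y,z). (\<one>\<^bsub>X\<^esub>,y) \<in> L \<and> (y,z) \<in> M \<and> (z,\<one>\<^bsub>T\<^esub>) \<in> N}"
  let ?Z = "{z. (\<one>\<^bsub>X\<^esub>,z) \<in> L O M \<and> (z,\<one>\<^bsub>T\<^esub>) \<in> N}" and ?Y = "{y. (\<one>\<^bsub>X\<^esub>,y) \<in> L \<and> (y,\<one>\<^bsub>T\<^esub>) \<in> M O N}"
  have fin: "finite ?Z" "finite ?Y"
    using finite_subset[OF _ f(2), of ?Z] finite_subset[OF _ f(1), of ?Y] l(2) n(1) by auto
  have f2: "finite {z. (y,z) \<in> M \<and> (z,\<one>\<^bsub>T\<^esub>) \<in> N}" for y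
    by (rule finite_subset[OF _ f(2)]) (use n(1) in auto)
  have f1: "finite {y. (\<one>\<^bsub>X\<^esub>,y) \<in> L \<and> (y,z) \<in> M}" for z
    by (rule finite_subset[OF _ f(1)]) (use m(1) in auto)
  have "card ?A = card (Sigma ?Y (\<lambda>y. {z. (y,z) \<in> M \<and> (z,\<one>\<^bsub>T\<^esub>) \<in> N}))"
    by (rule arg_cong[where f = card]) auto
  also have "\<dots> = (\<Sum>y\<in>?Y. kap Y T M N)"
    using fin f2 card_relcomp_fibre[OF g(2-4) M N] by (subst card_SigmaI) (auto intro!: sum.cong simp del: sum_constant)
  finally have 1: "card ?A = kap X T L (M O N) * kap Y T M N" by (simp add: kap_def)
  have "card ?A = card (prod.swap ` ?A)" by (simp add: card_image)
  also have "prod.swap ` ?A = Sigma ?Z (\<lambda>z. {y. (\<one>\<^bsub>X\<^esub>,y) \<in> L \<and> (y,z) \<in> M})"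
    by (auto simp: image_iff)
  also have "card \<dots> = (\<Sum>z\<in>?Z. kap X Z L M)"
    using fin f1 card_relcomp_fibre[OF g(1-3) L M] by (subst card_SigmaI) (auto intro!: sum.cong simp del: sum_constant)
  finally show ?thesis using 1 by (simp add: kap_def)
qed

text \<open>Count the triples \<open>(x,y,z)\<close> with \<open>(x,y) \<in> L\<close> and
  \<open>(y,z) \<in> M\<close>. Over each point of \<open>L O M\<close> there are \<open>kap\<close>
  of them; over each point of \<open>L\<close> there are \<open>|M|/|Y|\<close>, because
  \<open>M\<close> projects onto \<open>Y\<close> and its fibres over \<open>Y\<close> are cosets of
  one group.\<close>

lemma kap_card:
  assumes X: "fin_group X" and Y: "fin_group Y" and Z: "fin_group Z"
    and L: "L \<in> Sub (X \<times>\<times> Y)" and M: "M \<in> Sub (Y \<times>\<times> Z)" and full: "fst ` M = carrier Y"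
  shows "card (carrier Y) * kap X Z L M * card (L O M) = card L * card M"
proof -
  have g: "group X" "group Y" "group Z" and f: "finite (carrier X)" "finite (carrier Y)" "finite (carrier Z)" using assms by (auto simp: fin_group_def)
  note l = mem_Sub_DirProd[OF g(1,2) L] and m = mem_Sub_DirProd[OF g(2,3) M]
  have fin: "finite L" "finite M" "finite (L O M)"
    by (rule finite_subset[of _ "carrier X \<times> carrier Y"], use f l in auto,
      rule finite_subset[of _ "carrier Y \<times> carrier Z"], use f m in auto,
      rule finite_subset[of _ "carrier X \<times> carrier Z"], use f l(1) m(2) in auto)
  let ?k = "card {z. (\<one>\<^bsub>Y\<^esub>, z) \<in> M}"
  interpret Y: group Y by fact
  interpret Z: group Z by fact
  have k: "card {z. (y,z) \<in> M} = ?k" if y: "y \<in> carrier Y" for y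
  proof -
    obtain w where w: "(y,w) \<in> M" using full y by fastforce
    have c: "w \<in> carrier Z" using w m by auto
    have "bij_betw (\<lambda>b. b \<otimes>\<^bsub>Z\<^esub> w) {z. (\<one>\<^bsub>Y\<^esub>, z) \<in> M} {z. (y,z) \<in> M}"
    proof (rule bij_betwI[where g = "\<lambda>b. b \<otimes>\<^bsub>Z\<^esub> inv\<^bsub>Z\<^esub> w"], safe)
      fix b assume b: "(\<one>\<^bsub>Y\<^esub>, b) \<in> M"
      have [simp]: "b \<in> carrier Z" using b m by auto
      show "(y, b \<otimes>\<^bsub>Z\<^esub> w) \<in> M" using m(4)[OF b w] y by simp
      show "b \<otimes>\<^bsub>Z\<^esub> w \<otimes>\<^bsub>Z\<^esub> inv\<^bsub>Z\<^esub> w = b" using c by (simp add: Z.m_assoc)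
    next
      fix b assume b: "(y, b) \<in> M"
      have [simp]: "b \<in> carrier Z" using b m by auto
      show "(\<one>\<^bsub>Y\<^esub>, b \<otimes>\<^bsub>Z\<^esub> inv\<^bsub>Z\<^esub> w) \<in> M" using m(4)[OF b m(5)[OF w]] y by simp
      show "b \<otimes>\<^bsub>Z\<^esub> inv\<^bsub>Z\<^esub> w \<otimes>\<^bsub>Z\<^esub> w = b" using c by (simp add: Z.m_assoc)
    qed
    thus ?thesis by (simp add: bij_betw_same_card)
  qed
  have fz: "finite {z. (y,z) \<in> M}" for y by (rule finite_subset[OF _ f(3)]) (use m in auto)
  have fy: "finite {y. (x,y) \<in> L \<and> (y,z) \<in> M}" for x z by (rule finite_subset[OF _ f(2)]) (use l in auto)
  have "M = Sigma (carrier Y) (\<lambda>y. {z. (y,z) \<in> M})" using m by auto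
  hence "card M = card (Sigma (carrier Y) (\<lambda>y. {z. (y,z) \<in> M}))" by (rule arg_cong)
  also have "\<dots> = (\<Sum>y\<in>carrier Y. ?k)" using f fz by (subst card_SigmaI) (auto intro!: sum.cong k simp del: sum_constant)
  finally have 1: "card M = card (carrier Y) * ?k" by simp
  have "card (Sigma L (\<lambda>p. {z. (snd p,z) \<in> M})) = (\<Sum>p\<in>L. ?k)"
    using fin fz l(2) by (subst card_SigmaI) (auto intro!: sum.cong k simp del: sum_constant)
  also have "\<dots> = card L * ?k" by simp
  finally have 2: "card (Sigma L (\<lambda>p. {z. (snd p,z) \<in> M})) = card L * ?k" .
  have "card (Sigma (L O M) (\<lambda>p. {y. (fst p,y) \<in> L \<and> (y, snd p) \<in> M})) = (\<Sum>p\<in>L O M. kap X Z L M)"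
    using fin fy card_relcomp_fibre[OF g(1-3) L M] by (subst card_SigmaI) (auto intro!: sum.cong simp del: sum_constant)
  also have "\<dots> = card (L O M) * kap X Z L M" by simp
  finally have 3: "card (Sigma (L O M) (\<lambda>p. {y. (fst p,y) \<in> L \<and> (y, snd p) \<in> M})) = card (L O M) * kap X Z L M" .
  have "bij_betw (\<lambda>((x,y),z). ((x,z),y)) (Sigma L (\<lambda>p. {z. (snd p,z) \<in> M})) 
     (Sigma (L O M) (\<lambda>p. {y. (fst p,y) \<in> L \<and> (y, snd p) \<in> M}))"
    by (rule bij_betwI[where g = "\<lambda>((x,z),y). ((x,y),z)"]) auto
  from bij_betw_same_card[OF this] show ?thesis using 1 2 3 by (simp add: mult_ac)
qed

text \<open>If \<open>M\<close> projects onto the middle group, all conjugates of \<open>L\<close> and \<open>M\<close> compose to conjugates of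
  \<open>L O M\<close>: the Mackey formula has a single term.\<close>

lemma relcomp_conj_full:
  assumes X: "group X" and Y: "group Y" and Z: "group Z"
    and L: "L \<in> Sub (X \<times>\<times> Y)" and M: "M \<in> Sub (Y \<times>\<times> Z)" and full: "fst ` M = carrier Y"
    and L': "L' \<in> cls (X \<times>\<times> Y) L" and M': "M' \<in> cls (Y \<times>\<times> Z) M"
  shows "L' O M' \<in> cls (X \<times>\<times> Z) (L O M)"
proof -
  note m = mem_Sub_DirProd[OF Y Z M]
  interpret Y: group Y by fact
  interpret Z: group Z by fact
  obtain x y where xy: "x \<in> carrier X" "y \<in> carrier Y" "L' = conjg (X \<times>\<times> Y) (x,y) L"
    using L' by (auto simp: cls_def)
  obtain v w where vw: "v \<in> carrier Y" "w \<in> carrier Z" "M' = conjg (Y \<times>\<times> Z) (v,w) M"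
    using M' by (auto simp: cls_def)
  \<comment> \<open>The two middle conjugations differ by \<open>y^-1 v\<close>. As \<open>M\<close>
    projects onto \<open>Y\<close>, some element of \<open>M\<close> has this first coordinate, and
    \<open>M\<close> normalizes itself; so \<open>M'\<close> is also the conjugate of
    \<open>M\<close> by a pair beginning with \<open>y\<close>.\<close>
  obtain z where z: "(inv\<^bsub>Y\<^esub> y \<otimes>\<^bsub>Y\<^esub> v, z) \<in> M" using full xy vw
    by (metis (no_types, lifting) Y.inv_closed Y.m_closed fst_conv imageE prod.collapse)
  have zc: "z \<in> carrier Z" using z m by auto
  have "stab (Y \<times>\<times> Z) (conjg (Y \<times>\<times> Z)) M \<supseteq> M"
  proof
    fix p assume p: "p \<in> M"
    interpret YZ: group "Y \<times>\<times> Z" by (rule DirProd_group[OF Y Z])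
    have ms: "subgroup M (Y \<times>\<times> Z)" using M by (simp add: Sub_def)
    have c: "M \<subseteq> carrier (Y \<times>\<times> Z)" using subgroup.subset[OF ms] .
    have 1: "conjg (Y \<times>\<times> Z) q M \<subseteq> M" if "q \<in> M" for q
      using that subgroup.m_closed[OF ms] subgroup.m_inv_closed[OF ms] unfolding conjg_def by blast
    have "conjg (Y \<times>\<times> Z) p M = M"
    proof
      show "M \<subseteq> conjg (Y \<times>\<times> Z) p M"
      proof -
        have "conjg (Y \<times>\<times> Z) (inv\<^bsub>Y \<times>\<times> Z\<^esub> p) M \<subseteq> M" using 1 p subgroup.m_inv_closed[OF ms] by blast
        hence "conjg (Y \<times>\<times> Z) p (conjg (Y \<times>\<times> Z) (inv\<^bsub>Y \<times>\<times> Z\<^esub> p) M) \<subseteq> conjg (Y \<times>\<times> Z) p M"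
          unfolding conjg_def[of _ p] by (rule image_mono)
        thus ?thesis using acts_on_inv(2)[OF YZ.is_group conjg_Pow[OF YZ.is_group], of M p] c p by auto
      qed
    qed (rule 1[OF p])
    thus "p \<in> stab (Y \<times>\<times> Z) (conjg (Y \<times>\<times> Z)) M" using c p by (auto simp: stab_def)
  qed
  hence fix_z: "conjg (Y \<times>\<times> Z) (inv\<^bsub>Y\<^esub> y \<otimes>\<^bsub>Y\<^esub> v, z) M = M" using z by (auto simp: stab_def)
  let ?w = "w \<otimes>\<^bsub>Z\<^esub> inv\<^bsub>Z\<^esub> z"
  have "(v,w) = (y,?w) \<otimes>\<^bsub>Y \<times>\<times> Z\<^esub> (inv\<^bsub>Y\<^esub> y \<otimes>\<^bsub>Y\<^esub> v, z)"
    using xy vw zc by (simp add: Y.m_assoc[symmetric] Z.m_assoc)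
  moreover have "conjg (Y \<times>\<times> Z) ((y,?w) \<otimes>\<^bsub>Y \<times>\<times> Z\<^esub> (inv\<^bsub>Y\<^esub> y \<otimes>\<^bsub>Y\<^esub> v, z)) M = conjg (Y \<times>\<times> Z) (y,?w) (conjg (Y \<times>\<times> Z) (inv\<^bsub>Y\<^esub> y \<otimes>\<^bsub>Y\<^esub> v, z) M)"
    using xy vw zc Sub_subset[of "Y \<times>\<times> Z"] M
    by (intro acts_onD(3)[OF conjg_Pow[OF DirProd_group[OF Y Z]]]) auto
  ultimately have "M' = conjg (Y \<times>\<times> Z) (y,?w) M" using vw(3) fix_z by simp
  hence "L' O M' = conjg (X \<times>\<times> Z) (x,?w) (L O M)"
    using conjg_relcomp[OF X Y Z L M xy(1,2), of ?w] xy(3) vw zc by simp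
  thus ?thesis using xy vw zc unfolding cls_def by auto
qed

subsection \<open>The tensor product of transitive bisets\<close>

context
  fixes X :: "'x monoid" and Y :: "'y monoid" and Z :: "'z monoid" 
    and L :: "('x \<times> 'y) set" and M :: "('y \<times> 'z) set"
    and U V pact
  assumes X: "fin_group X" and Y: "fin_group Y" and Z: "fin_group Z"
    and L: "L \<in> Sub (X \<times>\<times> Y)" and M: "M \<in> Sub (Y \<times>\<times> Z)"
  defines "U \<equiv> {a <#\<^bsub>X \<times>\<times> Y\<^esub> L | a. a \<in> carrier (X \<times>\<times> Y)}"
    and "V \<equiv> {b <#\<^bsub>Y \<times>\<times> Z\<^esub> M | b. b \<in> carrier (Y \<times>\<times> Z)}"
    and "pact \<equiv> \<lambda>y (u,v). ((\<one>\<^bsub>X\<^esub>, y) <#\<^bsub>X \<times>\<times> Y\<^esub> u, (y, \<one>\<^bsub>Z\<^esub>) <#\<^bsub>Y \<times>\<times> Z\<^esub> v)"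
begin

lemma grps: "group X" "group Y" "group Z" "group (X \<times>\<times> Y)" "group (Y \<times>\<times> Z)" "group (X \<times>\<times> Z)"
  using X Y Z by (auto simp: fin_group_def DirProd_group)

lemma actU: "acts_on (X \<times>\<times> Y) (\<lambda>g u. g <#\<^bsub>X \<times>\<times> Y\<^esub> u) U"
  unfolding U_def by (rule lcos_acts[OF grps(4)]) (use L Sub_subset[of "X \<times>\<times> Y"] in blast)

lemma actV: "acts_on (Y \<times>\<times> Z) (\<lambda>g u. g <#\<^bsub>Y \<times>\<times> Z\<^esub> u) V"
  unfolding V_def by (rule lcos_acts[OF grps(5)]) (use M Sub_subset[of "Y \<times>\<times> Z"] in blast)

lemma finUV: "finite U" "finite V"
  using X Y Z unfolding U_def V_def fin_group_def Setcompr_eq_image by (auto intro!: finite_imageI)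

text \<open>In the encoding of bisets as left sets, \<open>(1,y)\<close> acts on \<open>u\<close> as
  right multiplication by \<open>y^-1\<close> and \<open>(y,1)\<close> on \<open>v\<close> as left
  multiplication by \<open>y\<close>. The orbits of this diagonal action are therefore the points of
  the tensor product over \<open>Y\<close>.\<close>

lemma pact_acts: "acts_on Y pact (U \<times> V)"
proof -
  interpret X: group X by (rule grps)
  interpret Y: group Y by (rule grps)
  interpret Z: group Z by (rule grps)
  have "((\<one>\<^bsub>X\<^esub>, g \<otimes>\<^bsub>Y\<^esub> h) <#\<^bsub>X \<times>\<times> Y\<^esub> u) = (\<one>\<^bsub>X\<^esub>, g) <#\<^bsub>X \<times>\<times> Y\<^esub> ((\<one>\<^bsub>X\<^esub>, h) <#\<^bsub>X \<times>\<times> Y\<^esub> u)"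
    if "g \<in> carrier Y" "h \<in> carrier Y" "u \<in> U" for g h u
    using acts_onD(3)[OF actU that(3), of "(\<one>\<^bsub>X\<^esub>, g)" "(\<one>\<^bsub>X\<^esub>, h)"] that by simp
  moreover have "((g \<otimes>\<^bsub>Y\<^esub> h, \<one>\<^bsub>Z\<^esub>) <#\<^bsub>Y \<times>\<times> Z\<^esub> u) = (g, \<one>\<^bsub>Z\<^esub>) <#\<^bsub>Y \<times>\<times> Z\<^esub> ((h, \<one>\<^bsub>Z\<^esub>) <#\<^bsub>Y \<times>\<times> Z\<^esub> u)"
    if "g \<in> carrier Y" "h \<in> carrier Y" "u \<in> V" for g h u
    using acts_onD(3)[OF actV that(3), of "(g, \<one>\<^bsub>Z\<^esub>)" "(h, \<one>\<^bsub>Z\<^esub>)"] that by simp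
  ultimately show ?thesis
    using acts_onD(1,2)[OF actU] acts_onD(1,2)[OF actV] by (auto simp: acts_on_def pact_def)
qed

lemma tcomp_set_orbits: "tcomp_set X Y Z L M = orb Y pact ` (U \<times> V)"
  unfolding tcomp_set_def U_def[symmetric] V_def[symmetric] orb_def pact_def by force

text \<open>The action on \<open>U \<times> V\<close> from which \<open>tcomp_act\<close> descends;
  it commutes with \<open>pact\<close>, which is why it passes to the orbits.\<close>

definition tact where "tact g = (\<lambda>(u, v). ((fst g, \<one>\<^bsub>Y\<^esub>) <#\<^bsub>X \<times>\<times> Y\<^esub> u, (\<one>\<^bsub>Y\<^esub>, snd g) <#\<^bsub>Y \<times>\<times> Z\<^esub> v))"

lemma tact_acts: "acts_on (X \<times>\<times> Z) tact (U \<times> V)"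
proof -
  interpret X: group X by (rule grps)
  interpret Y: group Y by (rule grps)
  interpret Z: group Z by (rule grps)
  have "((g \<otimes>\<^bsub>X\<^esub> h, \<one>\<^bsub>Y\<^esub>) <#\<^bsub>X \<times>\<times> Y\<^esub> u) = (g, \<one>\<^bsub>Y\<^esub>) <#\<^bsub>X \<times>\<times> Y\<^esub> ((h, \<one>\<^bsub>Y\<^esub>) <#\<^bsub>X \<times>\<times> Y\<^esub> u)"
    if "g \<in> carrier X" "h \<in> carrier X" "u \<in> U" for g h u
    using acts_onD(3)[OF actU that(3), of "(g, \<one>\<^bsub>Y\<^esub>)" "(h, \<one>\<^bsub>Y\<^esub>)"] that by simp
  moreover have "((\<one>\<^bsub>Y\<^esub>, g \<otimes>\<^bsub>Z\<^esub> h) <#\<^bsub>Y \<times>\<times> Z\<^esub> u) = (\<one>\<^bsub>Y\<^esub>, g) <#\<^bsub>Y \<times>\<times> Z\<^esub> ((\<one>\<^bsub>Y\<^esub>, h) <#\<^bsub>Y \<times>\<times> Z\<^esub> u)"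
    if "g \<in> carrier Z" "h \<in> carrier Z" "u \<in> V" for g h u
    using acts_onD(3)[OF actV that(3), of "(\<one>\<^bsub>Y\<^esub>, g)" "(\<one>\<^bsub>Y\<^esub>, h)"] that by simp
  ultimately show ?thesis
    using acts_onD(1,2)[OF actU] acts_onD(1,2)[OF actV] by (auto simp: acts_on_def tact_def)
qed

lemma tact_pact:
  assumes "p \<in> U \<times> V" "g \<in> carrier (X \<times>\<times> Z)" "y \<in> carrier Y"
  shows "tact g (pact y p) = pact y (tact g p)"
    "tact g (pact y p) = ((fst g, y) <#\<^bsub>X \<times>\<times> Y\<^esub> fst p, (y, snd g) <#\<^bsub>Y \<times>\<times> Z\<^esub> snd p)"
proof -
  interpret X: group X by (rule grps)
  interpret Y: group Y by (rule grps)
  interpret Z: group Z by (rule grps)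
  obtain u v where p: "p = (u,v)" "u \<in> U" "v \<in> V" using assms by auto
  obtain a b where g: "g = (a,b)" "a \<in> carrier X" "b \<in> carrier Z" using assms by auto
  show "tact g (pact y p) = pact y (tact g p)"
    "tact g (pact y p) = ((fst g, y) <#\<^bsub>X \<times>\<times> Y\<^esub> fst p, (y, snd g) <#\<^bsub>Y \<times>\<times> Z\<^esub> snd p)"
    using acts_onD(3)[OF actU p(2), of "(a,\<one>\<^bsub>Y\<^esub>)" "(\<one>\<^bsub>X\<^esub>,y)"] acts_onD(3)[OF actU p(2), of "(\<one>\<^bsub>X\<^esub>,y)" "(a,\<one>\<^bsub>Y\<^esub>)"]
     acts_onD(3)[OF actV p(3), of "(\<one>\<^bsub>Y\<^esub>,b)" "(y,\<one>\<^bsub>Z\<^esub>)"] acts_onD(3)[OF actV p(3), of "(y,\<one>\<^bsub>Z\<^esub>)" "(\<one>\<^bsub>Y\<^esub>,b)"]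
     g assms(3) by (auto simp: p tact_def pact_def)
qed

lemma tcomp_act_orb:
  assumes "p \<in> U \<times> V" "g \<in> carrier (X \<times>\<times> Z)"
  shows "tcomp_act X Y Z g (orb Y pact p) = orb Y pact (tact g p)"
proof -
  have "tcomp_act X Y Z g (orb Y pact p) = (\<lambda>y. tact g (pact y p)) ` carrier Y"
    unfolding tcomp_act_def orb_def tact_def by (simp add: image_image)
  also have "\<dots> = orb Y pact (tact g p)" unfolding orb_def
    by (intro image_cong refl) (simp add: tact_pact(1)[OF assms])
  finally show ?thesis .
qed

lemma tcomp_acts: "acts_on (X \<times>\<times> Z) (tcomp_act X Y Z) (tcomp_set X Y Z L M)"
proof -
  have "tcomp_act X Y Z (g \<otimes>\<^bsub>X \<times>\<times> Z\<^esub> h) (orb Y pact p) = tcomp_act X Y Z g (tcomp_act X Y Z h (orb Y pact p))"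
    if "p \<in> U \<times> V" "g \<in> carrier (X \<times>\<times> Z)" "h \<in> carrier (X \<times>\<times> Z)" for p g h
  proof -
    have "g \<otimes>\<^bsub>X \<times>\<times> Z\<^esub> h \<in> carrier (X \<times>\<times> Z)" using that grps(6) by (metis group.is_monoid monoid.m_closed)
    thus ?thesis using that acts_onD[OF tact_acts] by (simp add: tcomp_act_orb del: carrier_DirProd)
  qed
  moreover have "tcomp_act X Y Z \<one>\<^bsub>X \<times>\<times> Z\<^esub> (orb Y pact p) = orb Y pact p" if "p \<in> U \<times> V" for p
    using that acts_onD(2)[OF tact_acts] group.is_monoid[OF grps(6), THEN monoid.one_closed]
    by (simp add: tcomp_act_orb del: carrier_DirProd one_DirProd)
  moreover have "tcomp_act X Y Z g (orb Y pact p) \<in> orb Y pact ` (U \<times> V)" 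
    if "p \<in> U \<times> V" "g \<in> carrier (X \<times>\<times> Z)" for p g
    using that acts_onD(1)[OF tact_acts] by (simp add: tcomp_act_orb del: carrier_DirProd)
  ultimately show ?thesis unfolding tcomp_set_orbits acts_on_def by blast
qed

text \<open>The pair \<open>(x,z)\<close> fixes the \<open>Y\<close>-orbit of \<open>(u,v)\<close>
  exactly when some \<open>y\<close> makes \<open>(x,y)\<close> fix \<open>u\<close> and
  \<open>(y,z)\<close> fix \<open>v\<close>. This is where relational composition comes
  from.\<close>

lemma tcomp_stab:
  assumes "u \<in> U" "v \<in> V"
  shows "stab (X \<times>\<times> Z) (tcomp_act X Y Z) (orb Y pact (u,v)) 
    = stab (X \<times>\<times> Y) (\<lambda>g u. g <#\<^bsub>X \<times>\<times> Y\<^esub> u) u O stab (Y \<times>\<times> Z) (\<lambda>g u. g <#\<^bsub>Y \<times>\<times> Z\<^esub> u) v"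
proof -
  interpret X: group X by (rule grps)
  interpret Y: group Y by (rule grps)
  interpret Z: group Z by (rule grps)
  have p: "(u,v) \<in> U \<times> V" using assms by auto
  have 1: "tcomp_act X Y Z (x,z) (orb Y pact (u,v)) = orb Y pact (u,v) \<longleftrightarrow>
     (\<exists>y\<in>carrier Y. (x, y) <#\<^bsub>X \<times>\<times> Y\<^esub> u = u \<and> (y, z) <#\<^bsub>Y \<times>\<times> Z\<^esub> v = v)"
    if xz: "x \<in> carrier X" "z \<in> carrier Z" for x z
  proof -
    have t: "tact (x,z) (u,v) \<in> U \<times> V" using acts_onD(1)[OF tact_acts p] xz by simp
    have "tcomp_act X Y Z (x,z) (orb Y pact (u,v)) = orb Y pact (u,v) \<longleftrightarrow> 
       orb Y pact (tact (x,z) (u,v)) = orb Y pact (u,v)" using xz p by (simp add: tcomp_act_orb)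
    also have "\<dots> \<longleftrightarrow> (u,v) \<in> orb Y pact (tact (x,z) (u,v))"
      using orb_self[OF grps(2) pact_acts p] orb_eq[OF grps(2) pact_acts t] by blast
    also have "\<dots> \<longleftrightarrow> (\<exists>y\<in>carrier Y. (u,v) = tact (x,z) (pact y (u,v)))"
      using tact_pact(1)[OF p] xz by (auto simp: orb_def)
    also have "\<dots> \<longleftrightarrow> (\<exists>y\<in>carrier Y. (x, y) <#\<^bsub>X \<times>\<times> Y\<^esub> u = u \<and> (y, z) <#\<^bsub>Y \<times>\<times> Z\<^esub> v = v)"
      using tact_pact(2)[OF p] xz by auto
    finally show ?thesis .
  qed
  show ?thesis
    proof (rule Set.set_eqI)
    fix g show "g \<in> stab (X \<times>\<times> Z) (tcomp_act X Y Z) (orb Y pact (u,v)) \<longleftrightarrow>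
       g \<in> stab (X \<times>\<times> Y) (\<lambda>g u. g <#\<^bsub>X \<times>\<times> Y\<^esub> u) u O stab (Y \<times>\<times> Z) (\<lambda>g u. g <#\<^bsub>Y \<times>\<times> Z\<^esub> u) v"
    proof (cases g)
      case (Pair x z)
      show ?thesis using 1[of x z] unfolding Pair stab_def relcomp_unfold by auto
    qed
  qed
qed

lemma pact_stab:
  assumes "u \<in> U" "v \<in> V"
  shows "card (stab Y pact (u,v)) = kap X Z (stab (X \<times>\<times> Y) (\<lambda>g u. g <#\<^bsub>X \<times>\<times> Y\<^esub> u) u) (stab (Y \<times>\<times> Z) (\<lambda>g u. g <#\<^bsub>Y \<times>\<times> Z\<^esub> u) v)"
proof -
  interpret X: group X by (rule grps)
  interpret Y: group Y by (rule grps)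
  interpret Z: group Z by (rule grps)
  show ?thesis unfolding kap_def stab_def pact_def by (rule arg_cong[where f = card]) auto
qed

text \<open>Three replacements: orbits of \<open>X \<times> Z\<close> by points of the composite,
  these \<open>Y\<close>-orbits by pairs \<open>(u,v)\<close>, and the cosets \<open>u\<close>,
  \<open>v\<close> by the conjugates of \<open>L\<close> and \<open>M\<close> that are their
  stabilizers. The weights of the first two multiply to \<open>kap\<close> times
  \<open>|L' O M'|\<close>.\<close>

lemma biset_class_tcomp:
  fixes C
  defines "h \<equiv> \<lambda>L' M'. of_nat (kap X Z L' M' * card (L' O M')) * (if cls (X \<times>\<times> Z) (L' O M') = C then 1 else 0 :: 'k::field)"
  assumes [simp]: "CHAR('k) = 0"
  shows "biset_class (X \<times>\<times> Z) (tcomp_set X Y Z L M) (tcomp_act X Y Z) C =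
    of_nat (card (carrier Y)) * (\<Sum>L'\<in>cls (X \<times>\<times> Y) L. \<Sum>M'\<in>cls (Y \<times>\<times> Z) M. h L' M') 
    / (of_nat (card (cls (X \<times>\<times> Y) L) * card L) * of_nat (card (cls (Y \<times>\<times> Z) M) * card M))"
proof -
  have nz: "of_nat n = (0::'k) \<longleftrightarrow> n = 0" for n by (simp add: of_nat_eq_0_iff_char_dvd)
  let ?sL = "\<lambda>u. stab (X \<times>\<times> Y) (\<lambda>g u. g <#\<^bsub>X \<times>\<times> Y\<^esub> u) u" and ?sM = "\<lambda>v. stab (Y \<times>\<times> Z) (\<lambda>g u. g <#\<^bsub>Y \<times>\<times> Z\<^esub> u) v"
  let ?b = "biset_class (X \<times>\<times> Z) (tcomp_set X Y Z L M) (tcomp_act X Y Z) C :: 'k"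
  let ?x = "of_nat (card (carrier X)) :: 'k" and ?y = "of_nat (card (carrier Y)) :: 'k" and ?z = "of_nat (card (carrier Z)) :: 'k"
  have F: "fin_group (X \<times>\<times> Y)" "fin_group (Y \<times>\<times> Z)" "fin_group (X \<times>\<times> Z)" using X Y Z by (auto intro: fin_group_DirProd)
  have fin: "finite (tcomp_set X Y Z L M)" unfolding tcomp_set_orbits using finUV by simp
  have "?y * (?x * ?z * ?b) = ?y * (\<Sum>w\<in>orb Y pact ` (U \<times> V). of_nat (card (stab (X \<times>\<times> Z) (tcomp_act X Y Z) w)) * 
     (if cls (X \<times>\<times> Z) (stab (X \<times>\<times> Z) (tcomp_act X Y Z) w) = C then 1 else (0::'k)))"
    using biset_class_sum[OF F(3) tcomp_acts fin, where C = C and ?'k = 'k] unfolding tcomp_set_orbits by (simp add: card_cartesian_product)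
  also have "\<dots> = (\<Sum>p\<in>U \<times> V. of_nat (card (stab Y pact p)) * (of_nat (card (stab (X \<times>\<times> Z) (tcomp_act X Y Z) (orb Y pact p))) * 
     (if cls (X \<times>\<times> Z) (stab (X \<times>\<times> Z) (tcomp_act X Y Z) (orb Y pact p)) = C then 1 else (0::'k))))"
    by (rule sum_orbits[OF Y pact_acts]) (use finUV in simp)
  also have "\<dots> = (\<Sum>(u,v)\<in>U \<times> V. h (?sL u) (?sM v))"
    by (intro sum.cong refl) (clarsimp simp only: tcomp_stab pact_stab h_def mem_Sigma_iff of_nat_mult mult.assoc prod.case)
  also have "\<dots> = (\<Sum>u\<in>U. \<Sum>v\<in>V. h (?sL u) (?sM v))" by (simp add: sum.cartesian_product)
  finally have 1: "?y * (?x * ?z * ?b) = (\<Sum>u\<in>U. \<Sum>v\<in>V. h (?sL u) (?sM v))" .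
  let ?cL = "of_nat (card (cls (X \<times>\<times> Y) L)) * of_nat (card L) :: 'k" and ?cM = "of_nat (card (cls (Y \<times>\<times> Z) M)) * of_nat (card M) :: 'k"
  have 2: "?cM * (\<Sum>v\<in>V. h L' (?sM v)) = (?y * ?z) * (\<Sum>M'\<in>cls (Y \<times>\<times> Z) M. h L' M')" for L'
    using sum_lcos[OF F(2) M, of "h L'"] unfolding V_def by (simp add: card_cartesian_product)
  have 3: "?cL * (\<Sum>u\<in>U. H (?sL u)) = (?x * ?y) * (\<Sum>L'\<in>cls (X \<times>\<times> Y) L. H L')" for H :: "_ \<Rightarrow> 'k"
    using sum_lcos[OF F(1) L, of H] unfolding U_def by (simp add: card_cartesian_product)
  \<comment> \<open>The coset sums contribute \<open>|X||Y|\<close> and \<open>|Y||Z|\<close>, the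
    orbit counts \<open>|X||Y||Z|\<close>; one factor \<open>|Y|\<close> survives the
    cancellation.\<close>
  have "?cL * ?cM * (?y * (?x * ?z * ?b)) = ?cL * (\<Sum>u\<in>U. ?cM * (\<Sum>v\<in>V. h (?sL u) (?sM v)))"
    unfolding 1 by (simp add: sum_distrib_left mult_ac)
  also have "\<dots> = (?x * ?y) * ((?y * ?z) * (\<Sum>L'\<in>cls (X \<times>\<times> Y) L. \<Sum>M'\<in>cls (Y \<times>\<times> Z) M. h L' M'))"
    unfolding 2 3[of "\<lambda>L'. (?y * ?z) * (\<Sum>M'\<in>cls (Y \<times>\<times> Z) M. h L' M')"] by (simp only: sum_distrib_left)
  finally have "(?y * ?x * ?z) * (?cL * ?cM * ?b) = (?y * ?x * ?z) * (?y * (\<Sum>L'\<in>cls (X \<times>\<times> Y) L. \<Sum>M'\<in>cls (Y \<times>\<times> Z) M. h L' M'))"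
    by (simp add: mult_ac)
  moreover have "?y * ?x * ?z \<noteq> 0" using X Y Z by (auto simp: nz fin_group_def group.is_monoid dest!: group.is_monoid[THEN monoid.one_closed])
  ultimately have 4: "?cL * ?cM * ?b = ?y * (\<Sum>L'\<in>cls (X \<times>\<times> Y) L. \<Sum>M'\<in>cls (Y \<times>\<times> Z) M. h L' M')" by simp
  have "finite L" "finite M" "L \<noteq> {}" "M \<noteq> {}"
    using L M F Sub_subset[of "X \<times>\<times> Y"] Sub_subset[of "Y \<times>\<times> Z"] finite_subset[of L "carrier (X \<times>\<times> Y)"] finite_subset[of M "carrier (Y \<times>\<times> Z)"]
      mem_Sub_DirProd(3)[OF grps(1,2) L] mem_Sub_DirProd(3)[OF grps(2,3) M] by (auto simp: fin_group_def)
  hence "?cL * ?cM \<noteq> 0" using finite_cls[OF F(1), of L] finite_cls[OF F(2), of M] cls_self[OF grps(4) L] cls_self[OF grps(5) M]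
    by (auto simp: nz)
  thus ?thesis using 4 by (simp add: field_simps)
qed

end

subsection \<open>The Burnside bimodule in terms of functions on subgroups\<close>

locale char0 =
  fixes k :: "'k::field itself"
  assumes CHAR0: "CHAR('k) = 0"
begin

lemma of_nat_0_iff: "(of_nat n :: 'k) = 0 \<longleftrightarrow> n = 0"
  by (simp add: of_nat_eq_0_iff_char_dvd CHAR0)

text \<open>Spreading the value on a conjugacy class evenly over its members, with weight \<open>1/|L|\<close>, turns
  biset composition into a convolution over pairs of subgroups with composite \<open>L O M\<close>.\<close>

definition tr :: "('d,'b) monoid_scheme \<Rightarrow> ('d set set \<Rightarrow> 'k) \<Rightarrow> 'd set \<Rightarrow> 'k" where
  "tr D a L = a (cls D L) / (of_nat (card (cls D L)) * of_nat (card L))"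

lemma cls_card_nz:
  assumes "fin_group D" "L \<in> Sub D"
  shows "(of_nat (card (cls D L)) :: 'k) \<noteq> 0" "(of_nat (card L) :: 'k) \<noteq> 0" "(of_nat (card (carrier D)) :: 'k) \<noteq> 0"
proof -
  have D: "group D" "finite (carrier D)" using assms by (auto simp: fin_group_def)
  have L: "subgroup L D" using assms by (simp add: Sub_def)
  show "(of_nat (card (cls D L)) :: 'k) \<noteq> 0"
    using finite_cls[OF assms(1)] cls_self[OF D(1) assms(2)] by (auto simp: of_nat_0_iff)
  have "finite L" using subgroup.subset[OF L] D finite_subset by blast
  thus "(of_nat (card L) :: 'k) \<noteq> 0" using subgroup.one_closed[OF L] by (auto simp: of_nat_0_iff)
  show "(of_nat (card (carrier D)) :: 'k) \<noteq> 0" using D subgroup.subset[OF L] subgroup.one_closed[OF L] by (auto simp: of_nat_0_iff)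
qed

lemma tr_cls: "fin_group D \<Longrightarrow> L \<in> Sub D \<Longrightarrow> a (cls D L) = tr D a L * of_nat (card (cls D L)) * of_nat (card L)"
  using cls_card_nz[of D L] by (simp add: tr_def)

lemma tr_conj:
  assumes "group D" "L \<in> Sub D" "M \<in> cls D L"
  shows "tr D a M = tr D a L"
  using assms by (simp add: tr_def cls_eq card_cls_mem)

lemma mem_conj_classes: "L \<in> Sub D \<Longrightarrow> cls D L \<in> conj_classes D"
  by (auto simp: conj_classes_cls Sub_def)

lemma finite_conj_classes: "fin_group D \<Longrightarrow> finite (conj_classes D)"
  using finite_Sub[of D] by (simp add: conj_classes_cls Sub_def)

lemma some_conj_class:
  assumes "group D" "C \<in> conj_classes D"
  shows "(SOME L. L \<in> C) \<in> Sub D" "cls D (SOME L. L \<in> C) = C"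
proof -
  obtain L where L: "L \<in> Sub D" "C = cls D L" using assms by (auto simp: conj_classes_cls Sub_def)
  hence "(SOME L. L \<in> C) \<in> C" using cls_self[OF assms(1) L(1)] by (metis someI)
  thus "(SOME L. L \<in> C) \<in> Sub D" "cls D (SOME L. L \<in> C) = C"
    using L cls_subset_Sub[OF assms(1) L(1)] cls_eq[OF assms(1) L(1)] by auto
qed

lemma cls_eq_iff: "group D \<Longrightarrow> L \<in> Sub D \<Longrightarrow> M \<in> Sub D \<Longrightarrow> cls D L = cls D M \<longleftrightarrow> L \<in> cls D M"
  using cls_eq cls_self by metis

lemma kB_eqI:
  assumes "fin_group X" "fin_group Y" "a \<in> kB X Y" "b \<in> kB X Y" "\<And>L. L \<in> Sub (X \<times>\<times> Y) \<Longrightarrow> a (cls (X \<times>\<times> Y) L) = b (cls (X \<times>\<times> Y) L)"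
  shows "a = b"
proof
  fix C show "a C = b C"
    using assms(3-5) by (cases "C \<in> conj_classes (X \<times>\<times> Y)") (auto simp: kB_def conj_classes_cls Sub_def)
qed

lemma kB_eqI_tr:
  assumes "fin_group X" "fin_group Y" "a \<in> kB X Y" "b \<in> kB X Y" "\<And>L. L \<in> Sub (X \<times>\<times> Y) \<Longrightarrow> tr (X \<times>\<times> Y) a L = tr (X \<times>\<times> Y) b L"
  shows "a = b"
  by (rule kB_eqI[OF assms(1-4)])
    (simp only: tr_cls[OF fin_group_DirProd[OF assms(1,2)], of _ a] tr_cls[OF fin_group_DirProd[OF assms(1,2)], of _ b] assms(5))

text \<open>The weight \<open>tr\<close> is a class function, so the representatives picked by
  \<open>SOME\<close> in \<open>bcomp\<close> disappear: the sums over the members of two classes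
  assemble into sums over all subgroups.\<close>

lemma bcomp_sum:
  fixes a b :: "_ \<Rightarrow> 'k"
  assumes X: "fin_group X" and Y: "fin_group Y" and Z: "fin_group Z"
  shows "bcomp X Y Z a b C = (\<Sum>L\<in>Sub (X \<times>\<times> Y). \<Sum>M\<in>Sub (Y \<times>\<times> Z).
     of_nat (card (carrier Y)) * (tr (X \<times>\<times> Y) a L * tr (Y \<times>\<times> Z) b M) *
       (of_nat (kap X Z L M * card (L O M)) * (if cls (X \<times>\<times> Z) (L O M) = C then 1 else 0)))"
proof -
  have F: "fin_group (X \<times>\<times> Y)" "fin_group (Y \<times>\<times> Z)" and G: "group (X \<times>\<times> Y)" "group (Y \<times>\<times> Z)"
    using X Y Z by (auto intro: fin_group_DirProd DirProd_group simp: fin_group_def)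
  let ?h = "\<lambda>L' M'. of_nat (kap X Z L' M' * card (L' O M')) * (if cls (X \<times>\<times> Z) (L' O M') = C then 1 else 0 :: 'k)"
  have "bcomp X Y Z a b C = (\<Sum>C1\<in>conj_classes (X \<times>\<times> Y). \<Sum>C2\<in>conj_classes (Y \<times>\<times> Z). 
     \<Sum>L\<in>C1. \<Sum>M\<in>C2. of_nat (card (carrier Y)) * (tr (X \<times>\<times> Y) a L * tr (Y \<times>\<times> Z) b M) * ?h L M)"
    unfolding bcomp_def
  proof (intro sum.cong refl)
    fix C1 C2 assume C: "C1 \<in> conj_classes (X \<times>\<times> Y)" "C2 \<in> conj_classes (Y \<times>\<times> Z)"
    define L0 where "L0 = (SOME L. L \<in> C1)"
    define M0 where "M0 = (SOME M. M \<in> C2)"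
    have L0: "L0 \<in> Sub (X \<times>\<times> Y)" "cls (X \<times>\<times> Y) L0 = C1" using some_conj_class[OF G(1) C(1)] by (auto simp: L0_def)
    have M0: "M0 \<in> Sub (Y \<times>\<times> Z)" "cls (Y \<times>\<times> Z) M0 = C2" using some_conj_class[OF G(2) C(2)] by (auto simp: M0_def)
    have "a C1 * b C2 * biset_class (X \<times>\<times> Z) (tcomp_set X Y Z L0 M0) (tcomp_act X Y Z) C =
       of_nat (card (carrier Y)) * (tr (X \<times>\<times> Y) a L0 * tr (Y \<times>\<times> Z) b M0) * (\<Sum>L\<in>C1. \<Sum>M\<in>C2. ?h L M)"
      unfolding biset_class_tcomp[OF X Y Z L0(1) M0(1) CHAR0, of C] tr_def L0(2) M0(2) by (simp add: field_simps)
    also have "\<dots> = (\<Sum>L\<in>C1. \<Sum>M\<in>C2. of_nat (card (carrier Y)) * (tr (X \<times>\<times> Y) a L * tr (Y \<times>\<times> Z) b M) * ?h L M)"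
      unfolding sum_distrib_left using tr_conj[OF G(1) L0(1), of _ a] tr_conj[OF G(2) M0(1), of _ b] L0 M0
      by (intro sum.cong refl) simp
    finally show "a C1 * b C2 * biset_class (X \<times>\<times> Z) (tcomp_set X Y Z (SOME L. L \<in> C1) (SOME M. M \<in> C2)) (tcomp_act X Y Z) C
       = (\<Sum>L\<in>C1. \<Sum>M\<in>C2. of_nat (card (carrier Y)) * (tr (X \<times>\<times> Y) a L * tr (Y \<times>\<times> Z) b M) * ?h L M)"
      unfolding L0_def M0_def .
  qed
  also have "\<dots> = (\<Sum>C1\<in>conj_classes (X \<times>\<times> Y). \<Sum>L\<in>C1. \<Sum>C2\<in>conj_classes (Y \<times>\<times> Z). 
     \<Sum>M\<in>C2. of_nat (card (carrier Y)) * (tr (X \<times>\<times> Y) a L * tr (Y \<times>\<times> Z) b M) * ?h L M)"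
    by (intro sum.cong refl sum.swap)
  also have "\<dots> = (\<Sum>L\<in>Sub (X \<times>\<times> Y). \<Sum>M\<in>Sub (Y \<times>\<times> Z). of_nat (card (carrier Y)) * (tr (X \<times>\<times> Y) a L * tr (Y \<times>\<times> Z) b M) * ?h L M)"
    by (simp only: sum_Sub[OF F(1)] sum_Sub[OF F(2)])
  finally show ?thesis .
qed

lemma bcomp_kB:
  fixes a b :: "_ \<Rightarrow> 'k"
  assumes "fin_group X" "fin_group Y" "fin_group Z"
  shows "bcomp X Y Z a b \<in> kB X Z"
proof -
  have g: "group X" "group Y" "group Z" using assms by (auto simp: fin_group_def)
  show ?thesis unfolding kB_def mem_Collect_eq
  proof (intro allI impI)
    fix C assume "C \<notin> conj_classes (X \<times>\<times> Z)"
    thus "bcomp X Y Z a b C = 0" unfolding bcomp_sum[OF assms]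
      using mem_conj_classes[OF relcomp_Sub[OF g]] by (intro sum.neutral ballI) auto
  qed
qed

lemma sum_act:
  assumes "group D" "acts_on D act S" "g \<in> carrier D"
  shows "(\<Sum>s\<in>S. F (act g s)) = (\<Sum>s\<in>S. F s :: 'k)"
  by (rule sum.reindex_bij_witness[where i = "act (inv\<^bsub>D\<^esub> g)" and j = "act g"])
    (use acts_on_inv[OF assms(1,2)] acts_onD[OF assms(2)] assms group.inv_closed[OF assms(1)] in auto)

lemma kap_conjg:
  assumes X: "group X" and Y: "group Y" and Z: "group Z"
    and L: "L \<in> Sub (X \<times>\<times> Y)" and M: "M \<in> Sub (Y \<times>\<times> Z)"
    and x: "x \<in> carrier X" "y \<in> carrier Y" "z \<in> carrier Z"
  shows "kap X Z (conjg (X \<times>\<times> Y) (x,y) L) (conjg (Y \<times>\<times> Z) (y,z) M) = kap X Z L M"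
proof -
  interpret X: group X by fact
  interpret Y: group Y by fact
  interpret Z: group Z by fact
  have s: "L \<subseteq> carrier X \<times> carrier Y" "M \<subseteq> carrier Y \<times> carrier Z" using Sub_subset L M by fastforce+
  let ?c = "\<lambda>b. y \<otimes>\<^bsub>Y\<^esub> b \<otimes>\<^bsub>Y\<^esub> inv\<^bsub>Y\<^esub> y"
  have x1: "a = \<one>\<^bsub>X\<^esub>" if "\<one>\<^bsub>X\<^esub> = x \<otimes>\<^bsub>X\<^esub> a \<otimes>\<^bsub>X\<^esub> inv\<^bsub>X\<^esub> x" "a \<in> carrier X" for a
    using conj_inj[OF X x(1) that(2) X.one_closed] that(1)[symmetric] x by simp
  have z1: "a = \<one>\<^bsub>Z\<^esub>" if "\<one>\<^bsub>Z\<^esub> = z \<otimes>\<^bsub>Z\<^esub> a \<otimes>\<^bsub>Z\<^esub> inv\<^bsub>Z\<^esub> z" "a \<in> carrier Z" for a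
    using conj_inj[OF Z x(3) that(2) Z.one_closed] that(1)[symmetric] x by simp
  have "{v. (\<one>\<^bsub>X\<^esub>, v) \<in> conjg (X \<times>\<times> Y) (x,y) L \<and> (v, \<one>\<^bsub>Z\<^esub>) \<in> conjg (Y \<times>\<times> Z) (y,z) M}
     = ?c ` {v. (\<one>\<^bsub>X\<^esub>, v) \<in> L \<and> (v, \<one>\<^bsub>Z\<^esub>) \<in> M}"
    unfolding mem_conjg_DirProd[OF X Y s(1) x(1,2)] mem_conjg_DirProd[OF Y Z s(2) x(2,3)]
  proof safe
    fix a b c d
    assume *: "(a,b) \<in> L" "\<one>\<^bsub>X\<^esub> = x \<otimes>\<^bsub>X\<^esub> a \<otimes>\<^bsub>X\<^esub> inv\<^bsub>X\<^esub> x" "(c,d) \<in> M" "\<one>\<^bsub>Z\<^esub> = z \<otimes>\<^bsub>Z\<^esub> d \<otimes>\<^bsub>Z\<^esub> inv\<^bsub>Z\<^esub> z" "?c b = ?c c"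
    have "a = \<one>\<^bsub>X\<^esub>" "d = \<one>\<^bsub>Z\<^esub>" "b = c" using x1 z1 conj_inj[OF Y x(2)] * s by blast+
    thus "?c b \<in> ?c ` {v. (\<one>\<^bsub>X\<^esub>, v) \<in> L \<and> (v, \<one>\<^bsub>Z\<^esub>) \<in> M}" using * by auto
  next
    fix v assume *: "(\<one>\<^bsub>X\<^esub>, v) \<in> L" "(v, \<one>\<^bsub>Z\<^esub>) \<in> M"
    show "(\<one>\<^bsub>X\<^esub>, ?c v) \<in> (\<lambda>(a, b). (x \<otimes>\<^bsub>X\<^esub> a \<otimes>\<^bsub>X\<^esub> inv\<^bsub>X\<^esub> x, ?c b)) ` L"
      by (rule rev_image_eqI[OF *(1)]) (use x in simp)
    show "(?c v, \<one>\<^bsub>Z\<^esub>) \<in> (\<lambda>(a, b). (?c a, z \<otimes>\<^bsub>Z\<^esub> b \<otimes>\<^bsub>Z\<^esub> inv\<^bsub>Z\<^esub> z)) ` M"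
      by (rule rev_image_eqI[OF *(2)]) (use x in simp)
  qed
  moreover have "inj_on ?c {v. (\<one>\<^bsub>X\<^esub>, v) \<in> L \<and> (v, \<one>\<^bsub>Z\<^esub>) \<in> M}"
    using conj_inj[OF Y x(2)] s by (intro inj_onI) blast
  ultimately show ?thesis unfolding kap_def by (simp add: card_image)
qed

text \<open>The condition is the equality \<open>L O M = N\<close> and not conjugacy. The right side
  is a class function of \<open>N\<close>, so the contributions of all conjugates of
  \<open>N\<close>, which \<open>bcomp_sum\<close> collects together, are equal; the factor
  \<open>|N|\<close> cancels against the one in \<open>tr\<close>.\<close>

lemma tr_bcomp:
  fixes a b :: "_ \<Rightarrow> 'k"
  assumes X: "fin_group X" and Y: "fin_group Y" and Z: "fin_group Z" and N: "N \<in> Sub (X \<times>\<times> Z)"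
  shows "tr (X \<times>\<times> Z) (bcomp X Y Z a b) N = (\<Sum>L\<in>Sub (X \<times>\<times> Y). \<Sum>M\<in>Sub (Y \<times>\<times> Z).
     if L O M = N then of_nat (card (carrier Y)) * of_nat (kap X Z L M) * (tr (X \<times>\<times> Y) a L * tr (Y \<times>\<times> Z) b M) else 0)"
proof -
  have g: "group X" "group Y" "group Z" using assms by (auto simp: fin_group_def)
  note G = DirProd_group[OF g(1,2)] DirProd_group[OF g(2,3)] DirProd_group[OF g(1,3)]
  interpret X: group X by (rule g)
  interpret Y: group Y by (rule g)
  interpret Z: group Z by (rule g)
  let ?w = "\<lambda>L M. of_nat (card (carrier Y)) * of_nat (kap X Z L M) * (tr (X \<times>\<times> Y) a L * tr (Y \<times>\<times> Z) b M)"
  let ?g = "\<lambda>N. \<Sum>L\<in>Sub (X \<times>\<times> Y). \<Sum>M\<in>Sub (Y \<times>\<times> Z). if L O M = N then ?w L M else 0"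
  \<comment> \<open>Conjugation of \<open>N\<close> by \<open>(x,z)\<close> is absorbed by
    reindexing \<open>L\<close> by \<open>(x,1)\<close> and \<open>M\<close> by
    \<open>(1,z)\<close>, which leaves the middle coordinate alone.\<close>
  have inv: "?g N' = ?g N" if N': "N' \<in> cls (X \<times>\<times> Z) N" for N'
  proof -
    obtain x z where xz: "x \<in> carrier X" "z \<in> carrier Z" "N' = conjg (X \<times>\<times> Z) (x,z) N" using N' by (auto simp: cls_def)
    let ?cL = "conjg (X \<times>\<times> Y) (x,\<one>\<^bsub>Y\<^esub>)" and ?cM = "conjg (Y \<times>\<times> Z) (\<one>\<^bsub>Y\<^esub>,z)"
    have c: "(x,\<one>\<^bsub>Y\<^esub>) \<in> carrier (X \<times>\<times> Y)" "(\<one>\<^bsub>Y\<^esub>,z) \<in> carrier (Y \<times>\<times> Z)" "(x,z) \<in> carrier (X \<times>\<times> Z)" using xz by auto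
    have "?g N' = (\<Sum>L\<in>Sub (X \<times>\<times> Y). \<Sum>M\<in>Sub (Y \<times>\<times> Z). if ?cL L O ?cM M = N' then ?w (?cL L) (?cM M) else 0)"
      by (simp only: sum_act[OF G(1) conjg_Sub[OF G(1)] c(1), of "\<lambda>L. \<Sum>M\<in>Sub (Y \<times>\<times> Z). if L O M = N' then ?w L M else 0", symmetric]
         sum_act[OF G(2) conjg_Sub[OF G(2)] c(2), of "\<lambda>M. if ?cL _ O M = N' then ?w (?cL _) M else 0", symmetric])
    also have "\<dots> = ?g N"
    proof (intro sum.cong refl)
      fix L M assume LM: "L \<in> Sub (X \<times>\<times> Y)" "M \<in> Sub (Y \<times>\<times> Z)"
      have "?cL L O ?cM M = N' \<longleftrightarrow> conjg (X \<times>\<times> Z) (x,z) (L O M) = conjg (X \<times>\<times> Z) (x,z) N"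
        using conjg_relcomp[OF g LM xz(1) Y.one_closed xz(2)] xz by simp
      also have "\<dots> \<longleftrightarrow> L O M = N"
        using acts_on_inv(1)[OF G(3) conjg_Sub[OF G(3)] _ c(3)] N relcomp_Sub[OF g LM] by metis
      finally show "(if ?cL L O ?cM M = N' then ?w (?cL L) (?cM M) else 0) = (if L O M = N then ?w L M else 0)"
        using tr_conj[OF G(1) LM(1), of "?cL L" a] tr_conj[OF G(2) LM(2), of "?cM M" b] c(1,2)
          kap_conjg[OF g LM xz(1) Y.one_closed xz(2)] by (auto simp: cls_def)
    qed
    finally show ?thesis .
  qed
  have "bcomp X Y Z a b (cls (X \<times>\<times> Z) N) = (\<Sum>L\<in>Sub (X \<times>\<times> Y). \<Sum>M\<in>Sub (Y \<times>\<times> Z). \<Sum>N'\<in>cls (X \<times>\<times> Z) N. 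
     of_nat (card N) * (if L O M = N' then ?w L M else 0))"
    unfolding bcomp_sum[OF X Y Z]
  proof (intro sum.cong refl)
    fix L M assume LM: "L \<in> Sub (X \<times>\<times> Y)" "M \<in> Sub (Y \<times>\<times> Z)"
    note S = relcomp_Sub[OF g LM]
    have *: "of_nat (card (L O M)) * (if cls (X \<times>\<times> Z) (L O M) = cls (X \<times>\<times> Z) N then 1 else 0)
       = (\<Sum>N'\<in>cls (X \<times>\<times> Z) N. if L O M = N' then of_nat (card N) else (0::'k))"
      using finite_cls[OF fin_group_DirProd[OF X Z], of N] card_cls_mem[OF G(3) N] by (simp add: cls_eq_iff[OF G(3) S N])
    hence "?w L M * (of_nat (card (L O M)) * (if cls (X \<times>\<times> Z) (L O M) = cls (X \<times>\<times> Z) N then 1 else 0))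
      = (\<Sum>N'\<in>cls (X \<times>\<times> Z) N. of_nat (card N) * (if L O M = N' then ?w L M else 0))"
      by (subst *, subst sum_distrib_left, intro sum.cong refl, simp)
    thus "of_nat (card (carrier Y)) * (tr (X \<times>\<times> Y) a L * tr (Y \<times>\<times> Z) b M) *
       (of_nat (kap X Z L M * card (L O M)) * (if cls (X \<times>\<times> Z) (L O M) = cls (X \<times>\<times> Z) N then 1 else 0))
      = (\<Sum>N'\<in>cls (X \<times>\<times> Z) N. of_nat (card N) * (if L O M = N' then ?w L M else 0))" by (simp only: of_nat_mult mult_ac)
  qed
  also have "\<dots> = (\<Sum>L\<in>Sub (X \<times>\<times> Y). \<Sum>N'\<in>cls (X \<times>\<times> Z) N. \<Sum>M\<in>Sub (Y \<times>\<times> Z). 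
     of_nat (card N) * (if L O M = N' then ?w L M else 0))" by (intro sum.cong refl sum.swap)
  also have "\<dots> = (\<Sum>N'\<in>cls (X \<times>\<times> Z) N. \<Sum>L\<in>Sub (X \<times>\<times> Y). \<Sum>M\<in>Sub (Y \<times>\<times> Z). 
     of_nat (card N) * (if L O M = N' then ?w L M else 0))" by (rule sum.swap)
  also have "\<dots> = (\<Sum>N'\<in>cls (X \<times>\<times> Z) N. of_nat (card N) * ?g N')"
    by (simp only: sum_distrib_left)
  also have "\<dots> = (\<Sum>N'\<in>cls (X \<times>\<times> Z) N. of_nat (card N) * ?g N)"
    using inv by (intro sum.cong refl) simp
  also have "\<dots> = ?g N * of_nat (card (cls (X \<times>\<times> Z) N)) * of_nat (card N)" by (simp only: sum_constant mult_ac)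
  finally show ?thesis using cls_card_nz[OF fin_group_DirProd[OF X Z] N] by (simp add: tr_def)
qed

text \<open>Both sides are sums over triples \<open>(L,M,K)\<close> with
  \<open>L O M O K = N\<close>. The inner composite \<open>R = L O M\<close> is summed away,
  \<open>kap_cocycle\<close> exchanges the weights, and \<open>R = M O K\<close> is introduced as
  the new inner composite.\<close>

lemma bcomp_assoc:
  fixes a b c :: "_ \<Rightarrow> 'k"
  assumes X: "fin_group X" and Y: "fin_group Y" and Z: "fin_group Z" and T: "fin_group T"
  shows "bcomp X Z T (bcomp X Y Z a b) c = bcomp X Y T a (bcomp Y Z T b c)"
proof (rule kB_eqI_tr[OF X T bcomp_kB[OF X Z T] bcomp_kB[OF X Y T]])
  fix N assume N: "N \<in> Sub (X \<times>\<times> T)"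
  have g: "group X" "group Y" "group Z" "group T" using assms by (auto simp: fin_group_def)
  note F = fin_group_DirProd[OF X Y] fin_group_DirProd[OF Y Z] fin_group_DirProd[OF Z T] fin_group_DirProd[OF X Z] fin_group_DirProd[OF Y T]
  note fin = F[THEN finite_Sub]
  let ?t = "\<lambda>L M K. tr (X \<times>\<times> Y) a L * tr (Y \<times>\<times> Z) b M * tr (Z \<times>\<times> T) c K"
  let ?c = "of_nat (card (carrier Y)) * of_nat (card (carrier Z)) :: 'k"
  have "tr (X \<times>\<times> T) (bcomp X Z T (bcomp X Y Z a b) c) N =
    (\<Sum>R\<in>Sub (X \<times>\<times> Z). \<Sum>K\<in>Sub (Z \<times>\<times> T). \<Sum>L\<in>Sub (X \<times>\<times> Y). \<Sum>M\<in>Sub (Y \<times>\<times> Z).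
      if L O M = R then (if L O M O K = N then ?c * of_nat (kap X Z L M * kap X T (L O M) K) * ?t L M K else 0) else 0)"
    unfolding tr_bcomp[OF X Z T N]
  proof (intro sum.cong refl)
    fix R K assume R: "R \<in> Sub (X \<times>\<times> Z)"
    show "(if R O K = N then of_nat (card (carrier Z)) * of_nat (kap X T R K) * (tr (X \<times>\<times> Z) (bcomp X Y Z a b) R * tr (Z \<times>\<times> T) c K) else 0)
      = (\<Sum>L\<in>Sub (X \<times>\<times> Y). \<Sum>M\<in>Sub (Y \<times>\<times> Z). if L O M = R then (if L O M O K = N then 
           ?c * of_nat (kap X Z L M * kap X T (L O M) K) * ?t L M K else 0) else 0)"
    proof (cases "R O K = N")
      case True
      show ?thesis unfolding tr_bcomp[OF X Y Z R] sum_distrib_left sum_distrib_right if_P[OF True]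
        by (intro sum.cong refl) (use True in \<open>auto simp: O_assoc[symmetric] mult_ac\<close>)
    next
      case False
      thus ?thesis by (simp add: O_assoc[symmetric] cong: if_cong)
    qed
  qed
  also have "\<dots> = (\<Sum>K\<in>Sub (Z \<times>\<times> T). \<Sum>L\<in>Sub (X \<times>\<times> Y). \<Sum>M\<in>Sub (Y \<times>\<times> Z). \<Sum>R\<in>Sub (X \<times>\<times> Z). 
      if L O M = R then (if L O M O K = N then ?c * of_nat (kap X Z L M * kap X T (L O M) K) * ?t L M K else 0) else 0)"
    by (subst sum.swap, intro sum.cong refl, subst sum.swap, intro sum.cong refl, rule sum.swap)
  also have "\<dots> = (\<Sum>K\<in>Sub (Z \<times>\<times> T). \<Sum>L\<in>Sub (X \<times>\<times> Y). \<Sum>M\<in>Sub (Y \<times>\<times> Z). 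
      if L O M O K = N then ?c * of_nat (kap X Z L M * kap X T (L O M) K) * ?t L M K else 0)"
    using fin relcomp_Sub[OF g(1-3)] by (intro sum.cong refl) simp
  also have "\<dots> = (\<Sum>K\<in>Sub (Z \<times>\<times> T). \<Sum>L\<in>Sub (X \<times>\<times> Y). \<Sum>M\<in>Sub (Y \<times>\<times> Z). 
      if L O M O K = N then ?c * of_nat (kap X T L (M O K) * kap Y T M K) * ?t L M K else 0)"
    using kap_cocycle[OF X Y Z T] by (intro sum.cong refl) simp
  also have "\<dots> = (\<Sum>K\<in>Sub (Z \<times>\<times> T). \<Sum>L\<in>Sub (X \<times>\<times> Y). \<Sum>M\<in>Sub (Y \<times>\<times> Z). \<Sum>R\<in>Sub (Y \<times>\<times> T). 
      if M O K = R then (if L O M O K = N then ?c * of_nat (kap X T L (M O K) * kap Y T M K) * ?t L M K else 0) else 0)"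
    using fin relcomp_Sub[OF g(2-4)] by (intro sum.cong refl) simp
  also have "\<dots> = (\<Sum>L\<in>Sub (X \<times>\<times> Y). \<Sum>K\<in>Sub (Z \<times>\<times> T). \<Sum>M\<in>Sub (Y \<times>\<times> Z). \<Sum>R\<in>Sub (Y \<times>\<times> T). 
      if M O K = R then (if L O M O K = N then ?c * of_nat (kap X T L (M O K) * kap Y T M K) * ?t L M K else 0) else 0)"
    by (rule sum.swap)
  also have "\<dots> = (\<Sum>L\<in>Sub (X \<times>\<times> Y). \<Sum>K\<in>Sub (Z \<times>\<times> T). \<Sum>R\<in>Sub (Y \<times>\<times> T). \<Sum>M\<in>Sub (Y \<times>\<times> Z). 
      if M O K = R then (if L O M O K = N then ?c * of_nat (kap X T L (M O K) * kap Y T M K) * ?t L M K else 0) else 0)"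
    by (rule sum.cong[OF refl], rule sum.cong[OF refl], rule sum.swap)
  also have "\<dots> = (\<Sum>L\<in>Sub (X \<times>\<times> Y). \<Sum>R\<in>Sub (Y \<times>\<times> T). \<Sum>K\<in>Sub (Z \<times>\<times> T). \<Sum>M\<in>Sub (Y \<times>\<times> Z). 
      if M O K = R then (if L O M O K = N then ?c * of_nat (kap X T L (M O K) * kap Y T M K) * ?t L M K else 0) else 0)"
    by (rule sum.cong[OF refl], rule sum.swap)
  also have "\<dots> = (\<Sum>L\<in>Sub (X \<times>\<times> Y). \<Sum>R\<in>Sub (Y \<times>\<times> T). \<Sum>M\<in>Sub (Y \<times>\<times> Z). \<Sum>K\<in>Sub (Z \<times>\<times> T). 
      if M O K = R then (if L O M O K = N then ?c * of_nat (kap X T L (M O K) * kap Y T M K) * ?t L M K else 0) else 0)"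
    by (rule sum.cong[OF refl], rule sum.cong[OF refl], rule sum.swap)
  also have "\<dots> = tr (X \<times>\<times> T) (bcomp X Y T a (bcomp Y Z T b c)) N"
    unfolding tr_bcomp[OF X Y T N]
  proof (intro sum.cong refl)
    fix L R assume R: "R \<in> Sub (Y \<times>\<times> T)"
    show "(\<Sum>M\<in>Sub (Y \<times>\<times> Z). \<Sum>K\<in>Sub (Z \<times>\<times> T).
      if M O K = R then (if L O M O K = N then ?c * of_nat (kap X T L (M O K) * kap Y T M K) * ?t L M K else 0) else 0)
     = (if L O R = N then of_nat (card (carrier Y)) * of_nat (kap X T L R) * (tr (X \<times>\<times> Y) a L * tr (Y \<times>\<times> T) (bcomp Y Z T b c) R) else 0)"
    proof (cases "L O R = N")
      case True
      show ?thesis unfolding tr_bcomp[OF Y Z T R] sum_distrib_left sum_distrib_right if_P[OF True]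
        by (intro sum.cong refl) (use True in \<open>auto simp: mult_ac\<close>)
    next
      case False
      thus ?thesis by (simp cong: if_cong)
    qed
  qed
  finally show "tr (X \<times>\<times> T) (bcomp X Z T (bcomp X Y Z a b) c) N = tr (X \<times>\<times> T) (bcomp X Y T a (bcomp Y Z T b c)) N" .
qed

lemma bas_kB: "L \<in> Sub (X \<times>\<times> Y) \<Longrightarrow> (bas (X \<times>\<times> Y) L :: _ \<Rightarrow> 'k) \<in> kB X Y"
  using mem_conj_classes by (auto simp: kB_def bas_def)

lemma tr_bas:
  assumes "group D" "L \<in> Sub D" "M \<in> Sub D"
  shows "tr D (bas D L) M = (if M \<in> cls D L then 1 / (of_nat (card (cls D L)) * of_nat (card L)) else 0)"
proof (cases "M \<in> cls D L")
  case True
  thus ?thesis using card_cls_mem[OF assms(1,2) True] by (simp add: tr_def bas_def cls_eq[OF assms(1,2) True])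
next
  case False
  hence "cls D M \<noteq> cls D L" using cls_eq_iff[OF assms(1,3,2)] by simp
  thus ?thesis using False by (simp add: tr_def bas_def)
qed

text \<open>By \<open>relcomp_conj_full\<close> every pair of conjugates composes into the class of
  \<open>L O M\<close>, and by \<open>kap_card\<close> the weight of each pair cancels
  \<open>|L| |M|\<close>; what remains is the average of 1 over all pairs.\<close>

lemma bcomp_bas:
  assumes X: "fin_group X" and Y: "fin_group Y" and Z: "fin_group Z"
    and L: "L \<in> Sub (X \<times>\<times> Y)" and M: "M \<in> Sub (Y \<times>\<times> Z)" and full: "fst ` M = carrier Y"
  shows "bcomp X Y Z (bas (X \<times>\<times> Y) L) (bas (Y \<times>\<times> Z) M) = (bas (X \<times>\<times> Z) (L O M) :: _ \<Rightarrow> 'k)"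
proof
  fix C
  have g: "group X" "group Y" "group Z" using assms by (auto simp: fin_group_def)
  note G = DirProd_group[OF g(1,2)] DirProd_group[OF g(2,3)] DirProd_group[OF g(1,3)]
  note F = fin_group_DirProd[OF X Y] fin_group_DirProd[OF Y Z]
  let ?r = "if C = cls (X \<times>\<times> Z) (L O M) then 1 else 0 :: 'k"
  let ?cL = "of_nat (card (cls (X \<times>\<times> Y) L)) :: 'k" and ?cM = "of_nat (card (cls (Y \<times>\<times> Z) M)) :: 'k"
  have "bcomp X Y Z (bas (X \<times>\<times> Y) L) (bas (Y \<times>\<times> Z) M) C = (\<Sum>L'\<in>Sub (X \<times>\<times> Y). \<Sum>M'\<in>Sub (Y \<times>\<times> Z).
     if L' \<in> cls (X \<times>\<times> Y) L then (if M' \<in> cls (Y \<times>\<times> Z) M then ?r / (?cL * ?cM) else 0) else 0)"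
    unfolding bcomp_sum[OF X Y Z]
  proof (intro sum.cong refl)
    fix L' M' assume S: "L' \<in> Sub (X \<times>\<times> Y)" "M' \<in> Sub (Y \<times>\<times> Z)"
    show "of_nat (card (carrier Y)) * (tr (X \<times>\<times> Y) (bas (X \<times>\<times> Y) L) L' * tr (Y \<times>\<times> Z) (bas (Y \<times>\<times> Z) M) M') *
        (of_nat (kap X Z L' M' * card (L' O M')) * (if cls (X \<times>\<times> Z) (L' O M') = C then 1 else 0)) =
       (if L' \<in> cls (X \<times>\<times> Y) L then (if M' \<in> cls (Y \<times>\<times> Z) M then ?r / (?cL * ?cM) else 0) else 0)"
    proof (cases "L' \<in> cls (X \<times>\<times> Y) L \<and> M' \<in> cls (Y \<times>\<times> Z) M")
      case True
      have c: "cls (X \<times>\<times> Z) (L' O M') = cls (X \<times>\<times> Z) (L O M)"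
        using relcomp_conj_full[OF g L M full] True cls_eq[OF G(3) relcomp_Sub[OF g L M]] by blast
      have f': "fst ` M' = carrier Y"
      proof -
        obtain y z where yz: "y \<in> carrier Y" "z \<in> carrier Z" "M' = conjg (Y \<times>\<times> Z) (y,z) M" using True by (auto simp: cls_def)
        have s: "M \<subseteq> carrier Y \<times> carrier Z" using M Sub_subset[of "Y \<times>\<times> Z"] by auto
        interpret Y: group Y by (rule g)
        have "fst ` M' = (\<lambda>b. y \<otimes>\<^bsub>Y\<^esub> b \<otimes>\<^bsub>Y\<^esub> inv\<^bsub>Y\<^esub> y) ` fst ` M"
          unfolding yz(3) mem_conjg_DirProd[OF g(2,3) s yz(1,2)] by force
        also have "\<dots> = carrier Y" unfolding full
        proof safe
          fix b assume b: "b \<in> carrier Y"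
          show "b \<in> (\<lambda>b. y \<otimes>\<^bsub>Y\<^esub> b \<otimes>\<^bsub>Y\<^esub> inv\<^bsub>Y\<^esub> y) ` carrier Y"
            by (rule rev_image_eqI[of "inv\<^bsub>Y\<^esub> y \<otimes>\<^bsub>Y\<^esub> b \<otimes>\<^bsub>Y\<^esub> y"]) (use b yz in \<open>auto simp: Y.m_assoc\<close>, simp add: Y.m_assoc[symmetric] yz b)
        qed (use yz in auto)
        finally show ?thesis .
      qed
      have "of_nat (card (carrier Y)) * of_nat (kap X Z L' M' * card (L' O M')) = (of_nat (card L') * of_nat (card M') :: 'k)"
        using kap_card[OF X Y Z S f'] by (metis mult.assoc of_nat_mult)
      thus ?thesis using True c card_cls_mem[OF G(1) L, of L'] card_cls_mem[OF G(2) M, of M']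
         cls_card_nz[OF F(1) L] cls_card_nz[OF F(2) M]
        by (simp add: tr_bas[OF G(1) L S(1)] tr_bas[OF G(2) M S(2)] field_simps)
    qed (use tr_bas[OF G(1) L S(1)] tr_bas[OF G(2) M S(2)] in auto)
  qed
  also have "\<dots> = (\<Sum>L'\<in>cls (X \<times>\<times> Y) L. \<Sum>M'\<in>cls (Y \<times>\<times> Z) M. ?r / (?cL * ?cM))"
  proof -
    have i: "Sub (X \<times>\<times> Y) \<inter> cls (X \<times>\<times> Y) L = cls (X \<times>\<times> Y) L" "Sub (Y \<times>\<times> Z) \<inter> cls (Y \<times>\<times> Z) M = cls (Y \<times>\<times> Z) M"
      using cls_subset_Sub[OF G(1) L] cls_subset_Sub[OF G(2) M] by auto
    have d: "(\<Sum>x\<in>A. if P then f x else 0) = (if P then (\<Sum>x\<in>A. f x) else (0::'k))" for A P and f :: "_ \<Rightarrow> 'k" by simp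
    show ?thesis unfolding d sum.inter_restrict[OF finite_Sub[OF F(1)], symmetric] sum.inter_restrict[OF finite_Sub[OF F(2)], symmetric] i ..
  qed
  also have "\<dots> = ?r" using cls_card_nz[OF F(1) L] cls_card_nz[OF F(2) M] by simp
  finally show "bcomp X Y Z (bas (X \<times>\<times> Y) L) (bas (Y \<times>\<times> Z) M) C = (bas (X \<times>\<times> Z) (L O M) C :: 'k)" unfolding bas_def[of "X \<times>\<times> Z" "L O M"] .
qed

end

subsection \<open>Linearity\<close>

abbreviation fscale :: "'k::field \<Rightarrow> ('c \<Rightarrow> 'k) \<Rightarrow> 'c \<Rightarrow> 'k" where
  "fscale c f \<equiv> (\<lambda>x. c * f x)"

text \<open>All spaces in sight consist of functions with pointwise operations, so one vector space
  structure provides \<open>span\<close> and \<open>subspace\<close> for \<open>kB\<close>,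
  \<open>kI\<close>, \<open>kOut\<close> and the formal combinations in \<open>Fsp\<close>.\<close>

global_interpretation fv: vector_space "fscale :: 'k::field \<Rightarrow> ('c \<Rightarrow> 'k) \<Rightarrow> 'c \<Rightarrow> 'k"
  by unfold_locales (auto simp: fun_eq_iff algebra_simps)

lemma sum_fun: "sum f A = (\<lambda>x. \<Sum>a\<in>A. f a x)"
  by (induction A rule: infinite_finite_induct) (auto simp: fun_eq_iff)

lemma kspan_span: "kspan S = fv.span S"
  unfolding kspan_def fv.span_explicit sum_fun by auto

lemma kB_subspace: "fv.subspace (kB X Y :: (_ \<Rightarrow> 'k::field) set)"
  by (auto simp: fv.subspace_def kB_def)

lemma bcomp_add_left: "bcomp X Y Z (a + a') b = bcomp X Y Z a b + bcomp X Y Z a' b"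
  by (auto simp: bcomp_def fun_eq_iff sum.distrib algebra_simps)

lemma bcomp_add_right: "bcomp X Y Z a (b + b') = bcomp X Y Z a b + bcomp X Y Z a b'"
  by (auto simp: bcomp_def fun_eq_iff sum.distrib algebra_simps)

lemma bcomp_scale_left: "bcomp X Y Z (fscale c a) b = fscale c (bcomp X Y Z a b)"
  by (auto simp: bcomp_def fun_eq_iff sum_distrib_left mult_ac)

lemma bcomp_scale_right: "bcomp X Y Z a (fscale c b) = fscale c (bcomp X Y Z a b)"
  by (auto simp: bcomp_def fun_eq_iff sum_distrib_left mult_ac)

lemma bcomp_zero_left: "bcomp X Y Z 0 b = 0"
  by (auto simp: bcomp_def fun_eq_iff)

lemma bcomp_zero_right: "bcomp X Y Z a 0 = 0"
  by (auto simp: bcomp_def fun_eq_iff)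

lemma bcomp_diff_left: "bcomp X Y Z (a - a') b = bcomp X Y Z a b - bcomp X Y Z a' b"
  by (auto simp: bcomp_def fun_eq_iff sum_subtractf algebra_simps)

lemma bcomp_diff_right: "bcomp X Y Z a (b - b') = bcomp X Y Z a b - bcomp X Y Z a b'"
  by (auto simp: bcomp_def fun_eq_iff sum_subtractf algebra_simps)

lemma bcomp_sum_left: "bcomp X Y Z (\<Sum>i\<in>I. f i) b = (\<Sum>i\<in>I. bcomp X Y Z (f i) b)"
  by (induction I rule: infinite_finite_induct) (simp_all only: sum.infinite sum.empty sum.insert bcomp_zero_left bcomp_add_left not_False_eq_True)

lemma bcomp_sum_right: "bcomp X Y Z a (\<Sum>i\<in>I. f i) = (\<Sum>i\<in>I. bcomp X Y Z a (f i))"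
  by (induction I rule: infinite_finite_induct) (simp_all only: sum.infinite sum.empty sum.insert bcomp_zero_right bcomp_add_right not_False_eq_True)

subsection \<open>Opposite bisets\<close>

lemma swap_image_converse: "(\<lambda>(y, x). (x, y)) ` L = L\<inverse>"
  by auto

lemma bop_converse: "bop a C = a (converse ` C)"
  by (simp add: bop_def swap_image_converse)

lemma cls_converse:
  assumes X: "group X" and Y: "group Y" and L: "L \<in> Sub (X \<times>\<times> Y)"
  shows "cls (Y \<times>\<times> X) (L\<inverse>) = converse ` cls (X \<times>\<times> Y) L"
proof -
  have s: "L \<subseteq> carrier X \<times> carrier Y" "L\<inverse> \<subseteq> carrier Y \<times> carrier X" using Sub_subset L by fastforce+
  have "conjg (Y \<times>\<times> X) (y,x) (L\<inverse>) = (conjg (X \<times>\<times> Y) (x,y) L)\<inverse>"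
    if "x \<in> carrier X" "y \<in> carrier Y" for x y
    unfolding mem_conjg_DirProd[OF X Y s(1) that] mem_conjg_DirProd[OF Y X s(2) that(2,1)] by force
  thus ?thesis unfolding cls_def by (force simp: image_iff)
qed

lemma converse_converse_image: "converse ` (converse ` C) = C"
  by (simp add: image_image)

lemma card_converse_image: "card (converse ` A) = card A"
  by (rule card_image, rule inj_onI) (metis converse_converse)

lemma bop_bop: "bop (bop a) = a"
  by (rule ext) (simp add: bop_converse converse_converse_image)

lemma bop_kB:
  assumes X: "group X" and Y: "group Y" and a: "a \<in> kB X Y"
  shows "bop a \<in> kB Y X"
proof -
  have "a (converse ` C) = 0" if C: "C \<notin> conj_classes (Y \<times>\<times> X)" for C
  proof -
    have "converse ` C \<notin> conj_classes (X \<times>\<times> Y)"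
    proof
      assume "converse ` C \<in> conj_classes (X \<times>\<times> Y)"
      then obtain L where L: "L \<in> Sub (X \<times>\<times> Y)" "converse ` C = cls (X \<times>\<times> Y) L" by (auto simp: conj_classes_cls Sub_def)
      have "C = cls (Y \<times>\<times> X) (L\<inverse>)" using cls_converse[OF X Y L(1)] L(2) converse_converse_image by metis
      thus False using C converse_Sub[OF X Y L(1)] by (auto simp: conj_classes_cls Sub_def)
    qed
    thus ?thesis using a by (simp add: kB_def)
  qed
  thus ?thesis by (simp add: kB_def bop_converse)
qed

context char0
begin

lemma tr_bop:
  assumes X: "group X" and Y: "group Y" and L: "L \<in> Sub (Y \<times>\<times> X)"
  shows "tr (Y \<times>\<times> X) (bop a) L = tr (X \<times>\<times> Y) a (L\<inverse>)"
proof -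
  have 2: "cls (X \<times>\<times> Y) (L\<inverse>) = converse ` cls (Y \<times>\<times> X) L" by (rule cls_converse[OF Y X L])
  have "card (L\<inverse>) = card L" by (rule card_inverse)
  thus ?thesis unfolding tr_def bop_converse 2 by (simp add: card_converse_image)
qed

text \<open>The converse of \<open>L O M\<close> is \<open>M\<inverse> O L\<inverse>\<close>, and
  \<open>kap\<close> is symmetric under this exchange.\<close>

lemma bop_bcomp:
  fixes a b :: "_ \<Rightarrow> 'k"
  assumes X: "fin_group X" and Y: "fin_group Y" and Z: "fin_group Z"
  shows "bop (bcomp X Y Z a b) = bcomp Z Y X (bop b) (bop a)"
proof (rule kB_eqI_tr[OF Z X bop_kB bcomp_kB[OF Z Y X]])
  have g: "group X" "group Y" "group Z" using assms by (auto simp: fin_group_def)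
  thus "group X" "group Z" by simp_all
  show "bcomp X Y Z a b \<in> kB X Z" by (rule bcomp_kB[OF X Y Z])
  fix N assume N: "N \<in> Sub (Z \<times>\<times> X)"
  have r: "(\<Sum>M\<in>Sub (A \<times>\<times> B). F M) = (\<Sum>M\<in>Sub (B \<times>\<times> A). F (M\<inverse>))" if "group A" "group B" for A B and F :: "_ \<Rightarrow> 'k"
    by (rule sum.reindex_bij_witness[where i = converse and j = converse]) (use converse_Sub that in auto)
  have k: "kap X Z (L\<inverse>) (M\<inverse>) = kap Z X M L" for L M
    by (simp add: kap_def conj_commute)
  have n: "L\<inverse> O M\<inverse> = N\<inverse> \<longleftrightarrow> M O L = N" for L M
    by (metis converse_converse converse_relcomp)
  have "tr (Z \<times>\<times> X) (bop (bcomp X Y Z a b)) N = (\<Sum>L\<in>Sub (Y \<times>\<times> X). \<Sum>M\<in>Sub (Z \<times>\<times> Y).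
     if L\<inverse> O M\<inverse> = N\<inverse> then of_nat (card (carrier Y)) * of_nat (kap X Z (L\<inverse>) (M\<inverse>)) * (tr (X \<times>\<times> Y) a (L\<inverse>) * tr (Y \<times>\<times> Z) b (M\<inverse>)) else 0)"
    unfolding tr_bop[OF g(1,3) N] tr_bcomp[OF X Y Z converse_Sub[OF g(3,1) N]] r[OF g(1,2)] r[OF g(2,3)] ..
  also have "\<dots> = (\<Sum>L\<in>Sub (Y \<times>\<times> X). \<Sum>M\<in>Sub (Z \<times>\<times> Y).
     if M O L = N then of_nat (card (carrier Y)) * of_nat (kap Z X M L) * (tr (Z \<times>\<times> Y) (bop b) M * tr (Y \<times>\<times> X) (bop a) L) else 0)"
    unfolding k n using tr_bop[OF g(1,2)] tr_bop[OF g(2,3)] by (intro sum.cong refl) simp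
  also have "\<dots> = tr (Z \<times>\<times> X) (bcomp Z Y X (bop b) (bop a)) N"
    unfolding tr_bcomp[OF Z Y X N] by (rule sum.swap)
  finally show "tr (Z \<times>\<times> X) (bop (bcomp X Y Z a b)) N = tr (Z \<times>\<times> X) (bcomp Z Y X (bop b) (bop a)) N" .
qed

subsection \<open>The ideal of bisets factoring through smaller groups\<close>

lemma kB_expand:
  fixes a :: "_ \<Rightarrow> 'k"
  assumes "fin_group X" "fin_group Y" "a \<in> kB X Y"
  shows "a = (\<Sum>C\<in>conj_classes (X \<times>\<times> Y). fscale (a C) (bas (X \<times>\<times> Y) (SOME L. L \<in> C)))"
proof
  fix D
  have G: "group (X \<times>\<times> Y)" using assms by (simp add: fin_group_def DirProd_group)
  have "(\<Sum>C\<in>conj_classes (X \<times>\<times> Y). fscale (a C) (bas (X \<times>\<times> Y) (SOME L. L \<in> C))) D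
     = (\<Sum>C\<in>conj_classes (X \<times>\<times> Y). if D = C then a C else 0)"
    unfolding sum_fun using some_conj_class[OF G] by (intro sum.cong refl) (auto simp: bas_def)
  also have "\<dots> = a D" using finite_conj_classes[OF fin_group_DirProd[OF assms(1,2)]] assms(3) by (auto simp: kB_def)
  finally show "a D = (\<Sum>C\<in>conj_classes (X \<times>\<times> Y). fscale (a C) (bas (X \<times>\<times> Y) (SOME L. L \<in> C))) D" ..
qed

end

text \<open>For a subgroup this says that \<open>L\<close> is the graph of a surjection from a
  subgroup of \<open>X\<close> onto \<open>H\<close>. In Goursat's description the section of
  \<open>H\<close> attached to \<open>L\<close> is then \<open>H/1\<close>, so that
  \<open>(X \<times> H)/L\<close> admits no smaller middle group.\<close>

definition top_sub :: "'x monoid \<Rightarrow> 'h monoid \<Rightarrow> ('x \<times> 'h) set \<Rightarrow> bool" where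
  "top_sub X H L \<longleftrightarrow> (\<forall>h\<in>carrier H. \<exists>x. (x,h) \<in> L) \<and> (\<forall>h. (\<one>\<^bsub>X\<^esub>,h) \<in> L \<longrightarrow> h = \<one>\<^bsub>H\<^esub>)"

lemma top_sub_inj:
  assumes X: "group X" and H: "group H" and L: "L \<in> Sub (X \<times>\<times> H)" and t: "top_sub X H L" and "(x,h) \<in> L" "(x,h') \<in> L"
  shows "h = h'"
proof -
  note l = mem_Sub_DirProd[OF X H L]
  interpret X: group X by fact
  interpret H: group H by fact
  have c: "h \<in> carrier H" "h' \<in> carrier H" "x \<in> carrier X" using l assms by auto
  have "(\<one>\<^bsub>X\<^esub>, h \<otimes>\<^bsub>H\<^esub> inv\<^bsub>H\<^esub> h') \<in> L" using l(4)[OF assms(5) l(5)[OF assms(6)]] c by simp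
  hence "h \<otimes>\<^bsub>H\<^esub> inv\<^bsub>H\<^esub> h' = \<one>\<^bsub>H\<^esub>" using t by (auto simp: top_sub_def)
  thus ?thesis using c H.inv_equality by fastforce
qed

lemma top_sub_conj:
  assumes X: "group X" and H: "group H" and L: "L \<in> Sub (X \<times>\<times> H)" and t: "top_sub X H L" and M: "M \<in> cls (X \<times>\<times> H) L"
  shows "top_sub X H M"
proof -
  interpret X: group X by fact
  interpret H: group H by fact
  obtain x h where xh: "x \<in> carrier X" "h \<in> carrier H" "M = conjg (X \<times>\<times> H) (x,h) L" using M by (auto simp: cls_def)
  have s: "L \<subseteq> carrier X \<times> carrier H" using L Sub_subset by fastforce
  note e = xh(3)[unfolded mem_conjg_DirProd[OF X H s xh(1,2)]]
  show ?thesis unfolding top_sub_def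
  proof (intro conjI ballI allI impI)
    fix b assume b: "b \<in> carrier H"
    hence "inv\<^bsub>H\<^esub> h \<otimes>\<^bsub>H\<^esub> b \<otimes>\<^bsub>H\<^esub> h \<in> carrier H" using xh by simp
    then obtain a where a: "(a, inv\<^bsub>H\<^esub> h \<otimes>\<^bsub>H\<^esub> b \<otimes>\<^bsub>H\<^esub> h) \<in> L" using t unfolding top_sub_def by blast
    have "h \<otimes>\<^bsub>H\<^esub> (inv\<^bsub>H\<^esub> h \<otimes>\<^bsub>H\<^esub> b \<otimes>\<^bsub>H\<^esub> h) \<otimes>\<^bsub>H\<^esub> inv\<^bsub>H\<^esub> h = (h \<otimes>\<^bsub>H\<^esub> inv\<^bsub>H\<^esub> h) \<otimes>\<^bsub>H\<^esub> b \<otimes>\<^bsub>H\<^esub> (h \<otimes>\<^bsub>H\<^esub> inv\<^bsub>H\<^esub> h)"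
      using b xh by (simp only: H.m_assoc H.m_closed H.inv_closed)
    also have "\<dots> = b" using b xh by simp
    finally have "(x \<otimes>\<^bsub>X\<^esub> a \<otimes>\<^bsub>X\<^esub> inv\<^bsub>X\<^esub> x, b) \<in> M" unfolding e by (intro rev_image_eqI[OF a]) simp
    thus "\<exists>a. (a,b) \<in> M" ..
  next
    fix b assume "(\<one>\<^bsub>X\<^esub>, b) \<in> M"
    then obtain a c where ac: "(a,c) \<in> L" "\<one>\<^bsub>X\<^esub> = x \<otimes>\<^bsub>X\<^esub> a \<otimes>\<^bsub>X\<^esub> inv\<^bsub>X\<^esub> x" "b = h \<otimes>\<^bsub>H\<^esub> c \<otimes>\<^bsub>H\<^esub> inv\<^bsub>H\<^esub> h" unfolding e by auto
    have "a = \<one>\<^bsub>X\<^esub>" using conj_inj[OF X xh(1), of a "\<one>\<^bsub>X\<^esub>"] ac(1) ac(2)[symmetric] s xh by auto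
    hence "c = \<one>\<^bsub>H\<^esub>" using t ac by (auto simp: top_sub_def)
    thus "b = \<one>\<^bsub>H\<^esub>" using ac xh by simp
  qed
qed

lemma subquots_group:
  assumes H: "fin_group H" and K: "K \<in> subquots H"
  shows "fin_group K"
proof -
  obtain S T where ST: "K = (H\<lparr>carrier := S\<rparr>) Mod T" "subgroup S H" "T \<lhd> (H\<lparr>carrier := S\<rparr>)" using K by (auto simp: subquots_def)
  have "finite S" using H ST(2) finite_subset subgroup.subset by (auto simp: fin_group_def)
  hence "finite (carrier K)" unfolding ST(1) FactGroup_def RCOSETS_def by simp
  thus ?thesis using normal.factorgroup_is_group[OF ST(3)] ST(1) by (simp add: fin_group_def)
qed

text \<open>The second factor inherits both properties: \<open>M\<close> projects onto
  \<open>H\<close>, and \<open>(1,h) \<in> M\<close> implies \<open>(1,h) \<in> L O M\<close>.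
  Choosing some \<open>k\<close> with \<open>(k,h) \<in> M\<close> for each \<open>h\<close>
  therefore embeds \<open>H\<close> into \<open>K\<close> as a set.\<close>

lemma relcomp_top_card:
  fixes K :: "'c monoid"
  assumes X: "group X" and K: "fin_group K" and H: "group H"
    and L: "L \<in> Sub (X \<times>\<times> K)" and M: "M \<in> Sub (K \<times>\<times> H)" and t: "top_sub X H (L O M)"
  shows "card (carrier H) \<le> card (carrier K)"
proof -
  have g: "group K" "finite (carrier K)" using K by (auto simp: fin_group_def)
  note l = mem_Sub_DirProd[OF X g(1) L] and m = mem_Sub_DirProd[OF g(1) H M]
  have tM: "top_sub K H M" using t l(3) unfolding top_sub_def by blast
  have ex: "\<forall>h\<in>carrier H. \<exists>k. (k,h) \<in> M" using tM by (auto simp: top_sub_def)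
  then obtain f where f: "\<And>h. h \<in> carrier H \<Longrightarrow> (f h, h) \<in> M" by metis
  have "inj_on f (carrier H)"
    using f top_sub_inj[OF g(1) H M tM] by (intro inj_onI) metis
  thus ?thesis using f m(1) g(2) by (intro card_inj_on_le[of f]) auto
qed

text \<open>A subgroup \<open>L\<close> of \<open>X \<times> H\<close> factors through the section \<open>S/T\<close> of \<open>H\<close>, where \<open>S\<close> is its second projection
  and \<open>T\<close> the kernel part.\<close>

lemma top_sub_factor:
  assumes X: "fin_group X" and H: "fin_group H" and L: "L \<in> Sub (X \<times>\<times> H)" and nt: "\<not> top_sub X H L"
  obtains K L1 M1 where "K \<in> subquots H" "card (carrier K) < card (carrier H)" "L1 \<in> Sub (X \<times>\<times> K)" "M1 \<in> Sub (K \<times>\<times> H)"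
    "fst ` M1 = carrier K" "L1 O M1 = L"
proof -
  have g: "group X" "group H" and fin: "finite (carrier H)" using X H by (auto simp: fin_group_def)
  interpret X: group X by (rule g)
  interpret H: group H by (rule g)
  note l = mem_Sub_DirProd[OF g L]
  define S where "S = snd ` L"
  define T where "T = {h. (\<one>\<^bsub>X\<^esub>,h) \<in> L}"
  let ?S = "H\<lparr>carrier := S\<rparr>"
  define K where "K = ?S Mod T"
  have S: "subgroup S H"
  proof (rule H.subgroupI)
    show "S \<subseteq> carrier H" "S \<noteq> {}" using l(2,3) by (auto simp: S_def)
    show "inv\<^bsub>H\<^esub> a \<in> S" if "a \<in> S" for a using that l(5) unfolding S_def by force
    show "a \<otimes>\<^bsub>H\<^esub> b \<in> S" if "a \<in> S" "b \<in> S" for a b using that l(4) unfolding S_def by force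
  qed
  have Sc: "S \<subseteq> carrier H" by (rule subgroup.subset[OF S])
  interpret S: group ?S by (rule subgroup.subgroup_is_group[OF S g(2)])
  have Tc: "T \<subseteq> S" by (force simp: T_def S_def)
  have invS: "inv\<^bsub>?S\<^esub> h = inv\<^bsub>H\<^esub> h" if "h \<in> S" for h using H.m_inv_consistent[OF S that] .
  have TS: "subgroup T ?S"
  proof (rule S.subgroupI)
    show "T \<subseteq> carrier ?S" using Tc by simp
    show "T \<noteq> {}" using l(3) by (auto simp: T_def)
    show "inv\<^bsub>?S\<^esub> a \<in> T" if "a \<in> T" for a using that l(5)[of "\<one>\<^bsub>X\<^esub>" a] invS[of a] Tc by (auto simp: T_def)
    show "a \<otimes>\<^bsub>?S\<^esub> b \<in> T" if "a \<in> T" "b \<in> T" for a b using that l(4)[of "\<one>\<^bsub>X\<^esub>" a "\<one>\<^bsub>X\<^esub>" b] by (auto simp: T_def)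
  qed
  have N: "T \<lhd> ?S"
  proof (rule S.normal_invI[OF TS])
    fix a h assume "a \<in> carrier ?S" "h \<in> T"
    hence a: "a \<in> S" and h: "(\<one>\<^bsub>X\<^esub>,h) \<in> L" by (auto simp: T_def)
    obtain x where x: "(x,a) \<in> L" using a by (auto simp: S_def)
    have "x \<in> carrier X" using x l by auto
    thus "a \<otimes>\<^bsub>?S\<^esub> h \<otimes>\<^bsub>?S\<^esub> inv\<^bsub>?S\<^esub> a \<in> T"
      using l(4)[OF l(4)[OF x h] l(5)[OF x]] invS[OF a] by (simp add: T_def)
  qed
  have Kin: "K \<in> subquots H" unfolding subquots_def K_def using S N by blast
  have K: "group K" using subquots_group[OF H Kin] by (simp add: fin_group_def)
  have carK: "carrier K = {T #>\<^bsub>?S\<^esub> a | a. a \<in> S}" unfolding K_def FactGroup_def RCOSETS_def by auto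
  have multK: "(T #>\<^bsub>?S\<^esub> a) \<otimes>\<^bsub>K\<^esub> (T #>\<^bsub>?S\<^esub> b) = T #>\<^bsub>?S\<^esub> (a \<otimes>\<^bsub>H\<^esub> b)" if "a \<in> S" "b \<in> S" for a b
    using normal.rcos_sum[OF N, of a b] that by (simp add: K_def FactGroup_def)
  have invK: "inv\<^bsub>K\<^esub> (T #>\<^bsub>?S\<^esub> a) = T #>\<^bsub>?S\<^esub> (inv\<^bsub>H\<^esub> a)" if "a \<in> S" for a
  proof -
    have "T #>\<^bsub>?S\<^esub> a \<in> carrier K" using carK that by blast
    from normal.inv_FactGroup[OF N this[unfolded K_def]] show ?thesis
      using normal.rcos_inv[OF N, of a] that unfolding K_def invS[OF that, symmetric] by simp
  qed
  have oneK: "\<one>\<^bsub>K\<^esub> = T" by (simp add: K_def FactGroup_def)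
  have T1: "T #>\<^bsub>?S\<^esub> \<one>\<^bsub>H\<^esub> = T" using S.coset_mult_one[of T] Tc by simp
  have cardK: "card (carrier K) * card T = card S"
    using S.lagrange[OF TS] by (simp add: K_def FactGroup_def order_def)
  have finS: "finite S" "finite T" by (rule finite_subset[OF Sc fin], rule finite_subset[OF Tc finite_subset[OF Sc fin]])
  have T0: "\<one>\<^bsub>H\<^esub> \<in> T" using l(3) by (simp add: T_def)
  have cT: "card T \<noteq> 0" using finS T0 by auto
  \<comment> \<open>Failure of \<open>top_sub\<close> means that the projection \<open>S\<close> is
    proper or that the kernel part \<open>T\<close> is nontrivial; either way
    \<open>|S/T| < |H|\<close>.\<close>
  have "card (carrier K) < card (carrier H)"
  proof (cases "S = carrier H")
    case False
    hence "card S < card (carrier H)" using Sc fin by (intro psubset_card_mono) auto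
    thus ?thesis using cardK cT by (metis One_nat_def Suc_leI le_less_trans mult.right_neutral mult_le_mono2 neq0_conv)
  next
    case True
    hence "\<exists>h\<in>T. h \<noteq> \<one>\<^bsub>H\<^esub>" using nt unfolding top_sub_def S_def T_def by force
    then obtain h where "h \<in> T" "h \<noteq> \<one>\<^bsub>H\<^esub>" by auto
    hence "card {h, \<one>\<^bsub>H\<^esub>} \<le> card T" using finS T0 by (intro card_mono) auto
    hence "2 \<le> card T" using \<open>h \<noteq> \<one>\<^bsub>H\<^esub>\<close> by simp
    hence "card (carrier K) * 2 \<le> card (carrier H)" using cardK True by (metis mult_le_mono2)
    moreover have "card (carrier H) > 0" using fin by (auto simp: card_gt_0_iff)
    ultimately show ?thesis by linarith
  qed
  \<comment> \<open>\<open>L1\<close> is \<open>L\<close> followed by the projection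
    \<open>S \<rightarrow> S/T\<close>, and \<open>M1\<close> is the graph of that projection read
    backwards.\<close>
  define L1 where "L1 = (\<lambda>(x,h). (x, T #>\<^bsub>?S\<^esub> h)) ` L"
  define M1 where "M1 = (\<lambda>h. (T #>\<^bsub>?S\<^esub> h, h)) ` S"
  have LS: "h \<in> S" if "(x,h) \<in> L" for x h using that by (force simp: S_def)
  have L1: "L1 \<in> Sub (X \<times>\<times> K)"
  proof (rule Sub_DirProdI[OF g(1) K])
    show "L1 \<subseteq> carrier X \<times> carrier K" using l(1) LS carK by (auto simp: L1_def)
    show "(\<one>\<^bsub>X\<^esub>, \<one>\<^bsub>K\<^esub>) \<in> L1" unfolding L1_def by (rule rev_image_eqI[OF l(3)]) (simp only: prod.case T1 oneK)
    fix x y x' y' assume *: "(x,y) \<in> L1" "(x',y') \<in> L1"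
    then obtain h h' where h: "y = T #>\<^bsub>?S\<^esub> h" "y' = T #>\<^bsub>?S\<^esub> h'" "(x,h) \<in> L" "(x',h') \<in> L" by (auto simp: L1_def)
    show "(x \<otimes>\<^bsub>X\<^esub> x', y \<otimes>\<^bsub>K\<^esub> y') \<in> L1"
      unfolding L1_def by (rule rev_image_eqI[OF l(4)[OF h(3,4)]]) (use h LS multK in auto)
  next
    fix x y assume *: "(x,y) \<in> L1"
    then obtain h where h: "y = T #>\<^bsub>?S\<^esub> h" "(x,h) \<in> L" by (auto simp: L1_def)
    show "(inv\<^bsub>X\<^esub> x, inv\<^bsub>K\<^esub> y) \<in> L1"
      unfolding L1_def by (rule rev_image_eqI[OF l(5)[OF h(2)]]) (use h LS invK in auto)
  qed
  have M1: "M1 \<in> Sub (K \<times>\<times> H)"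
  proof (rule Sub_DirProdI[OF K g(2)])
    show "M1 \<subseteq> carrier K \<times> carrier H" using Sc carK by (auto simp: M1_def)
    show "(\<one>\<^bsub>K\<^esub>, \<one>\<^bsub>H\<^esub>) \<in> M1" unfolding M1_def by (rule rev_image_eqI[OF subgroup.one_closed[OF S]]) (simp only: prod.case T1 oneK)
    fix x y x' y' assume *: "(x,y) \<in> M1" "(x',y') \<in> M1"
    hence h: "x = T #>\<^bsub>?S\<^esub> y" "x' = T #>\<^bsub>?S\<^esub> y'" "y \<in> S" "y' \<in> S" by (auto simp: M1_def)
    show "(x \<otimes>\<^bsub>K\<^esub> x', y \<otimes>\<^bsub>H\<^esub> y') \<in> M1"
      unfolding M1_def by (rule rev_image_eqI[OF subgroup.m_closed[OF S h(3,4)]]) (use h multK in auto)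
  next
    fix x y assume *: "(x,y) \<in> M1"
    hence h: "x = T #>\<^bsub>?S\<^esub> y" "y \<in> S" by (auto simp: M1_def)
    show "(inv\<^bsub>K\<^esub> x, inv\<^bsub>H\<^esub> y) \<in> M1"
      unfolding M1_def by (rule rev_image_eqI[OF subgroup.m_inv_closed[OF S h(2)]]) (use h invK in auto)
  qed
  have "L1 O M1 = L"
  proof
    show "L \<subseteq> L1 O M1" using LS by (force simp: L1_def M1_def)
    show "L1 O M1 \<subseteq> L"
    proof safe
      fix x z h h' assume "(x,h) \<in> L1" "(h,z) \<in> M1"
      then obtain y where y: "(x,y) \<in> L" "T #>\<^bsub>?S\<^esub> y = T #>\<^bsub>?S\<^esub> z" "z \<in> S" by (auto simp: L1_def M1_def)
      have "z \<in> T #>\<^bsub>?S\<^esub> z" using S.rcos_self[OF _ TS, of z] y(3) by simp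
      then obtain t where t: "t \<in> T" "z = t \<otimes>\<^bsub>H\<^esub> y" using y(2)[symmetric] by (auto simp: r_coset_def)
      show "(x,z) \<in> L" using l(4)[of "\<one>\<^bsub>X\<^esub>" t x y] l(1)[OF y(1)] t y by (auto simp: T_def)
    qed
  qed
  moreover have "fst ` M1 = carrier K" unfolding M1_def carK image_image by auto
  ultimately show ?thesis using that Kin \<open>card (carrier K) < card (carrier H)\<close> L1 M1 by blast
qed

context char0
begin

text \<open>A composite through a smaller group has no component on a \<open>top_sub\<close> class,
  by \<open>relcomp_top_card\<close>. Conversely a subgroup that is not \<open>top_sub\<close>
  factors through a smaller section with full second factor, so its basis element is a single
  composite by \<open>bcomp_bas\<close>.\<close>

lemma kI_iff:
  fixes X :: "'x monoid" and H :: "'h monoid"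
  assumes X: "fin_group X" and H: "fin_group H"
  shows "(a :: _ \<Rightarrow> 'k) \<in> kI X H \<longleftrightarrow> a \<in> kB X H \<and> (\<forall>L\<in>Sub (X \<times>\<times> H). top_sub X H L \<longrightarrow> a (cls (X \<times>\<times> H) L) = 0)"
proof
  have g: "group X" "group H" using assms by (auto simp: fin_group_def)
  have G: "group (X \<times>\<times> H)" using g by (rule DirProd_group)
  let ?S = "{a :: _ \<Rightarrow> 'k. a \<in> kB X H \<and> (\<forall>L\<in>Sub (X \<times>\<times> H). top_sub X H L \<longrightarrow> a (cls (X \<times>\<times> H) L) = 0)}"
  have s: "fv.subspace ?S" using kB_subspace[of X H] by (auto simp: fv.subspace_def)
  have sub: "kI X H \<subseteq> ?S" unfolding kI_def kspan_span
  proof (rule fv.span_minimal[OF _ s], safe)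
    fix K :: "'h set monoid" and a b :: "_ \<Rightarrow> 'k" assume K: "K \<in> subquots H" "card (carrier K) < card (carrier H)"
    have KK: "fin_group K" and gK: "group K" using subquots_group[OF H K(1)] by (auto simp: fin_group_def)
    show "bcomp X K H a b \<in> kB X H" by (rule bcomp_kB[OF X KK H])
    fix L assume L: "L \<in> Sub (X \<times>\<times> H)" "top_sub X H L"
    have "cls (X \<times>\<times> H) (L' O M') \<noteq> cls (X \<times>\<times> H) L" if "L' \<in> Sub (X \<times>\<times> K)" "M' \<in> Sub (K \<times>\<times> H)" for L' M'
    proof
      assume "cls (X \<times>\<times> H) (L' O M') = cls (X \<times>\<times> H) L"
      hence "L' O M' \<in> cls (X \<times>\<times> H) L" using cls_self[OF G relcomp_Sub[OF g(1) gK g(2) that]] by simp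
      from relcomp_top_card[OF g(1) KK g(2) that top_sub_conj[OF g L this]] show False using K(2) by simp
    qed
    thus "bcomp X K H a b (cls (X \<times>\<times> H) L) = 0" unfolding bcomp_sum[OF X KK H] by (intro sum.neutral ballI) simp
  qed
  show "a \<in> kI X H \<Longrightarrow> a \<in> kB X H \<and> (\<forall>L\<in>Sub (X \<times>\<times> H). top_sub X H L \<longrightarrow> a (cls (X \<times>\<times> H) L) = 0)" using sub by blast
  assume a: "a \<in> kB X H \<and> (\<forall>L\<in>Sub (X \<times>\<times> H). top_sub X H L \<longrightarrow> a (cls (X \<times>\<times> H) L) = 0)"
  have bas: "(bas (X \<times>\<times> H) L :: _ \<Rightarrow> 'k) \<in> kI X H" if "L \<in> Sub (X \<times>\<times> H)" "\<not> top_sub X H L" for L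
  proof -
    obtain K L1 M1 where *: "K \<in> subquots H" "card (carrier K) < card (carrier H)" "L1 \<in> Sub (X \<times>\<times> K)" "M1 \<in> Sub (K \<times>\<times> H)"
      "fst ` M1 = carrier K" "L1 O M1 = L" using top_sub_factor[OF X H \<open>L \<in> Sub (X \<times>\<times> H)\<close> \<open>\<not> top_sub X H L\<close>] by metis
    have "bas (X \<times>\<times> H) L = (bcomp X K H (bas (X \<times>\<times> K) L1) (bas (K \<times>\<times> H) M1) :: _ \<Rightarrow> 'k)"
      using bcomp_bas[OF X subquots_group[OF H *(1)] H *(3,4,5)] *(6) by simp
    moreover have "(bcomp X K H (bas (X \<times>\<times> K) L1) (bas (K \<times>\<times> H) M1) :: _ \<Rightarrow> 'k) \<in> kI X H"
      unfolding kI_def kspan_span using *(1,2) bas_kB[OF *(3)] bas_kB[OF *(4)] by (intro fv.span_base) blast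
    ultimately show ?thesis by simp
  qed
  have "fscale (a C) (bas (X \<times>\<times> H) (SOME L. L \<in> C)) \<in> kI X H" if "C \<in> conj_classes (X \<times>\<times> H)" for C
  proof (cases "top_sub X H (SOME L. L \<in> C)")
    case True
    hence "a C = 0" using a some_conj_class[OF G that] by metis
    thus ?thesis unfolding kI_def kspan_span using fv.span_zero by (simp add: zero_fun_def)
  next
    case False
    thus ?thesis using bas[OF some_conj_class(1)[OF G that]] unfolding kI_def kspan_span by (intro fv.span_scale)
  qed
  hence "(\<Sum>C\<in>conj_classes (X \<times>\<times> H). fscale (a C) (bas (X \<times>\<times> H) (SOME L. L \<in> C))) \<in> kI X H"
    unfolding kI_def kspan_span by (rule fv.span_sum)
  thus "a \<in> kI X H" using kB_expand[OF X H] a by simp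
qed

lemma kI_subspace: "fv.subspace (kI X H :: (_ \<Rightarrow> 'k) set)"
  unfolding kI_def kspan_span by (rule fv.subspace_span)

lemma kI_kB: "fin_group X \<Longrightarrow> fin_group H \<Longrightarrow> (a :: _ \<Rightarrow> 'k) \<in> kI X H \<Longrightarrow> a \<in> kB X H"
  using kI_iff by blast

lemma kI_left_ideal:
  fixes a b :: "_ \<Rightarrow> 'k"
  assumes X: "fin_group X" and Y: "fin_group Y" and H: "fin_group H" and b: "b \<in> kI Y H"
  shows "bcomp X Y H a b \<in> kI X H"
  using b unfolding kI_def[of Y] kspan_span
proof (induction rule: fv.span_induct_alt)
  case base
  show ?case using fv.subspace_0[OF kI_subspace, of X H] by (simp only: bcomp_zero_right)
next
  case (step c x y)
  then obtain K d e where *: "x = bcomp Y K H d e" "K \<in> subquots H" "card (carrier K) < card (carrier H)" "d \<in> kB Y K" "e \<in> kB K H" by blast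
  have K: "fin_group K" by (rule subquots_group[OF H *(2)])
  have "bcomp X Y H a x = bcomp X K H (bcomp X Y K a d) e" unfolding *(1) by (rule bcomp_assoc[OF X Y K H, symmetric])
  also have "\<dots> \<in> kI X H" unfolding kI_def kspan_span using * bcomp_kB[OF X Y K] by (intro fv.span_base) blast
  finally show ?case unfolding bcomp_add_right bcomp_scale_right
    by (intro fv.subspace_add[OF kI_subspace] fv.subspace_scale[OF kI_subspace] step.IH)
qed

text \<open>The middle group has to remain a smaller subquotient of the right-hand group, which is
  ensured by composing with elements of \<open>kB H H\<close>; hence the shape
  \<open>bcomp X H H\<close>.\<close>

lemma kI_right_ideal:
  fixes a b :: "_ \<Rightarrow> 'k"
  assumes X: "fin_group X" and H: "fin_group H" and a: "a \<in> kI X H"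
  shows "bcomp X H H a b \<in> kI X H"
proof -
  \<comment> \<open>The ideal in the goal is folded, because unfolding \<open>kI X H\<close> in the
    hypothesis would otherwise unfold it there as well.\<close>
  define J :: "(_ \<Rightarrow> 'k) set" where "J = kI X H"
  have J: "fv.subspace J" unfolding J_def by (rule kI_subspace)
  have "bcomp X H H a b \<in> J" using a unfolding kI_def[of X] kspan_span
  proof (induction rule: fv.span_induct_alt)
    case base
    show ?case using fv.subspace_0[OF J] by (simp only: bcomp_zero_left)
  next
    case (step c x y)
    then obtain K d e where *: "x = bcomp X K H d e" "K \<in> subquots H" "card (carrier K) < card (carrier H)" "d \<in> kB X K" "e \<in> kB K H" by blast
    have K: "fin_group K" by (rule subquots_group[OF H *(2)])
    have "bcomp X H H x b = bcomp X K H d (bcomp K H H e b)" unfolding *(1) by (rule bcomp_assoc[OF X K H H])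
    also have "\<dots> \<in> J" unfolding J_def kI_def kspan_span using * bcomp_kB[OF K H H] by (intro fv.span_base) blast
    finally show ?case unfolding bcomp_add_left bcomp_scale_left
      by (intro fv.subspace_add[OF J] fv.subspace_scale[OF J] step.IH)
  qed
  thus ?thesis unfolding J_def .
qed

end

subsection \<open>Outer automorphisms\<close>

text \<open>The coordinates are ordered so that this is the stabilizer of the identity in the biset
  of \<open>isoB\<close>, and so that relational composition becomes composition of maps.\<close>

definition dia :: "'h monoid \<Rightarrow> ('h \<Rightarrow> 'h) \<Rightarrow> ('h \<times> 'h) set" where
  "dia H \<sigma> = (\<lambda>h. (\<sigma> h, h)) ` carrier H"

lemma AutxD:
  assumes "group H" "\<sigma> \<in> Autx H"
  shows "bij_betw \<sigma> (carrier H) (carrier H)" "\<And>x. x \<in> carrier H \<Longrightarrow> \<sigma> x \<in> carrier H"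
    "\<And>x y. x \<in> carrier H \<Longrightarrow> y \<in> carrier H \<Longrightarrow> \<sigma> (x \<otimes>\<^bsub>H\<^esub> y) = \<sigma> x \<otimes>\<^bsub>H\<^esub> \<sigma> y"
    "\<sigma> \<one>\<^bsub>H\<^esub> = \<one>\<^bsub>H\<^esub>" "\<And>x. x \<in> carrier H \<Longrightarrow> \<sigma> (inv\<^bsub>H\<^esub> x) = inv\<^bsub>H\<^esub> \<sigma> x"
    "\<And>y. y \<in> carrier H \<Longrightarrow> \<exists>x\<in>carrier H. y = \<sigma> x" "\<sigma> \<in> extensional (carrier H)"
proof -
  have i: "\<sigma> \<in> iso H H" and "\<sigma> \<in> extensional (carrier H)" using assms by (auto simp: Autx_def)
  thus "\<sigma> \<in> extensional (carrier H)" by simp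
  have h: "\<sigma> \<in> hom H H" using i by (simp add: iso_def)
  interpret group_hom H H \<sigma> using assms h by (simp add: group_hom_def group_hom_axioms_def)
  show b: "bij_betw \<sigma> (carrier H) (carrier H)" using i by (simp add: iso_def)
  show "\<And>x. x \<in> carrier H \<Longrightarrow> \<sigma> x \<in> carrier H" by simp
  show "\<And>x y. x \<in> carrier H \<Longrightarrow> y \<in> carrier H \<Longrightarrow> \<sigma> (x \<otimes>\<^bsub>H\<^esub> y) = \<sigma> x \<otimes>\<^bsub>H\<^esub> \<sigma> y" by simp
  show "\<sigma> \<one>\<^bsub>H\<^esub> = \<one>\<^bsub>H\<^esub>" by simp
  show "\<And>x. x \<in> carrier H \<Longrightarrow> \<sigma> (inv\<^bsub>H\<^esub> x) = inv\<^bsub>H\<^esub> \<sigma> x" by simp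
  show "\<And>y. y \<in> carrier H \<Longrightarrow> \<exists>x\<in>carrier H. y = \<sigma> x" using b by (auto simp: bij_betw_def)
qed

lemma Autx_ext: "\<sigma> \<in> Autx H \<Longrightarrow> \<tau> \<in> Autx H \<Longrightarrow> (\<And>x. x \<in> carrier H \<Longrightarrow> \<sigma> x = \<tau> x) \<Longrightarrow> \<sigma> = \<tau>"
  unfolding Autx_def by (auto intro: extensionalityI)

lemma AutxI:
  assumes "group H" "\<And>x. x \<in> carrier H \<Longrightarrow> f x \<in> carrier H"
    "\<And>x y. x \<in> carrier H \<Longrightarrow> y \<in> carrier H \<Longrightarrow> f (x \<otimes>\<^bsub>H\<^esub> y) = f x \<otimes>\<^bsub>H\<^esub> f y"
    "inj_on f (carrier H)" "\<And>y. y \<in> carrier H \<Longrightarrow> \<exists>x\<in>carrier H. y = f x"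
  shows "restrict f (carrier H) \<in> Autx H"
proof -
  interpret group H by fact
  have "bij_betw f (carrier H) (carrier H)" unfolding bij_betw_def using assms by blast
  thus ?thesis using assms by (auto simp: Autx_def iso_def hom_def cong: bij_betw_cong)
qed

lemma dia_Sub: 
  assumes "group H" "\<sigma> \<in> Autx H" 
  shows "dia H \<sigma> \<in> Sub (H \<times>\<times> H)"
proof -
  note a = AutxD[OF assms]
  interpret group H by fact
  show ?thesis
    by (rule Sub_DirProdI) (use assms a in \<open>auto simp: dia_def image_iff\<close>)
qed

lemma dia_fst: "group H \<Longrightarrow> \<sigma> \<in> Autx H \<Longrightarrow> fst ` dia H \<sigma> = carrier H"
  using AutxD(1)[of H \<sigma>] by (auto simp: dia_def image_image bij_betw_def)

lemma dia_top: 
  assumes "group H" "\<sigma> \<in> Autx H" 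
  shows "top_sub H H (dia H \<sigma>)"
proof -
  note a = AutxD[OF assms]
  have "h = \<one>\<^bsub>H\<^esub>" if "h \<in> carrier H" "\<sigma> h = \<one>\<^bsub>H\<^esub>" for h
    using a(1) that a(4) group.is_monoid[OF assms(1), THEN monoid.one_closed] by (metis bij_betw_def inj_onD)
  thus ?thesis by (force simp: top_sub_def dia_def)
qed

text \<open>A choice function \<open>s\<close> with \<open>(s h, h) \<in> L\<close> is injective
  because first coordinates determine second ones; finiteness makes it surjective, and then
  \<open>L\<close> can contain nothing beyond its graph.\<close>

lemma top_sub_dia:
  assumes H: "fin_group H" and L: "L \<in> Sub (H \<times>\<times> H)" and t: "top_sub H H L"
  obtains \<sigma> where "\<sigma> \<in> Autx H" "L = dia H \<sigma>"
proof -
  have g: "group H" and f: "finite (carrier H)" using H by (auto simp: fin_group_def)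
  interpret group H by (rule g)
  note l = mem_Sub_DirProd[OF g g L]
  have "\<forall>h\<in>carrier H. \<exists>x. (x,h) \<in> L" using t by (auto simp: top_sub_def)
  then obtain s where s: "\<And>h. h \<in> carrier H \<Longrightarrow> (s h, h) \<in> L" by metis
  have sc: "\<And>h. h \<in> carrier H \<Longrightarrow> s h \<in> carrier H" using s l by blast
  have inj: "inj_on s (carrier H)" using s top_sub_inj[OF g g L t] by (intro inj_onI) metis
  have surj: "s ` carrier H = carrier H"
    using endo_inj_surj[OF f _ inj] sc by auto
  have Ls: "x = s h" if xh: "(x,h) \<in> L" for x h
  proof -
    obtain y where y: "y \<in> carrier H" "x = s y" using surj l(1)[OF xh] by auto
    hence "y = h" using s[OF y(1)] xh top_sub_inj[OF g g L t] by metis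
    thus ?thesis using y by simp
  qed
  have "restrict s (carrier H) \<in> Autx H"
  proof (rule AutxI[OF g sc _ inj])
    show "s (x \<otimes>\<^bsub>H\<^esub> y) = s x \<otimes>\<^bsub>H\<^esub> s y" if "x \<in> carrier H" "y \<in> carrier H" for x y
      using Ls[OF l(4)[OF s[OF that(1)] s[OF that(2)]]] by simp
    show "\<exists>x\<in>carrier H. y = s x" if "y \<in> carrier H" for y using surj that by auto
  qed
  moreover have "L = dia H (restrict s (carrier H))" using s Ls l(2) by (force simp: dia_def)
  ultimately show ?thesis using that by blast
qed

text \<open>Conjugating the graph of \<open>\<sigma>\<close> by \<open>(b,c)\<close> and writing
  \<open>b = \<sigma> d\<close> turns \<open>\<sigma>\<close> into \<open>\<sigma>\<close> composed
  with conjugation by \<open>d c^-1\<close>. So conjugacy of graphs is equality of outer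
  classes.\<close>

lemma dia_cls:
  assumes H: "group H" and s: "\<sigma> \<in> Autx H"
  shows "\<tau> \<in> outcls H \<sigma> \<longleftrightarrow> \<tau> \<in> Autx H \<and> dia H \<tau> \<in> cls (H \<times>\<times> H) (dia H \<sigma>)"
proof
  interpret group H by (rule H)
  note a = AutxD[OF H s]
  have ds: "dia H \<sigma> \<subseteq> carrier H \<times> carrier H" using a by (auto simp: dia_def)
  { assume "\<tau> \<in> outcls H \<sigma>"
    then obtain h where h: "\<tau> \<in> Autx H" "h \<in> carrier H" "\<And>x. x \<in> carrier H \<Longrightarrow> \<tau> x = \<sigma> (h \<otimes>\<^bsub>H\<^esub> x \<otimes>\<^bsub>H\<^esub> inv\<^bsub>H\<^esub> h)"
      by (auto simp: outcls_def)
    have "dia H \<tau> = conjg (H \<times>\<times> H) (\<one>\<^bsub>H\<^esub>, inv\<^bsub>H\<^esub> h) (dia H \<sigma>)"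
      unfolding mem_conjg_DirProd[OF H H ds one_closed inv_closed[OF h(2)]]
    proof safe
      fix x y assume "(x,y) \<in> dia H \<tau>"
      hence y: "y \<in> carrier H" "x = \<tau> y" by (auto simp: dia_def)
      show "(x,y) \<in> (\<lambda>(a, b). (\<one>\<^bsub>H\<^esub> \<otimes>\<^bsub>H\<^esub> a \<otimes>\<^bsub>H\<^esub> inv\<^bsub>H\<^esub> \<one>\<^bsub>H\<^esub>, inv\<^bsub>H\<^esub> h \<otimes>\<^bsub>H\<^esub> b \<otimes>\<^bsub>H\<^esub> inv\<^bsub>H\<^esub> (inv\<^bsub>H\<^esub> h))) ` dia H \<sigma>"
      proof (rule rev_image_eqI[of "(\<sigma> (h \<otimes>\<^bsub>H\<^esub> y \<otimes>\<^bsub>H\<^esub> inv\<^bsub>H\<^esub> h), h \<otimes>\<^bsub>H\<^esub> y \<otimes>\<^bsub>H\<^esub> inv\<^bsub>H\<^esub> h)"])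
        show "(\<sigma> (h \<otimes>\<^bsub>H\<^esub> y \<otimes>\<^bsub>H\<^esub> inv\<^bsub>H\<^esub> h), h \<otimes>\<^bsub>H\<^esub> y \<otimes>\<^bsub>H\<^esub> inv\<^bsub>H\<^esub> h) \<in> dia H \<sigma>"
          using y h unfolding dia_def by blast
        have "inv\<^bsub>H\<^esub> h \<otimes>\<^bsub>H\<^esub> (h \<otimes>\<^bsub>H\<^esub> y \<otimes>\<^bsub>H\<^esub> inv\<^bsub>H\<^esub> h) \<otimes>\<^bsub>H\<^esub> h = (inv\<^bsub>H\<^esub> h \<otimes>\<^bsub>H\<^esub> h) \<otimes>\<^bsub>H\<^esub> y \<otimes>\<^bsub>H\<^esub> (inv\<^bsub>H\<^esub> h \<otimes>\<^bsub>H\<^esub> h)"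
          using y h by (simp only: m_assoc m_closed inv_closed)
        thus "(x, y) = (case (\<sigma> (h \<otimes>\<^bsub>H\<^esub> y \<otimes>\<^bsub>H\<^esub> inv\<^bsub>H\<^esub> h), h \<otimes>\<^bsub>H\<^esub> y \<otimes>\<^bsub>H\<^esub> inv\<^bsub>H\<^esub> h) of (a, b) \<Rightarrow>
           (\<one>\<^bsub>H\<^esub> \<otimes>\<^bsub>H\<^esub> a \<otimes>\<^bsub>H\<^esub> inv\<^bsub>H\<^esub> \<one>\<^bsub>H\<^esub>, inv\<^bsub>H\<^esub> h \<otimes>\<^bsub>H\<^esub> b \<otimes>\<^bsub>H\<^esub> inv\<^bsub>H\<^esub> (inv\<^bsub>H\<^esub> h)))"
          using y h a(2)[of "h \<otimes>\<^bsub>H\<^esub> y \<otimes>\<^bsub>H\<^esub> inv\<^bsub>H\<^esub> h"] by simp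
      qed
    next
      fix x y assume "(x,y) \<in> dia H \<sigma>"
      hence y: "y \<in> carrier H" "x = \<sigma> y" by (auto simp: dia_def)
      have "h \<otimes>\<^bsub>H\<^esub> (inv\<^bsub>H\<^esub> h \<otimes>\<^bsub>H\<^esub> y \<otimes>\<^bsub>H\<^esub> h) \<otimes>\<^bsub>H\<^esub> inv\<^bsub>H\<^esub> h = (h \<otimes>\<^bsub>H\<^esub> inv\<^bsub>H\<^esub> h) \<otimes>\<^bsub>H\<^esub> y \<otimes>\<^bsub>H\<^esub> (h \<otimes>\<^bsub>H\<^esub> inv\<^bsub>H\<^esub> h)"
        using y h by (simp only: m_assoc m_closed inv_closed)
      hence "h \<otimes>\<^bsub>H\<^esub> (inv\<^bsub>H\<^esub> h \<otimes>\<^bsub>H\<^esub> y \<otimes>\<^bsub>H\<^esub> h) \<otimes>\<^bsub>H\<^esub> inv\<^bsub>H\<^esub> h = y" using y h by simp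
      thus "(\<one>\<^bsub>H\<^esub> \<otimes>\<^bsub>H\<^esub> x \<otimes>\<^bsub>H\<^esub> inv\<^bsub>H\<^esub> \<one>\<^bsub>H\<^esub>, inv\<^bsub>H\<^esub> h \<otimes>\<^bsub>H\<^esub> y \<otimes>\<^bsub>H\<^esub> inv\<^bsub>H\<^esub> (inv\<^bsub>H\<^esub> h)) \<in> dia H \<tau>"
        using y h(2) h(3)[of "inv\<^bsub>H\<^esub> h \<otimes>\<^bsub>H\<^esub> y \<otimes>\<^bsub>H\<^esub> h"] a(2) unfolding dia_def by (intro rev_image_eqI[of "inv\<^bsub>H\<^esub> h \<otimes>\<^bsub>H\<^esub> y \<otimes>\<^bsub>H\<^esub> h"]) simp_all
    qed
    thus "\<tau> \<in> Autx H \<and> dia H \<tau> \<in> cls (H \<times>\<times> H) (dia H \<sigma>)" using h by (auto simp: cls_def) }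
  { assume t: "\<tau> \<in> Autx H \<and> dia H \<tau> \<in> cls (H \<times>\<times> H) (dia H \<sigma>)"
    then obtain b c where bc: "b \<in> carrier H" "c \<in> carrier H" "dia H \<tau> = conjg (H \<times>\<times> H) (b,c) (dia H \<sigma>)" by (auto simp: cls_def)
    obtain d where d: "d \<in> carrier H" "b = \<sigma> d" using a(6)[OF bc(1)] by auto
    have "\<tau> x = \<sigma> ((d \<otimes>\<^bsub>H\<^esub> inv\<^bsub>H\<^esub> c) \<otimes>\<^bsub>H\<^esub> x \<otimes>\<^bsub>H\<^esub> inv\<^bsub>H\<^esub> (d \<otimes>\<^bsub>H\<^esub> inv\<^bsub>H\<^esub> c))" if x: "x \<in> carrier H" for x
    proof -
      have "(\<tau> x, x) \<in> conjg (H \<times>\<times> H) (b,c) (dia H \<sigma>)" using bc(3) x by (auto simp: dia_def)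
      then obtain y where y: "y \<in> carrier H" "\<tau> x = b \<otimes>\<^bsub>H\<^esub> \<sigma> y \<otimes>\<^bsub>H\<^esub> inv\<^bsub>H\<^esub> b" "x = c \<otimes>\<^bsub>H\<^esub> y \<otimes>\<^bsub>H\<^esub> inv\<^bsub>H\<^esub> c"
        unfolding mem_conjg_DirProd[OF H H ds bc(1,2)] by (auto simp: dia_def)
      have "(d \<otimes>\<^bsub>H\<^esub> inv\<^bsub>H\<^esub> c) \<otimes>\<^bsub>H\<^esub> x \<otimes>\<^bsub>H\<^esub> inv\<^bsub>H\<^esub> (d \<otimes>\<^bsub>H\<^esub> inv\<^bsub>H\<^esub> c) = d \<otimes>\<^bsub>H\<^esub> (inv\<^bsub>H\<^esub> c \<otimes>\<^bsub>H\<^esub> c) \<otimes>\<^bsub>H\<^esub> y \<otimes>\<^bsub>H\<^esub> (inv\<^bsub>H\<^esub> c \<otimes>\<^bsub>H\<^esub> c) \<otimes>\<^bsub>H\<^esub> inv\<^bsub>H\<^esub> d"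
        unfolding y(3) using y(1) bc d by (simp only: inv_mult_group inv_inv m_assoc m_closed inv_closed)
      also have "\<dots> = d \<otimes>\<^bsub>H\<^esub> y \<otimes>\<^bsub>H\<^esub> inv\<^bsub>H\<^esub> d" using y(1) bc d by simp
      finally show ?thesis using y d a by simp
    qed
    thus "\<tau> \<in> outcls H \<sigma>" unfolding outcls_def using t bc d by (auto intro!: bexI[of _ "d \<otimes>\<^bsub>H\<^esub> inv\<^bsub>H\<^esub> c"]) }
qed

lemma outcls_eq_iff:
  assumes H: "group H" and s: "\<sigma> \<in> Autx H" and t: "\<tau> \<in> Autx H"
  shows "outcls H \<tau> = outcls H \<sigma> \<longleftrightarrow> cls (H \<times>\<times> H) (dia H \<tau>) = cls (H \<times>\<times> H) (dia H \<sigma>)"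
proof -
  note G = DirProd_group[OF H H]
  have "outcls H \<tau> = outcls H \<sigma> \<Longrightarrow> dia H \<tau> \<in> cls (H \<times>\<times> H) (dia H \<sigma>)"
    using dia_cls[OF H s, of \<tau>] dia_cls[OF H t, of \<tau>] t cls_self[OF G dia_Sub[OF H t]] by simp
  thus ?thesis using dia_cls[OF H s] dia_cls[OF H t] cls_eq[OF G dia_Sub[OF H s], of "dia H \<tau>"] by blast
qed

lemma Out_some:
  assumes H: "group H" and o: "ob \<in> Out H"
  shows "(SOME \<sigma>. \<sigma> \<in> ob) \<in> Autx H" "outcls H (SOME \<sigma>. \<sigma> \<in> ob) = ob"
proof -
  obtain \<sigma> where s: "\<sigma> \<in> Autx H" "ob = outcls H \<sigma>" using o by (auto simp: Out_def)
  note G = DirProd_group[OF H H]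
  have "\<sigma> \<in> ob" using dia_cls[OF H s(1)] s cls_self[OF G dia_Sub[OF H s(1)]] by simp
  hence "(SOME \<sigma>. \<sigma> \<in> ob) \<in> ob" by (rule someI[of "\<lambda>\<sigma>. \<sigma> \<in> ob"])
  thus 1: "(SOME \<sigma>. \<sigma> \<in> ob) \<in> Autx H"
    and "outcls H (SOME \<sigma>. \<sigma> \<in> ob) = ob"
    using dia_cls[OF H s(1)] s(2) outcls_eq_iff[OF H s(1)] cls_eq[OF G dia_Sub[OF H s(1)]] by auto
qed

lemma compose_Autx:
  assumes H: "group H" and s: "\<sigma> \<in> Autx H" and t: "\<tau> \<in> Autx H"
  shows "compose (carrier H) \<sigma> \<tau> \<in> Autx H" "dia H \<sigma> O dia H \<tau> = dia H (compose (carrier H) \<sigma> \<tau>)"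
proof -
  note a = AutxD[OF H s] and b = AutxD[OF H t]
  interpret group H by (rule H)
  show "compose (carrier H) \<sigma> \<tau> \<in> Autx H" unfolding compose_def
  proof (rule AutxI[OF H])
    have "bij_betw (\<sigma> \<circ> \<tau>) (carrier H) (carrier H)" using a(1) b(1) by (rule bij_betw_trans[rotated])
    thus "inj_on (\<lambda>x. \<sigma> (\<tau> x)) (carrier H)" by (simp add: bij_betw_def o_def)
    show "\<exists>x\<in>carrier H. y = \<sigma> (\<tau> x)" if "y \<in> carrier H" for y using a(6) b(6) that by metis
  qed (use a b in auto)
  show "dia H \<sigma> O dia H \<tau> = dia H (compose (carrier H) \<sigma> \<tau>)"
  proof
    show "dia H \<sigma> O dia H \<tau> \<subseteq> dia H (compose (carrier H) \<sigma> \<tau>)" by (auto simp: dia_def compose_def)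
    show "dia H (compose (carrier H) \<sigma> \<tau>) \<subseteq> dia H \<sigma> O dia H \<tau>" using b(2) by (auto simp: dia_def compose_def)
  qed
qed

lemma id_Autx: 
  assumes H: "group H" shows "restrict (\<lambda>x. x) (carrier H) \<in> Autx H"
  by (rule AutxI[OF H]) auto

lemma inv_Autx:
  assumes H: "group H" and s: "\<sigma> \<in> Autx H"
  obtains \<tau> where "\<tau> \<in> Autx H" "\<And>x. x \<in> carrier H \<Longrightarrow> \<tau> (\<sigma> x) = x" "\<And>x. x \<in> carrier H \<Longrightarrow> \<sigma> (\<tau> x) = x"
proof -
  note a = AutxD[OF H s]
  interpret group H by (rule H)
  let ?f = "inv_into (carrier H) \<sigma>"
  have f: "?f (\<sigma> x) = x" if "x \<in> carrier H" for x using a(1) that by (simp add: bij_betw_def)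
  have f': "\<sigma> (?f x) = x" "?f x \<in> carrier H" if "x \<in> carrier H" for x using a(1) that
    by (auto simp: bij_betw_def f_inv_into_f inv_into_into)
  have "restrict ?f (carrier H) \<in> Autx H"
  proof (rule AutxI[OF H])
    show "?f (x \<otimes>\<^bsub>H\<^esub> y) = ?f x \<otimes>\<^bsub>H\<^esub> ?f y" if "x \<in> carrier H" "y \<in> carrier H" for x y
      using that f[of "?f x \<otimes>\<^bsub>H\<^esub> ?f y"] f'[of x] f'[of y] a(3) by simp
    show "inj_on ?f (carrier H)" using f' by (metis inj_onI)
    show "\<exists>x\<in>carrier H. y = ?f x" if "y \<in> carrier H" for y using f[OF that] a(2)[OF that] by metis
  qed (use f' in auto)
  thus ?thesis using that[of "restrict ?f (carrier H)"] f f' a by simp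
qed

context char0
begin

lemma isoB_bas:
  assumes H: "group H" and s: "\<sigma> \<in> Autx H"
  shows "(isoB H \<sigma> :: _ \<Rightarrow> 'k) = bas (H \<times>\<times> H) (dia H \<sigma>)"
proof -
  note a = AutxD[OF H s]
  interpret group H by (rule H)
  let ?act = "\<lambda>g u. fst g \<otimes>\<^bsub>H\<^esub> u \<otimes>\<^bsub>H\<^esub> inv\<^bsub>H\<^esub> (\<sigma> (snd g))"
  have act: "acts_on (H \<times>\<times> H) ?act (carrier H)" unfolding acts_on_def
    using a by (auto simp: inv_mult_group m_assoc)
  have st: "stab (H \<times>\<times> H) ?act \<one>\<^bsub>H\<^esub> = dia H \<sigma>"
  proof -
    have "x = \<sigma> y" if "x \<otimes>\<^bsub>H\<^esub> inv\<^bsub>H\<^esub> (\<sigma> y) = \<one>\<^bsub>H\<^esub>" "x \<in> carrier H" "y \<in> carrier H" for x y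
      using that a(2) inv_equality[of x "inv\<^bsub>H\<^esub> (\<sigma> y)"] by simp
    hence "g \<in> stab (H \<times>\<times> H) ?act \<one>\<^bsub>H\<^esub> \<longleftrightarrow> g \<in> dia H \<sigma>" for g
      using a(2) by (cases g) (auto simp: stab_def dia_def image_iff)
    thus ?thesis by blast
  qed
  have "carrier H \<subseteq> orb (H \<times>\<times> H) ?act \<one>\<^bsub>H\<^esub>"
  proof
    fix x assume "x \<in> carrier H"
    thus "x \<in> orb (H \<times>\<times> H) ?act \<one>\<^bsub>H\<^esub>" unfolding orb_def by (intro rev_image_eqI[of "(x,\<one>\<^bsub>H\<^esub>)"]) (use a in auto)
  qed
  thus ?thesis unfolding isoB_def using biset_class_transitive[OF DirProd_group[OF H H] act one_closed] st by simp
qed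

lemma isoEl_bas:
  assumes H: "group H" and s: "\<sigma> \<in> Autx H"
  shows "(isoEl H (outcls H \<sigma>) :: _ \<Rightarrow> 'k) = bas (H \<times>\<times> H) (dia H \<sigma>)"
proof -
  have o: "outcls H \<sigma> \<in> Out H" using s by (simp add: Out_def)
  note t = Out_some[OF H o]
  have "cls (H \<times>\<times> H) (dia H (SOME \<tau>. \<tau> \<in> outcls H \<sigma>)) = cls (H \<times>\<times> H) (dia H \<sigma>)"
    using outcls_eq_iff[OF H s t(1)] t(2) by simp
  thus ?thesis unfolding isoEl_def isoB_bas[OF H t(1)] by (simp add: bas_def)
qed

lemma bas_eq_iff: "(bas D L :: _ \<Rightarrow> 'k) = bas D M \<longleftrightarrow> cls D L = cls D M"
  by (auto simp: bas_def fun_eq_iff split: if_splits)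

text \<open>Independence of the representatives is read off from the product of basis elements in
  \<open>kB H H\<close>, where a graph matters only up to conjugacy, instead of from a computation
  with inner automorphisms. This is why the group \<open>Out H\<close> is set up over the
  coefficient field.\<close>

lemma outmul_outcls:
  assumes HH: "fin_group H" and s: "\<sigma> \<in> Autx H" and t: "\<tau> \<in> Autx H"
  shows "outmul H (outcls H \<sigma>) (outcls H \<tau>) = outcls H (compose (carrier H) \<sigma> \<tau>)"
proof -
  have H: "group H" using HH by (simp add: fin_group_def)
  have o: "outcls H \<sigma> \<in> Out H" "outcls H \<tau> \<in> Out H" using s t by (auto simp: Out_def)
  note s' = Out_some[OF H o(1)] and t' = Out_some[OF H o(2)]
  let ?s = "SOME x. x \<in> outcls H \<sigma>" and ?t = "SOME x. x \<in> outcls H \<tau>"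
  have "(bas (H \<times>\<times> H) (dia H ?s O dia H ?t) :: _ \<Rightarrow> 'k) = bcomp H H H (bas (H \<times>\<times> H) (dia H ?s)) (bas (H \<times>\<times> H) (dia H ?t))"
    by (rule bcomp_bas[OF HH HH HH dia_Sub[OF H s'(1)] dia_Sub[OF H t'(1)] dia_fst[OF H t'(1)], symmetric])
  also have "\<dots> = bcomp H H H (isoEl H (outcls H \<sigma>)) (isoEl H (outcls H \<tau>))"
    using isoEl_bas[OF H s'(1)] isoEl_bas[OF H t'(1)] s'(2) t'(2) by simp
  also have "\<dots> = bcomp H H H (bas (H \<times>\<times> H) (dia H \<sigma>)) (bas (H \<times>\<times> H) (dia H \<tau>))"
    by (simp only: isoEl_bas[OF H s] isoEl_bas[OF H t])
  also have "\<dots> = bas (H \<times>\<times> H) (dia H \<sigma> O dia H \<tau>)"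
    by (rule bcomp_bas[OF HH HH HH dia_Sub[OF H s] dia_Sub[OF H t] dia_fst[OF H t]])
  finally have "cls (H \<times>\<times> H) (dia H (compose (carrier H) ?s ?t)) = cls (H \<times>\<times> H) (dia H (compose (carrier H) \<sigma> \<tau>))"
    using compose_Autx(2)[OF H s'(1) t'(1)] compose_Autx(2)[OF H s t] by (simp add: bas_eq_iff)
  thus ?thesis unfolding outmul_def
    using outcls_eq_iff[OF H compose_Autx(1)[OF H s t] compose_Autx(1)[OF H s'(1) t'(1)]] by simp
qed

end

definition OutG :: "'h monoid \<Rightarrow> ('h \<Rightarrow> 'h) set monoid" where
  "OutG H = \<lparr>carrier = Out H, mult = outmul H, one = outid H\<rparr>"

lemma OutG_simps [simp]: "carrier (OutG H) = Out H" "x \<otimes>\<^bsub>OutG H\<^esub> y = outmul H x y" "\<one>\<^bsub>OutG H\<^esub> = outid H"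
  by (simp_all add: OutG_def)

context char0
begin

lemma OutG_group:
  assumes HH: "fin_group H"
  shows "group (OutG H)"
proof -
  have H: "group H" using HH by (simp add: fin_group_def)
  note M = outmul_outcls[OF HH] and C = compose_Autx(1)[OF H] and A = AutxD[OF H]
  show ?thesis
  proof (rule groupI)
    show "x \<otimes>\<^bsub>OutG H\<^esub> y \<in> carrier (OutG H)" if "x \<in> carrier (OutG H)" "y \<in> carrier (OutG H)" for x y
      using that M C by (auto simp: Out_def)
    show "\<one>\<^bsub>OutG H\<^esub> \<in> carrier (OutG H)" using id_Autx[OF H] by (auto simp: Out_def outid_def)
    show "x \<otimes>\<^bsub>OutG H\<^esub> y \<otimes>\<^bsub>OutG H\<^esub> z = x \<otimes>\<^bsub>OutG H\<^esub> (y \<otimes>\<^bsub>OutG H\<^esub> z)"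
      if xyz: "x \<in> carrier (OutG H)" "y \<in> carrier (OutG H)" "z \<in> carrier (OutG H)" for x y z
    proof -
      obtain a b c where abc: "a \<in> Autx H" "b \<in> Autx H" "c \<in> Autx H" "x = outcls H a" "y = outcls H b" "z = outcls H c"
        using xyz by (auto simp: Out_def)
      have "compose (carrier H) (compose (carrier H) a b) c = compose (carrier H) a (compose (carrier H) b c)"
        using A(2)[OF abc(3)] by (auto simp: compose_def restrict_def fun_eq_iff)
      thus ?thesis using abc M C by simp
    qed
    show "\<one>\<^bsub>OutG H\<^esub> \<otimes>\<^bsub>OutG H\<^esub> x = x" if x: "x \<in> carrier (OutG H)" for x
    proof -
      obtain a where a: "a \<in> Autx H" "x = outcls H a" using x by (auto simp: Out_def)
      have "compose (carrier H) (restrict (\<lambda>x. x) (carrier H)) a = a"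
        by (rule Autx_ext[OF C[OF id_Autx[OF H] a(1)] a(1)]) (use A(2)[OF a(1)] in \<open>auto simp: compose_def\<close>)
      thus ?thesis using a M[OF id_Autx[OF H] a(1)] by (simp add: outid_def)
    qed
    show "\<exists>y\<in>carrier (OutG H). y \<otimes>\<^bsub>OutG H\<^esub> x = \<one>\<^bsub>OutG H\<^esub>" if x: "x \<in> carrier (OutG H)" for x
    proof -
      obtain a where a: "a \<in> Autx H" "x = outcls H a" using x by (auto simp: Out_def)
      obtain b where b: "b \<in> Autx H" "\<And>x. x \<in> carrier H \<Longrightarrow> b (a x) = x" using inv_Autx[OF H a(1)] by metis
      have "compose (carrier H) b a = restrict (\<lambda>x. x) (carrier H)"
        using b by (auto simp: compose_def restrict_def fun_eq_iff)
      hence "outmul H (outcls H b) x = outid H" using a M[OF b(1) a(1)] by (simp add: outid_def)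
      thus ?thesis using b(1) by (auto simp: Out_def)
    qed
  qed
qed

end

lemma finite_Out:
  assumes "fin_group H" shows "finite (Out H)"
proof -
  have H: "group H" "finite (carrier H)" using assms by (auto simp: fin_group_def)
  have "Autx H \<subseteq> carrier H \<rightarrow>\<^sub>E carrier H" using AutxD(2,7)[OF H(1)] by (auto simp: PiE_def)
  hence "finite (Autx H)" by (rule finite_subset) (intro finite_PiE H)
  thus ?thesis by (simp add: Out_def)
qed

context char0
begin

lemma isoEl_mult:
  assumes HH: "fin_group H" and o: "ob \<in> Out H" "ob' \<in> Out H"
  shows "bcomp H H H (isoEl H ob) (isoEl H ob') = (isoEl H (outmul H ob ob') :: _ \<Rightarrow> 'k)"
proof -
  have H: "group H" using HH by (simp add: fin_group_def)
  obtain s t where st: "s \<in> Autx H" "ob = outcls H s" "t \<in> Autx H" "ob' = outcls H t" using o by (auto simp: Out_def)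
  show ?thesis unfolding st(2,4) outmul_outcls[OF HH st(1,3)] isoEl_bas[OF H st(1)] isoEl_bas[OF H st(3)]
    isoEl_bas[OF H compose_Autx(1)[OF H st(1,3)]] compose_Autx(2)[OF H st(1,3), symmetric]
    by (rule bcomp_bas[OF HH HH HH dia_Sub[OF H st(1)] dia_Sub[OF H st(3)] dia_fst[OF H st(3)]])
qed

lemma isoEl_kB:
  assumes HH: "fin_group H" and o: "ob \<in> Out H"
  shows "(isoEl H ob :: _ \<Rightarrow> 'k) \<in> kB H H"
proof -
  have H: "group H" using HH by (simp add: fin_group_def)
  obtain s where s: "s \<in> Autx H" "ob = outcls H s" using o by (auto simp: Out_def)
  show ?thesis unfolding s(2) isoEl_bas[OF H s(1)] by (rule bas_kB[OF dia_Sub[OF H s(1)]])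
qed

text \<open>The converse of the graph of an automorphism is the graph of its inverse.\<close>

lemma bop_isoEl:
  assumes HH: "fin_group H" and o: "ob \<in> Out H"
  shows "bop (isoEl H ob) = (isoEl H (inv\<^bsub>OutG H\<^esub> ob) :: _ \<Rightarrow> 'k)"
proof -
  have H: "group H" using HH by (simp add: fin_group_def)
  interpret O: group "OutG H" by (rule OutG_group[OF HH])
  obtain a where a: "a \<in> Autx H" "ob = outcls H a" using o by (auto simp: Out_def)
  obtain b where b: "b \<in> Autx H" "\<And>x. x \<in> carrier H \<Longrightarrow> b (a x) = x" "\<And>x. x \<in> carrier H \<Longrightarrow> a (b x) = x" using inv_Autx[OF H a(1)] by metis
  have "compose (carrier H) b a = restrict (\<lambda>x. x) (carrier H)"
    using b by (auto simp: compose_def restrict_def fun_eq_iff)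
  hence "outmul H (outcls H b) ob = outid H" using a outmul_outcls[OF HH b(1) a(1)] by (simp add: outid_def)
  hence i: "inv\<^bsub>OutG H\<^esub> ob = outcls H b" using O.inv_equality[of "outcls H b" ob] o b(1) by (auto simp: Out_def)
  have d: "(dia H b)\<inverse> = dia H a" using b AutxD(2)[OF H a(1)] AutxD(2)[OF H b(1)] by (force simp: dia_def)
  hence d': "(dia H a)\<inverse> = dia H b" by (metis converse_converse)
  have c: "converse ` cls (H \<times>\<times> H) (dia H a) = cls (H \<times>\<times> H) (dia H b)" using cls_converse[OF H H dia_Sub[OF H a(1)]] d' by simp
  have "bop (bas (H \<times>\<times> H) (dia H a)) = (bas (H \<times>\<times> H) (dia H b) :: _ \<Rightarrow> 'k)"
  proof (rule ext)
    fix C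
    have "converse ` C = cls (H \<times>\<times> H) (dia H a) \<longleftrightarrow> C = cls (H \<times>\<times> H) (dia H b)"
      using c converse_converse_image by metis
    thus "bop (bas (H \<times>\<times> H) (dia H a)) C = (bas (H \<times>\<times> H) (dia H b) C :: 'k)" by (simp add: bop_converse bas_def)
  qed
  thus ?thesis using i a(2) isoEl_bas[OF H a(1)] isoEl_bas[OF H b(1)] by simp
qed

subsection \<open>The projection onto the group algebra of the outer automorphism group\<close>

lemma isoEl_sum_eval:
  assumes HH: "fin_group H" and s: "\<sigma> \<in> Autx H"
  shows "(\<Sum>ob\<in>Out H. f ob * isoEl H ob (cls (H \<times>\<times> H) (dia H \<sigma>))) = (f (outcls H \<sigma>) :: 'k)"
proof -
  have H: "group H" using HH by (simp add: fin_group_def)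
  have "f ob * isoEl H ob (cls (H \<times>\<times> H) (dia H \<sigma>)) = (if ob = outcls H \<sigma> then f ob else 0)" if o: "ob \<in> Out H" for ob
  proof -
    obtain t where t: "t \<in> Autx H" "ob = outcls H t" using o by (auto simp: Out_def)
    show ?thesis unfolding t(2) isoEl_bas[OF H t(1)] using outcls_eq_iff[OF H s t(1)] by (auto simp: bas_def)
  qed
  thus ?thesis using finite_Out[OF HH] s by (simp add: Out_def)
qed

text \<open>The definite description in \<open>piB\<close> is resolved by evaluation at graphs of
  automorphisms: these are the only \<open>top_sub\<close> subgroups of \<open>H \<times> H\<close>,
  so an element of \<open>kB H H\<close> lies in \<open>kI H H\<close> exactly when it vanishes at
  all of them.\<close>

lemma piB_unique:
  fixes x :: "_ \<Rightarrow> 'k"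
  assumes HH: "fin_group H" and x: "x \<in> kB H H" and f: "f \<in> kOut H"
    and e: "\<And>\<sigma>. \<sigma> \<in> Autx H \<Longrightarrow> x (cls (H \<times>\<times> H) (dia H \<sigma>)) = f (outcls H \<sigma>)"
  shows "piB H x = f" "(\<lambda>C. x C - (\<Sum>ob\<in>Out H. f ob * isoEl H ob C)) \<in> kI H H"
proof -
  have H: "group H" using HH by (simp add: fin_group_def)
  show 1: "(\<lambda>C. x C - (\<Sum>ob\<in>Out H. f ob * isoEl H ob C)) \<in> kI H H"
    unfolding kI_iff[OF HH HH]
  proof (intro conjI ballI impI)
    show "(\<lambda>C. x C - (\<Sum>ob\<in>Out H. f ob * isoEl H ob C)) \<in> kB H H"
      using x isoEl_kB[OF HH] by (auto simp: kB_def)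
    fix L assume "L \<in> Sub (H \<times>\<times> H)" "top_sub H H L"
    then obtain s where "s \<in> Autx H" "L = dia H s" using top_sub_dia[OF HH] by metis
    thus "x (cls (H \<times>\<times> H) L) - (\<Sum>ob\<in>Out H. f ob * isoEl H ob (cls (H \<times>\<times> H) L)) = 0"
      using isoEl_sum_eval[OF HH, of s f] e by simp
  qed
  show "piB H x = f" unfolding piB_def
  proof (rule the_equality)
    show "f \<in> kOut H \<and> (\<lambda>C. x C - (\<Sum>ob\<in>Out H. f ob * isoEl H ob C)) \<in> kI H H" using f 1 by simp
    fix g assume g: "g \<in> kOut H \<and> (\<lambda>C. x C - (\<Sum>ob\<in>Out H. g ob * isoEl H ob C)) \<in> kI H H"
    show "g = f"
    proof
      fix ob show "g ob = f ob"
      proof (cases "ob \<in> Out H")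
        case True
        then obtain t where t: "t \<in> Autx H" "ob = outcls H t" by (auto simp: Out_def)
        have "x (cls (H \<times>\<times> H) (dia H t)) - (\<Sum>ob\<in>Out H. g ob * isoEl H ob (cls (H \<times>\<times> H) (dia H t))) = 0"
          using g dia_Sub[OF H t(1)] dia_top[OF H t(1)] unfolding kI_iff[OF HH HH] by blast
        thus ?thesis using isoEl_sum_eval[OF HH t(1), of g] e[OF t(1)] t by simp
      next
        case False thus ?thesis using f g by (simp add: kOut_def)
      qed
    qed
  qed
qed

lemma piB:
  fixes x :: "_ \<Rightarrow> 'k"
  assumes HH: "fin_group H" and x: "x \<in> kB H H"
  shows "piB H x \<in> kOut H" "\<And>\<sigma>. \<sigma> \<in> Autx H \<Longrightarrow> piB H x (outcls H \<sigma>) = x (cls (H \<times>\<times> H) (dia H \<sigma>))"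
    "x - (\<Sum>ob\<in>Out H. fscale (piB H x ob) (isoEl H ob)) \<in> kI H H"
proof -
  have H: "group H" using HH by (simp add: fin_group_def)
  define f where "f = (\<lambda>ob. if ob \<in> Out H then x (cls (H \<times>\<times> H) (dia H (SOME \<sigma>. \<sigma> \<in> ob))) else 0)"
  have fk: "f \<in> kOut H" by (simp add: f_def kOut_def)
  have fe: "x (cls (H \<times>\<times> H) (dia H \<sigma>)) = f (outcls H \<sigma>)" if s: "\<sigma> \<in> Autx H" for \<sigma>
  proof -
    have o: "outcls H \<sigma> \<in> Out H" using s by (simp add: Out_def)
    have "cls (H \<times>\<times> H) (dia H (SOME x. x \<in> outcls H \<sigma>)) = cls (H \<times>\<times> H) (dia H \<sigma>)"
      using outcls_eq_iff[OF H s Out_some(1)[OF H o]] Out_some(2)[OF H o] by simp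
    thus ?thesis using o by (simp add: f_def)
  qed
  note u = piB_unique[OF HH x fk fe]
  show "piB H x \<in> kOut H" "\<And>\<sigma>. \<sigma> \<in> Autx H \<Longrightarrow> piB H x (outcls H \<sigma>) = x (cls (H \<times>\<times> H) (dia H \<sigma>))" using u(1) fk fe by auto
  show "x - (\<Sum>ob\<in>Out H. fscale (piB H x ob) (isoEl H ob)) \<in> kI H H"
    using u by (simp add: sum_fun fun_diff_def)
qed

lemma kOut_eqI: "f \<in> kOut H \<Longrightarrow> g \<in> kOut H \<Longrightarrow> (\<And>\<sigma>. \<sigma> \<in> Autx H \<Longrightarrow> f (outcls H \<sigma>) = g (outcls H \<sigma>)) \<Longrightarrow> f = g"
proof
  fix ob assume a: "f \<in> kOut H" "g \<in> kOut H" "\<And>\<sigma>. \<sigma> \<in> Autx H \<Longrightarrow> f (outcls H \<sigma>) = g (outcls H \<sigma>)"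
  show "f ob = g ob"
  proof (cases "ob \<in> Out H")
    case True thus ?thesis using a(3) by (auto simp: Out_def)
  next
    case False thus ?thesis using a(1,2) by (simp add: kOut_def)
  qed
qed

lemma kOut_subspace: "fv.subspace (kOut H :: (_ \<Rightarrow> 'k) set)"
  by (auto simp: fv.subspace_def kOut_def)

lemma piB_add:
  fixes x y :: "_ \<Rightarrow> 'k"
  assumes HH: "fin_group H" and x: "x \<in> kB H H" and y: "y \<in> kB H H"
  shows "piB H (x + y) = piB H x + piB H y"
proof (rule kOut_eqI[of _ H])
  have k: "x + y \<in> kB H H" by (rule fv.subspace_add[OF kB_subspace x y])
  show "piB H (x + y) \<in> kOut H" by (rule piB(1)[OF HH k])
  show "piB H x + piB H y \<in> kOut H" by (rule fv.subspace_add[OF kOut_subspace piB(1)[OF HH x] piB(1)[OF HH y]])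
  fix s assume s: "s \<in> Autx H"
  show "piB H (x + y) (outcls H s) = (piB H x + piB H y) (outcls H s)"
    using piB(2)[OF HH x s] piB(2)[OF HH y s] piB(2)[OF HH k s] by simp
qed

lemma piB_scale:
  fixes x :: "_ \<Rightarrow> 'k"
  assumes HH: "fin_group H" and x: "x \<in> kB H H"
  shows "piB H (fscale c x) = fscale c (piB H x)"
proof (rule kOut_eqI[of _ H])
  have k: "fscale c x \<in> kB H H" by (rule fv.subspace_scale[OF kB_subspace x])
  show "piB H (fscale c x) \<in> kOut H" by (rule piB(1)[OF HH k])
  show "fscale c (piB H x) \<in> kOut H" by (rule fv.subspace_scale[OF kOut_subspace piB(1)[OF HH x]])
  fix s assume s: "s \<in> Autx H"
  show "piB H (fscale c x) (outcls H s) = (fscale c (piB H x)) (outcls H s)"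
    using piB(2)[OF HH x s] piB(2)[OF HH k s] by simp
qed

lemma piB_eq_0_iff:
  fixes x :: "_ \<Rightarrow> 'k"
  assumes HH: "fin_group H" and x: "x \<in> kB H H"
  shows "piB H x = 0 \<longleftrightarrow> x \<in> kI H H"
proof -
  have H: "group H" using HH by (simp add: fin_group_def)
  show ?thesis
  proof
    assume "piB H x = 0" thus "x \<in> kI H H" using piB(3)[OF HH x] by (simp add: zero_fun_def[symmetric])
  next
    assume i: "x \<in> kI H H"
    show "piB H x = 0"
      by (rule kOut_eqI[of _ H]) (use piB[OF HH x] i dia_Sub[OF H] dia_top[OF H] in \<open>auto simp: kOut_def kI_iff[OF HH HH]\<close>)
  qed
qed

lemma piB_isoEl:
  assumes HH: "fin_group H" and o: "ob \<in> Out H"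
  shows "piB H (isoEl H ob) = (\<lambda>p. if p = ob then 1 else (0::'k))"
proof (rule kOut_eqI[of _ H])
  have H: "group H" using HH by (simp add: fin_group_def)
  obtain t where t: "t \<in> Autx H" "ob = outcls H t" using o by (auto simp: Out_def)
  show "(piB H (isoEl H ob) :: _ \<Rightarrow> 'k) \<in> kOut H" by (rule piB(1)[OF HH isoEl_kB[OF HH o]])
  show "(\<lambda>p. if p = ob then 1 else (0::'k)) \<in> kOut H" using o by (auto simp: kOut_def)
  fix s assume s: "s \<in> Autx H"
  show "piB H (isoEl H ob) (outcls H s) = (if outcls H s = ob then 1 else (0::'k))"
    unfolding piB(2)[OF HH isoEl_kB[OF HH o] s] unfolding t(2) isoEl_bas[OF H t(1)] outcls_eq_iff[OF H t(1) s] by (simp add: bas_def)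
qed

lemma piB_sum: 
  fixes f :: "_ \<Rightarrow> _ \<Rightarrow> 'k"
  assumes HH: "fin_group H" and "\<And>i. i \<in> I \<Longrightarrow> f i \<in> kB H H"
  shows "piB H (\<Sum>i\<in>I. f i) = (\<Sum>i\<in>I. piB H (f i))"
  using assms(2)
proof (induction I rule: infinite_finite_induct)
  case (insert i I)
  have "(\<Sum>i\<in>I. f i) \<in> kB H H" using insert by (intro fv.subspace_sum[OF kB_subspace]) auto
  thus ?case using insert piB_add[OF HH, of "f i" "\<Sum>i\<in>I. f i"] by (simp del: plus_fun_apply)
next
  case (infinite I)
  show ?case unfolding sum.infinite[OF infinite(1)] piB_eq_0_iff[OF HH fv.subspace_0[OF kB_subspace]] by (rule fv.subspace_0[OF kI_subspace])
next
  case empty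
  show ?case unfolding sum.empty piB_eq_0_iff[OF HH fv.subspace_0[OF kB_subspace]] by (rule fv.subspace_0[OF kI_subspace])
qed

text \<open>The product of the group algebra of \<open>Out H\<close>.\<close>

definition conv :: "'h monoid \<Rightarrow> (('h \<Rightarrow> 'h) set \<Rightarrow> 'k) \<Rightarrow> (('h \<Rightarrow> 'h) set \<Rightarrow> 'k) \<Rightarrow> (('h \<Rightarrow> 'h) set \<Rightarrow> 'k)" where
  "conv H f g p = (\<Sum>a\<in>Out H. \<Sum>b\<in>Out H. if outmul H a b = p then f a * g b else 0)"

text \<open>Modulo \<open>kI H H\<close>, which absorbs composition on both sides, each factor
  equals its combination of \<open>isoEl\<close> classes, and these multiply like the group
  elements.\<close>

lemma piB_bcomp:
  fixes x y :: "_ \<Rightarrow> 'k"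
  assumes HH: "fin_group H" and x: "x \<in> kB H H" and y: "y \<in> kB H H"
  shows "piB H (bcomp H H H x y) = conv H (piB H x) (piB H y)"
proof -
  let ?X = "\<Sum>a\<in>Out H. fscale (piB H x a) (isoEl H a)" and ?Y = "\<Sum>a\<in>Out H. fscale (piB H y a) (isoEl H a)"
  interpret O: group "OutG H" by (rule OutG_group[OF HH])
  have i: "bcomp H H H (x - ?X) y \<in> kI H H" "bcomp H H H ?X (y - ?Y) \<in> kI H H"
    using kI_right_ideal[OF HH HH piB(3)[OF HH x]] kI_left_ideal[OF HH HH HH piB(3)[OF HH y]] by blast+
  have k: "bcomp H H H a b \<in> kB H H" for a b :: "_ \<Rightarrow> 'k" by (rule bcomp_kB[OF HH HH HH])
  have "bcomp H H H x y = bcomp H H H (x - ?X) y + (bcomp H H H ?X (y - ?Y) + bcomp H H H ?X ?Y)"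
    unfolding bcomp_diff_left bcomp_diff_right by simp
  hence "piB H (bcomp H H H x y) = piB H (bcomp H H H (x - ?X) y) + (piB H (bcomp H H H ?X (y - ?Y)) + piB H (bcomp H H H ?X ?Y))"
    using k fv.subspace_add[OF kB_subspace k k] by (simp only: piB_add[OF HH])
  also have "\<dots> = piB H (bcomp H H H ?X ?Y)"
    unfolding i[folded piB_eq_0_iff[OF HH k]] by simp
  also have "bcomp H H H ?X ?Y = (\<Sum>a\<in>Out H. \<Sum>b\<in>Out H. fscale (piB H x a) (fscale (piB H y b) (isoEl H (outmul H a b))))"
    unfolding bcomp_sum_left unfolding bcomp_sum_right unfolding bcomp_scale_left unfolding bcomp_scale_right
    by (intro sum.cong refl) (simp add: isoEl_mult[OF HH])
  also have "piB H \<dots> = (\<Sum>a\<in>Out H. \<Sum>b\<in>Out H. fscale (piB H x a) (fscale (piB H y b) (\<lambda>p. if p = outmul H a b then 1 else 0)))"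
  proof -
    have m: "outmul H a b \<in> Out H" if "a \<in> Out H" "b \<in> Out H" for a b using O.m_closed[of a b] that by simp
    have kk: "fscale c (isoEl H (outmul H a b)) \<in> kB H H" if "a \<in> Out H" "b \<in> Out H" for a b and c :: 'k
      by (intro fv.subspace_scale[OF kB_subspace] isoEl_kB[OF HH m[OF that]])
    have "piB H (\<Sum>a\<in>Out H. \<Sum>b\<in>Out H. fscale (piB H x a) (fscale (piB H y b) (isoEl H (outmul H a b))))
      = (\<Sum>a\<in>Out H. \<Sum>b\<in>Out H. piB H (fscale (piB H x a) (fscale (piB H y b) (isoEl H (outmul H a b)))))"
      using kk by (subst piB_sum[OF HH]) (auto intro!: fv.subspace_sum[OF kB_subspace] fv.subspace_scale[OF kB_subspace] isoEl_kB[OF HH m] sum.cong piB_sum[OF HH])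
    also have "\<dots> = (\<Sum>a\<in>Out H. \<Sum>b\<in>Out H. fscale (piB H x a) (fscale (piB H y b) (\<lambda>p. if p = outmul H a b then 1 else 0)))"
      by (intro sum.cong refl) (simp only: piB_scale[OF HH kk] piB_scale[OF HH isoEl_kB[OF HH m]] piB_isoEl[OF HH m])
    finally show ?thesis .
  qed
  also have "\<dots> = conv H (piB H x) (piB H y)"
    by (auto simp: fun_eq_iff sum_fun conv_def intro!: sum.cong)
  finally show ?thesis .
qed

end

subsection \<open>Deflation-restriction and its stabilizing outer automorphisms\<close>

context char0
begin

text \<open>Right composition with a full basis element maps basis elements to basis elements but
  may merge classes; the coefficient at \<open>C\<close> gathers everything that lands there. It is
  applied to graphs of automorphisms, where nothing merges, and to the subgroup of
  \<open>Defres\<close>, where the merging is what has to be understood.\<close>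

lemma bcomp_bas_right:
  fixes a :: "_ \<Rightarrow> 'k" and X :: "'x monoid" and Y :: "'y monoid" and Z :: "'z monoid"
  assumes X: "fin_group X" and Y: "fin_group Y" and Z: "fin_group Z" and a: "a \<in> kB X Y"
    and M: "M \<in> Sub (Y \<times>\<times> Z)" and full: "fst ` M = carrier Y"
  shows "bcomp X Y Z a (bas (Y \<times>\<times> Z) M) C =
     (\<Sum>C1\<in>conj_classes (X \<times>\<times> Y). if C = cls (X \<times>\<times> Z) ((SOME L. L \<in> C1) O M) then a C1 else 0)"
proof -
  have G: "group (X \<times>\<times> Y)" using X Y by (simp add: fin_group_def DirProd_group)
  have "bcomp X Y Z a (bas (Y \<times>\<times> Z) M) = (\<Sum>C1\<in>conj_classes (X \<times>\<times> Y). fscale (a C1) (bas (X \<times>\<times> Z) ((SOME L. L \<in> C1) O M)))"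
    by (subst kB_expand[OF X Y a], unfold bcomp_sum_left bcomp_scale_left, intro sum.cong refl)
      (simp add: bcomp_bas[OF X Y Z some_conj_class(1)[OF G] M full])
  thus ?thesis by (auto simp: sum_fun bas_def intro!: sum.cong)
qed

text \<open>Right composition with the graph of the inverse automorphism recovers the class of
  \<open>L\<close>.\<close>

lemma relcomp_dia_cancel:
  fixes X :: "'x monoid" and H :: "'h monoid"
  assumes X: "fin_group X" and H: "fin_group H" and L: "L \<in> Sub (X \<times>\<times> H)" "L' \<in> Sub (X \<times>\<times> H)" and s: "\<sigma> \<in> Autx H"
    and e: "cls (X \<times>\<times> H) (L O dia H \<sigma>) = cls (X \<times>\<times> H) (L' O dia H \<sigma>)"
  shows "cls (X \<times>\<times> H) L = cls (X \<times>\<times> H) L'"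
proof -
  have g: "group X" "group H" using X H by (auto simp: fin_group_def)
  obtain t where t: "t \<in> Autx H" "\<And>x. x \<in> carrier H \<Longrightarrow> \<sigma> (t x) = x" using inv_Autx[OF g(2) s] by metis
  have c: "R O dia H \<sigma> O dia H t = R" if R: "R \<in> Sub (X \<times>\<times> H)" for R
  proof -
    have "dia H \<sigma> O dia H t = Id_on (carrier H)"
      unfolding compose_Autx(2)[OF g(2) s t(1)] using t by (auto simp: dia_def compose_def)
    moreover have "R O Id_on (carrier H) = R" using mem_Sub_DirProd(2)[OF g R] by auto
    ultimately show ?thesis by simp
  qed
  have b: "(bas (X \<times>\<times> H) R :: _ \<Rightarrow> 'k) = bcomp X H H (bas (X \<times>\<times> H) (R O dia H \<sigma>)) (bas (H \<times>\<times> H) (dia H t))"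
    if R: "R \<in> Sub (X \<times>\<times> H)" for R
    unfolding bcomp_bas[OF X H H relcomp_Sub[OF g(1,2,2) R dia_Sub[OF g(2) s]] dia_Sub[OF g(2) t(1)] dia_fst[OF g(2) t(1)]] O_assoc c[OF R] ..
  have "(bas (X \<times>\<times> H) (L O dia H \<sigma>) :: _ \<Rightarrow> 'k) = bas (X \<times>\<times> H) (L' O dia H \<sigma>)" using e by (simp add: bas_eq_iff)
  hence "(bas (X \<times>\<times> H) L :: _ \<Rightarrow> 'k) = bas (X \<times>\<times> H) L'" using b[OF L(1)] b[OF L(2)] by simp
  thus ?thesis by (simp add: bas_eq_iff)
qed

end

section \<open>The section, its cosets and the automorphisms induced by its normalizer\<close>

locale sect = char0 k for k :: "'k::field itself" +
  fixes G :: "'g monoid" and P Q :: "'g set"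
  assumes fG: "fin_group G" and subP: "subgroup P G" and Qn: "Q \<lhd> (G\<lparr>carrier := P\<rparr>)"
begin

abbreviation "H \<equiv> secq G P Q"
abbreviation "\<Gamma> \<equiv> GammaGPQ G P Q"

sublocale G: group G using fG by (simp add: fin_group_def)

lemma fH: "fin_group H"
  by (rule subquots_group[OF fG]) (use subP Qn in \<open>auto simp: subquots_def secq_def\<close>)

sublocale H: group H using fH by (simp add: fin_group_def)
sublocale O: group "OutG H" by (rule OutG_group[OF fH])

lemma Pc: "P \<subseteq> carrier G" by (rule subgroup.subset[OF subP])
lemma Pm: "p \<in> P \<Longrightarrow> p \<in> carrier G" using Pc by auto
lemma Psub: "\<one>\<^bsub>G\<^esub> \<in> P" "a \<in> P \<Longrightarrow> b \<in> P \<Longrightarrow> a \<otimes>\<^bsub>G\<^esub> b \<in> P" "a \<in> P \<Longrightarrow> inv\<^bsub>G\<^esub> a \<in> P"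
  using subP by (auto simp: subgroup.one_closed subgroup.m_closed subgroup.m_inv_closed)

lemma Q_sub_P: "Q \<subseteq> P"
  using subgroup.subset[OF normal.axioms(1)[OF Qn]] by simp

lemma subQ: "subgroup Q G"
  using G.incl_subgroup[OF subP normal.axioms(1)[OF Qn]] .

lemma Qm: "q \<in> Q \<Longrightarrow> q \<in> carrier G" using Q_sub_P Pm by auto

lemma Q_normal: "p \<in> P \<Longrightarrow> q \<in> Q \<Longrightarrow> p \<otimes>\<^bsub>G\<^esub> q \<otimes>\<^bsub>G\<^esub> inv\<^bsub>G\<^esub> p \<in> Q"
  using normal.inv_op_closed2[OF Qn, of p q] G.m_inv_consistent[OF subP, of p] by simp

text \<open>Cosets are formed in \<open>G\<close> rather than in \<open>P\<close>: for elements of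
  \<open>P\<close> they are the elements of \<open>H\<close>, and for all of \<open>G\<close> they
  are the points of the biset \<open>Defres\<close>.\<close>

abbreviation cq where "cq p \<equiv> Q #>\<^bsub>G\<^esub> p"

lemma carrier_H: "carrier H = cq ` P"
  by (auto simp: secq_def FactGroup_def RCOSETS_def r_coset_def)

lemma one_H: "\<one>\<^bsub>H\<^esub> = Q" by (simp add: secq_def FactGroup_def)

lemma cq_one: "cq \<one>\<^bsub>G\<^esub> = Q" using subgroup.subset[OF subQ] by simp

lemma cq_eq_iff: "a \<in> carrier G \<Longrightarrow> b \<in> carrier G \<Longrightarrow> cq a = cq b \<longleftrightarrow> a \<otimes>\<^bsub>G\<^esub> inv\<^bsub>G\<^esub> b \<in> Q"
proof
  assume ab: "a \<in> carrier G" "b \<in> carrier G"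
  { assume "cq a = cq b"
    hence "a \<in> cq b" using G.rcos_self[OF ab(1) subQ] by simp
    then obtain q where "q \<in> Q" "a = q \<otimes>\<^bsub>G\<^esub> b" by (auto simp: r_coset_def)
    thus "a \<otimes>\<^bsub>G\<^esub> inv\<^bsub>G\<^esub> b \<in> Q" using ab Qm by (simp add: G.m_assoc) }
  { assume q: "a \<otimes>\<^bsub>G\<^esub> inv\<^bsub>G\<^esub> b \<in> Q"
    hence "a \<in> cq b" unfolding r_coset_def using ab
      by (auto intro!: bexI[OF _ q] simp: G.m_assoc)
    thus "cq a = cq b" using G.repr_independence[OF _ ab(2) subQ] by blast }
qed

text \<open>Normality of \<open>Q\<close> in \<open>P\<close> moves elements of \<open>Q\<close>
  past \<open>a\<close>. With \<open>b\<close> anywhere in \<open>G\<close> this is the left action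
  of \<open>H\<close> on the right cosets of \<open>Q\<close> in \<open>G\<close>.\<close>

lemma cq_mult_set: "a \<in> P \<Longrightarrow> b \<in> carrier G \<Longrightarrow> cq a <#>\<^bsub>G\<^esub> cq b = cq (a \<otimes>\<^bsub>G\<^esub> b)"
proof
  assume ab: "a \<in> P" "b \<in> carrier G"
  note a' = Pm[OF ab(1)]
  show "cq a <#>\<^bsub>G\<^esub> cq b \<subseteq> cq (a \<otimes>\<^bsub>G\<^esub> b)"
  proof
    fix x assume "x \<in> cq a <#>\<^bsub>G\<^esub> cq b"
    then obtain q r where qr: "q \<in> Q" "r \<in> Q" "x = q \<otimes>\<^bsub>G\<^esub> a \<otimes>\<^bsub>G\<^esub> (r \<otimes>\<^bsub>G\<^esub> b)" by (auto simp: r_coset_def set_mult_def)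
    have q': "q \<otimes>\<^bsub>G\<^esub> (a \<otimes>\<^bsub>G\<^esub> r \<otimes>\<^bsub>G\<^esub> inv\<^bsub>G\<^esub> a) \<in> Q" using Q_normal[OF ab(1) qr(2)] qr(1) subgroup.m_closed[OF subQ] by blast
    have "q \<otimes>\<^bsub>G\<^esub> (a \<otimes>\<^bsub>G\<^esub> r \<otimes>\<^bsub>G\<^esub> inv\<^bsub>G\<^esub> a) \<otimes>\<^bsub>G\<^esub> (a \<otimes>\<^bsub>G\<^esub> b) = q \<otimes>\<^bsub>G\<^esub> a \<otimes>\<^bsub>G\<^esub> r \<otimes>\<^bsub>G\<^esub> (inv\<^bsub>G\<^esub> a \<otimes>\<^bsub>G\<^esub> a) \<otimes>\<^bsub>G\<^esub> b"
      using qr(1,2)[THEN Qm] a' ab by (simp only: G.m_assoc G.m_closed G.inv_closed)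
    also have "\<dots> = x" using qr(1,2)[THEN Qm] a' ab qr(3) by (simp add: G.m_assoc)
    finally show "x \<in> cq (a \<otimes>\<^bsub>G\<^esub> b)" unfolding r_coset_def using q' by blast
  qed
  show "cq (a \<otimes>\<^bsub>G\<^esub> b) \<subseteq> cq a <#>\<^bsub>G\<^esub> cq b"
  proof
    fix x assume "x \<in> cq (a \<otimes>\<^bsub>G\<^esub> b)"
    then obtain q where q: "q \<in> Q" "x = q \<otimes>\<^bsub>G\<^esub> (a \<otimes>\<^bsub>G\<^esub> b)" by (auto simp: r_coset_def)
    hence "x = (q \<otimes>\<^bsub>G\<^esub> a) \<otimes>\<^bsub>G\<^esub> (\<one>\<^bsub>G\<^esub> \<otimes>\<^bsub>G\<^esub> b)" using a' ab Qm by (simp add: G.m_assoc)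
    thus "x \<in> cq a <#>\<^bsub>G\<^esub> cq b" unfolding r_coset_def set_mult_def using q(1) subgroup.one_closed[OF subQ] by blast
  qed
qed

lemma mult_H: "a \<in> P \<Longrightarrow> b \<in> P \<Longrightarrow> cq a \<otimes>\<^bsub>H\<^esub> cq b = cq (a \<otimes>\<^bsub>G\<^esub> b)"
proof -
  assume ab: "a \<in> P" "b \<in> P"
  have "cq a \<otimes>\<^bsub>H\<^esub> cq b = cq a <#>\<^bsub>G\<^esub> cq b" by (simp add: secq_def FactGroup_def set_mult_def)
  thus ?thesis using cq_mult_set[OF ab(1) Pm[OF ab(2)]] by simp
qed

lemma inv_H: "a \<in> P \<Longrightarrow> inv\<^bsub>H\<^esub> (cq a) = cq (inv\<^bsub>G\<^esub> a)"
  by (rule H.inv_equality) (use carrier_H Psub mult_H[of "inv\<^bsub>G\<^esub> a" a] Pm one_H cq_one in auto)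

text \<open>The projection \<open>P \<rightarrow> P/Q\<close> as a relation, which is the stabilizer
  of the point \<open>Q\<close> in the biset \<open>Defres\<close>.\<close>

definition defres_sub where "defres_sub = (\<lambda>p. (cq p, p)) ` P"

lemma defres_sub_Sub: "defres_sub \<in> Sub (H \<times>\<times> G)"
proof (rule Sub_DirProdI[OF H.is_group G.is_group])
  show "defres_sub \<subseteq> carrier H \<times> carrier G" using Pm by (auto simp: defres_sub_def carrier_H)
  show "(\<one>\<^bsub>H\<^esub>, \<one>\<^bsub>G\<^esub>) \<in> defres_sub" unfolding defres_sub_def one_H by (rule rev_image_eqI[OF Psub(1)]) (simp only: cq_one)
qed (use Psub mult_H inv_H in \<open>auto simp: defres_sub_def\<close>)

lemma defres_sub_fst: "fst ` defres_sub = carrier H"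
  by (simp add: defres_sub_def carrier_H image_image)

text \<open>The biset is transitive, and \<open>(Q p, y)\<close> fixes the coset \<open>Q\<close>
  exactly when \<open>Q p = Q y\<close>; this forces \<open>y \<in> P\<close>, since
  \<open>Q\<close> is contained in \<open>P\<close>.\<close>

lemma Defres_bas: "(Defres G P Q :: _ \<Rightarrow> 'k) = bas (H \<times>\<times> G) defres_sub"
proof -
  let ?act = "\<lambda>g S. (fst g <#>\<^bsub>G\<^esub> S) #>\<^bsub>G\<^esub> inv\<^bsub>G\<^esub> (snd g)"
  have U: "rcosets\<^bsub>G\<^esub> Q = cq ` carrier G" by (auto simp: RCOSETS_def)
  have a: "?act (cq p, g) (cq x) = cq (p \<otimes>\<^bsub>G\<^esub> x \<otimes>\<^bsub>G\<^esub> inv\<^bsub>G\<^esub> g)" if "p \<in> P" "g \<in> carrier G" "x \<in> carrier G" for p g x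
    using that Pm subgroup.subset[OF subQ] by (simp add: cq_mult_set G.coset_mult_assoc)
  have act: "acts_on (H \<times>\<times> G) ?act (rcosets\<^bsub>G\<^esub> Q)"
    unfolding acts_on_def U
  proof (intro conjI ballI)
    fix g s assume "g \<in> carrier (H \<times>\<times> G)" "s \<in> cq ` carrier G"
    then obtain p y x where *: "g = (cq p, y)" "p \<in> P" "y \<in> carrier G" "s = cq x" "x \<in> carrier G" by (auto simp: carrier_H)
    show "?act g s \<in> cq ` carrier G" unfolding *(1,4) a[OF *(2,3,5)] using * Pm by blast
  next
    fix s assume "s \<in> cq ` carrier G"
    then obtain x where x: "s = cq x" "x \<in> carrier G" by auto
    have "\<one>\<^bsub>H \<times>\<times> G\<^esub> = (cq \<one>\<^bsub>G\<^esub>, \<one>\<^bsub>G\<^esub>)" by (simp only: one_DirProd one_H cq_one)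
    thus "?act \<one>\<^bsub>H \<times>\<times> G\<^esub> s = s" using a[OF Psub(1) G.one_closed x(2)] x by (simp del: one_DirProd)
  next
    fix g h s assume "g \<in> carrier (H \<times>\<times> G)" "h \<in> carrier (H \<times>\<times> G)" "s \<in> cq ` carrier G"
    then obtain p y p' y' x where *: "g = (cq p, y)" "p \<in> P" "y \<in> carrier G" "h = (cq p', y')" "p' \<in> P" "y' \<in> carrier G"
      "s = cq x" "x \<in> carrier G" by (auto simp: carrier_H)
    have c: "p' \<otimes>\<^bsub>G\<^esub> x \<otimes>\<^bsub>G\<^esub> inv\<^bsub>G\<^esub> y' \<in> carrier G" using * Pm by simp
    show "?act (g \<otimes>\<^bsub>H \<times>\<times> G\<^esub> h) s = ?act g (?act h s)"
      unfolding *(1,4,7) mult_DirProd mult_H[OF *(2,5)] a[OF *(5,6,8)] a[OF *(2,3) c]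
        a[OF Psub(2)[OF *(2,5)] G.m_closed[OF *(3,6)] *(8)]
      using * Pm by (simp add: G.m_assoc G.inv_mult_group)
  qed
  have st: "stab (H \<times>\<times> G) ?act Q = defres_sub"
  proof -
    have "(cq p, y) \<in> stab (H \<times>\<times> G) ?act Q \<longleftrightarrow> (cq p, y) \<in> defres_sub" if p: "p \<in> P" and y: "y \<in> carrier G" for p y
    proof -
      have "(cq p, y) \<in> stab (H \<times>\<times> G) ?act Q \<longleftrightarrow> cq (p \<otimes>\<^bsub>G\<^esub> inv\<^bsub>G\<^esub> y) = Q"
        using a[OF p y G.one_closed] p y Pm by (auto simp: stab_def carrier_H cq_one)
      also have "\<dots> \<longleftrightarrow> cq p = cq y"
        using cq_eq_iff[of "p \<otimes>\<^bsub>G\<^esub> inv\<^bsub>G\<^esub> y" "\<one>\<^bsub>G\<^esub>"] cq_eq_iff[of p y] p y Pm cq_one by simp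
      also have "\<dots> \<longleftrightarrow> cq p = cq y \<and> y \<in> P"
      proof -
        have "y \<in> P" if "cq p = cq y"
        proof -
          have "y \<in> cq p" using G.rcos_self[OF y subQ] that by simp
          thus ?thesis using p Psub(2) Q_sub_P by (auto simp: r_coset_def)
        qed
        thus ?thesis by blast
      qed
      also have "\<dots> \<longleftrightarrow> (cq p, y) \<in> defres_sub" by (auto simp: defres_sub_def)
      finally show ?thesis .
    qed
    moreover have "stab (H \<times>\<times> G) ?act Q \<subseteq> cq ` P \<times> carrier G" by (auto simp: stab_def carrier_H)
    moreover have "defres_sub \<subseteq> cq ` P \<times> carrier G" using Pm by (auto simp: defres_sub_def)
    ultimately show ?thesis by blast
  qed
  have QU: "Q \<in> rcosets\<^bsub>G\<^esub> Q" unfolding U using cq_one by (metis G.one_closed rev_image_eqI)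
  have "rcosets\<^bsub>G\<^esub> Q \<subseteq> orb (H \<times>\<times> G) ?act Q"
  proof
    fix s assume "s \<in> rcosets\<^bsub>G\<^esub> Q"
    then obtain x where x: "s = cq x" "x \<in> carrier G" unfolding U by auto
    have "s = ?act (cq \<one>\<^bsub>G\<^esub>, inv\<^bsub>G\<^esub> x) Q" using a[OF Psub(1) G.inv_closed[OF x(2)] G.one_closed] x by (simp add: cq_one)
    moreover have "(cq \<one>\<^bsub>G\<^esub>, inv\<^bsub>G\<^esub> x) \<in> carrier (H \<times>\<times> G)" using x Psub(1) unfolding carrier_DirProd carrier_H by blast
    ultimately show "s \<in> orb (H \<times>\<times> G) ?act Q" unfolding orb_def by blast
  qed
  thus ?thesis unfolding Defres_def using biset_class_transitive[OF DirProd_group[OF H.is_group G.is_group] act QU] st by simp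
qed

definition conj_aut where "conj_aut n = restrict (\<lambda>S. (n <#\<^bsub>G\<^esub> S) #>\<^bsub>G\<^esub> inv\<^bsub>G\<^esub> n) (carrier H)"

lemma NG_conj: "n \<in> NGPQ G P Q \<Longrightarrow> p \<in> P \<Longrightarrow> n \<otimes>\<^bsub>G\<^esub> p \<otimes>\<^bsub>G\<^esub> inv\<^bsub>G\<^esub> n \<in> P"
  "n \<in> NGPQ G P Q \<Longrightarrow> q \<in> Q \<Longrightarrow> n \<otimes>\<^bsub>G\<^esub> q \<otimes>\<^bsub>G\<^esub> inv\<^bsub>G\<^esub> n \<in> Q"
  by (auto simp: NGPQ_def conjg_def)

lemma NG_subgroup: "subgroup (NGPQ G P Q) G"
proof -
  have "NGPQ G P Q = stab G (conjg G) P \<inter> stab G (conjg G) Q" by (auto simp: NGPQ_def stab_def)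
  moreover have "subgroup (stab G (conjg G) P) G" "subgroup (stab G (conjg G) Q) G"
    using stab_subgroup[OF G.is_group conjg_Pow[OF G.is_group]] Pc Qm by blast+
  ultimately show ?thesis using G.subgroups_Inter_pair by simp
qed

lemma conj_aut_coset: "n \<in> NGPQ G P Q \<Longrightarrow> p \<in> P \<Longrightarrow> conj_aut n (cq p) = cq (n \<otimes>\<^bsub>G\<^esub> p \<otimes>\<^bsub>G\<^esub> inv\<^bsub>G\<^esub> n)"
proof -
  assume n: "n \<in> NGPQ G P Q" and p: "p \<in> P"
  have nc: "n \<in> carrier G" using n by (simp add: NGPQ_def)
  note pc = Pm[OF p]
  have Qe: "Q = (\<lambda>q. n \<otimes>\<^bsub>G\<^esub> q \<otimes>\<^bsub>G\<^esub> inv\<^bsub>G\<^esub> n) ` Q" using n by (simp add: NGPQ_def conjg_def)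
  have e: "n \<otimes>\<^bsub>G\<^esub> (q \<otimes>\<^bsub>G\<^esub> p) \<otimes>\<^bsub>G\<^esub> inv\<^bsub>G\<^esub> n = n \<otimes>\<^bsub>G\<^esub> q \<otimes>\<^bsub>G\<^esub> inv\<^bsub>G\<^esub> n \<otimes>\<^bsub>G\<^esub> (n \<otimes>\<^bsub>G\<^esub> p \<otimes>\<^bsub>G\<^esub> inv\<^bsub>G\<^esub> n)" if q: "q \<in> Q" for q
  proof -
    have "n \<otimes>\<^bsub>G\<^esub> q \<otimes>\<^bsub>G\<^esub> inv\<^bsub>G\<^esub> n \<otimes>\<^bsub>G\<^esub> (n \<otimes>\<^bsub>G\<^esub> p \<otimes>\<^bsub>G\<^esub> inv\<^bsub>G\<^esub> n) = n \<otimes>\<^bsub>G\<^esub> q \<otimes>\<^bsub>G\<^esub> (inv\<^bsub>G\<^esub> n \<otimes>\<^bsub>G\<^esub> n) \<otimes>\<^bsub>G\<^esub> p \<otimes>\<^bsub>G\<^esub> inv\<^bsub>G\<^esub> n"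
      using nc pc Qm[OF q] by (simp only: G.m_assoc G.m_closed G.inv_closed)
    thus ?thesis using nc pc Qm[OF q] by (simp add: G.m_assoc)
  qed
  have "conj_aut n (cq p) = (\<lambda>q. n \<otimes>\<^bsub>G\<^esub> (q \<otimes>\<^bsub>G\<^esub> p) \<otimes>\<^bsub>G\<^esub> inv\<^bsub>G\<^esub> n) ` Q"
    using p unfolding conj_aut_def carrier_H by (auto simp: r_coset_def l_coset_def)
  also have "\<dots> = (\<lambda>q. n \<otimes>\<^bsub>G\<^esub> q \<otimes>\<^bsub>G\<^esub> inv\<^bsub>G\<^esub> n \<otimes>\<^bsub>G\<^esub> (n \<otimes>\<^bsub>G\<^esub> p \<otimes>\<^bsub>G\<^esub> inv\<^bsub>G\<^esub> n)) ` Q" by (intro image_cong refl e)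
  also have "\<dots> = (\<lambda>q. q \<otimes>\<^bsub>G\<^esub> (n \<otimes>\<^bsub>G\<^esub> p \<otimes>\<^bsub>G\<^esub> inv\<^bsub>G\<^esub> n)) ` ((\<lambda>q. n \<otimes>\<^bsub>G\<^esub> q \<otimes>\<^bsub>G\<^esub> inv\<^bsub>G\<^esub> n) ` Q)" by (simp only: image_image)
  also have "\<dots> = cq (n \<otimes>\<^bsub>G\<^esub> p \<otimes>\<^bsub>G\<^esub> inv\<^bsub>G\<^esub> n)" unfolding Qe[symmetric] by (auto simp: r_coset_def)
  finally show ?thesis .
qed

lemma conj_aut_compose:
  assumes n: "n \<in> NGPQ G P Q" and m: "m \<in> NGPQ G P Q"
  shows "compose (carrier H) (conj_aut n) (conj_aut m) = conj_aut (n \<otimes>\<^bsub>G\<^esub> m)"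
proof
  have c: "n \<in> carrier G" "m \<in> carrier G" using n m by (auto simp: NGPQ_def)
  fix S show "compose (carrier H) (conj_aut n) (conj_aut m) S = conj_aut (n \<otimes>\<^bsub>G\<^esub> m) S"
  proof (cases "S \<in> carrier H")
    case True
    then obtain p where p: "p \<in> P" "S = cq p" by (auto simp: carrier_H)
    have "compose (carrier H) (conj_aut n) (conj_aut m) S = conj_aut n (conj_aut m S)" using True by (simp add: compose_def)
    also have "\<dots> = conj_aut (n \<otimes>\<^bsub>G\<^esub> m) S" unfolding p(2) conj_aut_coset[OF m p(1)] conj_aut_coset[OF n NG_conj(1)[OF m p(1)]]
        conj_aut_coset[OF subgroup.m_closed[OF NG_subgroup n m] p(1)] using c Pm[OF p(1)] by (simp add: G.m_assoc G.inv_mult_group)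
    finally show ?thesis .
  qed (simp add: compose_def conj_aut_def)
qed

lemma conj_aut_one: "conj_aut \<one>\<^bsub>G\<^esub> = restrict (\<lambda>x. x) (carrier H)"
proof
  fix S show "conj_aut \<one>\<^bsub>G\<^esub> S = restrict (\<lambda>x. x) (carrier H) S"
  proof (cases "S \<in> carrier H")
    case True
    then obtain p where p: "p \<in> P" "S = cq p" by (auto simp: carrier_H)
    thus ?thesis using conj_aut_coset[OF subgroup.one_closed[OF NG_subgroup] p(1)] Pm[OF p(1)] True by simp
  qed (simp add: conj_aut_def)
qed

lemma conj_aut_Autx:
  assumes n: "n \<in> NGPQ G P Q"
  shows "conj_aut n \<in> Autx H"
proof -
  note i = subgroup.m_inv_closed[OF NG_subgroup n]
  have c: "n \<in> carrier G" using n by (auto simp: NGPQ_def)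
  have car: "conj_aut m x \<in> carrier H" if "m \<in> NGPQ G P Q" "x \<in> carrier H" for m x
    using that conj_aut_coset[of m] NG_conj(1)[of m] by (auto simp: carrier_H)
  have ii: "conj_aut (inv\<^bsub>G\<^esub> n) (conj_aut n x) = x" "conj_aut n (conj_aut (inv\<^bsub>G\<^esub> n) x) = x" if "x \<in> carrier H" for x
    using fun_cong[OF conj_aut_compose[OF i n], of x] fun_cong[OF conj_aut_compose[OF n i], of x] that c conj_aut_one by (auto simp: compose_def)
  have "restrict (conj_aut n) (carrier H) \<in> Autx H"
  proof (rule AutxI[OF H.is_group car[OF n]])
    fix x y assume "x \<in> carrier H" "y \<in> carrier H"
    then obtain p r where p: "p \<in> P" "x = cq p" "r \<in> P" "y = cq r" by (auto simp: carrier_H)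
    have "n \<otimes>\<^bsub>G\<^esub> p \<otimes>\<^bsub>G\<^esub> inv\<^bsub>G\<^esub> n \<otimes>\<^bsub>G\<^esub> (n \<otimes>\<^bsub>G\<^esub> r \<otimes>\<^bsub>G\<^esub> inv\<^bsub>G\<^esub> n) = n \<otimes>\<^bsub>G\<^esub> p \<otimes>\<^bsub>G\<^esub> (inv\<^bsub>G\<^esub> n \<otimes>\<^bsub>G\<^esub> n) \<otimes>\<^bsub>G\<^esub> r \<otimes>\<^bsub>G\<^esub> inv\<^bsub>G\<^esub> n"
      using c p(1,3)[THEN Pm] by (simp only: G.m_assoc G.m_closed G.inv_closed)
    thus "conj_aut n (x \<otimes>\<^bsub>H\<^esub> y) = conj_aut n x \<otimes>\<^bsub>H\<^esub> conj_aut n y"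
      unfolding p(2,4) mult_H[OF p(1,3)] conj_aut_coset[OF n p(1)] conj_aut_coset[OF n p(3)] mult_H[OF NG_conj(1)[OF n p(1)] NG_conj(1)[OF n p(3)]]
        conj_aut_coset[OF n Psub(2)[OF p(1,3)]] using c p(1,3)[THEN Pm] by (simp add: G.m_assoc)
  next
    show "inj_on (conj_aut n) (carrier H)" using ii by (metis inj_onI)
    show "\<exists>x\<in>carrier H. y = conj_aut n x" if "y \<in> carrier H" for y using ii(2)[OF that] car[OF i that] by metis
  qed simp
  moreover have "restrict (conj_aut n) (carrier H) = conj_aut n" by (simp add: conj_aut_def)
  ultimately show ?thesis by simp
qed

lemma Gamma_eq: "\<Gamma> = (\<lambda>n. outcls H (conj_aut n)) ` NGPQ G P Q"
  by (simp add: GammaGPQ_def conj_aut_def)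

lemma Gamma_subgroup: "subgroup \<Gamma> (OutG H)"
proof (rule O.subgroupI)
  show "\<Gamma> \<subseteq> carrier (OutG H)" using conj_aut_Autx by (auto simp: Gamma_eq Out_def)
  show "\<Gamma> \<noteq> {}" using subgroup.one_closed[OF NG_subgroup] by (auto simp: Gamma_eq)
  have m: "outmul H (outcls H (conj_aut a)) (outcls H (conj_aut b)) = outcls H (conj_aut (a \<otimes>\<^bsub>G\<^esub> b))" if "a \<in> NGPQ G P Q" "b \<in> NGPQ G P Q" for a b
    using outmul_outcls[OF fH conj_aut_Autx[OF that(1)] conj_aut_Autx[OF that(2)]] conj_aut_compose[OF that] by simp
  show "a \<otimes>\<^bsub>OutG H\<^esub> b \<in> \<Gamma>" if "a \<in> \<Gamma>" "b \<in> \<Gamma>" for a b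
    using that m subgroup.m_closed[OF NG_subgroup] by (auto simp: Gamma_eq)
  show "inv\<^bsub>OutG H\<^esub> a \<in> \<Gamma>" if a: "a \<in> \<Gamma>" for a
  proof -
    obtain n where n: "n \<in> NGPQ G P Q" "a = outcls H (conj_aut n)" using a by (auto simp: Gamma_eq)
    note i = subgroup.m_inv_closed[OF NG_subgroup n(1)]
    have "n \<in> carrier G" using n(1) by (simp add: NGPQ_def)
    hence "outmul H (outcls H (conj_aut (inv\<^bsub>G\<^esub> n))) a = outid H" using m[OF i n(1)] n(2) conj_aut_one by (simp add: outid_def)
    hence "inv\<^bsub>OutG H\<^esub> a = outcls H (conj_aut (inv\<^bsub>G\<^esub> n))"
      using O.inv_equality[of "outcls H (conj_aut (inv\<^bsub>G\<^esub> n))" a] conj_aut_Autx[OF i] conj_aut_Autx[OF n(1)] n(2) by (auto simp: Out_def)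
    thus ?thesis using i by (auto simp: Gamma_eq)
  qed
qed

lemma Gamma_Out: "\<gamma> \<in> \<Gamma> \<Longrightarrow> \<gamma> \<in> Out H"
  using subgroup.subset[OF Gamma_subgroup] by auto

lemma finite_Gamma: "finite \<Gamma>"
  using finite_subset[OF subgroup.subset[OF Gamma_subgroup]] finite_Out[OF fH] by simp

lemma Gamma_nz: "(of_nat (card \<Gamma>) :: 'k) \<noteq> 0"
  using subgroup.one_closed[OF Gamma_subgroup] finite_Gamma by (auto simp: of_nat_0_iff)

text \<open>The projection of \<open>P\<close> followed by conjugation by \<open>n\<close> on
  \<open>H\<close> is, as a relation, the projection conjugated by \<open>(1, n^-1)\<close>, because
  \<open>n\<close> normalizes both \<open>P\<close> and \<open>Q\<close>. Up to conjugacy in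
  \<open>H \<times> G\<close> nothing has changed.\<close>

lemma isoEl_Defres:
  assumes "\<gamma> \<in> \<Gamma>"
  shows "bcomp H H G (isoEl H \<gamma>) (Defres G P Q) = (Defres G P Q :: _ \<Rightarrow> 'k)"
proof -
  obtain n where n: "n \<in> NGPQ G P Q" "\<gamma> = outcls H (conj_aut n)" using assms by (auto simp: Gamma_eq)
  have c: "n \<in> carrier G" using n(1) by (simp add: NGPQ_def)
  note i = subgroup.m_inv_closed[OF NG_subgroup n(1)]
  have gc: "defres_sub \<subseteq> carrier H \<times> carrier G" using Pm by (auto simp: defres_sub_def carrier_H)
  have "dia H (conj_aut n) O defres_sub = (\<lambda>p. (cq (n \<otimes>\<^bsub>G\<^esub> p \<otimes>\<^bsub>G\<^esub> inv\<^bsub>G\<^esub> n), p)) ` P"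
    using conj_aut_coset[OF n(1)] by (force simp: dia_def defres_sub_def carrier_H)
  also have "\<dots> = conjg (H \<times>\<times> G) (\<one>\<^bsub>H\<^esub>, inv\<^bsub>G\<^esub> n) defres_sub"
  proof -
    have e: "n \<otimes>\<^bsub>G\<^esub> (inv\<^bsub>G\<^esub> n \<otimes>\<^bsub>G\<^esub> p \<otimes>\<^bsub>G\<^esub> n) \<otimes>\<^bsub>G\<^esub> inv\<^bsub>G\<^esub> n = p" if "p \<in> carrier G" for p
    proof -
      have "n \<otimes>\<^bsub>G\<^esub> (inv\<^bsub>G\<^esub> n \<otimes>\<^bsub>G\<^esub> p \<otimes>\<^bsub>G\<^esub> n) \<otimes>\<^bsub>G\<^esub> inv\<^bsub>G\<^esub> n = (n \<otimes>\<^bsub>G\<^esub> inv\<^bsub>G\<^esub> n) \<otimes>\<^bsub>G\<^esub> p \<otimes>\<^bsub>G\<^esub> (n \<otimes>\<^bsub>G\<^esub> inv\<^bsub>G\<^esub> n)"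
        using that c by (simp only: G.m_assoc G.m_closed G.inv_closed)
      thus ?thesis using that c by simp
    qed
    have e': "inv\<^bsub>G\<^esub> n \<otimes>\<^bsub>G\<^esub> (n \<otimes>\<^bsub>G\<^esub> p \<otimes>\<^bsub>G\<^esub> inv\<^bsub>G\<^esub> n) \<otimes>\<^bsub>G\<^esub> n = p" if "p \<in> carrier G" for p
    proof -
      have "inv\<^bsub>G\<^esub> n \<otimes>\<^bsub>G\<^esub> (n \<otimes>\<^bsub>G\<^esub> p \<otimes>\<^bsub>G\<^esub> inv\<^bsub>G\<^esub> n) \<otimes>\<^bsub>G\<^esub> n = (inv\<^bsub>G\<^esub> n \<otimes>\<^bsub>G\<^esub> n) \<otimes>\<^bsub>G\<^esub> p \<otimes>\<^bsub>G\<^esub> (inv\<^bsub>G\<^esub> n \<otimes>\<^bsub>G\<^esub> n)"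
        using that c by (simp only: G.m_assoc G.m_closed G.inv_closed)
      thus ?thesis using that c by simp
    qed
    have "conjg (H \<times>\<times> G) (\<one>\<^bsub>H\<^esub>, inv\<^bsub>G\<^esub> n) defres_sub = (\<lambda>p. (cq p, inv\<^bsub>G\<^esub> n \<otimes>\<^bsub>G\<^esub> p \<otimes>\<^bsub>G\<^esub> n)) ` P"
      unfolding mem_conjg_DirProd[OF H.is_group G.is_group gc H.one_closed G.inv_closed[OF c]] unfolding defres_sub_def image_image
      by (intro image_cong refl) (use c carrier_H in auto)
    also have "\<dots> = (\<lambda>p. (cq (n \<otimes>\<^bsub>G\<^esub> p \<otimes>\<^bsub>G\<^esub> inv\<^bsub>G\<^esub> n), p)) ` P"
    proof safe
      fix p assume p: "p \<in> P"
      show "(cq p, inv\<^bsub>G\<^esub> n \<otimes>\<^bsub>G\<^esub> p \<otimes>\<^bsub>G\<^esub> n) \<in> (\<lambda>p. (cq (n \<otimes>\<^bsub>G\<^esub> p \<otimes>\<^bsub>G\<^esub> inv\<^bsub>G\<^esub> n), p)) ` P"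
        by (rule rev_image_eqI[of "inv\<^bsub>G\<^esub> n \<otimes>\<^bsub>G\<^esub> p \<otimes>\<^bsub>G\<^esub> n"]) (use NG_conj(1)[OF i p] c e[OF Pm[OF p]] in auto)
      show "(cq (n \<otimes>\<^bsub>G\<^esub> p \<otimes>\<^bsub>G\<^esub> inv\<^bsub>G\<^esub> n), p) \<in> (\<lambda>p. (cq p, inv\<^bsub>G\<^esub> n \<otimes>\<^bsub>G\<^esub> p \<otimes>\<^bsub>G\<^esub> n)) ` P"
        by (rule rev_image_eqI[OF NG_conj(1)[OF n(1) p]]) (use e'[OF Pm[OF p]] in auto)
    qed
    finally show ?thesis by simp
  qed
  finally have "cls (H \<times>\<times> G) (dia H (conj_aut n) O defres_sub) = cls (H \<times>\<times> G) defres_sub"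
    using cls_conjg[OF DirProd_group[OF H.is_group G.is_group] defres_sub_Sub, of "(\<one>\<^bsub>H\<^esub>, inv\<^bsub>G\<^esub> n)"] c by simp
  thus ?thesis
    unfolding n(2) isoEl_bas[OF H.is_group conj_aut_Autx[OF n(1)]] Defres_bas
     bcomp_bas[OF fH fH fG dia_Sub[OF H.is_group conj_aut_Autx[OF n(1)]] defres_sub_Sub defres_sub_fst] by (simp add: bas_eq_iff)
qed

subsection \<open>The kernel of composition with deflation-restriction\<close>

lemma mem_relcomp_defres: "(g,p) \<in> L O defres_sub \<longleftrightarrow> p \<in> P \<and> (g, cq p) \<in> L"
  by (auto simp: defres_sub_def)

text \<open>The second component \<open>b\<close> of a conjugating pair must normalize the section:
  as \<open>L0\<close> is \<open>top_sub\<close>, \<open>P\<close> is the second projection of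
  \<open>L0 O defres_sub\<close> and \<open>Q\<close> is its kernel part. The conjugation then
  factors through the automorphism of \<open>H\<close> that the normalizer element
  \<open>b^-1\<close> induces.\<close>

lemma relcomp_defres_conj:
  assumes L: "L \<in> Sub (G \<times>\<times> H)" and L0: "L0 \<in> Sub (G \<times>\<times> H)" and t: "top_sub G H L0"
    and e: "cls (G \<times>\<times> G) (L O defres_sub) = cls (G \<times>\<times> G) (L0 O defres_sub)"
  shows "\<exists>n\<in>NGPQ G P Q. cls (G \<times>\<times> H) L0 = cls (G \<times>\<times> H) (L O dia H (conj_aut n))"
proof -
  note g = G.is_group and h = H.is_group
  note GG = DirProd_group[OF g g] and GH = DirProd_group[OF g h]
  note S = relcomp_Sub[OF g h g L defres_sub_Sub] and S0 = relcomp_Sub[OF g h g L0 defres_sub_Sub]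
  note l = mem_Sub_DirProd[OF g h L] and l0 = mem_Sub_DirProd[OF g h L0]
  have "L0 O defres_sub \<in> cls (G \<times>\<times> G) (L O defres_sub)" using cls_self[OF GG S0] e by simp
  then obtain a b where ab: "a \<in> carrier G" "b \<in> carrier G" "L0 O defres_sub = conjg (G \<times>\<times> G) (a,b) (L O defres_sub)" by (auto simp: cls_def)
  have sc: "L O defres_sub \<subseteq> carrier G \<times> carrier G" using S Sub_subset by fastforce
  let ?c = "\<lambda>x. a \<otimes>\<^bsub>G\<^esub> x \<otimes>\<^bsub>G\<^esub> inv\<^bsub>G\<^esub> a" and ?d = "\<lambda>x. b \<otimes>\<^bsub>G\<^esub> x \<otimes>\<^bsub>G\<^esub> inv\<^bsub>G\<^esub> b"
  have E: "L0 O defres_sub = (\<lambda>(x,y). (?c x, ?d y)) ` (L O defres_sub)" unfolding ab(3) by (rule mem_conjg_DirProd[OF g g sc ab(1,2)])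
  have E': "\<exists>u v. (u,v) \<in> S \<and> x = ?c u \<and> y = ?d v" if "(x,y) \<in> (\<lambda>(x,y). (?c x, ?d y)) ` S" for S x y
    using that by auto
  have fin: "finite P" "finite Q" using fG finite_subset[OF Pc] finite_subset[OF Q_sub_P] by (auto simp: fin_group_def)
  \<comment> \<open>The projection of \<open>L0\<close> onto \<open>H\<close> puts \<open>P\<close>
    inside \<open>b P b^-1\<close>, and equal orders give the rest. For \<open>Q\<close> below, the
    inclusion goes the other way, through the trivial kernel part of \<open>L0\<close>.\<close>
  have bP: "P = ?d ` P"
  proof (rule card_subset_eq)
    show "finite (?d ` P)" using fin by simp
    show "P \<subseteq> ?d ` P"
    proof
      fix p assume p: "p \<in> P"
      then obtain x where "(x, cq p) \<in> L0" using t carrier_H unfolding top_sub_def by blast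
      hence "(x,p) \<in> L0 O defres_sub" using p by (simp only: mem_relcomp_defres)
      then obtain u v where "(u,v) \<in> L O defres_sub" "p = ?d v" using E'[of x p "L O defres_sub"] unfolding E by blast
      thus "p \<in> ?d ` P" by (simp add: mem_relcomp_defres)
    qed
    show "card P = card (?d ` P)" using card_conjg[OF g Pc ab(2)] by (simp add: conjg_def)
  qed
  have bQ: "?d ` Q = Q"
  proof (rule card_subset_eq)
    show "?d ` Q \<subseteq> Q"
    proof safe
      fix q assume q: "q \<in> Q"
      have "cq q = Q" using G.coset_join2[OF Qm[OF q] subQ q] .
      hence "(\<one>\<^bsub>G\<^esub>, q) \<in> L O defres_sub" using l(3) q Q_sub_P one_H by (auto simp only: mem_relcomp_defres)
      hence "(?c \<one>\<^bsub>G\<^esub>, ?d q) \<in> L0 O defres_sub" unfolding E by (rule rev_image_eqI) simp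
      hence d: "(\<one>\<^bsub>G\<^esub>, cq (?d q)) \<in> L0" "?d q \<in> P" using ab(1) by (simp_all add: mem_relcomp_defres)
      hence "cq (?d q) = Q" using t unfolding top_sub_def one_H by blast
      thus "?d q \<in> Q" using G.rcos_self[OF Pm[OF d(2)] subQ] by simp
    qed
    show "card (?d ` Q) = card Q" using card_conjg[OF g _ ab(2), of Q] Qm by (auto simp: conjg_def)
  qed (rule fin)
  have bN: "b \<in> NGPQ G P Q" using ab bP bQ by (simp add: NGPQ_def conjg_def)
  let ?n = "inv\<^bsub>G\<^esub> b"
  have nN: "?n \<in> NGPQ G P Q" by (rule subgroup.m_inv_closed[OF NG_subgroup bN])
  let ?M = "L O dia H (conj_aut ?n)"
  have M: "?M \<in> Sub (G \<times>\<times> H)" by (rule relcomp_Sub[OF g h h L dia_Sub[OF h conj_aut_Autx[OF nN]]])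
  have Mm: "(x, cq p) \<in> ?M \<longleftrightarrow> (x, cq (?n \<otimes>\<^bsub>G\<^esub> p \<otimes>\<^bsub>G\<^esub> b)) \<in> L" if p: "p \<in> P" for x p
  proof -
    have "(x, cq p) \<in> ?M \<longleftrightarrow> (x, conj_aut ?n (cq p)) \<in> L" using p by (auto simp: dia_def carrier_H)
    thus ?thesis using conj_aut_coset[OF nN p] ab by simp
  qed
  have "L0 = conjg (G \<times>\<times> H) (a, \<one>\<^bsub>H\<^esub>) ?M"
  proof -
    have Mc: "?M \<subseteq> carrier G \<times> carrier H" using M Sub_subset by fastforce
    have "conjg (G \<times>\<times> H) (a, \<one>\<^bsub>H\<^esub>) ?M = (\<lambda>(x,y). (?c x, y)) ` ?M"
      unfolding mem_conjg_DirProd[OF g h Mc ab(1) H.one_closed] by (rule image_cong) (use Mc in auto)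
    also have "\<dots> = L0"
    proof (intro equalityI subsetI)
      fix w assume w: "w \<in> (\<lambda>(x,y). (?c x, y)) ` ?M"
      have "\<exists>x y. (x,y) \<in> S \<and> w = (?c x, y)" if "w \<in> (\<lambda>(x,y). (?c x, y)) ` S" for S :: "('g \<times> 'g set) set"
        using that by auto
      then obtain x y where xy: "(x,y) \<in> ?M" "w = (?c x, y)" using w by blast
      have "y \<in> carrier H" using subsetD[OF Mc xy(1)] by simp
      then obtain p where p: "p \<in> P" "y = cq p" unfolding carrier_H by blast
      let ?q = "?n \<otimes>\<^bsub>G\<^esub> p \<otimes>\<^bsub>G\<^esub> b"
      have q: "?q \<in> P" using NG_conj(1)[OF nN p(1)] ab by simp
      have "(x, ?q) \<in> L O defres_sub" unfolding mem_relcomp_defres using xy(1) Mm[OF p(1), of x] p q by simp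
      hence "(?c x, ?d ?q) \<in> L0 O defres_sub" unfolding E by (rule rev_image_eqI) simp
      moreover have "?d ?q = p"
      proof -
        have "?d ?q = (b \<otimes>\<^bsub>G\<^esub> inv\<^bsub>G\<^esub> b) \<otimes>\<^bsub>G\<^esub> p \<otimes>\<^bsub>G\<^esub> (b \<otimes>\<^bsub>G\<^esub> inv\<^bsub>G\<^esub> b)"
          using Pm[OF p(1)] ab(2) by (simp only: G.m_assoc G.m_closed G.inv_closed)
        thus ?thesis using Pm[OF p(1)] ab(2) by simp
      qed
      ultimately show "w \<in> L0" unfolding xy(2) using p by (simp add: mem_relcomp_defres)
    next
      fix w assume w: "w \<in> L0"
      obtain x y where xy: "(x,y) \<in> L0" "w = (x,y)" using w by (cases w) auto
      then obtain p where p: "p \<in> P" "y = cq p" using l0(2) carrier_H by blast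
      have "(x,p) \<in> L0 O defres_sub" using xy(1) p by (simp only: mem_relcomp_defres)
      then obtain u v where uv: "(u,v) \<in> L O defres_sub" "x = ?c u" "p = ?d v" using E'[of x p "L O defres_sub"] unfolding E by blast
      have v: "v \<in> P" "(u, cq v) \<in> L" using uv(1) by (simp_all add: mem_relcomp_defres)
      have "?n \<otimes>\<^bsub>G\<^esub> p \<otimes>\<^bsub>G\<^esub> b = (inv\<^bsub>G\<^esub> b \<otimes>\<^bsub>G\<^esub> b) \<otimes>\<^bsub>G\<^esub> v \<otimes>\<^bsub>G\<^esub> (inv\<^bsub>G\<^esub> b \<otimes>\<^bsub>G\<^esub> b)"
        unfolding uv(3) using Pm[OF v(1)] ab(2) by (simp only: G.m_assoc G.m_closed G.inv_closed)
      hence "?n \<otimes>\<^bsub>G\<^esub> p \<otimes>\<^bsub>G\<^esub> b = v" using Pm[OF v(1)] ab(2) by simp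
      hence "(u, y) \<in> ?M" using v(2) Mm[OF p(1)] p(2) by simp
      thus "w \<in> (\<lambda>(x,y). (?c x, y)) ` ?M" by (rule rev_image_eqI) (simp add: uv(2) xy(2))
    qed
    finally show ?thesis by simp
  qed
  hence "cls (G \<times>\<times> H) L0 = cls (G \<times>\<times> H) ?M" using cls_conjg[OF GH M, of "(a, \<one>\<^bsub>H\<^esub>)"] ab(1) by simp
  thus ?thesis using nN by blast
qed

text \<open>The classes \<open>L\<close> that become conjugate to a given \<open>L\<^sub>0\<close> after composition with \<open>Defres\<close> form one \<open>\<Gamma>\<close>-orbit,
  on which an invariant \<open>\<alpha>\<close> is constant.\<close>

lemma Defres_inj:
  fixes \<alpha> :: "_ \<Rightarrow> 'k"
  assumes a: "\<alpha> \<in> kB G H" and z: "bcomp G H G \<alpha> (Defres G P Q) = 0"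
    and inv: "\<And>\<gamma>. \<gamma> \<in> \<Gamma> \<Longrightarrow> bcomp G H H \<alpha> (isoEl H \<gamma>) = \<alpha>"
  shows "\<alpha> \<in> kI G H"
  unfolding kI_iff[OF fG fH]
proof (intro conjI ballI impI a)
  note g = G.is_group and h = H.is_group
  note GH = DirProd_group[OF g h]
  fix L0 assume L0: "L0 \<in> Sub (G \<times>\<times> H)" and t: "top_sub G H L0"
  let ?C = "conj_classes (G \<times>\<times> H)" and ?r = "\<lambda>C. SOME L. L \<in> C"
  let ?A = "{C \<in> ?C. cls (G \<times>\<times> G) (?r C O defres_sub) = cls (G \<times>\<times> G) (L0 O defres_sub)}"
  have fC: "finite ?C" by (rule finite_conj_classes[OF fin_group_DirProd[OF fG fH]])
  \<comment> \<open>By \<open>relcomp_defres_conj\<close> such a class is carried to that of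
    \<open>L0\<close> by an element of \<Gamma>. Composition with it is injective on classes, so the
    coefficient of the invariant \<open>\<alpha>\<close> at \<open>L0\<close> comes from
    \<open>C\<close> alone.\<close>
  have const: "\<alpha> C = \<alpha> (cls (G \<times>\<times> H) L0)" if C: "C \<in> ?A" for C
  proof -
    note r = some_conj_class[OF GH, of C]
    have CC: "C \<in> ?C" using C by simp
    obtain n where n: "n \<in> NGPQ G P Q" "cls (G \<times>\<times> H) L0 = cls (G \<times>\<times> H) (?r C O dia H (conj_aut n))"
      using relcomp_defres_conj[OF r(1)[OF CC] L0 t] C by blast
    note cA = conj_aut_Autx[OF n(1)]
    have o: "outcls H (conj_aut n) \<in> \<Gamma>" using n(1) by (auto simp: Gamma_eq)
    have "\<alpha> (cls (G \<times>\<times> H) L0) = bcomp G H H \<alpha> (bas (H \<times>\<times> H) (dia H (conj_aut n))) (cls (G \<times>\<times> H) L0)"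
      using inv[OF o] isoEl_bas[OF h cA] by simp
    also have "\<dots> = (\<Sum>C1\<in>?C. if cls (G \<times>\<times> H) L0 = cls (G \<times>\<times> H) (?r C1 O dia H (conj_aut n)) then \<alpha> C1 else 0)"
      by (rule bcomp_bas_right[OF fG fH fH a dia_Sub[OF h cA] dia_fst[OF h cA]])
    also have "\<dots> = (\<Sum>C1\<in>?C. if C1 = C then \<alpha> C1 else 0)"
    proof (intro sum.cong refl)
      fix C1 assume C1: "C1 \<in> ?C"
      have "cls (G \<times>\<times> H) L0 = cls (G \<times>\<times> H) (?r C1 O dia H (conj_aut n)) \<longleftrightarrow> C1 = C"
        using n(2) relcomp_dia_cancel[OF fG fH r(1)[OF CC] some_conj_class(1)[OF GH C1] cA] r(2)[OF CC] some_conj_class(2)[OF GH C1] by metis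
      thus "(if cls (G \<times>\<times> H) L0 = cls (G \<times>\<times> H) (?r C1 O dia H (conj_aut n)) then \<alpha> C1 else 0) = (if C1 = C then \<alpha> C1 else 0)" by simp
    qed
    also have "\<dots> = \<alpha> C" using fC CC by simp
    finally show ?thesis by simp
  qed
  \<comment> \<open>The coefficient of the vanishing composite at the class of
    \<open>L0 O defres_sub\<close> is the sum of \<open>\<alpha>\<close> over \<open>?A\<close>,
    hence \<open>|?A|\<close> times one value; \<open>?A\<close> is nonempty since it contains the
    class of \<open>L0\<close>.\<close>
  have "0 = bcomp G H G \<alpha> (bas (H \<times>\<times> G) defres_sub) (cls (G \<times>\<times> G) (L0 O defres_sub))" using z unfolding Defres_bas by simp
  also have "\<dots> = (\<Sum>C1\<in>?C. if cls (G \<times>\<times> G) (L0 O defres_sub) = cls (G \<times>\<times> G) (?r C1 O defres_sub) then \<alpha> C1 else 0)"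
    by (rule bcomp_bas_right[OF fG fH fG a defres_sub_Sub defres_sub_fst])
  also have "\<dots> = (\<Sum>C1\<in>?A. \<alpha> C1)" using fC by (simp add: sum.inter_filter eq_commute)
  also have "\<dots> = of_nat (card ?A) * \<alpha> (cls (G \<times>\<times> H) L0)" using const by simp
  finally have "of_nat (card ?A) * \<alpha> (cls (G \<times>\<times> H) L0) = 0" by simp
  moreover have "cls (G \<times>\<times> H) L0 \<in> ?A"
  proof -
    note c = mem_conj_classes[OF L0]
    note r = some_conj_class[OF GH c]
    have "(bas (G \<times>\<times> H) (?r (cls (G \<times>\<times> H) L0)) :: _ \<Rightarrow> 'k) = bas (G \<times>\<times> H) L0" using r(2) by (simp add: bas_eq_iff)
    hence "(bas (G \<times>\<times> G) (?r (cls (G \<times>\<times> H) L0) O defres_sub) :: _ \<Rightarrow> 'k) = bas (G \<times>\<times> G) (L0 O defres_sub)"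
      using bcomp_bas[OF fG fH fG r(1) defres_sub_Sub defres_sub_fst] bcomp_bas[OF fG fH fG L0 defres_sub_Sub defres_sub_fst] by metis
    thus ?thesis using c by (simp add: bas_eq_iff)
  qed
  ultimately show "\<alpha> (cls (G \<times>\<times> H) L0) = 0" using fC by (auto simp: of_nat_0_iff)
qed

end

section \<open>The coefficient of the identity as a symmetric, nondegenerate form\<close>

context char0
begin

text \<open>In a group \<open>ab = 1\<close> holds exactly when \<open>ba = 1\<close>, so
  \<open>tauO\<close> is a trace.\<close>

lemma tauO_comm:
  fixes x y :: "_ \<Rightarrow> 'k"
  assumes H: "fin_group H" and x: "x \<in> kB H H" and y: "y \<in> kB H H"
  shows "tauO H (piB H (bcomp H H H x y)) = tauO H (piB H (bcomp H H H y x))"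
proof -
  interpret O: group "OutG H" by (rule OutG_group[OF H])
  have "outmul H a b = outid H \<longleftrightarrow> outmul H b a = outid H" if "a \<in> Out H" "b \<in> Out H" for a b
    using O.inv_comm[of a b] O.inv_comm[of b a] that by auto
  hence "conv H f g (outid H) = conv H g f (outid H)" for f g :: "_ \<Rightarrow> 'k"
    unfolding conv_def by (subst sum.swap, intro sum.cong refl) (simp add: mult.commute)
  thus ?thesis by (simp add: tauO_def piB_bcomp[OF H x y] piB_bcomp[OF H y x])
qed

text \<open>The diagonal is its own converse.\<close>

lemma tauO_bop:
  fixes x :: "_ \<Rightarrow> 'k"
  assumes H: "fin_group H" and x: "x \<in> kB H H"
  shows "tauO H (piB H (bop x)) = tauO H (piB H x)"
proof -
  have g: "group H" using H by (simp add: fin_group_def)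
  note i = id_Autx[OF g]
  let ?d = "dia H (restrict (\<lambda>x. x) (carrier H))"
  have "?d\<inverse> = ?d" by (auto simp: dia_def)
  hence "converse ` cls (H \<times>\<times> H) ?d = cls (H \<times>\<times> H) ?d" using cls_converse[OF g g dia_Sub[OF g i]] by simp
  thus ?thesis
    by (simp add: tauO_def outid_def piB(2)[OF H x i] piB(2)[OF H bop_kB[OF g g x] i] bop_converse)
qed

text \<open>Multiplication by the inverse group element moves any coefficient to the identity. This
  is the nondegeneracy by which vanishing of \<open>tauO\<close> on enough products gives vanishing
  of \<open>piB\<close>.\<close>

lemma piB_coeff:
  fixes x :: "_ \<Rightarrow> 'k"
  assumes H: "fin_group H" and x: "x \<in> kB H H" and o: "ob \<in> Out H"
  shows "piB H x ob = tauO H (piB H (bcomp H H H (isoEl H (inv\<^bsub>OutG H\<^esub> ob)) x))"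
proof -
  interpret O: group "OutG H" by (rule OutG_group[OF H])
  have i: "inv\<^bsub>OutG H\<^esub> ob \<in> Out H" using O.inv_closed[of ob] o by simp
  have e: "outmul H (inv\<^bsub>OutG H\<^esub> ob) b = outid H \<longleftrightarrow> b = ob" if "b \<in> Out H" for b
  proof
    assume "outmul H (inv\<^bsub>OutG H\<^esub> ob) b = outid H"
    hence "inv\<^bsub>OutG H\<^esub> ob \<otimes>\<^bsub>OutG H\<^esub> b = \<one>\<^bsub>OutG H\<^esub>" by simp
    hence "inv\<^bsub>OutG H\<^esub> b = inv\<^bsub>OutG H\<^esub> ob" by (rule O.inv_equality) (use i that in auto)
    hence "inv\<^bsub>OutG H\<^esub> (inv\<^bsub>OutG H\<^esub> b) = inv\<^bsub>OutG H\<^esub> (inv\<^bsub>OutG H\<^esub> ob)" by (rule arg_cong)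
    thus "b = ob" using O.inv_inv o that by auto
  next
    assume "b = ob" thus "outmul H (inv\<^bsub>OutG H\<^esub> ob) b = outid H" using O.l_inv[of ob] o by simp
  qed
  have "tauO H (piB H (bcomp H H H (isoEl H (inv\<^bsub>OutG H\<^esub> ob)) x)) =
     (\<Sum>a\<in>Out H. \<Sum>b\<in>Out H. if outmul H a b = outid H then (if a = inv\<^bsub>OutG H\<^esub> ob then 1 else 0) * piB H x b else 0)"
    unfolding tauO_def piB_bcomp[OF H isoEl_kB[OF H i] x] conv_def piB_isoEl[OF H i] ..
  also have "\<dots> = (\<Sum>a\<in>Out H. if a = inv\<^bsub>OutG H\<^esub> ob then (\<Sum>b\<in>Out H. if outmul H a b = outid H then piB H x b else 0) else 0)"
  proof (rule sum.cong[OF refl])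
    fix a
    show "(\<Sum>b\<in>Out H. if outmul H a b = outid H then (if a = inv\<^bsub>OutG H\<^esub> ob then 1 else 0) * piB H x b else 0) =
      (if a = inv\<^bsub>OutG H\<^esub> ob then (\<Sum>b\<in>Out H. if outmul H a b = outid H then piB H x b else 0) else 0)"
      by (cases "a = inv\<^bsub>OutG H\<^esub> ob") (simp_all cong: if_cong)
  qed
  also have "\<dots> = (\<Sum>b\<in>Out H. if outmul H (inv\<^bsub>OutG H\<^esub> ob) b = outid H then piB H x b else 0)"
    using finite_Out[OF H] i by simp
  also have "\<dots> = (\<Sum>b\<in>Out H. if b = ob then piB H x b else 0)" using e by (intro sum.cong refl) simp
  also have "\<dots> = piB H x ob" using finite_Out[OF H] o by simp
  finally show ?thesis ..
qed

end

section \<open>Averaging over \<Gamma> and the radical of the form\<close>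

context sect
begin

text \<open>This is \<open>|\<Gamma>|\<close> times the idempotent of the trivial character of
  \<Gamma>. It is left unnormalised; \<open>|\<Gamma>|\<close> is divided out only when an averaged
  element is wanted.\<close>

definition sG :: "('g set \<times> 'g set) set set \<Rightarrow> 'k" where "sG = (\<Sum>\<gamma>\<in>\<Gamma>. isoEl H \<gamma>)"

lemma sG_kB: "sG \<in> kB H H"
  unfolding sG_def by (intro fv.subspace_sum[OF kB_subspace] isoEl_kB[OF fH] Gamma_Out)

lemma Gamma_mult: "a \<in> \<Gamma> \<Longrightarrow> b \<in> \<Gamma> \<Longrightarrow> outmul H a b \<in> \<Gamma>"
  using subgroup.m_closed[OF Gamma_subgroup] by simp

lemma Gamma_inv: "a \<in> \<Gamma> \<Longrightarrow> inv\<^bsub>OutG H\<^esub> a \<in> \<Gamma>"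
  using subgroup.m_inv_closed[OF Gamma_subgroup] by simp

lemma Gamma_translate:
  fixes F :: "_ \<Rightarrow> 'm::comm_monoid_add"
  assumes "\<gamma> \<in> \<Gamma>"
  shows "(\<Sum>a\<in>\<Gamma>. F (outmul H a \<gamma>)) = (\<Sum>a\<in>\<Gamma>. F a)" "(\<Sum>a\<in>\<Gamma>. F (inv\<^bsub>OutG H\<^esub> a)) = (\<Sum>a\<in>\<Gamma>. F a)"
proof -
  let ?i = "inv\<^bsub>OutG H\<^esub> \<gamma>"
  have c: "outmul H (outmul H a \<gamma>) ?i = a" "outmul H (outmul H a ?i) \<gamma> = a" if "a \<in> \<Gamma>" for a
    using O.m_assoc[of a \<gamma> ?i] O.m_assoc[of a ?i \<gamma>] O.r_inv[of \<gamma>] O.l_inv[of \<gamma>] O.r_one[of a] O.inv_closed[of \<gamma>]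
      Gamma_Out[OF that] Gamma_Out[OF assms] by simp_all
  show "(\<Sum>a\<in>\<Gamma>. F (outmul H a \<gamma>)) = (\<Sum>a\<in>\<Gamma>. F a)"
    by (rule sum.reindex_bij_witness[where i = "\<lambda>a. outmul H a ?i" and j = "\<lambda>a. outmul H a \<gamma>"])
      (use c Gamma_mult Gamma_inv assms in auto)
  show "(\<Sum>a\<in>\<Gamma>. F (inv\<^bsub>OutG H\<^esub> a)) = (\<Sum>a\<in>\<Gamma>. F a)"
    by (rule sum.reindex_bij_witness[where i = "\<lambda>a. inv\<^bsub>OutG H\<^esub> a" and j = "\<lambda>a. inv\<^bsub>OutG H\<^esub> a"])
      (use Gamma_inv Gamma_Out O.inv_inv in auto)
qed

lemma sG_isoEl: "\<gamma> \<in> \<Gamma> \<Longrightarrow> bcomp H H H sG (isoEl H \<gamma>) = sG"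
proof -
  assume g: "\<gamma> \<in> \<Gamma>"
  have "bcomp H H H sG (isoEl H \<gamma>) = (\<Sum>a\<in>\<Gamma>. isoEl H (outmul H a \<gamma>))"
    unfolding sG_def bcomp_sum_left by (intro sum.cong refl isoEl_mult[OF fH] Gamma_Out g)
  thus ?thesis unfolding sG_def Gamma_translate(1)[OF g] .
qed

lemma bop_sum: "bop (\<Sum>i\<in>I. f i) = (\<Sum>i\<in>I. bop (f i))"
  by (rule ext) (simp add: bop_converse sum_fun)

lemma sG_bop: "bop sG = sG"
proof -
  have "bop sG = (\<Sum>a\<in>\<Gamma>. isoEl H (inv\<^bsub>OutG H\<^esub> a))"
    unfolding sG_def bop_sum by (intro sum.cong refl bop_isoEl[OF fH] Gamma_Out)
  thus ?thesis unfolding sG_def Gamma_translate(2)[OF subgroup.one_closed[OF Gamma_subgroup]] .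
qed

lemma sG_Defres: "bcomp H H G sG (Defres G P Q) = fscale (of_nat (card \<Gamma>)) (Defres G P Q)"
proof -
  have "bcomp H H G sG (Defres G P Q) = (\<Sum>\<gamma>\<in>\<Gamma>. Defres G P Q)"
    unfolding sG_def bcomp_sum_left by (intro sum.cong refl isoEl_Defres)
  thus ?thesis unfolding sum_fun by simp
qed

lemma bcomp_sG_isoEl: "\<gamma> \<in> \<Gamma> \<Longrightarrow> bcomp X H H (bcomp X H H \<alpha> sG) (isoEl H \<gamma>) = bcomp X H H \<alpha> sG" if "fin_group X"
  using bcomp_assoc[OF that fH fH fH, of \<alpha> sG "isoEl H \<gamma>"] sG_isoEl by simp

text \<open>\<open>Defres\<close> absorbs \<Gamma>, so replacing \<open>\<alpha>\<close> by its
  average does not change its composite with \<open>Defres\<close>: every element of the left ideal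
  has an exactly invariant coefficient.\<close>

lemma bcomp_sG_Defres:
  "bcomp G H G (bcomp G H H \<alpha> sG) (Defres G P Q) = fscale (of_nat (card \<Gamma>)) (bcomp G H G \<alpha> (Defres G P Q))"
  using bcomp_assoc[OF fG fH fH fG, of \<alpha> sG "Defres G P Q"] by (simp only: sG_Defres bcomp_scale_right)

lemma fixG_iff: "fixG G P Q \<alpha> \<longleftrightarrow> (\<forall>\<gamma>\<in>\<Gamma>. bcomp G H H \<alpha> (isoEl H \<gamma>) - \<alpha> \<in> kI G H)"
  by (simp add: fixG_def fun_diff_def)

text \<open>\<open>fixG\<close> is invariance modulo \<open>kI\<close>, so each of the
  \<open>|\<Gamma>|\<close> summands differs from \<open>\<alpha>\<close> by a member of
  \<open>kI\<close>.\<close>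

lemma fix_sG:
  assumes "fixG G P Q \<alpha>"
  shows "bcomp G H H \<alpha> sG - fscale (of_nat (card \<Gamma>)) \<alpha> \<in> kI G H"
proof -
  have "bcomp G H H \<alpha> sG - fscale (of_nat (card \<Gamma>)) \<alpha> = (\<Sum>\<gamma>\<in>\<Gamma>. bcomp G H H \<alpha> (isoEl H \<gamma>) - \<alpha>)"
    unfolding sG_def bcomp_sum_right sum_subtractf by (simp add: sum_fun fun_eq_iff)
  also have "\<dots> \<in> kI G H" using assms by (intro fv.subspace_sum[OF kI_subspace]) (simp add: fixG_iff)
  finally show ?thesis .
qed

text \<open>The radical condition in unrestricted form: arbitrary \<open>\<psi>\<close> in place of
  opposites of fixed elements, and \<pi> in place of its coefficient at the identity. In this form
  it can be compared with the condition that defines \<open>JHV\<close>.\<close>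

definition radical_elt :: "(('g \<times> 'g set) set set \<Rightarrow> 'k) \<Rightarrow> bool" where
  "radical_elt \<alpha> \<longleftrightarrow> (\<forall>\<psi>\<in>kB H G. piB H (bcomp H G H \<psi> (bcomp G H H \<alpha> sG)) = 0)"

lemma piB_kI: "x \<in> kI H H \<Longrightarrow> piB H x = (0 :: _ \<Rightarrow> 'k)"
  using piB_eq_0_iff[OF fH kI_kB[OF fH fH]] by blast

text \<open>One direction uses the exactly invariant average of \<open>\<alpha>\<close>. In the
  other, \<open>Defres_inj\<close> controls the difference between \<open>\<alpha>\<close> and the
  coefficients that witness membership, and the trace property together with
  \<open>piB_coeff\<close> widens the restricted test to the unrestricted one.\<close>

lemma radical_elt_Rpre:
  fixes \<alpha> :: "_ \<Rightarrow> 'k"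
  assumes a: "\<alpha> \<in> kB G H"
  shows "bcomp G H G \<alpha> (Defres G P Q) \<in> Rpre G P Q \<longleftrightarrow> radical_elt \<alpha>"
proof
  let ?n = "of_nat (card \<Gamma>) :: 'k"
  let ?D = "Defres G P Q"
  note kk = bcomp_kB[OF fH fG fH] and kg = bcomp_kB[OF fG fH fH]
  { assume K: "radical_elt \<alpha>"
    define \<beta> where "\<beta> = fscale (1/?n) (bcomp G H H \<alpha> sG)"
    have bk: "\<beta> \<in> kB G H" unfolding \<beta>_def by (rule fv.subspace_scale[OF kB_subspace kg])
    have bD: "bcomp G H G \<beta> ?D = bcomp G H G \<alpha> ?D"
      unfolding \<beta>_def bcomp_scale_left bcomp_sG_Defres using Gamma_nz by (simp add: fun_eq_iff)
    have bfix: "fixG G P Q \<beta>" unfolding fixG_iff \<beta>_def bcomp_scale_left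
      using fv.subspace_0[OF kI_subspace, of G H] by (simp add: bcomp_sG_isoEl[OF fG])
    have "formG G P Q \<beta> \<phi> = 0" if p: "\<phi> \<in> kB G H" for \<phi>
    proof -
      have "formG G P Q \<beta> \<phi> = tauO H (piB H (bop (bcomp H G H (bop \<beta>) \<phi>)))"
        unfolding formG_def by (rule tauO_bop[OF fH kk, symmetric])
      also have "bop (bcomp H G H (bop \<beta>) \<phi>) = bcomp H G H (bop \<phi>) \<beta>"
        unfolding bop_bcomp[OF fH fG fH] bop_bop ..
      also have "\<dots> = fscale (1/?n) (bcomp H G H (bop \<phi>) (bcomp G H H \<alpha> sG))" unfolding \<beta>_def bcomp_scale_right ..
      also have "piB H \<dots> = fscale (1/?n) (piB H (bcomp H G H (bop \<phi>) (bcomp G H H \<alpha> sG)))" by (rule piB_scale[OF fH kk])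
      also have "\<dots> = 0" using K bop_kB[OF G.is_group H.is_group p] by (simp add: radical_elt_def fun_eq_iff)
      finally show ?thesis by (simp add: tauO_def)
    qed
    moreover have "(0 :: _ \<Rightarrow> 'k) \<in> Kless G P Q"
      unfolding Kless_def using fv.subspace_0[OF kI_subspace, of G H] bcomp_zero_left by (metis (mono_tags, lifting) mem_Collect_eq)
    moreover have "bcomp G H G \<alpha> ?D = (\<lambda>C. (0 :: _ \<Rightarrow> 'k) C + bcomp G H G \<beta> ?D C)" unfolding bD by simp
    ultimately show "bcomp G H G \<alpha> ?D \<in> Rpre G P Q" unfolding Rpre_def using bk bfix by blast }
  { assume "bcomp G H G \<alpha> ?D \<in> Rpre G P Q"
    then obtain x \<beta> where x: "bcomp G H G \<alpha> ?D = (\<lambda>C. x C + bcomp G H G \<beta> ?D C)" "x \<in> Kless G P Q"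
      and b: "\<beta> \<in> kB G H" "fixG G P Q \<beta>" "\<And>\<phi>. \<phi> \<in> kB G H \<Longrightarrow> fixG G P Q \<phi> \<Longrightarrow> formG G P Q \<beta> \<phi> = 0"
      unfolding Rpre_def by blast
    obtain \<delta> where d: "\<delta> \<in> kI G H" "x = bcomp G H G \<delta> ?D" using x(2) unfolding Kless_def by blast
    have dk: "\<delta> \<in> kB G H" by (rule kI_kB[OF fG fH d(1)])
    \<comment> \<open>The coefficient \<open>\<alpha> - \<delta> - \<beta>\<close> composes with
      \<open>Defres\<close> to 0. Averaging makes it exactly invariant, as \<open>Defres_inj\<close>
      requires, and \<open>\<delta>\<close> stays in \<open>kI\<close> under averaging.\<close>
    let ?e = "bcomp G H H (\<alpha> - \<delta> - \<beta>) sG"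
    have "bcomp G H G ?e ?D = 0"
      unfolding bcomp_sG_Defres bcomp_diff_left x(1) d(2) by (simp add: fun_eq_iff algebra_simps)
    hence eI: "?e \<in> kI G H" by (rule Defres_inj[OF kg _ bcomp_sG_isoEl[OF fG]])
    have dI: "bcomp G H H \<delta> sG \<in> kI G H" by (rule kI_right_ideal[OF fG fH d(1)])
    have tau: "tauO H (piB H (bcomp H G H \<psi> \<beta>)) = 0" if p: "\<psi> \<in> kB H G" for \<psi>
    proof -
      \<comment> \<open>The opposite of \<open>sG \<psi>\<close> is a fixed element, so the form may
        be tested on it. The trace property then moves \<open>sG\<close> next to
        \<open>\<beta>\<close>, where it acts as \<open>|\<Gamma>|\<close> modulo \<open>kI\<close>;
        an arbitrary \<open>\<psi>\<close> has been reached.\<close>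
      define \<phi> where "\<phi> = bop (bcomp H H G sG \<psi>)"
      have pe: "\<phi> = bcomp G H H (bop \<psi>) sG" unfolding \<phi>_def bop_bcomp[OF fH fH fG] sG_bop ..
      have pk: "\<phi> \<in> kB G H" unfolding pe by (rule kg)
      have "fixG G P Q \<phi>" unfolding fixG_iff pe using fv.subspace_0[OF kI_subspace, of G H] by (simp add: bcomp_sG_isoEl[OF fG])
      hence "0 = formG G P Q \<beta> \<phi>" using b(3)[OF pk] by simp
      also have "\<dots> = tauO H (piB H (bop (bcomp H G H (bop \<beta>) \<phi>)))"
        unfolding formG_def by (rule tauO_bop[OF fH kk, symmetric])
      also have "bop (bcomp H G H (bop \<beta>) \<phi>) = bcomp H G H (bcomp H H G sG \<psi>) \<beta>"
        unfolding bop_bcomp[OF fH fG fH] \<phi>_def bop_bop ..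
      also have "\<dots> = bcomp H H H sG (bcomp H G H \<psi> \<beta>)" by (rule bcomp_assoc[OF fH fH fG fH])
      also have "tauO H (piB H \<dots>) = tauO H (piB H (bcomp H H H (bcomp H G H \<psi> \<beta>) sG))" by (rule tauO_comm[OF fH sG_kB kk])
      also have "bcomp H H H (bcomp H G H \<psi> \<beta>) sG = bcomp H G H \<psi> (bcomp G H H \<beta> sG)" by (rule bcomp_assoc[OF fH fG fH fH])
      also have "\<dots> = bcomp H G H \<psi> (bcomp G H H \<beta> sG - fscale ?n \<beta>) + fscale ?n (bcomp H G H \<psi> \<beta>)"
        unfolding bcomp_diff_right bcomp_scale_right by (simp add: fun_eq_iff)
      also have "piB H \<dots> = piB H (bcomp H G H \<psi> (bcomp G H H \<beta> sG - fscale ?n \<beta>)) + fscale ?n (piB H (bcomp H G H \<psi> \<beta>))"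
        using kk fv.subspace_scale[OF kB_subspace kk] by (simp only: piB_add[OF fH] piB_scale[OF fH])
      also have "piB H (bcomp H G H \<psi> (bcomp G H H \<beta> sG - fscale ?n \<beta>)) = 0"
        by (rule piB_kI[OF kI_left_ideal[OF fH fG fH fix_sG[OF b(2)]]])
      finally show ?thesis using Gamma_nz by (simp add: tauO_def)
    qed
    have pib: "piB H (bcomp H G H \<psi> \<beta>) = 0" if p: "\<psi> \<in> kB H G" for \<psi>
    proof
      fix ob show "piB H (bcomp H G H \<psi> \<beta>) ob = 0 ob"
      proof (cases "ob \<in> Out H")
        case True
        have "piB H (bcomp H G H \<psi> \<beta>) ob = tauO H (piB H (bcomp H G H (bcomp H H G (isoEl H (inv\<^bsub>OutG H\<^esub> ob)) \<psi>) \<beta>))"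
          unfolding piB_coeff[OF fH kk True] bcomp_assoc[OF fH fH fG fH] ..
        also have "\<dots> = 0" by (rule tau[OF bcomp_kB[OF fH fH fG]])
        finally show ?thesis by simp
      next
        case False
        thus ?thesis using piB(1)[OF fH kk] by (simp add: kOut_def)
      qed
    qed
    show "radical_elt \<alpha>" unfolding radical_elt_def
    proof
      fix \<psi> :: "_ \<Rightarrow> 'k" assume p: "\<psi> \<in> kB H G"
      have "bcomp G H H \<alpha> sG = (?e + bcomp G H H \<delta> sG) + ((bcomp G H H \<beta> sG - fscale ?n \<beta>) + fscale ?n \<beta>)"
        unfolding bcomp_diff_left by (simp add: fun_eq_iff)
      hence "bcomp H G H \<psi> (bcomp G H H \<alpha> sG) = bcomp H G H \<psi> (?e + bcomp G H H \<delta> sG) +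
        (bcomp H G H \<psi> (bcomp G H H \<beta> sG - fscale ?n \<beta>) + fscale ?n (bcomp H G H \<psi> \<beta>))"
        by (simp only: bcomp_add_right bcomp_scale_right)
      hence "piB H (bcomp H G H \<psi> (bcomp G H H \<alpha> sG)) = piB H (bcomp H G H \<psi> (?e + bcomp G H H \<delta> sG)) +
        (piB H (bcomp H G H \<psi> (bcomp G H H \<beta> sG - fscale ?n \<beta>)) + fscale ?n (piB H (bcomp H G H \<psi> \<beta>)))"
        using kk fv.subspace_scale[OF kB_subspace kk] fv.subspace_add[OF kB_subspace kk fv.subspace_scale[OF kB_subspace kk]]
        by (simp only: piB_add[OF fH] piB_scale[OF fH])
      also have "\<dots> = 0"
        unfolding pib[OF p] piB_kI[OF kI_left_ideal[OF fH fG fH fix_sG[OF b(2)]]]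
          piB_kI[OF kI_left_ideal[OF fH fG fH fv.subspace_add[OF kI_subspace eI dI]]] by (simp add: fun_eq_iff)
      finally show "piB H (bcomp H G H \<psi> (bcomp G H H \<alpha> sG)) = 0" .
    qed }
qed

end

subsection \<open>Quotients and direct sums of modules\<close>

text \<open>Records of type \<open>kmod\<close> carry no axioms. Quotients and transport of
  structure rest on an abelian group whose carrier is preserved by the scalars and by the acting set
  \<open>A\<close>.\<close>

definition kmd :: "'a set \<Rightarrow> ('a,'k,'m) kmod \<Rightarrow> bool" where
  "kmd A M \<longleftrightarrow> mzero M \<in> mcar M \<and> (\<forall>x\<in>mcar M. \<forall>y\<in>mcar M. madd M x y \<in> mcar M)
   \<and> (\<forall>x\<in>mcar M. \<forall>y\<in>mcar M. \<forall>z\<in>mcar M. madd M (madd M x y) z = madd M x (madd M y z))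
   \<and> (\<forall>x\<in>mcar M. \<forall>y\<in>mcar M. madd M x y = madd M y x)
   \<and> (\<forall>x\<in>mcar M. madd M (mzero M) x = x)
   \<and> (\<forall>x\<in>mcar M. \<exists>y\<in>mcar M. madd M x y = mzero M)
   \<and> (\<forall>c. \<forall>x\<in>mcar M. msmul M c x \<in> mcar M) \<and> (\<forall>a\<in>A. \<forall>x\<in>mcar M. mact M a x \<in> mcar M)"

definition khom :: "'a set \<Rightarrow> ('a,'k,'m) kmod \<Rightarrow> ('a,'k,'n) kmod \<Rightarrow> ('m \<Rightarrow> 'n) \<Rightarrow> bool" where
  "khom A M N f \<longleftrightarrow> (\<forall>x\<in>mcar M. f x \<in> mcar N) \<and> (\<forall>x\<in>mcar M. \<forall>y\<in>mcar M. f (madd M x y) = madd N (f x) (f y))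
     \<and> (\<forall>c. \<forall>x\<in>mcar M. f (msmul M c x) = msmul N c (f x))
     \<and> (\<forall>a\<in>A. \<forall>x\<in>mcar M. f (mact M a x) = mact N a (f x))"

definition addsub :: "('a,'k,'m) kmod \<Rightarrow> 'm set \<Rightarrow> bool" where
  "addsub M N \<longleftrightarrow> N \<subseteq> mcar M \<and> mzero M \<in> N \<and> (\<forall>x\<in>N. \<forall>y\<in>N. madd M x y \<in> N) \<and> (\<forall>x\<in>N. \<exists>y\<in>N. madd M x y = mzero M)"

lemma kmdD:
  assumes "kmd A M"
  shows "mzero M \<in> mcar M" "\<And>x y. x \<in> mcar M \<Longrightarrow> y \<in> mcar M \<Longrightarrow> madd M x y \<in> mcar M"
    "\<And>x y z. x \<in> mcar M \<Longrightarrow> y \<in> mcar M \<Longrightarrow> z \<in> mcar M \<Longrightarrow> madd M (madd M x y) z = madd M x (madd M y z)"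
    "\<And>x y. x \<in> mcar M \<Longrightarrow> y \<in> mcar M \<Longrightarrow> madd M x y = madd M y x"
    "\<And>x. x \<in> mcar M \<Longrightarrow> madd M (mzero M) x = x" "\<And>x. x \<in> mcar M \<Longrightarrow> madd M x (mzero M) = x"
    "\<And>x. x \<in> mcar M \<Longrightarrow> \<exists>y\<in>mcar M. madd M x y = mzero M"
    "\<And>c x. x \<in> mcar M \<Longrightarrow> msmul M c x \<in> mcar M" "\<And>a x. a \<in> A \<Longrightarrow> x \<in> mcar M \<Longrightarrow> mact M a x \<in> mcar M"
proof -
  note k = assms[unfolded kmd_def]
  show "mzero M \<in> mcar M" "\<And>x y. x \<in> mcar M \<Longrightarrow> y \<in> mcar M \<Longrightarrow> madd M x y \<in> mcar M"
    "\<And>x y z. x \<in> mcar M \<Longrightarrow> y \<in> mcar M \<Longrightarrow> z \<in> mcar M \<Longrightarrow> madd M (madd M x y) z = madd M x (madd M y z)"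
    "\<And>x y. x \<in> mcar M \<Longrightarrow> y \<in> mcar M \<Longrightarrow> madd M x y = madd M y x"
    "\<And>x. x \<in> mcar M \<Longrightarrow> madd M (mzero M) x = x" 
    "\<And>x. x \<in> mcar M \<Longrightarrow> \<exists>y\<in>mcar M. madd M x y = mzero M"
    "\<And>c x. x \<in> mcar M \<Longrightarrow> msmul M c x \<in> mcar M" "\<And>a x. a \<in> A \<Longrightarrow> x \<in> mcar M \<Longrightarrow> mact M a x \<in> mcar M"
    using k by blast+
  show "\<And>x. x \<in> mcar M \<Longrightarrow> madd M x (mzero M) = x" using k by metis
qed

lemma kmd_cancel:
  assumes "kmd A M" "x \<in> mcar M" "y \<in> mcar M" "z \<in> mcar M" "madd M x y = madd M x z"
  shows "y = z"
proof -
  note k = kmdD[OF assms(1)]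
  obtain w where w: "w \<in> mcar M" "madd M x w = mzero M" using k(7)[OF assms(2)] by auto
  have "madd M w (madd M x y) = madd M w (madd M x z)" using assms(5) by simp
  thus ?thesis using k(3)[OF w(1) assms(2) assms(3)] k(3)[OF w(1) assms(2) assms(4)] k(4)[OF w(1) assms(2)] w k(5) assms by simp
qed

lemma khom_zero:
  assumes M: "kmd A M" and N: "kmd A N" and f: "khom A M N f"
  shows "f (mzero M) = mzero N"
proof -
  note k = kmdD[OF M] and n = kmdD[OF N]
  have c: "f (mzero M) \<in> mcar N" using f k(1) by (simp add: khom_def)
  have "madd N (f (mzero M)) (f (mzero M)) = f (madd M (mzero M) (mzero M))" using f k(1) unfolding khom_def by metis
  also have "\<dots> = madd N (f (mzero M)) (mzero N)" using k(5)[OF k(1)] n(6)[OF c] by simp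
  finally show ?thesis by (rule kmd_cancel[OF N c c n(1)])
qed

lemma kernel_addsub:
  assumes M: "kmd A M" and N: "kmd A N" and f: "khom A M N f"
  shows "addsub M {x \<in> mcar M. f x = mzero N}"
proof -
  note k = kmdD[OF M] and n = kmdD[OF N]
  have "\<exists>y\<in>mcar M. f y = mzero N \<and> madd M x y = mzero M" if x: "x \<in> mcar M" "f x = mzero N" for x
  proof -
    obtain y where y: "y \<in> mcar M" "madd M x y = mzero M" using k(7)[OF x(1)] by auto
    have "f (madd M x y) = madd N (f x) (f y)" using f x(1) y(1) unfolding khom_def by blast
    hence "f y = mzero N" using x y khom_zero[OF M N f] n(5)[of "f y"] f by (simp add: khom_def)
    thus ?thesis using y by blast
  qed
  moreover have "f (madd M x y) = mzero N" if "x \<in> mcar M" "y \<in> mcar M" "f x = mzero N" "f y = mzero N" for x y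
    using that f n(5)[OF n(1)] unfolding khom_def by metis
  ultimately show ?thesis using k(1,2) khom_zero[OF M N f] unfolding addsub_def by blast
qed

lemma qcos_eqI:
  assumes M: "kmd A M" and N: "addsub M N" and x: "x \<in> mcar M" and n: "n \<in> N"
  shows "qcos M N (madd M x n) = qcos M N x"
proof -
  note k = kmdD[OF M]
  have Nc: "N \<subseteq> mcar M" and Na: "\<And>x y. x \<in> N \<Longrightarrow> y \<in> N \<Longrightarrow> madd M x y \<in> N" using N by (auto simp: addsub_def)
  obtain m where m: "m \<in> N" "madd M n m = mzero M" using N n by (auto simp: addsub_def)
  have "madd M (madd M x n) y \<in> qcos M N x" if "y \<in> N" for y
    using k(3)[OF x, of n y] Na[OF n that] n that Nc by (auto simp: qcos_def)
  moreover have "madd M x y \<in> qcos M N (madd M x n)" if "y \<in> N" for y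
  proof -
    have "madd M (madd M x n) (madd M m y) = madd M x (madd M (madd M n m) y)"
      using k(2,3) x subsetD[OF Nc n] subsetD[OF Nc m(1)] subsetD[OF Nc that] by simp
    also have "\<dots> = madd M x y" using m k(5) that Nc by auto
    finally show ?thesis using Na[OF m(1) that] unfolding qcos_def by (metis (mono_tags, lifting) mem_Collect_eq)
  qed
  ultimately show ?thesis unfolding qcos_def[of M N x] qcos_def[of M N "madd M x n"] by (auto simp: qcos_def)
qed

text \<open>The operations of \<open>qmod\<close> are evaluated at representatives chosen by
  \<open>SOME\<close>; the choice is off by an element of \<open>N\<close>.\<close>

lemma qrep_qcos:
  assumes M: "kmd A M" and N: "addsub M N" and x: "x \<in> mcar M"
  obtains n where "n \<in> N" "qrep (qcos M N x) = madd M x n"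
proof -
  have "madd M x (mzero M) \<in> qcos M N x" using N by (auto simp: qcos_def addsub_def)
  hence "qrep (qcos M N x) \<in> qcos M N x" unfolding qrep_def by (rule someI[of "\<lambda>y. y \<in> qcos M N x"])
  thus ?thesis using that by (auto simp: qcos_def)
qed

lemma qrep_car:
  assumes M: "kmd A M" and N: "addsub M N" and x: "x \<in> mcar M"
  shows "qrep (qcos M N x) \<in> mcar M" "qcos M N (qrep (qcos M N x)) = qcos M N x"
proof -
  obtain n where n: "n \<in> N" "qrep (qcos M N x) = madd M x n" by (rule qrep_qcos[OF assms])
  have "n \<in> mcar M" using n N by (auto simp: addsub_def)
  thus "qrep (qcos M N x) \<in> mcar M" "qcos M N (qrep (qcos M N x)) = qcos M N x"
    using n kmdD(2)[OF M x] qcos_eqI[OF M N x n(1)] by auto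
qed

lemma qmod_add:
  assumes M: "kmd A M" and N: "addsub M N" and x: "x \<in> mcar M" "y \<in> mcar M"
  shows "madd (qmod M N) (qcos M N x) (qcos M N y) = qcos M N (madd M x y)"
proof -
  note k = kmdD[OF M]
  obtain n where n: "n \<in> N" "qrep (qcos M N x) = madd M x n" by (rule qrep_qcos[OF M N x(1)])
  obtain m where m: "m \<in> N" "qrep (qcos M N y) = madd M y m" by (rule qrep_qcos[OF M N x(2)])
  have c: "n \<in> mcar M" "m \<in> mcar M" and nm: "madd M n m \<in> N" using n m N by (auto simp: addsub_def)
  have "madd M (madd M x n) (madd M y m) = madd M x (madd M n (madd M y m))" using k(2,3) x c by simp
  also have "madd M n (madd M y m) = madd M y (madd M n m)" using k(3,4) x c by metis
  also have "madd M x (madd M y (madd M n m)) = madd M (madd M x y) (madd M n m)" using k(2,3) x c by simp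
  finally show ?thesis using qcos_eqI[OF M N k(2)[OF x] nm] by (simp add: qmod_def n m)
qed

lemma qmod_kmd:
  assumes M: "kmd A M" and N: "addsub M N"
  shows "kmd A (qmod M N)"
proof -
  note k = kmdD[OF M] and q = qmod_add[OF M N]
  have car: "mcar (qmod M N) = qcos M N ` mcar M" and z: "mzero (qmod M N) = qcos M N (mzero M)" by (auto simp: qmod_def)
  have inv: "\<exists>y\<in>mcar M. madd (qmod M N) (qcos M N x) (qcos M N y) = qcos M N (mzero M)" if "x \<in> mcar M" for x
    using k(7)[OF that] q[OF that] by metis
  show ?thesis unfolding kmd_def car z
  proof (intro conjI ballI allI)
    show "msmul (qmod M N) c X \<in> qcos M N ` mcar M" if "X \<in> qcos M N ` mcar M" for c X
      using that qrep_car(1)[OF M N] k(8) by (auto simp: qmod_def)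
    show "mact (qmod M N) a X \<in> qcos M N ` mcar M" if "a \<in> A" "X \<in> qcos M N ` mcar M" for a X
      using that qrep_car(1)[OF M N] k(9) by (auto simp: qmod_def)
  qed (use k q inv in auto)
qed

text \<open>A homomorphism that vanishes on \<open>N\<close> does not see which representatives
  \<open>qmod\<close> uses.\<close>

lemma qmod_hom:
  assumes M: "kmd A M" and N: "addsub M N" and T: "kmd A T" and f: "khom A M T f"
    and n0: "\<And>n. n \<in> N \<Longrightarrow> f n = mzero T"
  shows "x \<in> mcar M \<Longrightarrow> f (qrep (qcos M N x)) = f x" "khom A (qmod M N) T (\<lambda>X. f (qrep X))"
    "(\<lambda>X. f (qrep X)) ` mcar (qmod M N) = f ` mcar M"
proof -
  note k = kmdD[OF M] and t = kmdD[OF T]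
  have ff: "\<And>x. x \<in> mcar M \<Longrightarrow> f x \<in> mcar T" "\<And>x y. x \<in> mcar M \<Longrightarrow> y \<in> mcar M \<Longrightarrow> f (madd M x y) = madd T (f x) (f y)"
    "\<And>c x. x \<in> mcar M \<Longrightarrow> f (msmul M c x) = msmul T c (f x)" "\<And>a x. a \<in> A \<Longrightarrow> x \<in> mcar M \<Longrightarrow> f (mact M a x) = mact T a (f x)"
    using f by (auto simp: khom_def)
  have r: "f (qrep (qcos M N x)) = f x" if x: "x \<in> mcar M" for x
  proof -
    obtain n where n: "n \<in> N" "qrep (qcos M N x) = madd M x n" by (rule qrep_qcos[OF M N x])
    have "n \<in> mcar M" using n N by (auto simp: addsub_def)
    thus ?thesis using n ff(2)[OF x] n0[OF n(1)] t(6)[OF ff(1)[OF x]] by simp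
  qed
  thus "x \<in> mcar M \<Longrightarrow> f (qrep (qcos M N x)) = f x" .
  show "(\<lambda>X. f (qrep X)) ` mcar (qmod M N) = f ` mcar M" using r by (auto simp: qmod_def image_image)
  have car: "mcar (qmod M N) = qcos M N ` mcar M" by (simp add: qmod_def)
  show "khom A (qmod M N) T (\<lambda>X. f (qrep X))" unfolding khom_def car
  proof (intro conjI ballI allI)
    fix X assume "X \<in> qcos M N ` mcar M"
    then obtain x where x: "x \<in> mcar M" "X = qcos M N x" by auto
    note rc = qrep_car[OF M N x(1)]
    show "f (qrep X) \<in> mcar T" using x r ff(1) by simp
    show "f (qrep (msmul (qmod M N) c X)) = msmul T c (f (qrep X))" for c
      using r[OF k(8)[OF rc(1)]] ff(3)[OF rc(1)] x by (simp add: qmod_def)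
    show "f (qrep (mact (qmod M N) a X)) = mact T a (f (qrep X))" if "a \<in> A" for a
      using r[OF k(9)[OF that rc(1)]] ff(4)[OF that rc(1)] x by (simp add: qmod_def)
    fix Y assume "Y \<in> qcos M N ` mcar M"
    then obtain y where y: "y \<in> mcar M" "Y = qcos M N y" by auto
    show "f (qrep (madd (qmod M N) X Y)) = madd T (f (qrep X)) (f (qrep Y))"
      using qmod_add[OF M N x(1) y(1)] r[OF k(2)[OF x(1) y(1)]] ff(2)[OF x(1) y(1)] r x y by simp
  qed
qed

lemma mod_isoI: "khom A M N f \<Longrightarrow> bij_betw f (mcar M) (mcar N) \<Longrightarrow> mod_iso A M N"
  unfolding mod_iso_def khom_def by blast

lemma mod_isoE:
  assumes "mod_iso A M N" obtains f where "khom A M N f" "bij_betw f (mcar M) (mcar N)"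
proof -
  from assms obtain f where f: "bij_betw f (mcar M) (mcar N)"
     "(\<forall>x\<in>mcar M. \<forall>y\<in>mcar M. f (madd M x y) = madd N (f x) (f y))
     \<and> (\<forall>c. \<forall>x\<in>mcar M. f (msmul M c x) = msmul N c (f x))
     \<and> (\<forall>a\<in>A. \<forall>x\<in>mcar M. f (mact M a x) = mact N a (f x))"
    unfolding mod_iso_def by (elim exE conjE) simp
  have "khom A M N f" unfolding khom_def using f(2) bij_betwE[OF f(1)] by simp
  thus ?thesis using that f(1) by simp
qed

text \<open>Cosets are compared through the values of \<open>f\<close>, so scalars and action on the
  quotient are handled without showing separately that they do not depend on
  representatives.\<close>

lemma first_iso:
  assumes M: "kmd A M" and T: "kmd A T" and f: "khom A M T f" and surj: "f ` mcar M = mcar T"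
    and N: "N = {x \<in> mcar M. f x = mzero T}"
  shows "mod_iso A (qmod M N) T"
proof -
  note k = kmdD[OF M] and t = kmdD[OF T]
  have Ns: "addsub M N" unfolding N by (rule kernel_addsub[OF M T f])
  note q = qmod_hom[OF M Ns T f]
  have n0: "\<And>n. n \<in> N \<Longrightarrow> f n = mzero T" by (simp add: N)
  have "inj_on (\<lambda>X. f (qrep X)) (mcar (qmod M N))"
  proof (rule inj_onI)
    fix X Y assume XY: "X \<in> mcar (qmod M N)" "Y \<in> mcar (qmod M N)" "f (qrep X) = f (qrep Y)"
    then obtain x y where x: "x \<in> mcar M" "X = qcos M N x" and y: "y \<in> mcar M" "Y = qcos M N y" by (auto simp: qmod_def)
    have e: "f x = f y" using XY(3) q(1)[OF n0 x(1)] q(1)[OF n0 y(1)] x y by simp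
    obtain z where z: "z \<in> mcar M" "madd M x z = mzero M" using k(7)[OF x(1)] by auto
    have c: "madd M y z \<in> mcar M" by (rule k(2)[OF y(1) z(1)])
    have "f (madd M y z) = madd T (f y) (f z)" "f (madd M x z) = madd T (f x) (f z)"
      using f x(1) y(1) z(1) unfolding khom_def by blast+
    hence "f (madd M y z) = f (madd M x z)" using e by simp
    hence "madd M y z \<in> N" using z c khom_zero[OF M T f] by (simp add: N)
    moreover have "madd M x (madd M y z) = y" using k(3,4,6) x(1) y(1) z by metis
    ultimately show "X = Y" using qcos_eqI[OF M Ns x(1)] x y by metis
  qed
  thus ?thesis using q(2)[OF n0] q(3)[OF n0] surj by (intro mod_isoI[of _ _ _ "\<lambda>X. f (qrep X)"]) (auto simp: bij_betw_def)
qed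

lemma mod_iso_sym:
  assumes M: "kmd A M" and i: "mod_iso A M N"
  shows "mod_iso A N M"
proof -
  note k = kmdD[OF M]
  obtain f where f: "khom A M N f" "bij_betw f (mcar M) (mcar N)" by (rule mod_isoE[OF i])
  let ?g = "inv_into (mcar M) f"
  have g: "?g y \<in> mcar M" "f (?g y) = y" if "y \<in> mcar N" for y
    using that f(2) by (auto simp: bij_betw_def inv_into_into f_inv_into_f)
  have gf: "?g (f x) = x" if "x \<in> mcar M" for x using that f(2) by (auto simp: bij_betw_def)
  have "khom A N M ?g" unfolding khom_def
  proof (intro conjI ballI allI)
    fix x assume x: "x \<in> mcar N"
    show "?g x \<in> mcar M" by (rule g[OF x])
    show "?g (msmul N c x) = msmul M c (?g x)" for c
      using gf[OF k(8)[OF g(1)[OF x], of c]] f(1) g[OF x] by (simp add: khom_def)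
    show "?g (mact N a x) = mact M a (?g x)" if "a \<in> A" for a
      using gf[OF k(9)[OF that g(1)[OF x]]] f(1) g[OF x] that by (simp add: khom_def)
    fix y assume y: "y \<in> mcar N"
    show "?g (madd N x y) = madd M (?g x) (?g y)"
      using gf[OF k(2)[OF g(1)[OF x] g(1)[OF y]]] f(1) g[OF x] g[OF y] by (simp add: khom_def)
  qed
  thus ?thesis using bij_betw_inv_into[OF f(2)] by (rule mod_isoI)
qed

lemma mod_iso_trans:
  assumes "mod_iso A M N" "mod_iso A N R"
  shows "mod_iso A M R"
proof -
  obtain f where f: "khom A M N f" "bij_betw f (mcar M) (mcar N)" by (rule mod_isoE[OF assms(1)])
  obtain g where g: "khom A N R g" "bij_betw g (mcar N) (mcar R)" by (rule mod_isoE[OF assms(2)])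
  have "khom A M R (g \<circ> f)" using f(1) g(1) by (simp add: khom_def)
  thus ?thesis using bij_betw_trans[OF f(2) g(2)] by (rule mod_isoI)
qed

lemma mod_iso_dsum:
  assumes i: "\<And>i. i < n \<Longrightarrow> mod_iso A (M i) (N i)"
  shows "mod_iso A (dsum n M) (dsum n N)"
proof -
  have "\<exists>f. khom A (M i) (N i) f \<and> bij_betw f (mcar (M i)) (mcar (N i))" if "i < n" for i
    using mod_isoE[OF i[OF that]] by blast
  then obtain f where f: "\<And>i. i < n \<Longrightarrow> khom A (M i) (N i) (f i)" "\<And>i. i < n \<Longrightarrow> bij_betw (f i) (mcar (M i)) (mcar (N i))"
    by metis
  define F where "F = (\<lambda>x i. if i < n then f i (x i) else undefined)"
  define F' where "F' = (\<lambda>x i. if i < n then inv_into (mcar (M i)) (f i) (x i) else undefined)"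
  have "khom A (dsum n M) (dsum n N) F"
    unfolding khom_def using f(1) by (auto simp: F_def dsum_def fun_eq_iff khom_def)
  moreover have "bij_betw F (mcar (dsum n M)) (mcar (dsum n N))"
  proof (rule bij_betwI[where g = F'])
    show "F \<in> mcar (dsum n M) \<rightarrow> mcar (dsum n N)" using f(1) by (auto simp: F_def dsum_def khom_def)
    show "F' \<in> mcar (dsum n N) \<rightarrow> mcar (dsum n M)" using f(2) by (auto simp: F'_def dsum_def bij_betw_def inv_into_into)
    show "F' (F x) = x" if "x \<in> mcar (dsum n M)" for x
      using that f(2) by (auto simp: F_def F'_def dsum_def bij_betw_def fun_eq_iff)
    show "F (F' x) = x" if "x \<in> mcar (dsum n N)" for x
      using that f(2) by (auto simp: F_def F'_def dsum_def bij_betw_def fun_eq_iff f_inv_into_f)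
  qed
  ultimately show ?thesis by (rule mod_isoI)
qed

text \<open>A complement of the image of \<open>S\<close> is pulled back along the
  isomorphism.\<close>

lemma semisimple_iso:
  assumes M: "kmd A M" and N: "kmd A N" and i: "mod_iso A M N" and s: "semisimple_mod A N"
  shows "semisimple_mod A M"
  unfolding semisimple_mod_def
proof (intro allI impI)
  note k = kmdD[OF M] and n = kmdD[OF N]
  obtain f where f: "khom A M N f" "bij_betw f (mcar M) (mcar N)" by (rule mod_isoE[OF i])
  have ff: "\<And>x. x \<in> mcar M \<Longrightarrow> f x \<in> mcar N" "\<And>x y. x \<in> mcar M \<Longrightarrow> y \<in> mcar M \<Longrightarrow> f (madd M x y) = madd N (f x) (f y)"
    "\<And>c x. x \<in> mcar M \<Longrightarrow> f (msmul M c x) = msmul N c (f x)" "\<And>a x. a \<in> A \<Longrightarrow> x \<in> mcar M \<Longrightarrow> f (mact M a x) = mact N a (f x)"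
    using f(1) by (auto simp: khom_def)
  note f0 = khom_zero[OF M N f(1)]
  have inj: "x = y" if "f x = f y" "x \<in> mcar M" "y \<in> mcar M" for x y using that f(2) by (auto simp: bij_betw_def inj_on_def)
  fix S assume S: "submodule A M S"
  have Sc: "S \<subseteq> mcar M" using S by (simp add: submodule_def)
  have "submodule A N (f ` S)"
  proof -
    have "madd N (f x) (f y) \<in> f ` S" if "x \<in> S" "y \<in> S" for x y
      using that S ff(2)[of x y] Sc unfolding submodule_def by (metis imageI subsetD)
    moreover have "msmul N c (f x) \<in> f ` S" if "x \<in> S" for c x
      using that S ff(3)[of x c] Sc unfolding submodule_def by (metis imageI subsetD)
    moreover have "mact N a (f x) \<in> f ` S" if "x \<in> S" "a \<in> A" for a x
      using that S ff(4)[of a x] Sc unfolding submodule_def by (metis imageI subsetD)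
    moreover have "mzero N \<in> f ` S" using f0 S unfolding submodule_def by (metis imageI)
    ultimately show ?thesis using Sc ff(1) by (auto simp: submodule_def)
  qed
  then obtain T where T: "submodule A N T" "f ` S \<inter> T = {mzero N}" "{madd N x y | x y. x \<in> f ` S \<and> y \<in> T} = mcar N"
    using s[unfolded semisimple_mod_def, THEN spec, of "f ` S"] by (elim impE exE conjE) simp_all
  let ?T = "{x \<in> mcar M. f x \<in> T}"
  have "submodule A M ?T" unfolding submodule_def
  proof (intro conjI ballI allI)
    show "mzero M \<in> ?T" using k(1) f0 T(1) by (simp add: submodule_def)
    fix x assume "x \<in> ?T"
    hence x: "x \<in> mcar M" "f x \<in> T" by auto
    show "msmul M c x \<in> ?T" for c using k(8)[OF x(1)] ff(3)[OF x(1)] x(2) T(1) by (simp add: submodule_def)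
    show "mact M a x \<in> ?T" if "a \<in> A" for a using that k(9)[OF that x(1)] ff(4)[OF that x(1)] x(2) T(1) by (simp add: submodule_def)
    fix y assume "y \<in> ?T"
    hence y: "y \<in> mcar M" "f y \<in> T" by auto
    show "madd M x y \<in> ?T" using k(2)[OF x(1) y(1)] ff(2)[OF x(1) y(1)] x(2) y(2) T(1) by (simp add: submodule_def)
  qed blast
  moreover have "S \<inter> ?T = {mzero M}"
  proof -
    have "mzero M \<in> S \<inter> ?T" using S T(1) k(1) f0 by (auto simp: submodule_def)
    moreover have "x = mzero M" if "x \<in> S \<inter> ?T" for x
    proof -
      have "f x = mzero N" using that T(2) by blast
      thus ?thesis using inj[of x "mzero M"] that k(1) f0 by simp
    qed
    ultimately show ?thesis by blast
  qed
  moreover have "{madd M x y | x y. x \<in> S \<and> y \<in> ?T} = mcar M"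
  proof -
    have "z \<in> {madd M x y | x y. x \<in> S \<and> y \<in> ?T}" if z: "z \<in> mcar M" for z
    proof -
      have "f z \<in> {madd N x y | x y. x \<in> f ` S \<and> y \<in> T}" unfolding T(3) by (rule ff(1)[OF z])
      then obtain x t where xt: "x \<in> S" "t \<in> T" "f z = madd N (f x) t" by blast
      have "t \<in> mcar N" using xt T(1) by (auto simp: submodule_def)
      then obtain y where y: "y \<in> mcar M" "t = f y" using f(2) by (auto simp: bij_betw_def)
      have xm: "x \<in> mcar M" using xt(1) Sc by blast
      have "f z = f (madd M x y)" using xt(3) y ff(2)[OF xm y(1)] by simp
      hence "z = madd M x y" by (rule inj[OF _ z k(2)[OF xm y(1)]])
      thus ?thesis using xt y by blast
    qed
    moreover have "{madd M x y | x y. x \<in> S \<and> y \<in> ?T} \<subseteq> mcar M" using Sc k(2) by blast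
    ultimately show ?thesis by blast
  qed
  ultimately show "\<exists>T. submodule A M T \<and> S \<inter> T = {mzero M} \<and> {madd M x y |x y. x \<in> S \<and> y \<in> T} = mcar M" by blast
qed

context sect
begin

subsection \<open>The permutation module\<close>

abbreviation W :: "(('g set \<Rightarrow> 'g set) set \<Rightarrow> 'k, 'k, ('g set \<Rightarrow> 'g set) set set \<Rightarrow> 'k) kmod" where
  "W \<equiv> permW H \<Gamma>"

abbreviation wa where "wa \<equiv> mact W"

abbreviation oinv where "oinv a \<equiv> inv\<^bsub>OutG H\<^esub> a"

abbreviation tl where "tl a D \<equiv> (\<lambda>d. outmul H a d) ` D"

abbreviation DD where "DD \<equiv> outcosets H \<Gamma>"

lemma O_closed: "a \<in> Out H \<Longrightarrow> b \<in> Out H \<Longrightarrow> outmul H a b \<in> Out H" "a \<in> Out H \<Longrightarrow> oinv a \<in> Out H" "outid H \<in> Out H"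
  using O.m_closed[of a b] O.inv_closed[of a] O.one_closed by auto

lemma O_assoc: "a \<in> Out H \<Longrightarrow> b \<in> Out H \<Longrightarrow> c \<in> Out H \<Longrightarrow> outmul H (outmul H a b) c = outmul H a (outmul H b c)"
  using O.m_assoc[of a b c] by simp

lemma O_inv: "a \<in> Out H \<Longrightarrow> outmul H a (oinv a) = outid H" "a \<in> Out H \<Longrightarrow> outmul H (oinv a) a = outid H"
  "a \<in> Out H \<Longrightarrow> outmul H (outid H) a = a" "a \<in> Out H \<Longrightarrow> outmul H a (outid H) = a"
  using O.r_inv[of a] O.l_inv[of a] O.l_one[of a] O.r_one[of a] by auto

lemma O_solve: "a \<in> Out H \<Longrightarrow> b \<in> Out H \<Longrightarrow> c \<in> Out H \<Longrightarrow> outmul H a b = c \<longleftrightarrow> b = outmul H (oinv a) c"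
  using O_assoc[of "oinv a" a b] O_assoc[of a "oinv a" c] O_inv O_closed by metis

lemma O_inv_mult: "a \<in> Out H \<Longrightarrow> b \<in> Out H \<Longrightarrow> oinv (outmul H a b) = outmul H (oinv b) (oinv a)"
  using O.inv_mult_group[of a b] by simp

lemma tl_tl: "a \<in> Out H \<Longrightarrow> b \<in> Out H \<Longrightarrow> D \<subseteq> Out H \<Longrightarrow> tl a (tl b D) = tl (outmul H a b) D"
  unfolding image_image by (intro image_cong refl) (use O_assoc in auto)

lemma tl_id: "D \<subseteq> Out H \<Longrightarrow> tl (outid H) D = D"
  using O_inv(3) by (force simp: image_iff)

lemma Gamma_sub: "\<Gamma> \<subseteq> Out H" using Gamma_Out by auto

lemma DD_eq: "DD = (\<lambda>a. tl a \<Gamma>) ` Out H"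
  by (auto simp: outcosets_def)

lemma DD_sub: "D \<in> DD \<Longrightarrow> D \<subseteq> Out H"
  using Gamma_sub O_closed by (auto simp: DD_eq)

lemma finite_DD: "finite DD"
  unfolding DD_eq using finite_Out[OF fH] by simp

lemma tl_DD: "a \<in> Out H \<Longrightarrow> D \<in> DD \<Longrightarrow> tl a D \<in> DD"
proof -
  assume a: "a \<in> Out H" "D \<in> DD"
  then obtain b where b: "b \<in> Out H" "D = tl b \<Gamma>" by (auto simp: DD_eq)
  show "tl a D \<in> DD" unfolding b(2) tl_tl[OF a(1) b(1) Gamma_sub] DD_eq using O_closed(1)[OF a(1) b(1)] by blast
qed

lemma tl_inv: "a \<in> Out H \<Longrightarrow> D \<subseteq> Out H \<Longrightarrow> tl (oinv a) (tl a D) = D" "a \<in> Out H \<Longrightarrow> D \<subseteq> Out H \<Longrightarrow> tl a (tl (oinv a) D) = D"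
  by (simp_all add: tl_tl O_closed O_inv tl_id)

lemma tl_Gamma_iff: "a \<in> Out H \<Longrightarrow> tl a \<Gamma> = \<Gamma> \<longleftrightarrow> a \<in> \<Gamma>"
proof
  assume a: "a \<in> Out H"
  { assume "tl a \<Gamma> = \<Gamma>"
    moreover have "outmul H a (outid H) \<in> tl a \<Gamma>" using subgroup.one_closed[OF Gamma_subgroup] by simp
    ultimately show "a \<in> \<Gamma>" using O_inv(4)[OF a] by simp }
  { assume g: "a \<in> \<Gamma>"
    have "tl a \<Gamma> \<subseteq> \<Gamma>" "tl (oinv a) \<Gamma> \<subseteq> \<Gamma>" using Gamma_mult g Gamma_inv by auto
    hence "tl a (tl (oinv a) \<Gamma>) \<subseteq> tl a \<Gamma>" by (intro image_mono)
    thus "tl a \<Gamma> = \<Gamma>" using \<open>tl a \<Gamma> \<subseteq> \<Gamma>\<close> tl_inv(2)[OF a Gamma_sub] by simp }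
qed

text \<open>Left translation by a single \<open>a\<close> in function form. The cut-off outside
  \<open>DD\<close> makes the result an element of \<open>W\<close> for every argument.\<close>

definition wt :: "('g set \<Rightarrow> 'g set) set \<Rightarrow> (('g set \<Rightarrow> 'g set) set set \<Rightarrow> 'k) \<Rightarrow> (('g set \<Rightarrow> 'g set) set set \<Rightarrow> 'k)" where
  "wt a w = (\<lambda>D. if D \<in> DD then w (tl (oinv a) D) else 0)"

lemma wt_linear: "wt a (w + w') = wt a w + wt a w'" "wt a (fscale c w) = fscale c (wt a w)" "wt a 0 = 0"
  by (auto simp: wt_def fun_eq_iff)

lemma wt_wt: "a \<in> Out H \<Longrightarrow> b \<in> Out H \<Longrightarrow> wt a (wt b w) = wt (outmul H a b) w"
  unfolding wt_def using tl_DD[OF O_closed(2)[of a]] tl_tl[OF O_closed(2)[of b] O_closed(2)[of a] DD_sub]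
  by (simp add: fun_eq_iff O_inv_mult)

lemma W_simps: "mcar W = {w. \<forall>D. D \<notin> DD \<longrightarrow> w D = 0}" "mzero W = 0" "madd W = (+)" "msmul W = fscale"
  by (auto simp: permW_def fun_eq_iff)

lemma W_subspace: "fv.subspace (mcar W)"
  by (auto simp: W_simps fv.subspace_def)

lemma wt_id: "w \<in> mcar W \<Longrightarrow> wt (outid H) w = w"
proof -
  assume w: "w \<in> mcar W"
  have "oinv (outid H) = outid H" using O.inv_one by simp
  thus ?thesis using w tl_id[OF DD_sub] by (auto simp: wt_def W_simps fun_eq_iff)
qed

lemma wt_car: "wt a w \<in> mcar W"
  by (simp add: wt_def W_simps)

text \<open>For fixed \<open>a\<close> the inner sum in \<open>permW\<close> can be nonzero only at
  the coset \<open>a^-1 D\<close>.\<close>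

lemma wa_wt: "wa f w = (\<Sum>a\<in>Out H. fscale (f a) (wt a w))"
proof
  fix D
  have "(\<Sum>D'\<in>DD. if tl a D' = D then f a * w D' else 0) = f a * wt a w D" if a: "a \<in> Out H" for a
  proof (cases "D \<in> DD")
    case True
    have "tl a D' = D \<longleftrightarrow> D' = tl (oinv a) D" if "D' \<in> DD" for D'
      using tl_inv[OF a] DD_sub[OF that] DD_sub[OF True] by metis
    hence "(\<Sum>D'\<in>DD. if tl a D' = D then f a * w D' else 0) = (\<Sum>D'\<in>DD. if D' = tl (oinv a) D then f a * w D' else 0)"
      by (intro sum.cong refl) simp
    thus ?thesis using finite_DD tl_DD[OF O_closed(2)[OF a] True] True by (simp add: wt_def)
  next
    case False
    have "tl a D' \<noteq> D" if "D' \<in> DD" for D' using tl_DD[OF a that] False by auto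
    thus ?thesis using False by (simp add: wt_def)
  qed
  thus "wa f w D = (\<Sum>a\<in>Out H. fscale (f a) (wt a w)) D" by (simp add: permW_def sum_fun)
qed

lemma wa_car: "wa f w \<in> mcar W"
  unfolding wa_wt by (intro fv.subspace_sum[OF W_subspace] fv.subspace_scale[OF W_subspace] wt_car)

lemma wa_add: "wa f (w + w') = wa f w + wa f w'"
  by (rule ext) (simp add: wa_wt wt_linear sum_fun distrib_left sum.distrib)

lemma wa_scale: "wa f (fscale c w) = fscale c (wa f w)"
proof
  fix D
  have "wa f (fscale c w) D = (\<Sum>a\<in>Out H. f a * (c * wt a w D))" unfolding wa_wt wt_linear sum_fun ..
  also have "\<dots> = c * (\<Sum>a\<in>Out H. f a * wt a w D)" by (simp only: sum_distrib_left mult.left_commute)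
  finally show "wa f (fscale c w) D = fscale c (wa f w) D" unfolding wa_wt sum_fun .
qed

lemma wa_zero: "wa f 0 = 0"
  by (simp add: wa_wt wt_linear sum_fun fun_eq_iff)

lemma wa_add_left: "wa (f + g) w = wa f w + wa g w"
  by (rule ext) (simp add: wa_wt sum_fun distrib_right sum.distrib)

lemma wa_scale_left: "wa (fscale c f) w = fscale c (wa f w)"
proof
  fix D
  have "wa (fscale c f) w D = (\<Sum>a\<in>Out H. c * f a * wt a w D)" unfolding wa_wt sum_fun ..
  also have "\<dots> = c * (\<Sum>a\<in>Out H. f a * wt a w D)" by (simp only: sum_distrib_left mult.assoc)
  finally show "wa (fscale c f) w D = fscale c (wa f w) D" unfolding wa_wt sum_fun .
qed

lemma wa_conv: "wa (conv H f g) w = wa f (wa g w)"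
proof
  fix D
  have s: "wt a (\<Sum>b\<in>Out H. F b) = (\<Sum>b\<in>Out H. wt a (F b))" for a and F :: "_ \<Rightarrow> _ \<Rightarrow> 'k"
    unfolding wt_def sum_fun by (intro ext) simp
  have "wa f (wa g w) D = (\<Sum>a\<in>Out H. \<Sum>b\<in>Out H. f a * (g b * wt (outmul H a b) w D))"
  proof -
    have "wa f (wa g w) = (\<Sum>a\<in>Out H. fscale (f a) (\<Sum>b\<in>Out H. fscale (g b) (wt (outmul H a b) w)))"
      unfolding wa_wt s wt_linear by (intro sum.cong refl arg_cong[where f = "fscale _"]) (simp add: wt_wt)
    thus ?thesis unfolding sum_fun sum_distrib_left by (rule fun_cong)
  qed
  moreover have "wa (conv H f g) w D = (\<Sum>p\<in>Out H. \<Sum>a\<in>Out H. \<Sum>b\<in>Out H. if outmul H a b = p then f a * g b * wt p w D else 0)"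
    unfolding wa_wt conv_def sum_fun sum_distrib_right by (intro sum.cong refl) simp
  moreover have "\<dots> = (\<Sum>a\<in>Out H. \<Sum>p\<in>Out H. \<Sum>b\<in>Out H. if outmul H a b = p then f a * g b * wt p w D else 0)"
    by (rule sum.swap)
  moreover have "\<dots> = (\<Sum>a\<in>Out H. \<Sum>b\<in>Out H. \<Sum>p\<in>Out H. if outmul H a b = p then f a * g b * wt p w D else 0)"
    by (rule sum.cong[OF refl], rule sum.swap)
  moreover have "\<dots> = (\<Sum>a\<in>Out H. \<Sum>b\<in>Out H. f a * g b * wt (outmul H a b) w D)"
    using finite_Out[OF fH] O_closed(1) by (intro sum.cong refl) simp
  ultimately show "wa (conv H f g) w D = wa f (wa g w) D" by (simp add: mult.assoc)
qed

section \<open>The trivial coset as a generator of the permutation module\<close>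

definition odelta :: "('g set \<Rightarrow> 'g set) set \<Rightarrow> ('g set \<Rightarrow> 'g set) set \<Rightarrow> 'k" where
  "odelta a = (\<lambda>p. if p = a then 1 else 0)"

lemma odelta_kOut: "a \<in> Out H \<Longrightarrow> odelta a \<in> kOut H"
  by (auto simp: odelta_def kOut_def)

lemma wa_odelta: "a \<in> Out H \<Longrightarrow> wa (odelta a) w = wt a w"
proof -
  assume a: "a \<in> Out H"
  have "wa (odelta a) w = (\<Sum>b\<in>Out H. if b = a then wt b w else 0)"
    unfolding wa_wt by (intro sum.cong refl) (auto simp: odelta_def fun_eq_iff)
  thus ?thesis using a finite_Out[OF fH] by simp
qed

definition w0 :: "('g set \<Rightarrow> 'g set) set set \<Rightarrow> 'k" where "w0 = (\<lambda>D. if D = \<Gamma> then 1 else 0)"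

lemma Gamma_DD: "\<Gamma> \<in> DD"
  unfolding DD_eq using tl_id[OF Gamma_sub] O_closed(3) by (metis rev_image_eqI)

lemma w0_car: "w0 \<in> mcar W"
  using Gamma_DD by (auto simp: w0_def W_simps)

lemma wa_w0: 
  assumes o: "p \<in> Out H"
  shows "wa f w0 (tl p \<Gamma>) = (\<Sum>a\<in>Out H. if outmul H (oinv a) p \<in> \<Gamma> then f a else 0)"
proof -
  have "wt a w0 (tl p \<Gamma>) = (if outmul H (oinv a) p \<in> \<Gamma> then 1 else 0)" if a: "a \<in> Out H" for a
    using o a tl_Gamma_iff[OF O_closed(1)[OF O_closed(2)[OF a] o]] by (simp add: wt_def w0_def DD_eq tl_tl O_closed Gamma_sub)
  thus ?thesis unfolding wa_wt sum_fun by (intro sum.cong refl) simp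
qed

lemma piB_sG: "piB H sG = (\<lambda>p. if p \<in> \<Gamma> then 1 else 0)"
proof -
  have "piB H sG = (\<Sum>\<gamma>\<in>\<Gamma>. piB H (isoEl H \<gamma>))" unfolding sG_def by (rule piB_sum[OF fH]) (rule isoEl_kB[OF fH Gamma_Out])
  also have "\<dots> = (\<Sum>\<gamma>\<in>\<Gamma>. (\<lambda>p. if p = \<gamma> then 1 else 0))" by (intro sum.cong refl piB_isoEl[OF fH] Gamma_Out)
  finally show ?thesis using finite_Gamma by (simp add: sum_fun)
qed

text \<open>Reading the value at the coset \<open>p \<Gamma>\<close> as a coefficient at
  \<open>p\<close> identifies \<open>W\<close> with the left ideal of the group algebra generated by
  the sum over \<Gamma>, and \<open>w0\<close> with that sum.\<close>

lemma wa_w0_conv: "p \<in> Out H \<Longrightarrow> wa f w0 (tl p \<Gamma>) = conv H f (piB H sG) p"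
proof -
  assume p: "p \<in> Out H"
  have "(\<Sum>b\<in>Out H. if outmul H a b = p then f a * (if b \<in> \<Gamma> then 1 else 0) else 0) = (if outmul H (oinv a) p \<in> \<Gamma> then f a else 0)" if a: "a \<in> Out H" for a
  proof -
    have "(\<Sum>b\<in>Out H. if outmul H a b = p then f a * (if b \<in> \<Gamma> then 1 else 0) else 0) = 
       (\<Sum>b\<in>Out H. if b = outmul H (oinv a) p then f a * (if b \<in> \<Gamma> then 1 else 0) else 0)"
      using O_solve[OF a _ p] by (intro sum.cong refl) simp
    thus ?thesis using finite_Out[OF fH] O_closed(1)[OF O_closed(2)[OF a] p] by simp
  qed
  thus ?thesis unfolding wa_w0[OF p] conv_def piB_sG by (intro sum.cong refl) simp
qed

lemma wa_w0_zero_iff: "wa f w0 = 0 \<longleftrightarrow> conv H f (piB H sG) = 0"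
proof -
  have "wa f w0 = 0 \<longleftrightarrow> (\<forall>D\<in>DD. wa f w0 D = 0)"
    using wa_car[of f w0] by (auto simp: W_simps fun_eq_iff)
  also have "\<dots> \<longleftrightarrow> (\<forall>p\<in>Out H. conv H f (piB H sG) p = 0)" using wa_w0_conv unfolding DD_eq by auto
  also have "\<dots> \<longleftrightarrow> conv H f (piB H sG) = 0"
  proof -
    have "conv H f g p = 0" if "p \<notin> Out H" for p and g :: "_ \<Rightarrow> 'k"
      unfolding conv_def using that O_closed(1) by (intro sum.neutral ballI) auto
    thus ?thesis by (auto simp: fun_eq_iff)
  qed
  finally show ?thesis .
qed

text \<open>This links the form to the functor: right multiplication by the sum over \<Gamma> is
  replaced by application to \<open>w0\<close>, so the radical condition says that
  \<open>\<alpha> \<otimes> w0\<close> is annihilated in the sense of \<open>JHV\<close>.\<close>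

lemma radical_elt_w0: "radical_elt \<alpha> \<longleftrightarrow> (\<forall>\<psi>\<in>kB H G. wa (piB H (bcomp H G H \<psi> \<alpha>)) w0 = 0)"
  unfolding radical_elt_def wa_w0_zero_iff bcomp_assoc[OF fH fG fH fH, symmetric] piB_bcomp[OF fH bcomp_kB[OF fH fG fH] sG_kB] ..

lemma piB_surj:
  fixes f :: "_ \<Rightarrow> 'k"
  assumes "f \<in> kOut H"
  shows "\<exists>b\<in>kB H H. piB H b = f"
proof
  let ?b = "\<Sum>a\<in>Out H. fscale (f a) (isoEl H a)"
  show "?b \<in> kB H H" by (rule fv.subspace_sum[OF kB_subspace], rule fv.subspace_scale[OF kB_subspace], rule isoEl_kB[OF fH])
  have "piB H ?b = (\<Sum>a\<in>Out H. piB H (fscale (f a) (isoEl H a)))"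
    by (rule piB_sum[OF fH], rule fv.subspace_scale[OF kB_subspace], rule isoEl_kB[OF fH])
  also have "\<dots> = (\<Sum>a\<in>Out H. fscale (f a) (\<lambda>p. if p = a then 1 else 0))"
    by (intro sum.cong refl) (simp add: piB_scale[OF fH isoEl_kB[OF fH]] piB_isoEl[OF fH])
  also have "\<dots> = f"
  proof
    fix p
    have "(\<Sum>a\<in>Out H. fscale (f a) (\<lambda>p. if p = a then 1 else 0)) p = (\<Sum>a\<in>Out H. if p = a then f a else 0)"
      unfolding sum_fun by (intro sum.cong refl) simp
    thus "(\<Sum>a\<in>Out H. fscale (f a) (\<lambda>p. if p = a then 1 else 0)) p = f p"
      using assms finite_Out[OF fH] by (auto simp: kOut_def)
  qed
  finally show "piB H ?b = f" .
qed

lemma w0_generates: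
  assumes w: "w \<in> mcar W"
  shows "\<exists>b\<in>kB H H. w = wa (piB H b) w0"
proof -
  \<comment> \<open>Each coset is hit by \<open>|\<Gamma>|\<close> group elements, so its value is
    divided evenly among them.\<close>
  define f where "f = (\<lambda>a. if a \<in> Out H then w (tl a \<Gamma>) / of_nat (card \<Gamma>) else 0)"
  have "f \<in> kOut H" by (simp add: f_def kOut_def)
  then obtain b where b: "b \<in> kB H H" "piB H b = f" using piB_surj by blast
  have "wa f w0 D = w D" for D
  proof (cases "D \<in> DD")
    case True
    then obtain p where p: "p \<in> Out H" "D = tl p \<Gamma>" by (auto simp: DD_eq)
    have c: "tl a \<Gamma> = tl p \<Gamma>" if "a \<in> Out H" "outmul H (oinv a) p \<in> \<Gamma>" for a
    proof -
      have "tl (oinv a) (tl p \<Gamma>) = \<Gamma>" using that p tl_tl[OF O_closed(2) _ Gamma_sub] tl_Gamma_iff O_closed by simp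
      thus ?thesis using tl_inv(2)[OF that(1) DD_sub[OF True]] p(2) by simp
    qed
    have "wa f w0 D = (\<Sum>a\<in>Out H. if outmul H (oinv a) p \<in> \<Gamma> then w D / of_nat (card \<Gamma>) else 0)"
      unfolding p(2) wa_w0[OF p(1)] using c by (intro sum.cong refl) (simp add: f_def)
    also have "\<dots> = (\<Sum>a\<in>{a\<in>Out H. outmul H (oinv a) p \<in> \<Gamma>}. w D / of_nat (card \<Gamma>))"
      by (rule sum.inter_filter[OF finite_Out[OF fH], symmetric])
    also have "\<dots> = w D"
    proof -
      have "card {a\<in>Out H. outmul H (oinv a) p \<in> \<Gamma>} = card \<Gamma>"
      proof (rule bij_betw_same_card[of "\<lambda>a. outmul H (oinv a) p"], rule bij_betwI[where g = "\<lambda>\<gamma>. outmul H p (oinv \<gamma>)"])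
        have ii: "oinv (oinv a) = a" if "a \<in> Out H" for a using O.inv_inv[of a] that by simp
        have 1: "outmul H (oinv (outmul H p (oinv g))) p = g" if g: "g \<in> Out H" for g
          using O_inv_mult[OF p(1) O_closed(2)[OF g]] ii[OF g] O_assoc[OF g O_closed(2)[OF p(1)] p(1)] O_inv p(1) g by simp
        show "(\<lambda>a. outmul H (oinv a) p) \<in> {a\<in>Out H. outmul H (oinv a) p \<in> \<Gamma>} \<rightarrow> \<Gamma>" by auto
        show "(\<lambda>\<gamma>. outmul H p (oinv \<gamma>)) \<in> \<Gamma> \<rightarrow> {a\<in>Out H. outmul H (oinv a) p \<in> \<Gamma>}"
          using 1 O_closed p(1) Gamma_Out by auto
        show "outmul H (oinv (outmul H p (oinv \<gamma>))) p = \<gamma>" if "\<gamma> \<in> \<Gamma>" for \<gamma> using 1 Gamma_Out[OF that] by simp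
        show "outmul H p (oinv (outmul H (oinv a) p)) = a" if "a \<in> {a\<in>Out H. outmul H (oinv a) p \<in> \<Gamma>}" for a
          using O_inv_mult[OF O_closed(2) p(1), of a] ii[of a] O_assoc[OF p(1) O_closed(2)[OF p(1)], of a] O_inv that p(1) by simp
      qed
      thus ?thesis using Gamma_nz by simp
    qed
    finally show ?thesis .
  next
    case False
    thus ?thesis using wa_car[of f w0] w by (simp add: W_simps)
  qed
  hence "w = wa (piB H b) w0" unfolding b(2) by (intro ext) simp
  thus ?thesis using b(1) by blast
qed

lemma kOut_submodule:
  assumes "submodule (kOut H) W U"
  shows "fv.subspace U" "U \<subseteq> mcar W" "\<And>f w. f \<in> kOut H \<Longrightarrow> w \<in> U \<Longrightarrow> wa f w \<in> U"
  using assms by (auto simp: submodule_def W_simps fv.subspace_def)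

subsection \<open>Maschke's theorem\<close>

text \<open>A linear projection \<open>q\<close> onto \<open>U\<close> is averaged over
  \<open>Out H\<close>. Both \<open>q\<close> and the translations are defined on all functions, so
  the averaged \<open>p\<close> commutes with \<open>wa\<close> on the whole function space and not
  only on \<open>W\<close>.\<close>

lemma maschke:
  assumes U: "submodule (kOut H) W U"
  shows "\<exists>p. (\<forall>w w'. p (w + w') = p w + p w') \<and> (\<forall>c w. p (fscale c w) = fscale c (p w)) \<and>
    (\<forall>w. p w \<in> U) \<and> (\<forall>w\<in>U. p w = w) \<and> (\<forall>f w. p (wa f w) = wa f (p w))"
proof -
  note u = kOut_submodule[OF U]
  interpret vp: vector_space_pair "fscale :: 'k \<Rightarrow> (('g set \<Rightarrow> 'g set) set set \<Rightarrow> 'k) \<Rightarrow> _" "fscale :: 'k \<Rightarrow> (('g set \<Rightarrow> 'g set) set set \<Rightarrow> 'k) \<Rightarrow> _" ..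
  have "\<exists>q. q ` UNIV \<subseteq> U \<and> Vector_Spaces.linear fscale fscale q \<and> (\<forall>v\<in>U. q (id v) = v)"
    by (rule vp.linear_exists_left_inverse_on[OF fv.linear_id u(1)]) simp
  then obtain q where q: "\<And>w. q w \<in> U" "Vector_Spaces.linear fscale fscale q" "\<And>v. v \<in> U \<Longrightarrow> q v = v" by auto
  have ql: "q (w + w') = q w + q w'" "q (fscale c w) = fscale c (q w)" for w w' c
    using q(2) by (auto simp: Vector_Spaces.linear_iff)
  let ?n = "of_nat (card (Out H)) :: 'k"
  have nz: "?n \<noteq> 0" using finite_Out[OF fH] O_closed(3) by (auto simp: of_nat_0_iff)
  define S where "S = (\<lambda>w. \<Sum>a\<in>Out H. wt a (q (wt (oinv a) w)))"
  define p where "p = (\<lambda>w. fscale (1/?n) (S w))"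
  have wtU: "wt a w \<in> U" if "a \<in> Out H" "w \<in> U" for a w using u(3)[OF odelta_kOut[OF that(1)] that(2)] wa_odelta[OF that(1)] by simp
  have Sadd: "S (w + w') = S w + S w'" for w w'
    unfolding S_def wt_linear ql sum.distrib ..
  have Sscale: "S (fscale c w) = fscale c (S w)" for c w
    unfolding S_def wt_linear ql by (simp add: sum_fun sum_distrib_left)
  have Swt: "S (wt a w) = wt a (S w)" if a: "a \<in> Out H" for a w
  proof -
    have "S (wt a w) = (\<Sum>b\<in>Out H. wt b (q (wt (outmul H (oinv b) a) w)))"
      unfolding S_def by (intro sum.cong refl) (simp add: wt_wt O_closed a)
    also have "\<dots> = (\<Sum>b\<in>Out H. wt (outmul H a b) (q (wt (oinv b) w)))"
    proof (rule sum.reindex_bij_witness[where i = "outmul H a" and j = "outmul H (oinv a)"])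
      fix b assume b: "b \<in> Out H"
      show e: "outmul H a (outmul H (oinv a) b) = b" using O_assoc[OF a O_closed(2)[OF a] b] O_inv a b by simp
      show "outmul H (oinv a) b \<in> Out H" using O_closed a b by simp
      show "outmul H (oinv a) (outmul H a b) = b" using O_assoc[OF O_closed(2)[OF a] a b] O_inv a b by simp
      show "outmul H a b \<in> Out H" using O_closed a b by simp
      have "oinv (outmul H (oinv a) b) = outmul H (oinv b) a"
        using O_inv_mult[OF O_closed(2)[OF a] b] O.inv_inv[of a] a by simp
      thus "wt (outmul H a (outmul H (oinv a) b)) (q (wt (oinv (outmul H (oinv a) b)) w)) = wt b (q (wt (outmul H (oinv b) a) w))"
        by (simp only: e)
    qed
    also have "\<dots> = (\<Sum>b\<in>Out H. wt a (wt b (q (wt (oinv b) w))))" using a by (intro sum.cong refl) (simp add: wt_wt)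
    also have "\<dots> = wt a (S w)" unfolding S_def by (simp add: wt_def sum_fun fun_eq_iff)
    finally show ?thesis .
  qed
  have Swa: "S (wa f w) = wa f (S w)" for f w
  proof -
    have "S (\<Sum>a\<in>I. fscale (f a) (wt a w)) = (\<Sum>a\<in>I. fscale (f a) (wt a (S w)))" if "finite I" "I \<subseteq> Out H" for I
      using that
    proof (induction I rule: finite_induct)
      case empty
      have "S 0 = 0" using Sscale[of 0 0] by (simp add: zero_fun_def)
      thus ?case by (simp only: sum.empty)
    next
      case (insert a I)
      show ?case using insert Swt[of a w] Sadd Sscale by (simp del: plus_fun_apply)
    qed
    thus ?thesis unfolding wa_wt using finite_Out[OF fH] by simp
  qed
  have SU: "S w \<in> U" for w unfolding S_def by (intro fv.subspace_sum[OF u(1)] wtU q)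
  have Sid: "S w = fscale ?n w" if w: "w \<in> U" for w
  proof -
    have "S w = (\<Sum>a\<in>Out H. w)" unfolding S_def
    proof (intro sum.cong refl)
      fix a assume a: "a \<in> Out H"
      have "wt (oinv a) w \<in> U" using wtU[OF O_closed(2)[OF a] w] .
      thus "wt a (q (wt (oinv a) w)) = w" using q(3) wt_wt[OF a O_closed(2)[OF a]] O_inv(1)[OF a] wt_id w u(2) by auto
    qed
    thus ?thesis by (simp add: sum_fun fun_eq_iff)
  qed
  show ?thesis
  proof (intro exI[of _ p] conjI allI ballI)
    show "p (w + w') = p w + p w'" for w w' by (simp add: p_def Sadd fun_eq_iff add_divide_distrib)
    show "p (fscale c w) = fscale c (p w)" for c w by (simp add: p_def Sscale fun_eq_iff)
    show "p w \<in> U" for w unfolding p_def by (rule fv.subspace_scale[OF u(1) SU])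
    show "p w = w" if "w \<in> U" for w using nz by (simp add: p_def Sid[OF that])
    show "p (wa f w) = wa f (p w)" for f w unfolding p_def Swa wa_scale ..
  qed
qed


subsection \<open>The simple functor quotient as a module of maps\<close>

abbreviation cscale :: "'k \<Rightarrow> ('p \<Rightarrow> 'q \<Rightarrow> 'k) \<Rightarrow> 'p \<Rightarrow> 'q \<Rightarrow> 'k" where
  "cscale c F \<equiv> (\<lambda>\<psi>. fscale c (F \<psi>))"

text \<open>\<open>etens \<phi> w\<close> is the map \<open>\<psi> \<mapsto> \<pi>(\<psi>\<phi>)w\<close>, the image of \<open>\<phi> \<otimes> w\<close> modulo \<open>J\<close>; \<open>evalF\<close> extends it to formal
  combinations, so that its kernel is the preimage of \<open>J\<close>.\<close>

definition etens where
  "etens \<phi> w = (\<lambda>\<psi>. if \<psi> \<in> kB H G then wa (piB H (bcomp H G H \<psi> \<phi>)) w else 0)"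

definition evalF where
  "evalF f = (\<lambda>\<psi>. if \<psi> \<in> kB H G then
     \<Sum>q\<in>{q. f q \<noteq> 0}. fscale (f q) (wa (piB H (bcomp H G H \<psi> (fst q))) (snd q)) else 0)"

text \<open>The left action of \<open>kB G G\<close> on maps, by right composition in the argument.
  Values outside \<open>kB H G\<close> are set to 0, so that equality of functions is equality of
  maps on \<open>kB H G\<close>.\<close>

definition ract where
  "ract a F = (\<lambda>\<psi>. if \<psi> \<in> kB H G then F (bcomp H G G \<psi> a) else 0)"

lemma submod_simps: "mcar (submod W U) = U" "mzero (submod W U) = 0" "madd (submod W U) = (+)"
  "msmul (submod W U) = fscale" "mact (submod W U) = wa"
  by (simp_all add: submod_def W_simps)

lemma etens_add: "etens \<phi> (w + w') = etens \<phi> w + etens \<phi> w'" "etens (\<phi> + \<phi>') w = etens \<phi> w + etens \<phi>' w"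
  by (auto simp: etens_def fun_eq_iff wa_add bcomp_add_right piB_add[OF fH bcomp_kB[OF fH fG fH] bcomp_kB[OF fH fG fH]] wa_add_left simp del: plus_fun_apply, simp_all)

lemma etens_scale: "etens \<phi> (fscale c w) = cscale c (etens \<phi> w)" "etens (fscale c \<phi>) w = cscale c (etens \<phi> w)"
  by (auto simp: etens_def fun_eq_iff wa_scale bcomp_scale_right piB_scale[OF fH bcomp_kB[OF fH fG fH]] wa_scale_left)

lemma etens_0: "etens \<phi> 0 = 0"
  by (auto simp: etens_def fun_eq_iff wa_zero)

lemma etens_bcomp:
  assumes b: "b \<in> kB H H"
  shows "etens (bcomp G H H \<phi> b) w = etens \<phi> (wa (piB H b) w)"
  by (auto simp: etens_def fun_eq_iff bcomp_assoc[OF fH fG fH fH, symmetric]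
     piB_bcomp[OF fH bcomp_kB[OF fH fG fH] b] wa_conv)

lemma ract_etens: "ract a (etens \<phi> w) = etens (bcomp G G H a \<phi>) w"
  by (auto simp: etens_def ract_def fun_eq_iff bcomp_kB[OF fH fG fG] bcomp_assoc[OF fH fG fG fH])

lemma ract_linear: "ract a (F + F') = ract a F + ract a F'" "ract a (cscale c F) = cscale c (ract a F)" "ract a 0 = 0"
  by (auto simp: ract_def fun_eq_iff)

lemma ract_sum: "ract a (\<Sum>i\<in>I. F i :: _ \<Rightarrow> _ \<Rightarrow> 'k) = (\<Sum>i\<in>I. ract a (F i))"
  by (induction I rule: infinite_finite_induct) (simp_all only: sum.infinite sum.empty sum.insert ract_linear not_False_eq_True)

lemma sum_fun2: "(\<Sum>i\<in>I. F i) x y = (\<Sum>i\<in>I. F i x y)"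
  by (simp add: sum_fun)

text \<open>\<open>evalF\<close> sums over the exact support, which changes when combinations are
  added; a common finite superset makes its linearity visible.\<close>

lemma evalF_sup:
  assumes "finite A" "{q. f q \<noteq> 0} \<subseteq> A"
  shows "evalF f = (\<Sum>q\<in>A. cscale (f q) (etens (fst q) (snd q)))"
proof
  fix \<psi>
  have "(\<Sum>q\<in>{q. f q \<noteq> 0}. fscale (f q) (etens (fst q) (snd q) \<psi>)) = (\<Sum>q\<in>A. fscale (f q) (etens (fst q) (snd q) \<psi>))"
    by (rule sum.mono_neutral_left[OF assms]) auto
  moreover have "evalF f \<psi> = (\<Sum>q\<in>{q. f q \<noteq> 0}. fscale (f q) (etens (fst q) (snd q) \<psi>))"
    by (auto simp: evalF_def etens_def sum_fun fun_eq_iff)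
  ultimately show "evalF f \<psi> = (\<Sum>q\<in>A. cscale (f q) (etens (fst q) (snd q))) \<psi>" by (simp add: sum_fun)
qed

lemma evalF_fdelta: "evalF (fdelta (\<phi>, w)) = etens \<phi> w"
proof -
  have "evalF (fdelta (\<phi>, w)) = (\<Sum>q\<in>{(\<phi>,w)}. cscale (fdelta (\<phi>, w) q) (etens (fst q) (snd q)))"
    by (rule evalF_sup) (auto simp: fdelta_def)
  thus ?thesis by (simp add: fdelta_def)
qed

lemma evalF_add: 
  assumes "finite {q. f q \<noteq> 0}" "finite {q. g q \<noteq> 0}"
  shows "evalF (f + g) = evalF f + evalF g"
proof -
  let ?A = "{q. f q \<noteq> 0} \<union> {q. g q \<noteq> 0}"
  have A: "finite ?A" using assms by simp
  have "evalF (f + g) = (\<Sum>q\<in>?A. cscale ((f + g) q) (etens (fst q) (snd q)))" by (rule evalF_sup[OF A]) auto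
  also have "\<dots> = (\<Sum>q\<in>?A. cscale (f q) (etens (fst q) (snd q)) + cscale (g q) (etens (fst q) (snd q)))"
    by (intro sum.cong refl) (simp add: fun_eq_iff distrib_right)
  also have "\<dots> = (\<Sum>q\<in>?A. cscale (f q) (etens (fst q) (snd q))) + (\<Sum>q\<in>?A. cscale (g q) (etens (fst q) (snd q)))"
    by (rule sum.distrib)
  also have "\<dots> = evalF f + evalF g" using evalF_sup[OF A, of f] evalF_sup[OF A, of g] by simp
  finally show ?thesis .
qed

lemma evalF_scale: 
  assumes "finite {q. f q \<noteq> 0}"
  shows "evalF (fscale c f) = cscale c (evalF f)"
proof -
  have "evalF (fscale c f) = (\<Sum>q\<in>{q. f q \<noteq> 0}. cscale (c * f q) (etens (fst q) (snd q)))" by (rule evalF_sup[OF assms]) auto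
  also have "\<dots> = cscale c (evalF f)"
    unfolding evalF_sup[OF assms subset_refl] by (intro ext) (simp only: sum_fun2 sum_distrib_left mult.assoc)
  finally show ?thesis .
qed

lemma evalF_zero: "evalF 0 = 0"
  by (simp add: evalF_def fun_eq_iff)

context
  fixes U assumes U: "submodule (kOut H) W U"
begin

abbreviation "V \<equiv> submod W U"
abbreviation "FF \<equiv> Fsp G H V"

text \<open>The coefficient module is an arbitrary submodule \<open>U\<close> of \<open>W\<close>,
  since both \<open>W\<close> itself and the summands of a decomposition are treated.\<close>

definition "TMap = \<lparr> mcar = evalF ` FF, mzero = 0, madd = (+), msmul = cscale, mact = ract \<rparr>"

lemmas U_sub = kOut_submodule[OF U]

lemma FF_iff: "f \<in> FF \<longleftrightarrow> finite {q. f q \<noteq> 0} \<and> {q. f q \<noteq> 0} \<subseteq> kB G H \<times> U"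
  by (simp add: Fsp_def submod_simps)

lemma FF_subspace: "fv.subspace FF"
  unfolding fv.subspace_def
proof (intro conjI ballI allI)
  show "0 \<in> FF" by (simp add: FF_iff)
  fix f assume f: "f \<in> FF"
  show "fscale c f \<in> FF" for c using f finite_subset[of "{q. fscale c f q \<noteq> 0}" "{q. f q \<noteq> 0}"] by (auto simp: FF_iff)
  fix g assume g: "g \<in> FF"
  have s: "{q. (f + g) q \<noteq> 0} \<subseteq> {q. f q \<noteq> 0} \<union> {q. g q \<noteq> 0}" by auto
  have "finite {q. (f + g) q \<noteq> 0}" by (rule finite_subset[OF s]) (use f g in \<open>simp add: FF_iff\<close>)
  moreover have "{q. f q \<noteq> 0} \<union> {q. g q \<noteq> 0} \<subseteq> kB G H \<times> U" using f g by (simp add: FF_iff)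
  ultimately show "f + g \<in> FF" unfolding FF_iff using s by (meson subset_trans)
qed

lemma FF_fdelta: "\<phi> \<in> kB G H \<Longrightarrow> w \<in> U \<Longrightarrow> fdelta (\<phi>, w) \<in> FF"
  by (auto simp: FF_iff fdelta_def)

lemma Fmod_simps: "mcar (Fmod G H V) = FF" "mzero (Fmod G H V) = 0" "madd (Fmod G H V) = (+)" "msmul (Fmod G H V) = fscale"
  by (auto simp: Fmod_def fun_eq_iff)

text \<open>Formal combinations are pushed forward along
  \<open>(\<phi>,w) \<mapsto> (a \<phi>, w)\<close>. Distinct pairs may collide, so the evaluation
  is regrouped by the fibres of this map.\<close>

lemma Fmod_act:
  assumes f: "f \<in> FF" 
  shows "mact (Fmod G H V) a f \<in> FF" "evalF (mact (Fmod G H V) a f) = ract a (evalF f)"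
proof -
  let ?A = "{q. f q \<noteq> 0}" and ?m = "\<lambda>q. (bcomp G G H a (fst q), snd q)"
  let ?g = "mact (Fmod G H V) a f"
  have A: "finite ?A" "?A \<subseteq> kB G H \<times> U" using f by (auto simp: FF_iff)
  have g: "?g p = (\<Sum>q\<in>{q\<in>?A. ?m q = p}. f q)" for p by (simp add: Fmod_def)
  have sup: "{p. ?g p \<noteq> 0} \<subseteq> ?m ` ?A"
  proof
    fix p assume "p \<in> {p. ?g p \<noteq> 0}"
    hence "{q\<in>?A. ?m q = p} \<noteq> {}" unfolding g by (metis (mono_tags, lifting) mem_Collect_eq sum.empty)
    thus "p \<in> ?m ` ?A" by blast
  qed
  have mA: "finite (?m ` ?A)" using A by simp
  have "?m ` ?A \<subseteq> kB G H \<times> U" using A bcomp_kB[OF fG fG fH] by auto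
  thus "?g \<in> FF" unfolding FF_iff using sup finite_subset[OF sup mA] by blast
  have "evalF ?g = (\<Sum>p\<in>?m ` ?A. cscale (?g p) (etens (fst p) (snd p)))" by (rule evalF_sup[OF mA sup])
  also have "\<dots> = (\<Sum>p\<in>?m ` ?A. \<Sum>q\<in>{q\<in>?A. ?m q = p}. cscale (f q) (etens (fst (?m q)) (snd (?m q))))"
  proof (rule sum.cong[OF refl])
    fix p
    have "cscale (?g p) (etens (fst p) (snd p)) = (\<Sum>q\<in>{q\<in>?A. ?m q = p}. cscale (f q) (etens (fst p) (snd p)))"
      unfolding g by (intro ext) (simp only: sum_fun2 sum_distrib_right)
    also have "\<dots> = (\<Sum>q\<in>{q\<in>?A. ?m q = p}. cscale (f q) (etens (fst (?m q)) (snd (?m q))))" by (intro sum.cong refl) auto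
    finally show "cscale (?g p) (etens (fst p) (snd p)) = (\<Sum>q\<in>{q\<in>?A. ?m q = p}. cscale (f q) (etens (fst (?m q)) (snd (?m q))))" .
  qed
  also have "\<dots> = (\<Sum>q\<in>?A. cscale (f q) (etens (fst (?m q)) (snd (?m q))))"
    by (rule sum.image_gen[OF A(1), symmetric])
  also have "\<dots> = (\<Sum>q\<in>?A. ract a (cscale (f q) (etens (fst q) (snd q))))"
    by (intro sum.cong refl) (simp only: ract_linear ract_etens fst_conv snd_conv)
  also have "\<dots> = ract a (evalF f)" unfolding evalF_sup[OF A(1) subset_refl] ract_sum ..
  finally show "evalF ?g = ract a (evalF f)" .
qed

lemma Fmod_kmd: "kmd (kB G G) (Fmod G H V)"
  unfolding kmd_def Fmod_simps
proof (intro conjI ballI allI)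
  fix x assume x: "x \<in> FF"
  show "\<exists>y\<in>FF. x + y = 0"
    by (rule bexI[OF _ fv.subspace_neg[OF FF_subspace x]]) simp
  show "mact (Fmod G H V) a x \<in> FF" for a by (rule Fmod_act(1)[OF x])
qed (use fv.subspace_0[OF FF_subspace] fv.subspace_add[OF FF_subspace] fv.subspace_scale[OF FF_subspace] in \<open>auto simp: add.assoc add.commute simp del: plus_fun_apply zero_fun_apply\<close>)

lemma TMap_simps: "mcar TMap = evalF ` FF" "mzero TMap = 0" "madd TMap = (+)" "msmul TMap = cscale" "mact TMap = ract"
  by (simp_all add: TMap_def)

lemma evalF_lin:
  "f \<in> FF \<Longrightarrow> g \<in> FF \<Longrightarrow> evalF (f + g) = evalF f + evalF g" "f \<in> FF \<Longrightarrow> evalF (fscale c f) = cscale c (evalF f)"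
  by (auto simp: FF_iff evalF_add evalF_scale)

lemma TMap_closed: "0 \<in> mcar TMap" "F \<in> mcar TMap \<Longrightarrow> F' \<in> mcar TMap \<Longrightarrow> F + F' \<in> mcar TMap"
  "F \<in> mcar TMap \<Longrightarrow> cscale c F \<in> mcar TMap" "F \<in> mcar TMap \<Longrightarrow> ract a F \<in> mcar TMap"
  "\<phi> \<in> kB G H \<Longrightarrow> w \<in> U \<Longrightarrow> etens \<phi> w \<in> mcar TMap"
proof -
  show "0 \<in> mcar TMap" unfolding TMap_simps using evalF_zero fv.subspace_0[OF FF_subspace] by (metis imageI)
  { fix F F' assume "F \<in> mcar TMap" "F' \<in> mcar TMap"
    then obtain f g where f: "f \<in> FF" "F = evalF f" and g: "g \<in> FF" "F' = evalF g" unfolding TMap_simps by blast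
    show "F + F' \<in> mcar TMap"
      unfolding TMap_simps f(2) g(2) evalF_lin(1)[OF f(1) g(1), symmetric] by (rule imageI[OF fv.subspace_add[OF FF_subspace f(1) g(1)]]) }
  { fix F assume "F \<in> mcar TMap"
    then obtain f where f: "f \<in> FF" "F = evalF f" unfolding TMap_simps by blast
    show "cscale c F \<in> mcar TMap"
      unfolding TMap_simps f(2) evalF_lin(2)[OF f(1), symmetric] by (rule imageI[OF fv.subspace_scale[OF FF_subspace f(1)]])
    show "ract a F \<in> mcar TMap"
      unfolding TMap_simps f(2) Fmod_act(2)[OF f(1), symmetric] by (rule imageI[OF Fmod_act(1)[OF f(1)]]) }
  show "\<phi> \<in> kB G H \<Longrightarrow> w \<in> U \<Longrightarrow> etens \<phi> w \<in> mcar TMap"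
    unfolding TMap_simps using FF_fdelta evalF_fdelta by (metis imageI)
qed

lemma TMap_kmd: "kmd (kB G G) TMap"
  unfolding kmd_def
proof (intro conjI ballI allI)
  fix x assume x: "x \<in> mcar TMap"
  show "\<exists>y\<in>mcar TMap. madd TMap x y = mzero TMap"
    by (rule bexI[OF _ TMap_closed(3)[OF x, of "-1"]]) (auto simp: TMap_simps fun_eq_iff)
qed (use TMap_closed in \<open>auto simp: TMap_simps(2-5) add.assoc add.commute simp del: plus_fun_apply zero_fun_apply\<close>)

lemma evalF_hom: "khom (kB G G) (Fmod G H V) TMap evalF"
  unfolding khom_def Fmod_simps TMap_simps using evalF_lin Fmod_act by auto

text \<open>Scalars are absorbed into \<open>w\<close>, which leaves the addition of one
  \<open>etens\<close> term as the only step.\<close>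

lemma TMap_induct [consumes 1, case_names zero add]:
  assumes F: "F \<in> mcar TMap" and z: "Pr 0" and s: "\<And>\<phi> w F. \<phi> \<in> kB G H \<Longrightarrow> w \<in> U \<Longrightarrow> F \<in> mcar TMap \<Longrightarrow> Pr F \<Longrightarrow> Pr (etens \<phi> w + F)"
  shows "Pr F"
proof -
  obtain f where f: "f \<in> FF" "F = evalF f" using F by (auto simp: TMap_simps)
  let ?A = "{q. f q \<noteq> 0}"
  have A: "finite ?A" "?A \<subseteq> kB G H \<times> U" using f by (auto simp: FF_iff)
  have "(\<Sum>q\<in>B. cscale (f q) (etens (fst q) (snd q))) \<in> mcar TMap \<and> Pr (\<Sum>q\<in>B. cscale (f q) (etens (fst q) (snd q)))" if "finite B" "B \<subseteq> kB G H \<times> U" for B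
    using that
  proof (induction B rule: finite_induct)
    case empty
    show ?case unfolding sum.empty using TMap_closed(1) z by blast
  next
    case (insert q B)
    let ?S = "\<Sum>q\<in>B. cscale (f q) (etens (fst q) (snd q))"
    have S: "?S \<in> mcar TMap" "Pr ?S" using insert by auto
    have q: "fst q \<in> kB G H" "fscale (f q) (snd q) \<in> U" using insert fv.subspace_scale[OF U_sub(1)] by auto
    have "(\<Sum>q\<in>insert q B. cscale (f q) (etens (fst q) (snd q))) = etens (fst q) (fscale (f q) (snd q)) + ?S"
      using insert by (simp add: etens_scale del: plus_fun_apply)
    thus ?case using TMap_closed(2)[OF TMap_closed(5)[OF q] S(1)] s[OF q S] by (simp only:)
  qed
  thus ?thesis unfolding f(2) evalF_sup[OF A(1) subset_refl] using A by blast
qed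

text \<open>The elements of the model are \<open>kB(H,H)\<close>-linear maps from
  \<open>kB(H,G)\<close> to \<open>U\<close>, extended by 0; each property is additive and holds for
  \<open>etens\<close>. The linearity is what makes the span of the values of a submodule stable
  under \<open>Out H\<close>.\<close>

lemma TMap_vals:
  assumes "F \<in> mcar TMap"
  shows "F \<psi> \<in> U" "\<psi> \<notin> kB H G \<Longrightarrow> F \<psi> = 0" "\<psi> \<in> kB H G \<Longrightarrow> b \<in> kB H H \<Longrightarrow> wa (piB H b) (F \<psi>) = F (bcomp H H G b \<psi>)"
  using assms
proof (induction rule: TMap_induct)
  case zero
  { case 1 show ?case using fv.subspace_0[OF U_sub(1)] by (simp add: zero_fun_def) }
  { case 2 show ?case by simp }
  { case 3 show ?case by (simp add: wa_zero[unfolded zero_fun_def]) }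
next
  case (add \<phi> w F)
  { case 1
    have "etens \<phi> w \<psi> \<in> U" using add(2) U_sub(3) piB(1)[OF fH bcomp_kB[OF fH fG fH]] fv.subspace_0[OF U_sub(1)] by (simp add: etens_def)
    thus ?case unfolding plus_fun_apply[of "etens \<phi> w" F \<psi>] by (rule fv.subspace_add[OF U_sub(1) _ add(4)]) }
  { case 2 thus ?case using add(5) by (simp add: etens_def) }
  { case 3
    have "wa (piB H b) (etens \<phi> w \<psi>) = etens \<phi> w (bcomp H H G b \<psi>)"
      using 3 by (simp add: etens_def bcomp_kB[OF fH fH fG] bcomp_assoc[OF fH fH fG fH] piB_bcomp[OF fH _ bcomp_kB[OF fH fG fH]] wa_conv)
    thus ?case unfolding plus_fun_apply[of "etens \<phi> w" F \<psi>] plus_fun_apply[of "etens \<phi> w" F "bcomp H H G b \<psi>"] wa_add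
      using add(6)[OF 3] by (simp only:) }
qed

text \<open>Each of the five families of tensor relations is annihilated, because
  \<open>etens\<close> is additive and homogeneous in both arguments and, by
  \<open>etens_bcomp\<close>, balanced over \<open>kB H H\<close>.\<close>

lemma tens_rel_ker:
  assumes n: "n \<in> tens_rel G H V"
  shows "n \<in> FF" "evalF n = 0"
proof -
  let ?K = "{f \<in> FF. evalF f = 0}"
  have K: "fv.subspace ?K" unfolding fv.subspace_def
  proof (intro conjI ballI allI)
    show "0 \<in> ?K" using fv.subspace_0[OF FF_subspace] evalF_zero by blast
    fix f assume f: "f \<in> ?K"
    show "fscale c f \<in> ?K" for c using f fv.subspace_scale[OF FF_subspace, of f c] evalF_lin(2)[of f c] by (simp add: fun_eq_iff)
    fix g assume g: "g \<in> ?K"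
    show "f + g \<in> ?K" using f g fv.subspace_add[OF FF_subspace, of f g] evalF_lin(1)[of f g] by simp
  qed
  note D = FF_fdelta
  have sub: "f \<in> FF \<Longrightarrow> g \<in> FF \<Longrightarrow> f - g \<in> FF" for f g by (rule fv.subspace_diff[OF FF_subspace])
  have eneg: "evalF (f - g) = evalF f - evalF g" if "f \<in> FF" "g \<in> FF" for f g
  proof -
    have "evalF f = evalF (f - g) + evalF g" using evalF_lin(1)[OF sub[OF that] that(2)] by simp
    thus ?thesis by simp
  qed
  have "tens_rel G H V \<subseteq> ?K"
    unfolding tens_rel_def kspan_span submod_simps
  proof (rule fv.span_minimal[OF _ K], safe)
    fix a a' :: "_ \<Rightarrow> 'k" and w assume *: "a \<in> kB G H" "a' \<in> kB G H" "w \<in> U"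
    have e: "(\<lambda>q. fdelta (\<lambda>C. a C + a' C, w) q - fdelta (a, w) q - fdelta (a', w) q) = fdelta (a + a', w) - fdelta (a, w) - (fdelta (a', w) :: _ \<Rightarrow> 'k)"
      by (simp add: fun_eq_iff plus_fun_def)
    note m = D[OF fv.subspace_add[OF kB_subspace *(1,2)] *(3)] D[OF *(1,3)] D[OF *(2,3)]
    show "(\<lambda>q. fdelta (\<lambda>C. a C + a' C, w) q - fdelta (a, w) q - fdelta (a', w) q) \<in> FF"
      unfolding e by (intro sub m)
    show "evalF (\<lambda>q. fdelta (\<lambda>C. a C + a' C, w) q - fdelta (a, w) q - fdelta (a', w) q) = 0"
      unfolding e eneg[OF sub[OF m(1,2)] m(3)] eneg[OF m(1,2)] evalF_fdelta etens_add by simp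
  next
    fix a :: "_ \<Rightarrow> 'k" and w w' assume *: "a \<in> kB G H" "w \<in> U" "w' \<in> U"
    have e: "(\<lambda>q. fdelta (a, w + w') q - fdelta (a, w) q - fdelta (a, w') q) = fdelta (a, w + w') - fdelta (a, w) - (fdelta (a, w') :: _ \<Rightarrow> 'k)"
      by (simp add: fun_eq_iff)
    note m = D[OF *(1) fv.subspace_add[OF U_sub(1) *(2,3)]] D[OF *(1,2)] D[OF *(1,3)]
    show "(\<lambda>q. fdelta (a, w + w') q - fdelta (a, w) q - fdelta (a, w') q) \<in> FF"
      unfolding e by (intro sub m)
    show "evalF (\<lambda>q. fdelta (a, w + w') q - fdelta (a, w) q - fdelta (a, w') q) = 0"
      unfolding e eneg[OF sub[OF m(1,2)] m(3)] eneg[OF m(1,2)] evalF_fdelta etens_add by simp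
  next
    fix c and a :: "_ \<Rightarrow> 'k" and w assume *: "a \<in> kB G H" "w \<in> U"
    have e: "(\<lambda>q. fdelta (fscale c a, w) q - c * fdelta (a, w) q) = fdelta (fscale c a, w) - fscale c (fdelta (a, w) :: _ \<Rightarrow> 'k)"
      by (simp add: fun_eq_iff)
    note m = D[OF fv.subspace_scale[OF kB_subspace *(1)] *(2)] D[OF *]
    show "(\<lambda>q. fdelta (fscale c a, w) q - c * fdelta (a, w) q) \<in> FF"
      unfolding e by (intro sub m fv.subspace_scale[OF FF_subspace])
    show "evalF (\<lambda>q. fdelta (fscale c a, w) q - c * fdelta (a, w) q) = 0"
      unfolding e eneg[OF m(1) fv.subspace_scale[OF FF_subspace m(2)]] evalF_lin(2)[OF m(2)] evalF_fdelta etens_scale by simp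
  next
    fix c and a :: "_ \<Rightarrow> 'k" and w assume *: "a \<in> kB G H" "w \<in> U"
    have e: "(\<lambda>q. fdelta (a, fscale c w) q - c * fdelta (a, w) q) = fdelta (a, fscale c w) - fscale c (fdelta (a, w) :: _ \<Rightarrow> 'k)"
      by (simp add: fun_eq_iff)
    note m = D[OF *(1) fv.subspace_scale[OF U_sub(1) *(2)]] D[OF *]
    show "(\<lambda>q. fdelta (a, fscale c w) q - c * fdelta (a, w) q) \<in> FF"
      unfolding e by (intro sub m fv.subspace_scale[OF FF_subspace])
    show "evalF (\<lambda>q. fdelta (a, fscale c w) q - c * fdelta (a, w) q) = 0"
      unfolding e eneg[OF m(1) fv.subspace_scale[OF FF_subspace m(2)]] evalF_lin(2)[OF m(2)] evalF_fdelta etens_scale by simp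
  next
    fix a b :: "_ \<Rightarrow> 'k" and w assume *: "a \<in> kB G H" "b \<in> kB H H" "w \<in> U"
    have e: "(\<lambda>q. fdelta (bcomp G H H a b, w) q - fdelta (a, wa (piB H b) w) q) = fdelta (bcomp G H H a b, w) - (fdelta (a, wa (piB H b) w) :: _ \<Rightarrow> 'k)"
      by (simp add: fun_eq_iff)
    note m = D[OF bcomp_kB[OF fG fH fH] *(3)] D[OF *(1) U_sub(3)[OF piB(1)[OF fH *(2)] *(3)]]
    show "(\<lambda>q. fdelta (bcomp G H H a b, w) q - fdelta (a, wa (piB H b) w) q) \<in> FF"
      unfolding e by (intro sub m)
    show "evalF (\<lambda>q. fdelta (bcomp G H H a b, w) q - fdelta (a, wa (piB H b) w) q) = 0"
      unfolding e eneg[OF m] evalF_fdelta etens_bcomp[OF *(2)] by simp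
  qed
  thus "n \<in> FF" "evalF n = 0" using n by auto
qed

lemma tens_addsub: "addsub (Fmod G H V) (tens_rel G H V)"
proof -
  have s: "fv.subspace (tens_rel G H V)" unfolding tens_rel_def kspan_span by (rule fv.subspace_span)
  show ?thesis unfolding addsub_def Fmod_simps
  proof (intro conjI ballI)
    show "tens_rel G H V \<subseteq> FF" using tens_rel_ker(1) by blast
    show "0 \<in> tens_rel G H V" by (rule fv.subspace_0[OF s])
    fix x assume x: "x \<in> tens_rel G H V"
    show "\<exists>y\<in>tens_rel G H V. x + y = 0" by (rule bexI[OF _ fv.subspace_neg[OF s x]]) simp
    fix y assume "y \<in> tens_rel G H V"
    thus "x + y \<in> tens_rel G H V" by (rule fv.subspace_add[OF s x])
  qed
qed

lemma msum_sum: "msum V g I = sum g I"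
  unfolding msum_def submod_simps sum.eq_fold comp_def ..

text \<open>The outer quotient is by the classes that contain some combination killed by
  \<open>evalF\<close>. As \<open>evalF\<close> kills the tensor relations, it is constant on a
  class, so \<open>JHV\<close> is the kernel of the induced map and \<open>first_iso\<close>
  applies.\<close>

lemma SHV_iso: "mod_iso (kB G G) (SHV G H V) TMap" "kmd (kB G G) (SHV G H V)"
proof -
  let ?g = "\<lambda>X. evalF (qrep X)"
  note q = qmod_hom[OF Fmod_kmd tens_addsub TMap_kmd evalF_hom]
  have n0: "\<And>n. n \<in> tens_rel G H V \<Longrightarrow> evalF n = mzero TMap" by (simp add: tens_rel_ker(2) TMap_simps)
  have L: "kmd (kB G G) (LHV G H V)" unfolding LHV_def by (rule qmod_kmd[OF Fmod_kmd tens_addsub])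
  have g: "khom (kB G G) (LHV G H V) TMap ?g" unfolding LHV_def by (rule q(2)[OF n0])
  have surj: "?g ` mcar (LHV G H V) = mcar TMap" using q(3)[OF n0] unfolding LHV_def Fmod_simps TMap_simps by simp
  have c: "(\<forall>\<psi>\<in>kB H G. msum V (\<lambda>q. msmul V (f q) (mact V (piB H (bcomp H G H \<psi> (fst q))) (snd q))) {q. f q \<noteq> 0} = mzero V)
     \<longleftrightarrow> evalF f = 0" for f
    unfolding msum_sum submod_simps by (auto simp: evalF_def fun_eq_iff)
  have J: "JHV G H V = {X \<in> mcar (LHV G H V). ?g X = mzero TMap}"
  proof -
    have "(\<exists>f\<in>X. f \<in> FF \<and> evalF f = 0) \<longleftrightarrow> ?g X = 0" if X: "X \<in> mcar (LHV G H V)" for X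
    proof -
      obtain x where x: "x \<in> FF" "X = qcos (Fmod G H V) (tens_rel G H V) x" using X by (auto simp: LHV_def qmod_def Fmod_simps)
      have gx: "?g X = evalF x" using q(1)[OF n0] x by (simp add: Fmod_simps)
      have "x \<in> X" unfolding x(2) qcos_def Fmod_simps using tens_addsub by (force simp: addsub_def Fmod_simps)
      moreover have "evalF f = evalF x" if fX: "f \<in> X" for f
      proof -
        obtain n where n: "n \<in> tens_rel G H V" "f = x + n" using fX unfolding x(2) qcos_def Fmod_simps by blast
        show ?thesis unfolding n(2) evalF_lin(1)[OF x(1) tens_rel_ker(1)[OF n(1)]] tens_rel_ker(2)[OF n(1)] by simp
      qed
      ultimately show ?thesis using gx x(1) by metis
    qed
    thus ?thesis unfolding JHV_def c TMap_simps by blast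
  qed
  show "mod_iso (kB G G) (SHV G H V) TMap" unfolding SHV_def by (rule first_iso[OF L TMap_kmd g surj J])
  show "kmd (kB G G) (SHV G H V)"
    unfolding SHV_def J by (rule qmod_kmd[OF L kernel_addsub[OF L TMap_kmd g]])
qed

end


lemma W_submodule: "submodule (kOut H) W (mcar W)"
  unfolding submodule_def W_simps(2-4)
  using fv.subspace_0[OF W_subspace] fv.subspace_add[OF W_subspace] fv.subspace_scale[OF W_subspace] wa_car by blast

lemma submod_W: "submod W (mcar W) = W"
  by (simp add: submod_def)

abbreviation "TW \<equiv> TMap (mcar W)"

lemmas TW_simps = TMap_simps[OF W_submodule]

subsection \<open>Identification of the quotient of the left ideal\<close>

abbreviation "DR \<equiv> (Defres G P Q :: _ \<Rightarrow> 'k)"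

lemma radical_elt_etens: "radical_elt \<alpha> \<longleftrightarrow> etens \<alpha> w0 = 0"
  unfolding radical_elt_w0 by (auto simp: etens_def fun_eq_iff)

lemma etens_diff: "etens (\<alpha> - \<beta>) w = etens \<alpha> w - etens \<beta> w"
proof -
  have "etens \<alpha> w = etens ((\<alpha> - \<beta>) + \<beta>) w" by simp
  also have "\<dots> = etens (\<alpha> - \<beta>) w + etens \<beta> w" by (rule etens_add(2))
  finally show ?thesis by simp
qed

text \<open>The difference of the coefficients composes with \<open>Defres\<close> to 0, and 0
  belongs to \<open>Rpre\<close>; so \<open>radical_elt_Rpre\<close> applies to it. Injectivity of
  composition with \<open>Defres\<close> modulo \<open>kI\<close> enters through that lemma.\<close>

lemma bcomp_DR_eq:
  assumes a: "\<alpha> \<in> kB G H" and b: "\<beta> \<in> kB G H" and e: "bcomp G H G \<alpha> DR = bcomp G H G \<beta> DR"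
  shows "etens \<alpha> w0 = etens \<beta> w0"
proof -
  have z: "(0 :: _ \<Rightarrow> 'k) \<in> kB G H" by (rule fv.subspace_0[OF kB_subspace])
  have "radical_elt 0" unfolding radical_elt_def bcomp_zero_left bcomp_zero_right
    using piB_kI[OF fv.subspace_0[OF kI_subspace]] by simp
  hence "bcomp G H G 0 DR \<in> Rpre G P Q" using radical_elt_Rpre[OF z] by simp
  hence "bcomp G H G (\<alpha> - \<beta>) DR \<in> Rpre G P Q" unfolding bcomp_diff_left e bcomp_zero_left by simp
  hence "etens (\<alpha> - \<beta>) w0 = 0"
    using radical_elt_Rpre[OF fv.subspace_diff[OF kB_subspace a b]] radical_elt_etens by blast
  thus ?thesis by (simp only: etens_diff right_minus_eq)
qed

definition Kfull_map where "Kfull_map x = etens (SOME \<alpha>. \<alpha> \<in> kB G H \<and> x = bcomp G H G \<alpha> DR) w0"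

lemma Kfull_map: "\<alpha> \<in> kB G H \<Longrightarrow> Kfull_map (bcomp G H G \<alpha> DR) = etens \<alpha> w0"
proof -
  assume a: "\<alpha> \<in> kB G H"
  let ?P = "\<lambda>\<beta>. \<beta> \<in> kB G H \<and> bcomp G H G \<alpha> DR = bcomp G H G \<beta> DR"
  have s: "?P (SOME \<beta>. ?P \<beta>)" by (rule someI[of ?P \<alpha>]) (use a in simp)
  show ?thesis unfolding Kfull_map_def by (rule bcomp_DR_eq[OF a conjunct1[OF s] conjunct2[OF s], symmetric])
qed

abbreviation "KK \<equiv> (Kfull G P Q :: (_ \<Rightarrow> 'k) set)"

lemma KK_iff: "x \<in> KK \<longleftrightarrow> (\<exists>\<alpha>. \<alpha> \<in> kB G H \<and> x = bcomp G H G \<alpha> DR)"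
  by (auto simp: Kfull_def)

lemma regmod_simps: "mcar (regmod G S) = S" "mzero (regmod G S) = (0 :: _ \<Rightarrow> 'k)" "madd (regmod G S) = (+)"
  "msmul (regmod G S) = fscale" "mact (regmod G S) = bcomp G G G"
  by (auto simp: regmod_def fun_eq_iff)

lemma KK_ops:
  assumes a: "\<alpha> \<in> kB G H"
  shows "\<beta> \<in> kB G H \<Longrightarrow> bcomp G H G \<alpha> DR + bcomp G H G \<beta> DR = bcomp G H G (\<alpha> + \<beta>) DR"
    "\<beta> \<in> kB G H \<Longrightarrow> \<alpha> + \<beta> \<in> kB G H"
    "fscale c (bcomp G H G \<alpha> DR) = bcomp G H G (fscale c \<alpha>) DR" "fscale c \<alpha> \<in> kB G H"
    "bcomp G G G a (bcomp G H G \<alpha> DR) = bcomp G H G (bcomp G G H a \<alpha>) DR" "bcomp G G H a \<alpha> \<in> kB G H"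
  by (simp_all only: bcomp_add_left bcomp_scale_left bcomp_assoc[OF fG fG fH fG] bcomp_kB[OF fG fG fH]
     fv.subspace_add[OF kB_subspace] fv.subspace_scale[OF kB_subspace] a)

lemma KK_kmd: "kmd (kB G G) (regmod G KK)"
proof -
  have z: "0 \<in> KK" unfolding KK_iff using fv.subspace_0[OF kB_subspace] bcomp_zero_left by metis
  have a: "x + y \<in> KK" if "x \<in> KK" "y \<in> KK" for x y using that KK_ops(1,2) unfolding KK_iff by metis
  have s: "fscale c x \<in> KK" if "x \<in> KK" for c x using that KK_ops(3,4) unfolding KK_iff by metis
  have act: "bcomp G G G b x \<in> KK" if "x \<in> KK" for b x using that KK_ops(5,6) unfolding KK_iff by metis
  show ?thesis unfolding kmd_def regmod_simps
  proof (intro conjI ballI allI)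
    fix x assume x: "x \<in> KK"
    show "\<exists>y\<in>KK. x + y = 0" by (rule bexI[OF _ s[OF x, of "-1"]]) (simp add: fun_eq_iff)
  qed (use z a s act in \<open>auto simp: add.assoc add.commute simp del: plus_fun_apply zero_fun_apply\<close>)
qed

lemma Kfull_map_hom: "khom (kB G G) (regmod G KK) TW Kfull_map"
  unfolding khom_def regmod_simps TW_simps(3-5)
proof (intro conjI ballI allI)
  fix x assume "x \<in> KK"
  then obtain \<alpha> where a: "\<alpha> \<in> kB G H" "x = bcomp G H G \<alpha> DR" unfolding KK_iff by blast
  show "Kfull_map x \<in> mcar TW" unfolding a(2) Kfull_map[OF a(1)] by (rule TMap_closed(5)[OF W_submodule a(1) w0_car])
  show "Kfull_map (fscale c x) = cscale c (Kfull_map x)" for c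
    unfolding a(2) KK_ops(3)[OF a(1)] Kfull_map[OF KK_ops(4)[OF a(1)]] Kfull_map[OF a(1)] by (rule etens_scale(2))
  show "Kfull_map (bcomp G G G b x) = ract b (Kfull_map x)" for b
    unfolding a(2) KK_ops(5)[OF a(1)] Kfull_map[OF KK_ops(6)[OF a(1)]] Kfull_map[OF a(1)] ract_etens ..
  fix y assume "y \<in> KK"
  then obtain \<beta> where b: "\<beta> \<in> kB G H" "y = bcomp G H G \<beta> DR" unfolding KK_iff by blast
  show "Kfull_map (x + y) = Kfull_map x + Kfull_map y"
    unfolding a(2) b(2) KK_ops(1)[OF a(1) b(1)] Kfull_map[OF KK_ops(2)[OF a(1) b(1)]] Kfull_map[OF a(1)] Kfull_map[OF b(1)] by (rule etens_add(2))
qed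

text \<open>Since \<open>w0\<close> generates \<open>W\<close>, a term
  \<open>\<phi> \<otimes> w\<close> with \<open>w = b w0\<close> is
  \<open>\<phi> b \<otimes> w0\<close>; sums of such terms are again of the form
  \<open>\<alpha> \<otimes> w0\<close>.\<close>

lemma Kfull_map_surj: "Kfull_map ` KK = mcar TW"
proof
  show "Kfull_map ` KK \<subseteq> mcar TW" using Kfull_map_hom by (auto simp: khom_def regmod_simps)
  show "mcar TW \<subseteq> Kfull_map ` KK"
  proof
    fix F assume "F \<in> mcar TW"
    hence "\<exists>\<alpha>\<in>kB G H. F = etens \<alpha> w0"
    proof (induction rule: TMap_induct[OF W_submodule, consumes 1, case_names zero add])
      case zero
      have "etens 0 w0 = 0" using etens_diff[of 0 0 w0] by simp
      thus ?case using fv.subspace_0[OF kB_subspace] by metis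
    next
      case (add \<phi> w F)
      then obtain \<alpha> where a: "\<alpha> \<in> kB G H" "F = etens \<alpha> w0" by blast
      obtain b where b: "b \<in> kB H H" "w = wa (piB H b) w0" using w0_generates[OF add(2)] by blast
      have "etens \<phi> w + F = etens (bcomp G H H \<phi> b + \<alpha>) w0"
        unfolding b(2) etens_bcomp[OF b(1), symmetric] a(2) by (rule etens_add(2)[symmetric])
      thus ?case using fv.subspace_add[OF kB_subspace bcomp_kB[OF fG fH fH] a(1)] by blast
    qed
    then obtain \<alpha> where "\<alpha> \<in> kB G H" "F = etens \<alpha> w0" by blast
    thus "F \<in> Kfull_map ` KK" using Kfull_map KK_iff by (metis rev_image_eqI)
  qed
qed

lemma Rpre_ker: "(Rpre G P Q :: (_ \<Rightarrow> 'k) set) = {x \<in> KK. Kfull_map x = 0}"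
proof -
  have "x \<in> KK" if xR: "x \<in> Rpre G P Q" for x :: "_ \<Rightarrow> 'k"
  proof -
    obtain y \<beta> where y: "x = (\<lambda>C. y C + bcomp G H G \<beta> DR C)" "y \<in> Kless G P Q" "\<beta> \<in> kB G H"
      using xR unfolding Rpre_def by blast
    obtain \<delta> where d: "\<delta> \<in> kI G H" "y = bcomp G H G \<delta> DR" using y(2) unfolding Kless_def by blast
    note dk = kI_kB[OF fG fH d(1)]
    have "x = bcomp G H G (\<delta> + \<beta>) DR" unfolding y(1) d(2) bcomp_add_left by (simp add: fun_eq_iff)
    thus ?thesis using KK_ops(2)[OF dk y(3)] KK_iff by blast
  qed
  moreover have "x \<in> Rpre G P Q \<longleftrightarrow> Kfull_map x = 0" if "x \<in> KK" for x
  proof -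
    obtain \<alpha> where a: "\<alpha> \<in> kB G H" "x = bcomp G H G \<alpha> DR" using \<open>x \<in> KK\<close> unfolding KK_iff by blast
    show ?thesis unfolding a(2) Kfull_map[OF a(1)] radical_elt_Rpre[OF a(1)] radical_elt_etens ..
  qed
  ultimately show ?thesis by blast
qed

lemma KbarR_kmd: "kmd (kB G G) (KbarR G P Q :: (_, 'k, _) kmod)"
proof -
  have "addsub (regmod G KK) (Rpre G P Q)"
    using kernel_addsub[OF KK_kmd TMap_kmd[OF W_submodule] Kfull_map_hom] unfolding Rpre_ker regmod_simps TW_simps .
  thus ?thesis unfolding KbarR_def by (rule qmod_kmd[OF KK_kmd])
qed

lemma KbarR_iso: "mod_iso (kB G G) (KbarR G P Q :: (_, 'k, _) kmod) TW"
  unfolding KbarR_def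
proof (rule first_iso[OF KK_kmd TMap_kmd[OF W_submodule] Kfull_map_hom])
  show "Kfull_map ` mcar (regmod G KK) = mcar TW" unfolding regmod_simps by (rule Kfull_map_surj)
  show "Rpre G P Q = {x \<in> mcar (regmod G KK). Kfull_map x = mzero TW}" unfolding regmod_simps TW_simps by (rule Rpre_ker)
qed

subsection \<open>Semisimplicity\<close>

lemma TW_semisimple: "semisimple_mod (kB G G) TW"
  unfolding semisimple_mod_def
proof (intro allI impI)
  fix S assume S: "submodule (kB G G) TW S"
  note Wv = TMap_vals[OF W_submodule] and Wc = TMap_closed[OF W_submodule]
  have s: "S \<subseteq> mcar TW" "0 \<in> S" "\<And>F F'. F \<in> S \<Longrightarrow> F' \<in> S \<Longrightarrow> F + F' \<in> S" "\<And>c F. F \<in> S \<Longrightarrow> cscale c F \<in> S"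
    "\<And>a F. a \<in> kB G G \<Longrightarrow> F \<in> S \<Longrightarrow> ract a F \<in> S"
    using S[unfolded submodule_def TW_simps(2-5)] by (elim conjE; simp only:)+
  \<comment> \<open>Stability under \<open>Out H\<close> comes from \<open>TMap_vals(3)\<close>:
    acting on a value of \<open>F\<close> gives the value of the same \<open>F\<close> at another
    point.\<close>
  define U where "U = fv.span {F \<psi> | F \<psi>. F \<in> S \<and> \<psi> \<in> kB H G}"
  have Ug: "F \<psi> \<in> U" if "F \<in> S" for F \<psi>
  proof (cases "\<psi> \<in> kB H G")
    case True thus ?thesis unfolding U_def using that by (intro fv.span_base) blast
  next
    case False
    hence "F \<psi> = 0" using Wv(2)[of F] that s(1) by blast
    thus ?thesis unfolding U_def by (simp only: fv.span_zero)
  qed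
  have UW: "U \<subseteq> mcar W" unfolding U_def
    by (rule fv.span_minimal[OF _ W_subspace]) (use Wv(1) s(1) in blast)
  have Uwa: "wa f w \<in> U" if f: "f \<in> kOut H" and w: "w \<in> U" for f w
    using w unfolding U_def
  proof (induction rule: fv.span_induct_alt)
    case base
    show ?case unfolding wa_zero by (rule fv.span_zero)
  next
    case (step c x y)
    then obtain F \<psi> where F: "x = F \<psi>" "F \<in> S" "\<psi> \<in> kB H G" by blast
    obtain b where b: "b \<in> kB H H" "piB H b = f" using piB_surj[OF f] by blast
    have "wa f x = F (bcomp H H G b \<psi>)" unfolding F(1) b(2)[symmetric] using Wv(3)[of F \<psi> b] F s(1) b(1) by blast
    hence "wa f x \<in> fv.span {F \<psi> | F \<psi>. F \<in> S \<and> \<psi> \<in> kB H G}" using Ug[OF F(2)] unfolding U_def by simp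
    thus ?case unfolding wa_add wa_scale by (intro fv.span_add fv.span_scale step.IH)
  qed
  have U: "submodule (kOut H) W U" unfolding submodule_def W_simps(2-4)
    using UW Uwa unfolding U_def by (auto intro: fv.span_zero fv.span_add fv.span_scale simp del: plus_fun_apply zero_fun_apply)
  obtain p where pp: "\<forall>w w'. p (w + w') = p w + p w'" "\<forall>c w. p (fscale c w) = fscale c (p w)"
    "\<forall>w. p w \<in> U" "\<forall>w\<in>U. p w = w" "\<forall>f w. p (wa f w) = wa f (p w)" using maschke[OF U] by (elim exE conjE)
  note p = pp[rule_format]
  have p0: "p 0 = 0" using p(2)[of 0 0] by (simp add: zero_fun_def)
  \<comment> \<open>By linearity of \<open>F\<close> the map
    \<open>\<chi> \<mapsto> \<pi>(\<chi> \<phi>) F(\<psi>)\<close> equals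
    \<open>\<chi> \<mapsto> F(\<chi> \<phi> \<psi>)\<close>, which is the image of \<open>F\<close>
    under the element \<open>\<phi> \<psi>\<close> of \<open>kB G G\<close>; hence it stays in
    \<open>S\<close>.\<close>
  have etU: "etens \<phi> w \<in> S" if ph: "\<phi> \<in> kB G H" and w: "w \<in> U" for \<phi> w
    using w unfolding U_def
  proof (induction rule: fv.span_induct_alt)
    case base show ?case unfolding etens_0 by (rule s(2))
  next
    case (step c x y)
    then obtain F \<psi> where F: "x = F \<psi>" "F \<in> S" "\<psi> \<in> kB H G" by blast
    have FT: "F \<in> mcar TW" using F s(1) by blast
    have "etens \<phi> x = ract (bcomp G H G \<phi> \<psi>) F"
    proof
      fix \<chi> show "etens \<phi> x \<chi> = ract (bcomp G H G \<phi> \<psi>) F \<chi>"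
        unfolding etens_def ract_def F(1) using Wv(3)[OF FT F(3) bcomp_kB[OF fH fG fH, of \<chi> \<phi>]] bcomp_assoc[OF fH fG fH fG, of \<chi> \<phi> \<psi>] by simp
    qed
    hence "etens \<phi> x \<in> S" using s(5)[OF bcomp_kB[OF fG fH fG] F(2)] by simp
    thus ?case unfolding etens_add etens_scale by (intro s(3,4) step.IH)
  qed
  \<comment> \<open>Applying \<open>p\<close> to values turns \<open>etens \<phi> w\<close> into
    \<open>etens \<phi> (p w)\<close> with \<open>p w \<in> U\<close>, so it maps the whole model
    into \<open>S\<close>. On \<open>S\<close> it is the identity, which makes its kernel
    \<open>?T\<close> a complement.\<close>
  have pS: "(\<lambda>\<psi>. p (F \<psi>)) \<in> S" if "F \<in> mcar TW" for F
    using that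
  proof (induction rule: TMap_induct[OF W_submodule, consumes 1, case_names zero add])
    case zero
    have "(\<lambda>\<psi>. p ((0 :: _ \<Rightarrow> _ \<Rightarrow> 'k) \<psi>)) = 0" using p0 by (simp add: zero_fun_def)
    thus ?case using s(2) by metis
  next
    case (add \<phi> w F)
    have "(\<lambda>\<psi>. p ((etens \<phi> w + F) \<psi>)) = etens \<phi> (p w) + (\<lambda>\<psi>. p (F \<psi>))"
    proof
      fix \<psi>
      have "p (etens \<phi> w \<psi>) = etens \<phi> (p w) \<psi>" by (simp add: etens_def p(5) p0)
      thus "p ((etens \<phi> w + F) \<psi>) = (etens \<phi> (p w) + (\<lambda>\<psi>. p (F \<psi>))) \<psi>"
        unfolding plus_fun_apply[of "etens \<phi> w" F \<psi>] p(1) plus_fun_apply[of "etens \<phi> (p w)" _ \<psi>] by (simp only:)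
    qed
    thus ?case using s(3)[OF etU[OF add(1) p(3)] add(4)] by metis
  qed
  let ?T = "{F \<in> mcar TW. \<forall>\<psi>. p (F \<psi>) = 0}"
  have "submodule (kB G G) TW ?T" unfolding submodule_def TW_simps(2-5)
  proof (intro conjI ballI allI)
    show "0 \<in> ?T" using Wc(1) p0 by (simp add: zero_fun_def)
    fix F assume F: "F \<in> ?T"
    show "cscale c F \<in> ?T" for c using F Wc(3) p(2) by (auto simp: zero_fun_def)
    show "ract a F \<in> ?T" for a using F Wc(4) p0 by (auto simp: ract_def)
    fix F' assume F': "F' \<in> ?T"
    have "p ((F + F') \<psi>) = 0" for \<psi> unfolding plus_fun_apply[of F F' \<psi>] p(1) using F F' by simp
    thus "F + F' \<in> ?T" using F F' Wc(2) by blast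
  qed blast
  moreover have "S \<inter> ?T = {mzero TW}"
  proof -
    have "F = 0" if "F \<in> S" "F \<in> ?T" for F
    proof
      fix \<psi> show "F \<psi> = 0 \<psi>" using p(4)[OF Ug[OF that(1), of \<psi>]] that(2) by (simp add: zero_fun_def)
    qed
    moreover have "0 \<in> ?T" using Wc(1) p0 by (simp add: zero_fun_def)
    ultimately show ?thesis using s(2) unfolding TW_simps by blast
  qed
  moreover have "{madd TW x y | x y. x \<in> S \<and> y \<in> ?T} = mcar TW"
  proof -
    have "F \<in> {madd TW x y | x y. x \<in> S \<and> y \<in> ?T}" if F: "F \<in> mcar TW" for F
    proof -
      let ?p = "\<lambda>\<psi>. p (F \<psi>)"
      have e: "F = ?p + (F + cscale (-1) ?p)" by (simp add: fun_eq_iff)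
      have "F + cscale (-1) ?p \<in> mcar TW" using Wc(2)[OF F Wc(3)] pS[OF F] s(1) by blast
      moreover have "p ((F + cscale (-1) ?p) \<psi>) = 0" for \<psi>
        unfolding plus_fun_apply[of F _ \<psi>] p(1,2) p(4)[OF p(3)] by (simp add: fun_eq_iff)
      ultimately have "F + cscale (-1) ?p \<in> ?T" by blast
      thus ?thesis using e pS[OF F] unfolding TW_simps(3) by blast
    qed
    moreover have "{madd TW x y | x y. x \<in> S \<and> y \<in> ?T} \<subseteq> mcar TW" using s(1) Wc(2) unfolding TW_simps(3) by blast
    ultimately show ?thesis by blast
  qed
  ultimately show "\<exists>T. submodule (kB G G) TW T \<and> S \<inter> T = {mzero TW} \<and> {madd TW x y |x y. x \<in> S \<and> y \<in> T} = mcar TW" by blast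
qed

subsection \<open>Direct sum decompositions\<close>

text \<open>The isomorphism adds the components. Injectivity is checked at each
  \<open>\<psi>\<close> separately, where the values lie in the independent subspaces
  \<open>U i\<close>; surjectivity splits the vector \<open>w\<close> of each
  \<open>etens \<phi> w\<close>.\<close>

lemma TMap_dsum:
  assumes U: "\<And>i. i < n \<Longrightarrow> submodule (kOut H) W (U i)" and d: "internal_dsum W n U"
  shows "mod_iso (kB G G) (dsum n (\<lambda>i. TMap (U i))) TW"
proof -
  note Wc = TMap_closed[OF W_submodule]
  have msum: "msum W g I = sum g I" for g :: "nat \<Rightarrow> _" and I
    using msum_sum[OF W_submodule, of g I] unfolding submod_W .
  have sub: "mcar (TMap (U i)) \<subseteq> mcar TW" if i: "i < n" for i
  proof
    fix F assume "F \<in> mcar (TMap (U i))"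
    thus "F \<in> mcar TW"
    proof (induction rule: TMap_induct[OF U[OF i], consumes 1, case_names zero add])
      case zero show ?case by (rule Wc(1))
    next
      case (add \<phi> w F)
      have "w \<in> mcar W" using add(2) kOut_submodule(2)[OF U[OF i]] by blast
      thus ?case using Wc(2)[OF Wc(5)[OF add(1)] add(4)] by blast
    qed
  qed
  let ?D = "dsum n (\<lambda>i. TMap (U i))" and ?f = "\<lambda>x. \<Sum>i<n. x i"
  have car: "x \<in> mcar ?D \<longleftrightarrow> (\<forall>i<n. x i \<in> mcar (TMap (U i))) \<and> (\<forall>i\<ge>n. x i = undefined)" for x by (simp add: dsum_def)
  have sumW: "(\<Sum>i<m. x i) \<in> mcar TW" if "\<And>i. i < m \<Longrightarrow> x i \<in> mcar TW" for m and x :: "nat \<Rightarrow> _"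
    using that
  proof (induction m)
    case 0 show ?case using Wc(1) by (simp only: lessThan_0 sum.empty)
  next
    case (Suc m)
    have "(\<Sum>i<m. x i) \<in> mcar TW" "x m \<in> mcar TW" using Suc by auto
    thus ?case unfolding sum.lessThan_Suc by (rule Wc(2))
  qed
  have hom: "khom (kB G G) ?D TW ?f" unfolding khom_def TW_simps(3-5)
  proof (intro conjI ballI allI)
    fix x assume x: "x \<in> mcar ?D"
    show "?f x \<in> mcar TW" by (rule sumW) (use x sub car in blast)
    show "?f (msmul ?D c x) = cscale c (?f x)" for c
    proof -
      have "?f (msmul ?D c x) = (\<Sum>i<n. cscale c (x i))" by (intro sum.cong refl) (simp add: dsum_def TMap_simps(4)[OF U])
      thus ?thesis by (intro ext) (simp only: sum_fun2 sum_distrib_left)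
    qed
    show "?f (mact ?D a x) = ract a (?f x)" for a unfolding ract_sum by (intro sum.cong refl) (simp add: dsum_def TMap_simps(5)[OF U])
    fix y
    show "?f (madd ?D x y) = ?f x + ?f y" unfolding sum.distrib[symmetric] by (intro sum.cong refl) (simp add: dsum_def TMap_simps(3)[OF U])
  qed
  have inj: "inj_on ?f (mcar ?D)"
  proof (rule inj_onI)
    fix x y assume xy: "x \<in> mcar ?D" "y \<in> mcar ?D" "?f x = ?f y"
    have "x i \<psi> = y i \<psi>" if i: "i < n" for i \<psi>
    proof -
      let ?v = "\<lambda>i. x i \<psi> - y i \<psi>"
      have v: "?v i \<in> U i" if "i < n" for i
        using TMap_vals(1)[OF U[OF that], of "x i" \<psi>] TMap_vals(1)[OF U[OF that], of "y i" \<psi>] xy(1,2) car that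
          fv.subspace_diff[OF kOut_submodule(1)[OF U[OF that]]] by blast
      have z: "(\<Sum>i<n. ?v i) = 0"
      proof
        fix D
        have "(\<Sum>i<n. x i) \<psi> D = (\<Sum>i<n. y i) \<psi> D" using xy(3) by simp
        thus "(\<Sum>i<n. ?v i) D = 0 D" unfolding sum_fun2 by (simp add: sum_fun sum_subtractf)
      qed
      have "(\<forall>i<n. ?v i \<in> U i) \<longrightarrow> (\<Sum>i<n. ?v i) = 0 \<longrightarrow> (\<forall>i<n. ?v i = 0)"
        by (rule d[unfolded internal_dsum_def msum W_simps(2), THEN conjunct2, THEN spec])
      hence "?v i = 0" using v i z by blast
      thus ?thesis by simp
    qed
    moreover have "x i = y i" if "\<not> i < n" for i using that xy(1,2) car by simp
    ultimately show "x = y" by (intro ext) (metis ext)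
  qed
  have surj: "mcar TW \<subseteq> ?f ` mcar ?D"
  proof
    fix F assume "F \<in> mcar TW"
    thus "F \<in> ?f ` mcar ?D"
    proof (induction rule: TMap_induct[OF W_submodule, consumes 1, case_names zero add])
      case zero
      \<comment> \<open>Members of \<open>dsum\<close> are \<open>undefined\<close> from index
        \<open>n\<close> on, so the zero tuple has to be as well.\<close>
      let ?x = "\<lambda>i. if i < n then 0 else undefined"
      have m: "?x \<in> mcar ?D \<and> ?f ?x = 0" unfolding car
        using TMap_closed(1)[OF U] by (auto intro!: sum.neutral simp del: zero_fun_apply)
      show ?case by (rule image_eqI[OF _ conjunct1[OF m]]) (rule conjunct2[OF m, symmetric])
    next
      case (add \<phi> w F)
      then obtain x where x: "x \<in> mcar ?D" "F = ?f x" by blast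
      obtain v where v: "\<And>i. i < n \<Longrightarrow> v i \<in> U i" "w = (\<Sum>i<n. v i)"
        using d add(2) unfolding internal_dsum_def msum by blast
      let ?y = "\<lambda>i. if i < n then etens \<phi> (v i) + x i else undefined"
      have m: "?y \<in> mcar ?D" unfolding car using x(1)[unfolded car] TMap_closed(2)[OF U] TMap_closed(5)[OF U add(1) v(1)] by simp
      have e: "?f ?y = etens \<phi> w + F"
      proof -
        have "etens \<phi> (\<Sum>i\<in>I. v i) = (\<Sum>i\<in>I. etens \<phi> (v i))" for I
          by (induction I rule: infinite_finite_induct) (simp_all only: sum.infinite sum.empty sum.insert etens_0 etens_add(1) not_False_eq_True)
        hence "etens \<phi> w + F = (\<Sum>i<n. etens \<phi> (v i) + x i)" unfolding v(2) x(2) sum.distrib by simp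
        also have "\<dots> = ?f ?y" by (intro sum.cong refl) simp
        finally show ?thesis by simp
      qed
      show ?case by (rule image_eqI[OF _ m]) (rule e[symmetric])
    qed
  qed
  have "?f ` mcar ?D \<subseteq> mcar TW" using hom unfolding khom_def by blast
  hence "bij_betw ?f (mcar ?D) (mcar TW)" using inj surj unfolding bij_betw_def by blast
  thus ?thesis by (rule mod_isoI[OF hom])
qed

lemma dsum_kmd:
  assumes "\<And>i. i < n \<Longrightarrow> kmd A (M i)"
  shows "kmd A (dsum n M)"
proof -
  note k = kmdD[OF assms]
  have inv: "\<exists>y\<in>mcar (dsum n M). madd (dsum n M) x y = mzero (dsum n M)" if x: "x \<in> mcar (dsum n M)" for x
  proof -
    have "\<forall>i. \<exists>y. i < n \<longrightarrow> y \<in> mcar (M i) \<and> madd (M i) (x i) y = mzero (M i)"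
    proof
      fix i show "\<exists>y. i < n \<longrightarrow> y \<in> mcar (M i) \<and> madd (M i) (x i) y = mzero (M i)"
        using k(7)[of i "x i"] x by (cases "i < n") (auto simp: dsum_def)
    qed
    then obtain y where y: "\<And>i. i < n \<Longrightarrow> y i \<in> mcar (M i) \<and> madd (M i) (x i) (y i) = mzero (M i)" by metis
    show ?thesis by (rule bexI[of _ "\<lambda>i. if i < n then y i else undefined"]) (use y in \<open>auto simp: dsum_def fun_eq_iff\<close>)
  qed
  show ?thesis unfolding kmd_def
    by (intro conjI ballI allI inv) (use k in \<open>auto simp: dsum_def fun_eq_iff\<close>)
qed

end

text \<open>Multiplicities are expressed by repetition: the family \<open>U\<close> lists all simple
  summands, isomorphic ones separately, and the last assertion covers every such decomposition of
  the permutation module.\<close>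

theorem theorem11p4:
  fixes G :: "'g monoid" and P Q :: "'g set"
    and k :: "'k::field itself"
  assumes "alg_closed_field TYPE('k)" and "CHAR('k) = 0"
    and "group G" and "finite (carrier G)"
    and "subgroup P G" and "Q \<lhd> (G\<lparr>carrier := P\<rparr>)"
  shows "semisimple_mod (kB G G) (KbarR G P Q :: (_, 'k, _) kmod)
    \<and> mod_iso (kB G G) (KbarR G P Q :: (_, 'k, _) kmod)
         (SHV G (secq G P Q) (permW (secq G P Q) (GammaGPQ G P Q)))
    \<and> (\<forall>n U. (\<forall>i<n. simple_submodule (kOut (secq G P Q))
                       (permW (secq G P Q) (GammaGPQ G P Q) :: (_, 'k, _) kmod) (U i))
           \<and> internal_dsum (permW (secq G P Q) (GammaGPQ G P Q) :: (_, 'k, _) kmod) n U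
           \<longrightarrow> mod_iso (kB G G) (KbarR G P Q :: (_, 'k, _) kmod)
                 (dsum n (\<lambda>i. SHV G (secq G P Q)
                    (submod (permW (secq G P Q) (GammaGPQ G P Q)) (U i)))))"
proof -
  interpret sect k G P Q
    by (intro sect.intro char0.intro sect_axioms.intro) (use assms in \<open>simp_all add: fin_group_def\<close>)
  note TWk = TMap_kmd[OF W_submodule]
  show ?thesis
  proof (intro conjI allI impI)
    show "semisimple_mod (kB G G) (KbarR G P Q :: (_, 'k, _) kmod)"
      by (rule semisimple_iso[OF KbarR_kmd TWk KbarR_iso TW_semisimple])
    have "mod_iso (kB G G) TW (SHV G H W)"
      using mod_iso_sym[OF SHV_iso(2)[OF W_submodule] SHV_iso(1)[OF W_submodule]] unfolding submod_W .
    thus "mod_iso (kB G G) (KbarR G P Q :: (_, 'k, _) kmod) (SHV G H W)" by (rule mod_iso_trans[OF KbarR_iso])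
    fix n U assume a: "(\<forall>i<n. simple_submodule (kOut H) W (U i)) \<and> internal_dsum W n U"
    hence U: "\<And>i. i < n \<Longrightarrow> submodule (kOut H) W (U i)" by (auto simp: simple_submodule_def)
    have "mod_iso (kB G G) TW (dsum n (\<lambda>i. TMap (U i)))"
      by (rule mod_iso_sym[OF dsum_kmd[OF TMap_kmd[OF U]] TMap_dsum[OF U]]) (use a in auto)
    moreover have "mod_iso (kB G G) (dsum n (\<lambda>i. TMap (U i))) (dsum n (\<lambda>i. SHV G H (submod W (U i))))"
      by (rule mod_iso_dsum) (rule mod_iso_sym[OF SHV_iso(2)[OF U] SHV_iso(1)[OF U]])
    ultimately show "mod_iso (kB G G) (KbarR G P Q :: (_, 'k, _) kmod) (dsum n (\<lambda>i. SHV G H (submod W (U i))))"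
      by (rule mod_iso_trans[OF mod_iso_trans[OF KbarR_iso]])
  qed
qed

end
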